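(* Let $m,n$ be nonnegative integers. (a) Let $P_1$ be a poset on $[m]$ and $P_2$ a poset on $[n]$. As right $H_{m+n}(0)$-modules, $$\phi[M_{P_1}\boxtimes M_{P_2}]\cong M_{\overline{P_2}^*}\boxtimes M_{\overline{P_1}^*},\qquad \theta[M_{P_1}\boxtimes M_{P_2}]\cong\mathbf{M}_{P_1}\boxtimes\mathbf{M}_{P_2},\qquad \chi[M_{P_1}\boxtimes M_{P_2}]\cong\mathbf{M}_{\overline{P_2}}\boxtimes\mathbf{M}_{\overline{P_1}}.$$ (b) Let $P$ be a poset on $[m+n]$. As right $H_m(0)\otimes H_n(0)$-modules, $$\phi\big[M_P\downarrow^{H_{m+n}(0)}_{H_n(0)\otimes H_m(0)}\big]\cong M_{\overline{P}^*}\downarrow^{H_{m+n}(0)}_{H_m(0)\otimes H_n(0)},\qquad \theta\big[M_P\downarrow^{H_{m+n}(0)}_{H_m(0)\otimes H_n(0)}\big]\cong\mathbf{M}_P\downarrow^{H_{m+n}(0)}_{H_m(0)\otimes H_n(0)},$$ $$\chi\big[M_P\downarrow^{H_{m+n}(0)}_{H_m(0)\otimes H_n(0)}\big]\cong\mathbf{M}_{\overline{P}}\downarrow^{H_{m+n}(0)}_{H_m(0)\otimes H_n(0)}.$$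
   Context: Permutations in $\mathfrak{S}_n$ are composed as functions, $(\sigma\tau)(i)=\sigma(\tau(i))$; $s_i=(i\ i{+}1)$, $\ell$ is the length, and $\mathrm{Des}_R(\gamma)=\{i\in[n-1]:\ell(\gamma s_i)<\ell(\gamma)\}$. The $0$-Hecke algebra $H_n(0)$ is the associative unital $\mathbb{C}$-algebra generated by $\overline{\pi}_1,\dots,\overline{\pi}_{n-1}$ with relations $\overline{\pi}_i^2=-\overline{\pi}_i$, $\overline{\pi}_i\overline{\pi}_{i+1}\overline{\pi}_i=\overline{\pi}_{i+1}\overline{\pi}_i\overline{\pi}_{i+1}$, $\overline{\pi}_i\overline{\pi}_j=\overline{\pi}_j\overline{\pi}_i$ for $|i-j|\ge 2$; put $\pi_i=\overline{\pi}_i+1$. $H_m(0)\otimes H_n(0)$ is identified with the subalgebra of $H_{m+n}(0)$ generated by $\pi_i$, $i\in[m+n-1]\setminus\{m\}$. For a right $H_m(0)$-module $M$ and right $H_n(0)$-module $N$, $M\boxtimes N$ denotes the induced module $M\otimes N\uparrow_{H_m(0)\otimes H_n(0)}^{H_{m+n}(0)}$; $\downarrow$ denotes restriction. For a partial order $P$ on $[n]$, $\Sigma_R(P)$ is the set of $\sigma\in\mathfrak{S}_n$ with $\sigma^{-1}(i)<\sigma^{-1}(j)$ whenever $i\prec_P j$. The poset module $M_P$ is the right $H_n(0)$-module with $\mathbb{C}$-basis $\Sigma_R(P)$ and action $\gamma\cdot\overline{\pi}_i=-\gamma$ if $i\in\mathrm{Des}_R(\gamma)$; $0$ if $i\notin\mathrm{Des}_R(\gamma)$,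 $\gamma s_i\notin\Sigma_R(P)$; $\gamma s_i$ if $i\notin\mathrm{Des}_R(\gamma)$, $\gamma s_i\in\Sigma_R(P)$. The module $\mathbf{M}_P$ is the right $H_n(0)$-module with the same basis and action $\gamma\cdot\pi_i=\gamma$ if $i\in\mathrm{Des}_R(\gamma)$; $0$ if $i\notin\mathrm{Des}_R(\gamma)$, $\gamma s_i\notin\Sigma_R(P)$; $\gamma s_i$ if $i\notin\mathrm{Des}_R(\gamma)$, $\gamma s_i\in\Sigma_R(P)$. Poset involutions: $u\preceq_{\overline{P}}v\iff n+1-u\preceq_P n+1-v$, and $u\preceq_{P^*}v\iff v\preceq_P u$ (for $P$ on $[n]$); $\overline{P}^*=(\overline{P})^*$. $\phi,\theta$ are the involutions and $\chi$ the anti-involution of $H_N(0)$ (any $N$) given by $\phi(\overline{\pi}_i)=\overline{\pi}_{N-i}$, $\theta(\overline{\pi}_i)=-\pi_i$, $\chi(\overline{\pi}_i)=\overline{\pi}_i$. For an automorphism $\mu$ and a right module $M$, $\mu[M]$ is the space $M$ with action $v\cdot_\mu h=v\cdot\mu(h)$; for an anti-automorphism $\nu$, $\nu[M]$ is the dual space $M^*$ with right action $(\delta\cdot^\nu h)(v)=\delta(v\cdot\nu(h))$. In (b), the twists are by the restrictions of the (anti-)involutions of $H_{m+n}(0)$: $\theta$ and $\chi$ preserve $H_m(0)\otimes H_n(0)$, while $\phi$ maps $H_m(0)\otimes H_n(0)$ onto $H_n(0)\otimes H_m(0)$, so that the $\phi$-twist of an $H_n(0)\otimes H_m(0)$-module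 is an $H_m(0)\otimes H_n(0)$-module. *)

theory Defs
  imports
    Complex_Main
    "HOL-Algebra.Module"
    "HOL-Algebra.QuotRing"
    "HOL-Algebra.Generated_Rings"
    "HOL-Algebra.Free_Abelian_Groups"
    "HOL-Combinatorics.Permutations"
begin

section \<open>The 0-Hecke algebra\<close>

text \<open>
  A \<open>\<complex>\<close>-algebra is given by a record of type \<open>(complex, 'a) module\<close> (a ring with a scalar
  multiplication). The free associative unital \<open>\<complex>\<close>-algebra on the letters \<open>1, \<dots>, n - 1\<close> consists
  of the finitely supported functions on words, multiplied by convolution along the splittings of
  a word. The letter \<open>i\<close> stands for the generator \<open>\<pi>bar\<^sub>i\<close>.
\<close>

type_synonym free_elem = "nat list \<Rightarrow> complex"
type_synonym hecke_elem = "free_elem set"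

definition free_alg :: "nat \<Rightarrow> free_elem ring" where
  "free_alg n =
     \<lparr>carrier = {f. finite {w. f w \<noteq> 0} \<and> (\<forall>w. f w \<noteq> 0 \<longrightarrow> set w \<subseteq> {1..<n})},
      monoid.mult = (\<lambda>f g w. \<Sum>k\<le>length w. f (take k w) * g (drop k w)),
      one = (\<lambda>w. if w = [] then 1 else 0),
      ring.zero = (\<lambda>w. 0),
      add = (\<lambda>f g w. f w + g w)\<rparr>"

definition word :: "nat list \<Rightarrow> free_elem" where
  "word u = (\<lambda>w. if w = u then 1 else 0)"

definition hecke_relators :: "nat \<Rightarrow> free_elem set" where
  "hecke_relators n =
     {word [i, i] \<oplus>\<^bsub>free_alg n\<^esub> word [i] | i. i \<in> {1..<n}}
   \<union> {word [i, i + 1, i] \<ominus>\<^bsub>free_alg n\<^esub> word [i + 1, i, i + 1] | i. i \<in> {1..<n} \<and> i + 1 \<in> {1..<n}}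
   \<union> {word [i, j] \<ominus>\<^bsub>free_alg n\<^esub> word [j, i] | i j.
        i \<in> {1..<n} \<and> j \<in> {1..<n} \<and> \<bar>int i - int j\<bar> \<ge> 2}"

definition hecke_ideal :: "nat \<Rightarrow> free_elem set" where
  "hecke_ideal n = genideal (free_alg n) (hecke_relators n)"

definition hecke :: "nat \<Rightarrow> (complex, hecke_elem) module" where
  "hecke n = (let Q = free_alg n Quot hecke_ideal n in
     \<lparr>carrier = carrier Q, monoid.mult = monoid.mult Q, one = one Q, ring.zero = ring.zero Q,
      add = add Q,
      smult = (\<lambda>c X. (hecke_ideal n +>\<^bsub>free_alg n\<^esub> (\<lambda>w. if w = [] then c else 0)) \<otimes>\<^bsub>Q\<^esub> X)\<rparr>)"

definition pibar :: "nat \<Rightarrow> nat \<Rightarrow> hecke_elem" where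
  "pibar n i = hecke_ideal n +>\<^bsub>free_alg n\<^esub> word [i]"

definition pi_gen :: "nat \<Rightarrow> nat \<Rightarrow> hecke_elem" where
  "pi_gen n i = pibar n i \<oplus>\<^bsub>hecke n\<^esub> \<one>\<^bsub>hecke n\<^esub>"

text \<open>
  For a \<open>\<complex>\<close>-algebra \<open>A\<close> whose elements \<open>g i\<close> satisfy the defining relations of \<open>hecke n\<close>,
  \<open>hecke_hom A g\<close> is the algebra homomorphism from \<open>hecke n\<close> to \<open>A\<close> with \<open>\<pi>bar\<^sub>i \<mapsto> g i\<close>
  (elements of \<open>hecke n\<close> are cosets, on which the map of the free algebra is then constant).
\<close>

definition free_hom ::
  "(complex, 'a, 'm) module_scheme \<Rightarrow> (nat \<Rightarrow> 'a) \<Rightarrow> free_elem \<Rightarrow> 'a" where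
  "free_hom A g f =
     finsum A (\<lambda>w. f w \<odot>\<^bsub>A\<^esub> foldr (\<lambda>i a. g i \<otimes>\<^bsub>A\<^esub> a) w \<one>\<^bsub>A\<^esub>) {w. f w \<noteq> 0}"

definition hecke_hom ::
  "(complex, 'a, 'm) module_scheme \<Rightarrow> (nat \<Rightarrow> 'a) \<Rightarrow> hecke_elem \<Rightarrow> 'a" where
  "hecke_hom A g h = the_elem (free_hom A g ` h)"

definition opposite :: "('a, 'm) monoid_scheme \<Rightarrow> ('a, 'm) monoid_scheme" where
  "opposite A = A\<lparr>monoid.mult := \<lambda>x y. y \<otimes>\<^bsub>A\<^esub> x\<rparr>"

definition hecke_phi :: "nat \<Rightarrow> hecke_elem \<Rightarrow> hecke_elem" where
  "hecke_phi N = hecke_hom (hecke N) (\<lambda>i. pibar N (N - i))"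

definition hecke_theta :: "nat \<Rightarrow> hecke_elem \<Rightarrow> hecke_elem" where
  "hecke_theta N = hecke_hom (hecke N) (\<lambda>i. \<ominus>\<^bsub>hecke N\<^esub> pi_gen N i)"

definition hecke_chi :: "nat \<Rightarrow> hecke_elem \<Rightarrow> hecke_elem" where
  "hecke_chi N = hecke_hom (opposite (hecke N)) (pibar N)"


section \<open>Modules, twists, tensor products and induction\<close>

text \<open>
  An abelian group with an action of \<open>'r\<close>. As in \<^theory>\<open>HOL-Algebra.Free_Abelian_Groups\<close>, the
  addition of the group is the \<open>mult\<close> field and its zero is the \<open>one\<close> field. For a right module,
  \<open>act M x r\<close> is \<open>x \<cdot> r\<close>; for a left module (used only as second factor of \<open>tensor\<close> below),
  \<open>act M x r\<close> is \<open>r \<cdot> x\<close>. A right module over a \<open>\<complex>\<close>-algebra \<open>A\<close> is a complex vector space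
  through \<open>c x = x \<cdot> (c 1\<^sub>A)\<close>, so module homomorphisms are automatically \<open>\<complex>\<close>-linear.
\<close>

record ('v, 'r) acted = "'v monoid" +
  act :: "'v \<Rightarrow> 'r \<Rightarrow> 'v"

locale right_module = R: ring R + M: comm_group M
  for R :: "('r, 'm) ring_scheme" (structure) and M :: "('v, 'r, 'k) acted_scheme" (structure) +
  assumes act_closed: "\<lbrakk>x \<in> carrier M; r \<in> carrier R\<rbrakk> \<Longrightarrow> act M x r \<in> carrier M"
    and act_add_left: "\<lbrakk>x \<in> carrier M; y \<in> carrier M; r \<in> carrier R\<rbrakk>
      \<Longrightarrow> act M (x \<otimes>\<^bsub>M\<^esub> y) r = act M x r \<otimes>\<^bsub>M\<^esub> act M y r"
    and act_add_right: "\<lbrakk>x \<in> carrier M; r \<in> carrier R; s \<in> carrier R\<rbrakk>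
      \<Longrightarrow> act M x (r \<oplus>\<^bsub>R\<^esub> s) = act M x r \<otimes>\<^bsub>M\<^esub> act M x s"
    and act_mult: "\<lbrakk>x \<in> carrier M; r \<in> carrier R; s \<in> carrier R\<rbrakk>
      \<Longrightarrow> act M x (r \<otimes>\<^bsub>R\<^esub> s) = act M (act M x r) s"
    and act_one: "x \<in> carrier M \<Longrightarrow> act M x \<one>\<^bsub>R\<^esub> = x"

definition rmod_iso ::
  "('r, 'm) ring_scheme \<Rightarrow> ('v, 'r) acted \<Rightarrow> ('w, 'r) acted \<Rightarrow> bool" where
  "rmod_iso R M N \<longleftrightarrow> right_module R M \<and> right_module R N \<and>
     (\<exists>f \<in> iso M N. \<forall>x \<in> carrier M. \<forall>r \<in> carrier R. f (act M x r) = act N (f x) r)"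

text \<open>Restriction to a subring; only the carrier of \<open>A\<close> matters.\<close>

definition restriction ::
  "('r, 'm) ring_scheme \<Rightarrow> ('v, 'r) acted \<Rightarrow> ('v, 'r) acted" where
  "restriction A M = M\<lparr>act := \<lambda>x. restrict (act M x) (carrier A)\<rparr>"

text \<open>The twists \<open>\<mu>[M]\<close> and \<open>\<nu>[M]\<close> for an automorphism \<open>\<mu>\<close> and an anti-automorphism \<open>\<nu>\<close>.
  Linear functionals on \<open>M\<close> are extended by \<open>0\<close> outside the carrier.\<close>

definition twist :: "('r \<Rightarrow> 'r) \<Rightarrow> ('v, 'r) acted \<Rightarrow> ('v, 'r) acted" where
  "twist \<mu> M = M\<lparr>act := \<lambda>x r. act M x (\<mu> r)\<rparr>"

definition anti_twist ::
  "(complex, 'r, 'm) module_scheme \<Rightarrow> ('r \<Rightarrow> 'r) \<Rightarrow> ('v, 'r) acted \<Rightarrow> ('v \<Rightarrow> complex, 'r) acted" where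
  "anti_twist A \<nu> M =
     \<lparr>carrier = {\<delta>. (\<forall>x. x \<notin> carrier M \<longrightarrow> \<delta> x = 0)
          \<and> (\<forall>x \<in> carrier M. \<forall>y \<in> carrier M. \<delta> (x \<otimes>\<^bsub>M\<^esub> y) = \<delta> x + \<delta> y)
          \<and> (\<forall>x \<in> carrier M. \<forall>c. \<delta> (act M x (c \<odot>\<^bsub>A\<^esub> \<one>\<^bsub>A\<^esub>)) = c * \<delta> x)},
      monoid.mult = (\<lambda>\<delta> \<epsilon> x. \<delta> x + \<epsilon> x),
      one = (\<lambda>x. 0),
      act = (\<lambda>\<delta> r x. if x \<in> carrier M then \<delta> (act M x (\<nu> r)) else 0)\<rparr>"

text \<open>The tensor product \<open>X \<otimes>\<^sub>S Y\<close> of a right \<open>S\<close>-module \<open>X\<close> and a left \<open>S\<close>-module \<open>Y\<close>: the free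
  abelian group on pairs modulo biadditivity and \<open>S\<close>-balancedness.\<close>

definition tensor_relators ::
  "'r set \<Rightarrow> ('x, 'r) acted \<Rightarrow> ('y, 'r) acted \<Rightarrow> ('x \<times> 'y \<Rightarrow>\<^sub>0 int) set" where
  "tensor_relators S X Y =
     {frag_of (x \<otimes>\<^bsub>X\<^esub> x', y) - frag_of (x, y) - frag_of (x', y) | x x' y.
        x \<in> carrier X \<and> x' \<in> carrier X \<and> y \<in> carrier Y}
   \<union> {frag_of (x, y \<otimes>\<^bsub>Y\<^esub> y') - frag_of (x, y) - frag_of (x, y') | x y y'.
        x \<in> carrier X \<and> y \<in> carrier Y \<and> y' \<in> carrier Y}
   \<union> {frag_of (act X x r, y) - frag_of (x, act Y y r) | x y r.
        x \<in> carrier X \<and> y \<in> carrier Y \<and> r \<in> S}"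

definition tensor_kernel ::
  "'r set \<Rightarrow> ('x, 'r) acted \<Rightarrow> ('y, 'r) acted \<Rightarrow> ('x \<times> 'y \<Rightarrow>\<^sub>0 int) set" where
  "tensor_kernel S X Y =
     generate (free_Abelian_group (carrier X \<times> carrier Y)) (tensor_relators S X Y)"

definition tensor ::
  "'r set \<Rightarrow> ('x, 'r) acted \<Rightarrow> ('y, 'r) acted \<Rightarrow> ('x \<times> 'y \<Rightarrow>\<^sub>0 int) set monoid" where
  "tensor S X Y = free_Abelian_group (carrier X \<times> carrier Y) Mod tensor_kernel S X Y"

definition pure_tensor ::
  "'r set \<Rightarrow> ('x, 'r) acted \<Rightarrow> ('y, 'r) acted \<Rightarrow> 'x \<Rightarrow> 'y \<Rightarrow> ('x \<times> 'y \<Rightarrow>\<^sub>0 int) set" where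
  "pure_tensor S X Y x y =
     tensor_kernel S X Y #>\<^bsub>free_Abelian_group (carrier X \<times> carrier Y)\<^esub> frag_of (x, y)"

text \<open>The additive map from a tensor product to an abelian group \<open>K\<close> with \<open>x \<otimes> y \<mapsto> f (x, y)\<close>, for
  a biadditive balanced \<open>f\<close>.\<close>

definition tensor_lift ::
  "('k, 'm) monoid_scheme \<Rightarrow> ('x \<times> 'y \<Rightarrow> 'k) \<Rightarrow> ('x \<times> 'y \<Rightarrow>\<^sub>0 int) set \<Rightarrow> 'k" where
  "tensor_lift K f Z =
     the_elem ((\<lambda>F. finprod K (\<lambda>p. f p [^]\<^bsub>K\<^esub> Poly_Mapping.lookup F p) (Poly_Mapping.keys F)) ` Z)"

definition left_regular :: "('r, 'm) ring_scheme \<Rightarrow> ('r, 'r) acted" where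
  "left_regular B =
     \<lparr>carrier = carrier B, monoid.mult = add B, one = ring.zero B, act = (\<lambda>b a. a \<otimes>\<^bsub>B\<^esub> b)\<rparr>"

text \<open>The induced module \<open>X \<otimes>\<^sub>A B\<close> of a right \<open>A\<close>-module \<open>X\<close>, for a subring \<open>A\<close> of \<open>B\<close>.\<close>

definition induced ::
  "('r, 'm) ring_scheme \<Rightarrow> ('r, 'n) ring_scheme \<Rightarrow> ('v, 'r) acted
     \<Rightarrow> (('v \<times> 'r \<Rightarrow>\<^sub>0 int) set, 'r) acted" where
  "induced A B X = (let K = tensor (carrier A) X (left_regular B) in
     \<lparr>carrier = carrier K, monoid.mult = monoid.mult K, one = one K,
      act = (\<lambda>Z r. tensor_lift K
        (\<lambda>(x, b). pure_tensor (carrier A) X (left_regular B) x (b \<otimes>\<^bsub>B\<^esub> r)) Z)\<rparr>)"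

text \<open>The underlying complex vector spaces of an algebra and of a module over an algebra.\<close>

definition alg_space :: "(complex, 'r, 'm) module_scheme \<Rightarrow> ('r, complex) acted" where
  "alg_space A =
     \<lparr>carrier = carrier A, monoid.mult = add A, one = ring.zero A, act = (\<lambda>a c. c \<odot>\<^bsub>A\<^esub> a)\<rparr>"

definition mod_space ::
  "(complex, 'r, 'm) module_scheme \<Rightarrow> ('v, 'r) acted \<Rightarrow> ('v, complex) acted" where
  "mod_space A M =
     \<lparr>carrier = carrier M, monoid.mult = monoid.mult M, one = one M,
      act = (\<lambda>x c. act M x (c \<odot>\<^bsub>A\<^esub> \<one>\<^bsub>A\<^esub>))\<rparr>"


section \<open>Parabolic subalgebras and the induction product\<close>

text \<open>The subalgebra of \<open>hecke (m + n)\<close> generated by the \<open>\<pi>\<^sub>i\<close> with \<open>i \<noteq> m\<close>; the multiples of \<open>1\<close>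
  turn the generated subring into the generated \<open>\<complex>\<close>-subalgebra.\<close>

definition parabolic :: "nat \<Rightarrow> nat \<Rightarrow> (complex, hecke_elem) module" where
  "parabolic m n = (hecke (m + n))\<lparr>carrier := generate_ring (hecke (m + n))
     ({pi_gen (m + n) i | i. i \<in> {1..<m + n} - {m}}
      \<union> {c \<odot>\<^bsub>hecke (m + n)\<^esub> \<one>\<^bsub>hecke (m + n)\<^esub> | c. True})\<rparr>"

text \<open>The identification of \<open>hecke m \<otimes> hecke n\<close> with \<open>parabolic m n\<close>, given by
  \<open>\<pi>bar\<^sub>i \<otimes> 1 \<mapsto> \<pi>bar\<^sub>i\<close> and \<open>1 \<otimes> \<pi>bar\<^sub>j \<mapsto> \<pi>bar\<^sub>m\<^sub>+\<^sub>j\<close>.\<close>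

definition hecke_tensor :: "nat \<Rightarrow> nat \<Rightarrow> (hecke_elem \<times> hecke_elem \<Rightarrow>\<^sub>0 int) set monoid" where
  "hecke_tensor m n = tensor UNIV (alg_space (hecke m)) (alg_space (hecke n))"

definition parabolic_emb ::
  "nat \<Rightarrow> nat \<Rightarrow> (hecke_elem \<times> hecke_elem \<Rightarrow>\<^sub>0 int) set \<Rightarrow> hecke_elem" where
  "parabolic_emb m n = tensor_lift (add_monoid (hecke (m + n)))
     (\<lambda>(a, b). hecke_hom (hecke (m + n)) (pibar (m + n)) a
        \<otimes>\<^bsub>hecke (m + n)\<^esub> hecke_hom (hecke (m + n)) (\<lambda>j. pibar (m + n) (m + j)) b)"

text \<open>The tensor product \<open>M \<otimes> N\<close> over \<open>\<complex>\<close>, with \<open>(x \<otimes> y) \<cdot> (a \<otimes> b) = x a \<otimes> y b\<close>, as a right module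
  over \<open>parabolic m n\<close>.\<close>

definition outer_tensor ::
  "nat \<Rightarrow> nat \<Rightarrow> ('v, hecke_elem) acted \<Rightarrow> ('w, hecke_elem) acted
     \<Rightarrow> (('v \<times> 'w \<Rightarrow>\<^sub>0 int) set, hecke_elem) acted" where
  "outer_tensor m n M N =
    (let X = mod_space (hecke m) M; Y = mod_space (hecke n) N; K = tensor UNIV X Y in
     \<lparr>carrier = carrier K, monoid.mult = monoid.mult K, one = one K,
      act = (\<lambda>Z h.
        let T = inv_into (carrier (hecke_tensor m n)) (parabolic_emb m n) h in
        tensor_lift K (\<lambda>(x, y).
          tensor_lift K (\<lambda>(a, b). pure_tensor UNIV X Y (act M x a) (act N y b)) T) Z)\<rparr>)"

definition ind_prod ::
  "nat \<Rightarrow> nat \<Rightarrow> ('v, hecke_elem) acted \<Rightarrow> ('w, hecke_elem) acted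
     \<Rightarrow> ((('v \<times> 'w \<Rightarrow>\<^sub>0 int) set \<times> hecke_elem \<Rightarrow>\<^sub>0 int) set, hecke_elem) acted" where
  "ind_prod m n M N = induced (parabolic m n) (hecke (m + n)) (outer_tensor m n M N)"


section \<open>Poset modules\<close>

type_synonym perm = "nat \<Rightarrow> nat"

definition simple_transp :: "nat \<Rightarrow> perm" where
  "simple_transp i = transpose i (i + 1)"

text \<open>Coxeter length in the symmetric group on \<open>{1..n}\<close>.\<close>

definition len :: "nat \<Rightarrow> perm \<Rightarrow> nat" where
  "len n \<sigma> = (LEAST k. \<exists>is. length is = k \<and> set is \<subseteq> {1..<n} \<and>
     \<sigma> = foldr (\<lambda>i \<tau>. simple_transp i \<circ> \<tau>) is id)"

definition DesR :: "nat \<Rightarrow> perm \<Rightarrow> nat set" where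
  "DesR n \<gamma> = {i \<in> {1..<n}. len n (\<gamma> \<circ> simple_transp i) < len n \<gamma>}"

text \<open>A partial order on \<open>{1..n}\<close> is a relation \<open>P\<close> with \<open>partial_order_on {1..n} P\<close>, where
  \<open>(u, v) \<in> P\<close> means \<open>u \<preceq>\<^sub>P v\<close>. The dual \<open>P\<^sup>*\<close> is \<open>P\<inverse>\<close>.\<close>

definition SigmaR :: "nat \<Rightarrow> (nat \<times> nat) set \<Rightarrow> perm set" where
  "SigmaR n P = {\<sigma>. \<sigma> permutes {1..n} \<and>
     (\<forall>i j. (i, j) \<in> P \<and> i \<noteq> j \<longrightarrow> inv_into UNIV \<sigma> i < inv_into UNIV \<sigma> j)}"

definition bar :: "nat \<Rightarrow> (nat \<times> nat) set \<Rightarrow> (nat \<times> nat) set" where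
  "bar n P = {(u, v). u \<in> {1..n} \<and> v \<in> {1..n} \<and> (n + 1 - u, n + 1 - v) \<in> P}"

text \<open>Vectors in the span of a finite set \<open>B\<close> are functions supported on \<open>B\<close>. Given the images
  \<open>a \<gamma> i\<close> of the basis vectors \<open>\<gamma> \<in> B\<close> under \<open>\<pi>bar\<^sub>i\<close>, \<open>gen_op B a i\<close> is the linear extension, a word
  acts letter by letter from left to right, and a coset acts through any of its elements.\<close>

type_synonym vec = "perm \<Rightarrow> complex"

definition basis_vec :: "perm \<Rightarrow> vec" where
  "basis_vec \<gamma> = (\<lambda>\<tau>. if \<tau> = \<gamma> then 1 else 0)"

definition gen_op :: "perm set \<Rightarrow> (perm \<Rightarrow> nat \<Rightarrow> vec) \<Rightarrow> nat \<Rightarrow> vec \<Rightarrow> vec" where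
  "gen_op B a i v = (\<lambda>\<tau>. \<Sum>\<gamma>\<in>B. v \<gamma> * a \<gamma> i \<tau>)"

definition span_module :: "perm set \<Rightarrow> (perm \<Rightarrow> nat \<Rightarrow> vec) \<Rightarrow> (vec, hecke_elem) acted" where
  "span_module B a =
     \<lparr>carrier = {v. \<forall>\<tau>. v \<tau> \<noteq> 0 \<longrightarrow> \<tau> \<in> B},
      monoid.mult = (\<lambda>v w \<tau>. v \<tau> + w \<tau>),
      one = (\<lambda>\<tau>. 0),
      act = (\<lambda>v h. the_elem ((\<lambda>f \<tau>. \<Sum>w | f w \<noteq> 0. f w * fold (gen_op B a) w v \<tau>) ` h))\<rparr>"

definition poset_module :: "nat \<Rightarrow> (nat \<times> nat) set \<Rightarrow> (vec, hecke_elem) acted" where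
  "poset_module n P = span_module (SigmaR n P) (\<lambda>\<gamma> i \<tau>.
     if i \<in> DesR n \<gamma> then - basis_vec \<gamma> \<tau>
     else if \<gamma> \<circ> simple_transp i \<notin> SigmaR n P then 0
     else basis_vec (\<gamma> \<circ> simple_transp i) \<tau>)"

text \<open>The module \<open>\<^bold>M\<^sub>P\<close> is given by the action of \<open>\<pi>\<^sub>i\<close>; the action of \<open>\<pi>bar\<^sub>i = \<pi>\<^sub>i - 1\<close> is
  obtained by subtracting \<open>\<gamma>\<close>.\<close>

definition bold_poset_module :: "nat \<Rightarrow> (nat \<times> nat) set \<Rightarrow> (vec, hecke_elem) acted" where
  "bold_poset_module n P = span_module (SigmaR n P) (\<lambda>\<gamma> i \<tau>.
     (if i \<in> DesR n \<gamma> then basis_vec \<gamma> \<tau>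
      else if \<gamma> \<circ> simple_transp i \<notin> SigmaR n P then 0
      else basis_vec (\<gamma> \<circ> simple_transp i) \<tau>)
     - basis_vec \<gamma> \<tau>)"

end

theory Submission
  imports Defs
begin

text \<open>
  On linear extensions the isomorphisms are explicit: \<open>\<phi>\<close> conjugates by the longest permutation, \<open>\<theta>\<close>
  multiplies a basis vector by the sign of its permutation, and \<open>\<chi>\<close> sends a dual basis vector
  to its left multiple by the longest permutation, the matrices of the generators on \<open>M\<^sub>P\<close> and
  \<open>\<^bold>M\<close> of \<open>bar P\<close> being transposes of each other. Part (b) follows by restriction.

  Part (a) reduces to the same three isomorphisms because \<open>M\<^bsub>P\<^sub>1\<^esub> \<boxtimes> M\<^bsub>P\<^sub>2\<^esub>\<close> is the poset module of the
  disjoint union \<open>Q\<close> of \<open>P\<^sub>1\<close> and the shift of \<open>P\<^sub>2\<close>. The linear extensions of \<open>Q\<close> that preserve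
  \<open>{1..m}\<close> span a copy \<open>V\<^sub>0\<close> of \<open>M\<^bsub>P\<^sub>1\<^esub> \<otimes> M\<^bsub>P\<^sub>2\<^esub>\<close>, and every linear extension of \<open>Q\<close> is the product
  of one of these with a minimal coset representative. Choosing for the coset representative of a
  set \<open>S\<close> of positions an explicit product of generators \<open>T\<^sub>S\<close>, one has
  \<open>T\<^sub>S g\<^sub>i \<in> {T\<^bsub>s\<^sub>i S\<^esub>, e T\<^sub>S, g\<^sub>j T\<^sub>S}\<close>; hence \<open>\<gamma> \<mapsto> \<delta> \<otimes> T\<^sub>S\<close> is a module map inverse to
  \<open>z \<otimes> b \<mapsto> z \<cdot> b\<close>. No basis of the Hecke algebra is needed.
\<close>

section \<open>Complex algebras and the 0-Hecke algebra\<close>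

text \<open>Elements of \<open>hecke n\<close> are cosets, so every map out of it comes from the
  universal property; modules are homomorphisms into operators on functions, with composition
  reversed, and identities between actions are checked on generators and scalars. The outer tensor
  product acts through an arbitrarily chosen preimage under \<open>parabolic_emb\<close>. That the
  choice is harmless is seen after embedding the outer tensor product into the poset module of the
  disjoint union: there a preimage acts as its image does, and the embedding is injective. In the
  comparison of the induced module with that poset module, surjectivity is sorting; the obstacle is
  injectivity. It is settled by a map in the other direction, prescribed on multiples of basis
  vectors, whose compatibility with the generators rests on braid moves between products of cycles.
  The generators \<open>pibar\<close> and \<open>pi_gen\<close> satisfy
  \<open>g \<otimes> g = e \<odot> g\<close> with \<open>e = -1\<close> and \<open>e = 1\<close>,
  and otherwise the same relations. This is why one argument with a parameter \<open>e\<close>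
  serves both kinds of poset modules; the shift \<open>(1 + e) / 2\<close> returns to
  \<open>pibar\<close>.\<close>

locale complex_algebra = ring A for A :: "(complex, 'a, 'm) module_scheme" (structure) +
  assumes smult_closed [simp, intro]: "a \<in> carrier A \<Longrightarrow> c \<odot> a \<in> carrier A"
    and smult_l_distr: "a \<in> carrier A \<Longrightarrow> (c + d) \<odot> a = c \<odot> a \<oplus> d \<odot> a"
    and smult_r_distr: "\<lbrakk>a \<in> carrier A; b \<in> carrier A\<rbrakk> \<Longrightarrow> c \<odot> (a \<oplus> b) = c \<odot> a \<oplus> c \<odot> b"
    and smult_assoc: "a \<in> carrier A \<Longrightarrow> (c * d) \<odot> a = c \<odot> (d \<odot> a)"
    and smult_one [simp]: "a \<in> carrier A \<Longrightarrow> 1 \<odot> a = a"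
    and smult_mult_l: "\<lbrakk>a \<in> carrier A; b \<in> carrier A\<rbrakk> \<Longrightarrow> (c \<odot> a) \<otimes> b = c \<odot> (a \<otimes> b)"
    and smult_mult_r: "\<lbrakk>a \<in> carrier A; b \<in> carrier A\<rbrakk> \<Longrightarrow> a \<otimes> (c \<odot> b) = c \<odot> (a \<otimes> b)"
begin

lemma smult_zero [simp]: "a \<in> carrier A \<Longrightarrow> 0 \<odot> a = \<zero>"
  using smult_l_distr[of a 0 0] by (simp add: add.r_cancel_one')

lemma smult_minus_one: "a \<in> carrier A \<Longrightarrow> (-1) \<odot> a = \<ominus> a"
  using smult_l_distr[of a "-1" 1] by (simp add: add.inv_equality)

lemma scalar_central: "a \<in> carrier A \<Longrightarrow> (c \<odot> \<one>) \<otimes> a = a \<otimes> (c \<odot> \<one>)"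
  by (simp add: smult_mult_l smult_mult_r)

lemma smult_eq_mult: "a \<in> carrier A \<Longrightarrow> c \<odot> a = (c \<odot> \<one>) \<otimes> a"
  by (simp add: smult_mult_l)

definition word_prod :: "(nat \<Rightarrow> 'a) \<Rightarrow> nat list \<Rightarrow> 'a" where
  "word_prod g w = foldr (\<lambda>i a. g i \<otimes> a) w \<one>"

lemma word_prod_simps [simp]: "word_prod g [] = \<one>" "word_prod g (i # w) = g i \<otimes> word_prod g w"
  by (simp_all add: word_prod_def)

lemma word_prod_closed [simp]:
  "\<lbrakk>g ` X \<subseteq> carrier A; set w \<subseteq> X\<rbrakk> \<Longrightarrow> word_prod g w \<in> carrier A"
  by (induction w) auto

lemma word_prod_append:
  "\<lbrakk>g ` X \<subseteq> carrier A; set u \<subseteq> X; set v \<subseteq> X\<rbrakk>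
    \<Longrightarrow> word_prod g (u @ v) = word_prod g u \<otimes> word_prod g v"
  by (induction u) (auto simp: m_assoc image_subset_iff)

end

section \<open>The free algebra on words\<close>

definition free_monom :: "complex \<Rightarrow> nat list \<Rightarrow> free_elem" where
  "free_monom c u = (\<lambda>w. if w = u then c else 0)"

definition free_conv :: "free_elem \<Rightarrow> free_elem \<Rightarrow> free_elem" where
  "free_conv f g w = (\<Sum>k\<le>length w. f (take k w) * g (drop k w))"

lemma free_alg_simps [simp]:
  "monoid.mult (free_alg n) = free_conv"
  "one (free_alg n) = free_monom 1 []"
  "ring.zero (free_alg n) = (\<lambda>w. 0)"
  "add (free_alg n) = (\<lambda>f g w. f w + g w)"
  by (auto simp: free_alg_def free_conv_def free_monom_def fun_eq_iff)

lemma free_alg_carrier: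
  "f \<in> carrier (free_alg n) \<longleftrightarrow> finite {w. f w \<noteq> 0} \<and> (\<forall>w. f w \<noteq> 0 \<longrightarrow> set w \<subseteq> {1..<n})"
  by (simp add: free_alg_def)

lemma monom_carrier [simp]: "set u \<subseteq> {1..<n} \<Longrightarrow> free_monom c u \<in> carrier (free_alg n)"
  by (auto simp: free_alg_carrier free_monom_def)

lemma word_eq_monom: "word u = free_monom 1 u"
  by (simp add: word_def free_monom_def)

lemma free_alg_add_carrier:
  assumes "f \<in> carrier (free_alg n)" "g \<in> carrier (free_alg n)"
  shows "(\<lambda>w. f w + g w) \<in> carrier (free_alg n)"
proof -
  have "{w. f w + g w \<noteq> 0} \<subseteq> {w. f w \<noteq> 0} \<union> {w. g w \<noteq> 0}"
    by auto
  moreover have "finite ({w. f w \<noteq> 0} \<union> {w. g w \<noteq> 0})"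
    using assms by (simp add: free_alg_carrier)
  ultimately have "finite {w. f w + g w \<noteq> 0}"
    by (rule finite_subset)
  moreover have "set w \<subseteq> {1..<n}" if "f w + g w \<noteq> 0" for w
  proof -
    have "f w \<noteq> 0 \<or> g w \<noteq> 0"
      using that by auto
    then show ?thesis
      using assms by (auto simp: free_alg_carrier)
  qed
  ultimately show ?thesis
    by (simp add: free_alg_carrier)
qed

text \<open>Induction on the size of the support, removing one word at a time. The ring laws are
  additive in each argument, so this reduces them to monomials, where the product is
  concatenation.\<close>

lemma free_alg_induct [consumes 1, case_names zero add]:
  assumes "f \<in> carrier (free_alg n)"
    and zero: "P (\<lambda>w. 0)"
    and add: "\<And>f c u. \<lbrakk>f \<in> carrier (free_alg n); set u \<subseteq> {1..<n}; P f\<rbrakk>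
      \<Longrightarrow> P (\<lambda>w. f w + free_monom c u w)"
  shows "P f"
proof -
  have "P f" if "finite S" "{w. f w \<noteq> 0} = S" "f \<in> carrier (free_alg n)" for S f
    using that
  proof (induction S arbitrary: f rule: finite_induct)
    case empty
    then have "f = (\<lambda>w. 0)"
      by auto
    then show ?case
      using zero by simp
  next
    case (insert u S)
    let ?g = "\<lambda>w. if w = u then 0 else f w"
    have S: "{w. ?g w \<noteq> 0} = S"
      using insert.hyps insert.prems(1) by auto
    have g: "?g \<in> carrier (free_alg n)"
      using insert.prems(2) S insert.hyps(1) by (auto simp: free_alg_carrier)
    have "f u \<noteq> 0"
      using insert.prems(1) by auto
    then have "set u \<subseteq> {1..<n}"
      using insert.prems(2) by (auto simp: free_alg_carrier)
    then have "P (\<lambda>w. ?g w + free_monom (f u) u w)"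
      using add insert.IH[OF S g] g by blast
    moreover have "(\<lambda>w. ?g w + free_monom (f u) u w) = f"
      by (auto simp: free_monom_def)
    ultimately show ?case
      by simp
  qed
  then show ?thesis
    using assms(1) by (auto simp: free_alg_carrier)
qed

lemma conv_add_left: "free_conv (\<lambda>w. f w + g w) h = (\<lambda>w. free_conv f h w + free_conv g h w)"
  by (simp add: free_conv_def fun_eq_iff distrib_right sum.distrib)

lemma conv_add_right: "free_conv h (\<lambda>w. f w + g w) = (\<lambda>w. free_conv h f w + free_conv h g w)"
  by (simp add: free_conv_def fun_eq_iff distrib_left sum.distrib)

lemma conv_zero [simp]: "free_conv (\<lambda>w. 0) h = (\<lambda>w. 0)" "free_conv h (\<lambda>w. 0) = (\<lambda>w. 0)"
  by (simp_all add: free_conv_def fun_eq_iff)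

text \<open>A splitting of a word contributes only if its left half is \<open>u\<close> and its
  right half is \<open>v\<close>; this happens at most once, at \<open>k = length u\<close>.\<close>

lemma conv_monom: "free_conv (free_monom c u) (free_monom d v) = free_monom (c * d) (u @ v)"
proof
  fix w
  show "free_conv (free_monom c u) (free_monom d v) w = free_monom (c * d) (u @ v) w"
  proof (cases "w = u @ v")
    case True
    have "free_conv (free_monom c u) (free_monom d v) w
        = (\<Sum>k\<le>length w. if k = length u then c * d else 0)"
      unfolding free_conv_def
      by (rule sum.cong) (auto simp: free_monom_def True take_append append_eq_conv_conj min_def)
    then show ?thesis
      by (simp add: True free_monom_def)
  next
    case False
    have "free_monom c u (take k w) * free_monom d v (drop k w) = 0" for k
      using False append_take_drop_id[of k w] by (auto simp: free_monom_def)
    then have "free_conv (free_monom c u) (free_monom d v) w = 0"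
      unfolding free_conv_def by (intro sum.neutral ballI) simp
    then show ?thesis
      using False by (simp add: free_monom_def)
  qed
qed

lemma conv_carrier:
  assumes "f \<in> carrier (free_alg n)" "g \<in> carrier (free_alg n)"
  shows "free_conv f g \<in> carrier (free_alg n)"
  using assms(1)
proof (induction rule: free_alg_induct)
  case zero
  show ?case
    by (simp add: free_alg_carrier)
next
  case (add f c u)
  have "free_conv (free_monom c u) g \<in> carrier (free_alg n)"
    using assms(2)
  proof (induction rule: free_alg_induct)
    case zero
    show ?case
      by (simp add: free_alg_carrier)
  next
    case (add f d v)
    then show ?case
      using \<open>set u \<subseteq> _\<close> by (simp add: conv_add_right conv_monom free_alg_add_carrier)
  qed
  then show ?case
    using add by (simp add: conv_add_left free_alg_add_carrier)
qed

lemma conv_assoc: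
  assumes "f \<in> carrier (free_alg n)" "g \<in> carrier (free_alg n)" "h \<in> carrier (free_alg n)"
  shows "free_conv (free_conv f g) h = free_conv f (free_conv g h)"
  using assms(1)
proof (induction rule: free_alg_induct)
  case (add f c u)
  have "free_conv (free_conv (free_monom c u) g) h = free_conv (free_monom c u) (free_conv g h)"
    using assms(2)
  proof (induction rule: free_alg_induct)
    case (add g d v)
    have "free_conv (free_conv (free_monom c u) (free_monom d v)) h = free_conv (free_monom c u) (free_conv (free_monom d v) h)"
      using assms(3)
      by (induction rule: free_alg_induct) (simp_all add: conv_add_right conv_monom mult.assoc)
    then show ?case
      using add by (simp add: conv_add_left conv_add_right)
  qed simp
  then show ?case
    using add by (simp add: conv_add_left)
qed simp

lemma free_alg_ring: "ring (free_alg n)"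
proof (rule ringI)
  show "abelian_group (free_alg n)"
  proof (rule abelian_groupI)
    fix f assume f: "f \<in> carrier (free_alg n)"
    show "\<exists>g\<in>carrier (free_alg n). g \<oplus>\<^bsub>free_alg n\<^esub> f = \<zero>\<^bsub>free_alg n\<^esub>"
      by (rule bexI[of _ "\<lambda>w. - f w"]) (use f in \<open>auto simp: free_alg_carrier\<close>)
  qed (auto simp: free_alg_add_carrier add.assoc add.commute, simp add: free_alg_carrier)
  have [simp]: "free_conv (free_monom 1 []) f = f" "free_conv f (free_monom 1 []) = f"
    if "f \<in> carrier (free_alg n)" for f
    using that
    by (induction rule: free_alg_induct) (simp_all add: conv_add_left conv_add_right conv_monom)
  show "monoid (free_alg n)"
    by (rule monoidI) (simp_all add: conv_carrier conv_assoc)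
qed (simp_all add: conv_add_left conv_add_right)

section \<open>Evaluation of words in an algebra\<close>

context complex_algebra
begin

text \<open>Words may cancel in a sum. Evaluating over any finite superset of the support lets two
  elements be added over a common index set.\<close>

lemma free_hom_superset:
  assumes "g ` {1..<n} \<subseteq> carrier A" "finite S" "{w. f w \<noteq> 0} \<subseteq> S" "\<forall>w\<in>S. set w \<subseteq> {1..<n}"
  shows "free_hom A g f = finsum A (\<lambda>w. f w \<odot> word_prod g w) S"
  unfolding free_hom_def word_prod_def[symmetric]
  by (rule add.finprod_mono_neutral_cong_left) (use assms in \<open>auto intro!: smult_closed word_prod_closed[of g "{1..<n}"]\<close>)

context
  fixes g :: "nat \<Rightarrow> 'a" and n :: nat
  assumes g: "g ` {1..<n} \<subseteq> carrier A"
begin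

lemma free_hom_closed:
  assumes "f \<in> carrier (free_alg n)"
  shows "free_hom A g f \<in> carrier A"
proof -
  have "free_hom A g f = finsum A (\<lambda>w. f w \<odot> word_prod g w) {w. f w \<noteq> 0}"
    by (rule free_hom_superset[OF g]) (use assms in \<open>auto simp: free_alg_carrier\<close>)
  also have "\<dots> \<in> carrier A"
    using assms word_prod_closed[OF g] by (intro finsum_closed) (simp add: free_alg_carrier)
  finally show ?thesis .
qed

lemma free_hom_add:
  assumes f: "f \<in> carrier (free_alg n)" and h: "h \<in> carrier (free_alg n)"
  shows "free_hom A g (\<lambda>w. f w + h w) = free_hom A g f \<oplus> free_hom A g h"
proof -
  let ?S = "{w. f w \<noteq> 0} \<union> {w. h w \<noteq> 0}"
  have S: "finite ?S" "\<forall>w\<in>?S. set w \<subseteq> {1..<n}"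
    using f h by (auto simp: free_alg_carrier)
  have W: "word_prod g w \<in> carrier A" if "w \<in> ?S" for w
    using word_prod_closed[OF g] S(2) that by blast
  have "free_hom A g (\<lambda>w. f w + h w) = finsum A (\<lambda>w. (f w + h w) \<odot> word_prod g w) ?S"
    by (rule free_hom_superset[OF g S(1) _ S(2)]) auto
  also have "\<dots> = finsum A (\<lambda>w. f w \<odot> word_prod g w \<oplus> h w \<odot> word_prod g w) ?S"
    using W by (intro finsum_cong') (auto simp: smult_l_distr)
  also have "\<dots> = finsum A (\<lambda>w. f w \<odot> word_prod g w) ?S \<oplus> finsum A (\<lambda>w. h w \<odot> word_prod g w) ?S"
    using W by (intro finsum_addf) auto
  also have "finsum A (\<lambda>w. f w \<odot> word_prod g w) ?S = free_hom A g f"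
    by (rule free_hom_superset[OF g S(1) _ S(2), symmetric]) auto
  also have "finsum A (\<lambda>w. h w \<odot> word_prod g w) ?S = free_hom A g h"
    by (rule free_hom_superset[OF g S(1) _ S(2), symmetric]) auto
  finally show ?thesis .
qed

lemma free_hom_monom:
  assumes "set u \<subseteq> {1..<n}"
  shows "free_hom A g (free_monom c u) = c \<odot> word_prod g u"
proof -
  have W: "word_prod g u \<in> carrier A"
    using assms by (rule word_prod_closed[OF g])
  have "free_hom A g (free_monom c u) = finsum A (\<lambda>w. free_monom c u w \<odot> word_prod g w) {u}"
    by (rule free_hom_superset[OF g]) (use assms in \<open>auto simp: free_monom_def\<close>)
  also have "\<dots> = free_monom c u u \<odot> word_prod g u"
    using W by (subst finsum_insert) auto
  finally show ?thesis
    by (simp add: free_monom_def)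
qed

lemma free_hom_zero: "free_hom A g (\<lambda>w. 0) = \<zero>"
  by (simp add: free_hom_def)

lemma free_hom_mult:
  assumes f: "f \<in> carrier (free_alg n)" and h: "h \<in> carrier (free_alg n)"
  shows "free_hom A g (free_conv f h) = free_hom A g f \<otimes> free_hom A g h"
  using f
proof (induction rule: free_alg_induct)
  case zero
  show ?case
    by (simp add: free_hom_zero free_hom_closed h)
next
  case (add f c u)
  have W: "word_prod g u \<in> carrier A"
    using add.hyps(2) by (rule word_prod_closed[OF g])
  have "free_hom A g (free_conv (free_monom c u) h) = free_hom A g (free_monom c u) \<otimes> free_hom A g h"
    using h
  proof (induction rule: free_alg_induct)
    case zero
    show ?case
      using W by (simp add: free_hom_zero free_hom_monom[OF \<open>set u \<subseteq> {1..<n}\<close>])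
  next
    case (add h d v)
    have W': "word_prod g v \<in> carrier A"
      using add.hyps(2) by (rule word_prod_closed[OF g])
    have "free_hom A g (free_conv (free_monom c u) (free_monom d v))
        = free_hom A g (free_monom c u) \<otimes> free_hom A g (free_monom d v)"
      using add.hyps \<open>set u \<subseteq> {1..<n}\<close> W W'
      by (simp add: conv_monom free_hom_monom word_prod_append[OF g]
          smult_mult_l smult_mult_r mult.commute flip: smult_assoc)
    then show ?case
      using add \<open>set u \<subseteq> {1..<n}\<close>
      by (simp add: conv_add_right free_hom_add conv_carrier free_hom_closed r_distr)
  qed
  then show ?case
    using add h by (simp add: conv_add_left free_hom_add conv_carrier free_hom_closed l_distr)
qed

lemma free_hom_ring_hom: "free_hom A g \<in> ring_hom (free_alg n) A"
  using g
  by (intro ring_hom_memI)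
    (auto simp: free_hom_closed free_hom_add free_hom_mult free_hom_monom)

end

end

text \<open>The ring axioms see only five fields, so they pass between records that differ
  elsewhere: \<open>hecke n\<close> adds a scalar multiplication to the quotient ring.\<close>

lemma ring_cong:
  assumes "ring R" and "carrier S = carrier R" "monoid.mult S = monoid.mult R" "one S = one R"
    "ring.zero S = ring.zero R" "add S = add R"
  shows "ring S"
proof -
  interpret ring R
    by fact
  show ?thesis
    by (intro ringI abelian_groupI monoidI)
      (auto simp: assms m_assoc l_distr r_distr a_assoc add.m_lcomm a_comm intro: add.l_inv_ex)
qed

section \<open>The quotient by the Hecke relations and its universal property\<close>

abbreviation hecke_coset :: "nat \<Rightarrow> free_elem \<Rightarrow> hecke_elem" where
  "hecke_coset n f \<equiv> hecke_ideal n +>\<^bsub>free_alg n\<^esub> f"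

lemma hecke_relators_carrier: "hecke_relators n \<subseteq> carrier (free_alg n)"
proof -
  have "word u \<ominus>\<^bsub>free_alg n\<^esub> word v \<in> carrier (free_alg n)"
    if "set u \<subseteq> {1..<n}" "set v \<subseteq> {1..<n}" for u v
    using that by (intro ring.ring_simprules(4)[OF free_alg_ring]) (auto simp: word_eq_monom)
  moreover have "word u \<oplus>\<^bsub>free_alg n\<^esub> word v \<in> carrier (free_alg n)"
    if "set u \<subseteq> {1..<n}" "set v \<subseteq> {1..<n}" for u v
    using that by (intro ring.ring_simprules(1)[OF free_alg_ring]) (auto simp: word_eq_monom)
  ultimately show ?thesis
    unfolding hecke_relators_def by (intro Un_least subsetI; clarsimp)
qed

lemma hecke_ideal_ideal: "ideal (hecke_ideal n) (free_alg n)"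
  unfolding hecke_ideal_def
  by (rule ring.genideal_ideal[OF free_alg_ring hecke_relators_carrier])

lemma hecke_simps:
  "carrier (hecke n) = carrier (free_alg n Quot hecke_ideal n)"
  "monoid.mult (hecke n) = monoid.mult (free_alg n Quot hecke_ideal n)"
  "one (hecke n) = one (free_alg n Quot hecke_ideal n)"
  "ring.zero (hecke n) = ring.zero (free_alg n Quot hecke_ideal n)"
  "add (hecke n) = add (free_alg n Quot hecke_ideal n)"
  "smult (hecke n) c X = hecke_coset n (free_monom c []) \<otimes>\<^bsub>hecke n\<^esub> X"
  by (simp_all add: hecke_def Let_def free_monom_def)

lemma hecke_ring: "ring (hecke n)"
  by (rule ring_cong[OF ideal.quotient_is_ring[OF hecke_ideal_ideal]]) (simp_all add: hecke_simps)

lemma hecke_coset_ring_hom: "hecke_coset n \<in> ring_hom (free_alg n) (hecke n)"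
  using ideal.rcos_ring_hom[OF hecke_ideal_ideal[of n]]
  by (simp add: ring_hom_def hecke_simps)

lemma hecke_coset_closed:
  "f \<in> carrier (free_alg n) \<Longrightarrow> hecke_coset n f \<in> carrier (hecke n)"
  using ring_hom_closed[OF hecke_coset_ring_hom] .

lemma hecke_coset_add:
  "\<lbrakk>f \<in> carrier (free_alg n); g \<in> carrier (free_alg n)\<rbrakk>
    \<Longrightarrow> hecke_coset n (\<lambda>w. f w + g w) = hecke_coset n f \<oplus>\<^bsub>hecke n\<^esub> hecke_coset n g"
  using ring_hom_add[OF hecke_coset_ring_hom, of f n g] by simp

lemma hecke_coset_mult:
  "\<lbrakk>f \<in> carrier (free_alg n); g \<in> carrier (free_alg n)\<rbrakk>
    \<Longrightarrow> hecke_coset n (free_conv f g) = hecke_coset n f \<otimes>\<^bsub>hecke n\<^esub> hecke_coset n g"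
  using ring_hom_mult[OF hecke_coset_ring_hom, of f n g] by simp

lemma hecke_coset_one: "hecke_coset n (free_monom 1 []) = \<one>\<^bsub>hecke n\<^esub>"
  using ring_hom_one[OF hecke_coset_ring_hom, of n] by simp

lemma hecke_cases:
  assumes "h \<in> carrier (hecke n)"
  obtains f where "f \<in> carrier (free_alg n)" "h = hecke_coset n f"
  using assms by (auto simp: hecke_simps FactRing_def A_RCOSETS_def' a_r_coset_def')

text \<open>Scalars are multiples of the empty word. Their centrality in the free algebra gives
  \<open>a \<otimes> (c \<odot> b) = c \<odot> (a \<otimes> b)\<close> in the quotient.\<close>

lemma free_conv_scalar_comm:
  "f \<in> carrier (free_alg n) \<Longrightarrow> free_conv f (free_monom c []) = free_conv (free_monom c []) f"
  by (induction rule: free_alg_induct) (simp_all add: conv_add_left conv_add_right conv_monom mult.commute)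

lemma free_monom_add: "free_monom (c + d) u = (\<lambda>w. free_monom c u w + free_monom d u w)"
  by (auto simp: free_monom_def)

lemma hecke_algebra: "complex_algebra (hecke n)"
proof -
  interpret ring "hecke n"
    by (rule hecke_ring)
  note c = hecke_coset_closed[OF monom_carrier]
  show ?thesis
  proof (intro complex_algebra.intro complex_algebra_axioms.intro hecke_ring)
    fix a c d assume a: "a \<in> carrier (hecke n)"
    show "(c + d) \<odot>\<^bsub>hecke n\<^esub> a = c \<odot>\<^bsub>hecke n\<^esub> a \<oplus>\<^bsub>hecke n\<^esub> d \<odot>\<^bsub>hecke n\<^esub> a"
      using a by (simp add: hecke_simps(6) free_monom_add hecke_coset_add c l_distr)
    show "(c * d) \<odot>\<^bsub>hecke n\<^esub> a = c \<odot>\<^bsub>hecke n\<^esub> (d \<odot>\<^bsub>hecke n\<^esub> a)"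
      using a conv_monom[of c "[]" d "[]"]
        hecke_coset_mult[of "free_monom c []" n "free_monom d []"]
      by (simp add: hecke_simps(6) m_assoc c)
  next
    fix a b c assume a: "a \<in> carrier (hecke n)" and b: "b \<in> carrier (hecke n)"
    obtain f where f: "f \<in> carrier (free_alg n)" "a = hecke_coset n f"
      using a by (rule hecke_cases)
    have "hecke_coset n (free_monom c []) \<otimes>\<^bsub>hecke n\<^esub> a = a \<otimes>\<^bsub>hecke n\<^esub> hecke_coset n (free_monom c [])"
      using hecke_coset_mult[OF f(1), of "free_monom c []"]
        hecke_coset_mult[OF _ f(1), of "free_monom c []"] free_conv_scalar_comm[OF f(1), of c]
      by (simp add: f(2))
    then show "a \<otimes>\<^bsub>hecke n\<^esub> (c \<odot>\<^bsub>hecke n\<^esub> b) = c \<odot>\<^bsub>hecke n\<^esub> (a \<otimes>\<^bsub>hecke n\<^esub> b)"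
      using a b c by (simp add: hecke_simps(6) flip: m_assoc)
  qed (simp_all add: hecke_simps(6) c r_distr m_assoc hecke_coset_one)
qed

interpretation hecke: complex_algebra "hecke n" for n
  by (rule hecke_algebra)

lemma scalar_eq_coset: "c \<odot>\<^bsub>hecke n\<^esub> \<one>\<^bsub>hecke n\<^esub> = hecke_coset n (free_monom c [])"
  by (simp add: hecke_simps(6) hecke_coset_closed)

lemma pibar_eq_coset: "pibar n i = hecke_coset n (free_monom 1 [i])"
  by (simp add: pibar_def word_eq_monom)

lemma pibar_closed [simp]: "i \<in> {1..<n} \<Longrightarrow> pibar n i \<in> carrier (hecke n)"
  by (simp add: pibar_eq_coset hecke_coset_closed)

text \<open>Words grow at their right end, so the last generator is peeled off by right
  multiplication; for right modules this is the step that \<open>act_mult\<close> handles.\<close>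

lemma hecke_induct [consumes 1, case_names scalar add mult]:
  assumes "h \<in> carrier (hecke n)"
    and scalar: "\<And>c. P (c \<odot>\<^bsub>hecke n\<^esub> \<one>\<^bsub>hecke n\<^esub>)"
    and add: "\<And>x y. \<lbrakk>x \<in> carrier (hecke n); y \<in> carrier (hecke n); P x; P y\<rbrakk> \<Longrightarrow> P (x \<oplus>\<^bsub>hecke n\<^esub> y)"
    and mult: "\<And>x i. \<lbrakk>x \<in> carrier (hecke n); i \<in> {1..<n}; P x\<rbrakk> \<Longrightarrow> P (x \<otimes>\<^bsub>hecke n\<^esub> pibar n i)"
  shows "P h"
proof -
  have monom: "P (hecke_coset n (free_monom c u))" if "set u \<subseteq> {1..<n}" for c u
    using that
  proof (induction u rule: rev_induct)
    case Nil
    then show ?case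
      using scalar[of c] by (simp add: scalar_eq_coset)
  next
    case (snoc i u)
    then have "P (hecke_coset n (free_monom c u) \<otimes>\<^bsub>hecke n\<^esub> pibar n i)"
      by (intro mult hecke_coset_closed) auto
    then show ?case
      using snoc.prems by (simp add: pibar_eq_coset conv_monom flip: hecke_coset_mult)
  qed
  obtain f where f: "f \<in> carrier (free_alg n)" and h: "h = hecke_coset n f"
    using assms(1) by (rule hecke_cases)
  show ?thesis
    unfolding h using f
  proof (induction rule: free_alg_induct)
    case zero
    then show ?case
      using monom[of "[]" 0] by (simp add: free_monom_def)
  next
    case (add f c u)
    then show ?case
      using monom[of u c] assms(3) by (simp add: hecke_coset_add hecke_coset_closed)
  qed
qed

text \<open>The relations asked of the images of the generators. Commutation is recorded for
  \<open>i + 2 \<le> j\<close> only, its mirror image being the same equation read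
  backwards.\<close>

definition hecke_gens :: "(complex, 'a, 'm) module_scheme \<Rightarrow> nat \<Rightarrow> (nat \<Rightarrow> 'a) \<Rightarrow> bool" where
  "hecke_gens A n g \<longleftrightarrow> g ` {1..<n} \<subseteq> carrier A \<and>
     (\<forall>i\<in>{1..<n}. g i \<otimes>\<^bsub>A\<^esub> g i = \<ominus>\<^bsub>A\<^esub> g i) \<and>
     (\<forall>i\<in>{1..<n}. i + 1 \<in> {1..<n} \<longrightarrow>
        g i \<otimes>\<^bsub>A\<^esub> (g (i + 1) \<otimes>\<^bsub>A\<^esub> g i) = g (i + 1) \<otimes>\<^bsub>A\<^esub> (g i \<otimes>\<^bsub>A\<^esub> g (i + 1))) \<and>
     (\<forall>i\<in>{1..<n}. \<forall>j\<in>{1..<n}. i + 2 \<le> j \<longrightarrow> g i \<otimes>\<^bsub>A\<^esub> g j = g j \<otimes>\<^bsub>A\<^esub> g i)"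

lemma (in ring) minus_zero_eq: "\<lbrakk>a \<in> carrier R; b \<in> carrier R; a \<ominus> b = \<zero>\<rbrakk> \<Longrightarrow> a = b"
  by (metis a_minus_def add.inv_closed add.inv_equality minus_minus)

lemma hecke_gens_pibar: "hecke_gens (hecke n) n (pibar n)"
proof -
  interpret H: ring_hom_ring "free_alg n" "hecke n" "hecke_coset n"
    by (rule ring_hom_ringI2[OF free_alg_ring hecke_ring hecke_coset_ring_hom])
  have zero: "hecke_coset n r = \<zero>\<^bsub>hecke n\<^esub>" if "r \<in> hecke_relators n" for r
  proof -
    have "r \<in> hecke_ideal n"
      using that ring.genideal_self[OF free_alg_ring hecke_relators_carrier]
      unfolding hecke_ideal_def by blast
    then have "hecke_coset n r = hecke_ideal n"
      by (rule ring.a_rcos_zero[OF free_alg_ring hecke_ideal_ideal])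
    then show ?thesis
      by (simp add: hecke_simps FactRing_def)
  qed
  have [simp]: "hecke_coset n (\<ominus>\<^bsub>free_alg n\<^esub> f) = \<ominus>\<^bsub>hecke n\<^esub> hecke_coset n f"
    if "f \<in> carrier (free_alg n)" for f
    using that by (rule H.hom_a_inv)
  have diff: "hecke_coset n (word u) = hecke_coset n (word v)"
    if "word u \<ominus>\<^bsub>free_alg n\<^esub> word v \<in> hecke_relators n" "set u \<subseteq> {1..<n}" "set v \<subseteq> {1..<n}" for u v
  proof (rule hecke.minus_zero_eq)
    have v: "\<ominus>\<^bsub>free_alg n\<^esub> free_monom 1 v \<in> carrier (free_alg n)"
      using that by (intro ring.ring_simprules(3)[OF free_alg_ring]) simp
    show "hecke_coset n (word u) \<ominus>\<^bsub>hecke n\<^esub> hecke_coset n (word v) = \<zero>\<^bsub>hecke n\<^esub>"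
      using zero[OF that(1)] that ring_hom_add[OF hecke_coset_ring_hom _ v, of "free_monom 1 u"]
      by (simp add: a_minus_def word_eq_monom)
  qed (use that in \<open>simp_all add: word_eq_monom hecke_coset_closed\<close>)
  have split2: "hecke_coset n (word [i, j]) = pibar n i \<otimes>\<^bsub>hecke n\<^esub> pibar n j"
    if "i \<in> {1..<n}" "j \<in> {1..<n}" for i j
    using that hecke_coset_mult[of "free_monom 1 [i]" n "free_monom 1 [j]"]
    by (simp add: word_eq_monom pibar_eq_coset conv_monom)
  have split3: "hecke_coset n (word [i, j, k]) = pibar n i \<otimes>\<^bsub>hecke n\<^esub> (pibar n j \<otimes>\<^bsub>hecke n\<^esub> pibar n k)"
    if "i \<in> {1..<n}" "j \<in> {1..<n}" "k \<in> {1..<n}" for i j k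
    using that hecke_coset_mult[of "free_monom 1 [i]" n "free_monom 1 [j, k]"]
    by (simp add: word_eq_monom pibar_eq_coset conv_monom flip: hecke_coset_mult)
  show ?thesis
    unfolding hecke_gens_def
  proof (intro conjI ballI impI)
    fix i assume i: "i \<in> {1..<n}"
    have "word [i, i] \<oplus>\<^bsub>free_alg n\<^esub> word [i] \<in> hecke_relators n"
      unfolding hecke_relators_def using i by blast
    then have "hecke_coset n (word [i, i]) \<oplus>\<^bsub>hecke n\<^esub> pibar n i = \<zero>\<^bsub>hecke n\<^esub>"
      using zero i hecke_coset_add[of "free_monom 1 [i, i]" n "free_monom 1 [i]"]
      by (simp add: word_eq_monom pibar_eq_coset)
    then show "pibar n i \<otimes>\<^bsub>hecke n\<^esub> pibar n i = \<ominus>\<^bsub>hecke n\<^esub> pibar n i"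
      using i by (intro hecke.minus_equality[symmetric]) (auto simp: split2)
  next
    fix i assume i: "i \<in> {1..<n}" "i + 1 \<in> {1..<n}"
    have "word [i, i + 1, i] \<ominus>\<^bsub>free_alg n\<^esub> word [i + 1, i, i + 1] \<in> hecke_relators n"
      unfolding hecke_relators_def using i by blast
    then show "pibar n i \<otimes>\<^bsub>hecke n\<^esub> (pibar n (i + 1) \<otimes>\<^bsub>hecke n\<^esub> pibar n i)
        = pibar n (i + 1) \<otimes>\<^bsub>hecke n\<^esub> (pibar n i \<otimes>\<^bsub>hecke n\<^esub> pibar n (i + 1))"
      using diff[of "[i, i + 1, i]" "[i + 1, i, i + 1]"] i split3[of i "i + 1" i]
        split3[of "i + 1" i "i + 1"]
      by simp
  next
    fix i j assume i: "i \<in> {1..<n}" "j \<in> {1..<n}" "i + 2 \<le> j"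
    have "\<bar>int i - int j\<bar> \<ge> 2"
      using i(3) by linarith
    then have "word [i, j] \<ominus>\<^bsub>free_alg n\<^esub> word [j, i] \<in> hecke_relators n"
      unfolding hecke_relators_def using i by blast
    then show "pibar n i \<otimes>\<^bsub>hecke n\<^esub> pibar n j = pibar n j \<otimes>\<^bsub>hecke n\<^esub> pibar n i"
      using diff[of "[i, j]" "[j, i]"] i split2 by simp
  qed auto
qed

context complex_algebra
begin

text \<open>The kernel of the evaluation map is an ideal and contains the relators, hence the ideal
  they generate. This makes \<open>hecke_hom\<close> independent of representatives.\<close>

lemma hecke_ideal_le_kernel:
  assumes "hecke_gens A n g"
  shows "hecke_ideal n \<subseteq> a_kernel (free_alg n) A (free_hom A g)"
proof -
  have g: "g ` {1..<n} \<subseteq> carrier A"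
    using assms by (simp add: hecke_gens_def)
  note hom = free_hom_ring_hom[OF g]
  interpret H: ring_hom_ring "free_alg n" A "free_hom A g"
    by (rule ring_hom_ringI2[OF free_alg_ring ring_axioms hom])
  have word: "free_hom A g (word u) = word_prod g u" if "set u \<subseteq> {1..<n}" for u
    using that free_hom_monom[OF g that, of 1] word_prod_closed[OF g that]
    by (simp add: word_eq_monom)
  have diff: "free_hom A g (word u \<ominus>\<^bsub>free_alg n\<^esub> word v) = \<zero>"
    if "set u \<subseteq> {1..<n}" "set v \<subseteq> {1..<n}" "word_prod g u = word_prod g v" for u v
  proof -
    have u: "word u \<in> carrier (free_alg n)" and v: "word v \<in> carrier (free_alg n)"
      using that by (simp_all add: word_eq_monom)
    then have "\<ominus>\<^bsub>free_alg n\<^esub> word v \<in> carrier (free_alg n)"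
      by (intro ring.ring_simprules(3)[OF free_alg_ring])
    then show ?thesis
      using that H.hom_add[OF u, of "\<ominus>\<^bsub>free_alg n\<^esub> word v"] H.hom_a_inv[OF v]
        word_prod_closed[OF g that(2)]
      by (simp add: a_minus_def word r_neg del: free_alg_simps)
  qed
  have gi: "g i \<in> carrier A" if "i \<in> {1..<n}" for i
    using g that by blast
  have comm: "g i \<otimes> g j = g j \<otimes> g i" if ij: "i \<in> {1..<n}" "j \<in> {1..<n}" "\<bar>int i - int j\<bar> \<ge> 2" for i j
  proof -
    consider "i + 2 \<le> j" | "j + 2 \<le> i"
      using ij(3) by linarith
    then show ?thesis
      using assms ij(1,2) unfolding hecke_gens_def by cases metis+
  qed
  have "free_hom A g r = \<zero>" if r: "r \<in> hecke_relators n" for r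
    using r unfolding hecke_relators_def
  proof (elim UnE CollectE exE conjE)
    fix i assume i: "r = word [i, i] \<oplus>\<^bsub>free_alg n\<^esub> word [i]" "i \<in> {1..<n}"
    then have "free_hom A g r = word_prod g [i, i] \<oplus> word_prod g [i]"
      using H.hom_add[of "word [i, i]" "word [i]"] word[of "[i, i]"] word[of "[i]"]
      by (simp add: word_eq_monom)
    then show ?thesis
      using i(2) gi[OF i(2)] assms by (simp add: hecke_gens_def l_neg)
  next
    fix i assume "r = word [i, i + 1, i] \<ominus>\<^bsub>free_alg n\<^esub> word [i + 1, i, i + 1]"
      "i \<in> {1..<n}" "i + 1 \<in> {1..<n}"
    then show ?thesis
      using assms gi by (auto intro!: diff simp: hecke_gens_def)
  next
    fix i j assume "r = word [i, j] \<ominus>\<^bsub>free_alg n\<^esub> word [j, i]"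
      "i \<in> {1..<n}" "j \<in> {1..<n}" "2 \<le> \<bar>int i - int j\<bar>"
    then show ?thesis
      using comm gi by (auto intro!: diff)
  qed
  then have "hecke_relators n \<subseteq> a_kernel (free_alg n) A (free_hom A g)"
    using hecke_relators_carrier[of n] unfolding a_kernel_def' by blast
  then show ?thesis
    unfolding hecke_ideal_def
    by (intro ring.genideal_minimal[OF free_alg_ring] H.kernel_is_ideal)
qed

text \<open>All elements of a coset have the same value, and a coset is nonempty because the ideal
  contains zero. Hence \<open>the_elem\<close> is applied to a singleton.\<close>

lemma hecke_hom_coset:
  assumes "hecke_gens A n g" and f: "f \<in> carrier (free_alg n)"
  shows "hecke_hom A g (hecke_coset n f) = free_hom A g f"
proof -
  have g: "g ` {1..<n} \<subseteq> carrier A"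
    using assms by (simp add: hecke_gens_def)
  have "free_hom A g (\<lambda>w. r w + f w) = free_hom A g f" if "r \<in> hecke_ideal n" for r
  proof -
    have "r \<in> carrier (free_alg n) \<and> free_hom A g r = \<zero>"
      using hecke_ideal_le_kernel[OF assms(1)] that unfolding a_kernel_def' by blast
    then show ?thesis
      using f by (simp add: free_hom_add[OF g] free_hom_closed[OF g])
  qed
  moreover have "\<zero>\<^bsub>free_alg n\<^esub> \<in> hecke_ideal n"
    by (rule additive_subgroup.zero_closed[OF ideal.axioms(1)[OF hecke_ideal_ideal]])
  moreover have "hecke_coset n f = (\<lambda>r w. r w + f w) ` hecke_ideal n"
    by (auto simp: a_r_coset_def')
  ultimately have "free_hom A g ` hecke_coset n f = {free_hom A g f}"
    by (force simp: image_image)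
  then show ?thesis
    by (simp add: hecke_hom_def)
qed

lemma hecke_hom_ring_hom:
  assumes "hecke_gens A n g"
  shows "hecke_hom A g \<in> ring_hom (hecke n) A"
proof -
  have g: "g ` {1..<n} \<subseteq> carrier A"
    using assms by (simp add: hecke_gens_def)
  note co = hecke_hom_coset[OF assms]
  show ?thesis
  proof (rule ring_hom_memI)
    fix x assume "x \<in> carrier (hecke n)"
    then show "hecke_hom A g x \<in> carrier A"
      by (metis hecke_cases co free_hom_closed[OF g])
  next
    fix x y assume "x \<in> carrier (hecke n)" "y \<in> carrier (hecke n)"
    then obtain f h where f: "f \<in> carrier (free_alg n)" "x = hecke_coset n f"
      and h: "h \<in> carrier (free_alg n)" "y = hecke_coset n h"
      by (metis hecke_cases)
    show "hecke_hom A g (x \<otimes>\<^bsub>hecke n\<^esub> y) = hecke_hom A g x \<otimes> hecke_hom A g y"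
      using f h by (simp add: co conv_carrier free_hom_mult[OF g] flip: hecke_coset_mult)
    show "hecke_hom A g (x \<oplus>\<^bsub>hecke n\<^esub> y) = hecke_hom A g x \<oplus> hecke_hom A g y"
      using f h by (simp add: co free_alg_add_carrier free_hom_add[OF g] flip: hecke_coset_add)
  next
    show "hecke_hom A g \<one>\<^bsub>hecke n\<^esub> = \<one>"
      by (simp add: co free_hom_monom[OF g] flip: hecke_coset_one)
  qed
qed

lemma hecke_hom_pibar:
  assumes "hecke_gens A n g" and "i \<in> {1..<n}"
  shows "hecke_hom A g (pibar n i) = g i"
proof -
  have g: "g ` {1..<n} \<subseteq> carrier A"
    using assms by (simp add: hecke_gens_def)
  then have "g i \<in> carrier A"
    using assms(2) by blast
  then show ?thesis
    using assms by (simp add: pibar_eq_coset hecke_hom_coset free_hom_monom[OF g])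
qed

lemma hecke_hom_scalar:
  assumes "hecke_gens A n g"
  shows "hecke_hom A g (c \<odot>\<^bsub>hecke n\<^esub> \<one>\<^bsub>hecke n\<^esub>) = c \<odot> \<one>"
proof -
  have g: "g ` {1..<n} \<subseteq> carrier A"
    using assms by (simp add: hecke_gens_def)
  show ?thesis
    by (simp add: scalar_eq_coset hecke_hom_coset[OF assms] free_hom_monom[OF g])
qed

end

section \<open>The twists and operator algebras\<close>

lemma opposite_simps [simp]:
  "carrier (opposite A) = carrier A" "x \<otimes>\<^bsub>opposite A\<^esub> y = y \<otimes>\<^bsub>A\<^esub> x" "one (opposite A) = one A"
  by (simp_all add: opposite_def)

lemma opposite_ring_simps [simp]:
  fixes A :: "('a, 'm) ring_scheme"
  shows "ring.zero (opposite A) = ring.zero A" "add (opposite A) = add A"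
    "\<ominus>\<^bsub>opposite A\<^esub> x = \<ominus>\<^bsub>A\<^esub> x"
  by (simp_all add: opposite_def a_inv_def m_inv_def)

lemma opposite_smult [simp]:
  fixes A :: "(complex, 'a, 'm) module_scheme"
  shows "c \<odot>\<^bsub>opposite A\<^esub> x = c \<odot>\<^bsub>A\<^esub> x"
  by (simp add: opposite_def)

lemma (in ring) opposite_ring: "ring (opposite R)"
  by (intro ringI abelian_groupI monoidI)
    (auto simp: m_assoc l_distr r_distr a_assoc add.m_lcomm a_comm intro: add.l_inv_ex)

lemma (in complex_algebra) opposite_algebra: "complex_algebra (opposite A)"
  by (intro complex_algebra.intro complex_algebra_axioms.intro opposite_ring)
    (simp_all add: smult_l_distr smult_r_distr smult_assoc smult_mult_l smult_mult_r)

lemma (in complex_algebra) hecke_gens_opposite: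
  assumes "hecke_gens A n g"
  shows "hecke_gens (opposite A) n g"
proof -
  have "g i \<in> carrier A" if "i \<in> {1..<n}" for i
    using assms that by (auto simp: hecke_gens_def)
  then show ?thesis
    using assms unfolding hecke_gens_def by (auto simp: m_assoc)
qed

text \<open>Reversing the indices turns the pair \<open>i, i + 1\<close> into
  \<open>n - i, n - (i + 1)\<close>, in decreasing order, so the braid relation is used with its two
  sides exchanged.\<close>

lemma (in complex_algebra) hecke_gens_reverse:
  assumes "hecke_gens A n g"
  shows "hecke_gens A n (\<lambda>i. g (n - i))"
proof -
  have 1: "n - i \<in> {1..<n}" if "i \<in> {1..<n}" for i
    using that by auto
  have 2: "n - i = (n - (i + 1)) + 1" if "i + 1 \<in> {1..<n}" for i
    using that by auto
  show ?thesis
    unfolding hecke_gens_def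
  proof (intro conjI ballI impI)
    fix i assume i: "i \<in> {1..<n}" "i + 1 \<in> {1..<n}"
    have "g (n - (i + 1)) \<otimes> (g (n - (i + 1) + 1) \<otimes> g (n - (i + 1)))
        = g (n - (i + 1) + 1) \<otimes> (g (n - (i + 1)) \<otimes> g (n - (i + 1) + 1))"
      using assms 1[OF i(1)] 1[OF i(2)] 2[OF i(2)] unfolding hecke_gens_def by metis
    then show "g (n - i) \<otimes> (g (n - (i + 1)) \<otimes> g (n - i))
        = g (n - (i + 1)) \<otimes> (g (n - i) \<otimes> g (n - (i + 1)))"
      using 2[OF i(2)] by simp
  next
    fix i j assume "i \<in> {1..<n}" "j \<in> {1..<n}" "i + 2 \<le> j"
    then have "n - j \<in> {1..<n}" "n - i \<in> {1..<n}" "n - j + 2 \<le> n - i"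
      by auto
    then show "g (n - i) \<otimes> g (n - j) = g (n - j) \<otimes> g (n - i)"
      using assms unfolding hecke_gens_def by metis
  qed (use assms 1 in \<open>auto simp: hecke_gens_def\<close>)
qed

text \<open>Grouped so that for \<open>x = y\<close> with \<open>x \<otimes> x = \<ominus> x\<close>
  the first bracket vanishes and only \<open>x \<oplus> \<one>\<close> remains.\<close>

lemma (in ring) plus_one_mult:
  "\<lbrakk>x \<in> carrier R; y \<in> carrier R\<rbrakk> \<Longrightarrow> (x \<oplus> \<one>) \<otimes> (y \<oplus> \<one>) = (x \<otimes> y \<oplus> y) \<oplus> (x \<oplus> \<one>)"
  by (simp add: l_distr r_distr a_ac)

lemma (in complex_algebra) pi_relations:
  assumes "hecke_gens A n g"
  defines "p \<equiv> \<lambda>i. g i \<oplus> \<one>"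
  shows "i \<in> {1..<n} \<Longrightarrow> p i \<otimes> p i = p i"
    and "\<lbrakk>i \<in> {1..<n}; i + 1 \<in> {1..<n}\<rbrakk> \<Longrightarrow> p i \<otimes> (p (i + 1) \<otimes> p i) = p (i + 1) \<otimes> (p i \<otimes> p (i + 1))"
    and "\<lbrakk>i \<in> {1..<n}; j \<in> {1..<n}; i + 2 \<le> j\<rbrakk> \<Longrightarrow> p i \<otimes> p j = p j \<otimes> p i"
proof -
  have g: "g i \<in> carrier A" "g i \<otimes> g i = \<ominus> g i" if "i \<in> {1..<n}" for i
    using assms that by (auto simp: hecke_gens_def)
  show "p i \<otimes> p i = p i" if "i \<in> {1..<n}"
    using g[OF that] by (simp add: p_def plus_one_mult l_neg)
  show "p i \<otimes> p j = p j \<otimes> p i" if "i \<in> {1..<n}" "j \<in> {1..<n}" "i + 2 \<le> j"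
  proof -
    have "g i \<otimes> g j = g j \<otimes> g i"
      using assms that unfolding hecke_gens_def by metis
    then show ?thesis
      using g[OF that(1)] g[OF that(2)] plus_one_mult[of "g i" "g j"] plus_one_mult[of "g j" "g i"]
      by (simp add: p_def a_ac)
  qed
  \<comment> \<open>The product \<open>g i \<otimes> g i = \<ominus> g i\<close> cancels one of the
    linear terms. What is left is symmetric in \<open>i\<close> and \<open>j\<close> except for the
    cubic term, to which the braid relation of \<open>g\<close> applies.\<close>
  have expand: "p i \<otimes> (p j \<otimes> p i) = g i \<otimes> (g j \<otimes> g i) \<oplus> (g i \<otimes> g j \<oplus> (g j \<otimes> g i \<oplus> (g i \<oplus> (g j \<oplus> \<one>))))"
    if "i \<in> {1..<n}" "j \<in> {1..<n}" for i j
  proof -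
    note c = g(1)[OF that(1)] g(1)[OF that(2)]
    have e: "p j \<otimes> p i = g j \<otimes> g i \<oplus> g i \<oplus> (g j \<oplus> \<one>)"
      using c plus_one_mult[of "g j" "g i"] by (simp add: p_def)
    have "p i \<otimes> (p j \<otimes> p i) = g i \<otimes> (g j \<otimes> g i \<oplus> g i \<oplus> (g j \<oplus> \<one>))
        \<oplus> (g j \<otimes> g i \<oplus> g i \<oplus> (g j \<oplus> \<one>))"
      unfolding e using c by (simp add: p_def l_distr)
    also have "g i \<otimes> (g j \<otimes> g i \<oplus> g i \<oplus> (g j \<oplus> \<one>))
        = g i \<otimes> (g j \<otimes> g i) \<oplus> g i \<otimes> g j"
      using c g(2)[OF that(1)] by (simp add: r_distr a_ac r_neg1 r_neg2)
    finally show ?thesis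
      using c by (simp add: a_ac)
  qed
  show "p i \<otimes> (p (i + 1) \<otimes> p i) = p (i + 1) \<otimes> (p i \<otimes> p (i + 1))"
    if i: "i \<in> {1..<n}" "i + 1 \<in> {1..<n}"
  proof -
    have "g i \<otimes> (g (i + 1) \<otimes> g i) = g (i + 1) \<otimes> (g i \<otimes> g (i + 1))"
      using assms i unfolding hecke_gens_def by metis
    then show ?thesis
      using g[OF i(1)] g[OF i(2)] expand[OF i] expand[OF i(2,1)]
      by (simp add: a_ac)
  qed
qed

text \<open>Idempotency of \<open>g i \<oplus> \<one>\<close> becomes the quadratic relation of its
  negative; in the other relations both sides carry the same power of \<open>-1\<close>.\<close>

lemma (in complex_algebra) hecke_gens_theta:
  assumes "hecke_gens A n g"
  shows "hecke_gens A n (\<lambda>i. \<ominus> (g i \<oplus> \<one>))"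
proof -
  have g: "g i \<in> carrier A" if "i \<in> {1..<n}" for i
    using assms that by (auto simp: hecke_gens_def)
  show ?thesis
    unfolding hecke_gens_def
  proof (intro conjI ballI impI)
    show "(\<lambda>i. \<ominus> (g i \<oplus> \<one>)) ` {1..<n} \<subseteq> carrier A"
      using g by auto
  next
    fix i assume i: "i \<in> {1..<n}"
    show "\<ominus> (g i \<oplus> \<one>) \<otimes> (\<ominus> (g i \<oplus> \<one>)) = \<ominus> (\<ominus> (g i \<oplus> \<one>))"
      using pi_relations(1)[OF assms i] g[OF i] by (simp add: l_minus r_minus)
  next
    fix i assume i: "i \<in> {1..<n}" "i + 1 \<in> {1..<n}"
    show "\<ominus> (g i \<oplus> \<one>) \<otimes> (\<ominus> (g (i + 1) \<oplus> \<one>) \<otimes> (\<ominus> (g i \<oplus> \<one>)))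
      = \<ominus> (g (i + 1) \<oplus> \<one>) \<otimes> (\<ominus> (g i \<oplus> \<one>) \<otimes> (\<ominus> (g (i + 1) \<oplus> \<one>)))"
      using pi_relations(2)[OF assms i] g[OF i(1)] g[OF i(2)] by (simp add: l_minus r_minus)
  next
    fix i j assume i: "i \<in> {1..<n}" "j \<in> {1..<n}" "i + 2 \<le> j"
    show "\<ominus> (g i \<oplus> \<one>) \<otimes> (\<ominus> (g j \<oplus> \<one>)) = \<ominus> (g j \<oplus> \<one>) \<otimes> (\<ominus> (g i \<oplus> \<one>))"
      using pi_relations(3)[OF assms i] g[OF i(1)] g[OF i(2)] by (simp add: l_minus r_minus)
  qed
qed

lemma hecke_gens_phi: "hecke_gens (hecke n) n (\<lambda>i. pibar n (n - i))"
  by (rule hecke.hecke_gens_reverse[OF hecke_gens_pibar])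

lemma hecke_gens_theta: "hecke_gens (hecke n) n (\<lambda>i. \<ominus>\<^bsub>hecke n\<^esub> pi_gen n i)"
  unfolding pi_gen_def by (rule hecke.hecke_gens_theta[OF hecke_gens_pibar])

lemma hecke_gens_chi: "hecke_gens (opposite (hecke n)) n (pibar n)"
  by (rule hecke.hecke_gens_opposite[OF hecke_gens_pibar])

lemma hecke_phi_hom: "hecke_phi n \<in> ring_hom (hecke n) (hecke n)"
  unfolding hecke_phi_def by (rule hecke.hecke_hom_ring_hom[OF hecke_gens_phi])

lemma hecke_theta_hom: "hecke_theta n \<in> ring_hom (hecke n) (hecke n)"
  unfolding hecke_theta_def by (rule hecke.hecke_hom_ring_hom[OF hecke_gens_theta])

lemma hecke_chi_hom: "hecke_chi n \<in> ring_hom (hecke n) (opposite (hecke n))"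
  unfolding hecke_chi_def
  by (rule complex_algebra.hecke_hom_ring_hom[OF hecke.opposite_algebra hecke_gens_chi])

lemma hecke_twist_scalar:
  "hecke_phi n (c \<odot>\<^bsub>hecke n\<^esub> \<one>\<^bsub>hecke n\<^esub>) = c \<odot>\<^bsub>hecke n\<^esub> \<one>\<^bsub>hecke n\<^esub>"
  "hecke_theta n (c \<odot>\<^bsub>hecke n\<^esub> \<one>\<^bsub>hecke n\<^esub>) = c \<odot>\<^bsub>hecke n\<^esub> \<one>\<^bsub>hecke n\<^esub>"
  "hecke_chi n (c \<odot>\<^bsub>hecke n\<^esub> \<one>\<^bsub>hecke n\<^esub>) = c \<odot>\<^bsub>hecke n\<^esub> \<one>\<^bsub>hecke n\<^esub>"
  unfolding hecke_phi_def hecke_theta_def hecke_chi_def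
  using hecke.hecke_hom_scalar[OF hecke_gens_phi] hecke.hecke_hom_scalar[OF hecke_gens_theta]
    complex_algebra.hecke_hom_scalar[OF hecke.opposite_algebra hecke_gens_chi]
  by simp_all

lemma hecke_twist_pibar:
  assumes "i \<in> {1..<n}"
  shows "hecke_phi n (pibar n i) = pibar n (n - i)"
    "hecke_theta n (pibar n i) = \<ominus>\<^bsub>hecke n\<^esub> pi_gen n i"
    "hecke_chi n (pibar n i) = pibar n i"
  unfolding hecke_phi_def hecke_theta_def hecke_chi_def
  using hecke.hecke_hom_pibar[OF hecke_gens_phi assms] hecke.hecke_hom_pibar[OF hecke_gens_theta assms]
    complex_algebra.hecke_hom_pibar[OF hecke.opposite_algebra hecke_gens_chi assms]
  by simp_all

text \<open>The product \<open>F \<otimes> G\<close> means first \<open>F\<close>, then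
  \<open>G\<close>, so a homomorphism from \<open>hecke n\<close> into this algebra is a right
  action. Linearity is packed into a single equation in \<open>c\<close>, \<open>v\<close> and
  \<open>w\<close>.\<close>

definition op_alg :: "(complex, ('p \<Rightarrow> complex) \<Rightarrow> ('p \<Rightarrow> complex)) module" where
  "op_alg =
     \<lparr>carrier = {F. \<forall>c v w. F (\<lambda>t. c * v t + w t) = (\<lambda>t. c * F v t + F w t)},
      monoid.mult = (\<lambda>F G. G \<circ> F), one = id, ring.zero = (\<lambda>v t. 0),
      add = (\<lambda>F G v t. F v t + G v t), smult = (\<lambda>c F v t. c * F v t)\<rparr>"

lemma op_alg_simps [simp]:
  "F \<in> carrier op_alg \<longleftrightarrow> (\<forall>c v w. F (\<lambda>t. c * v t + w t) = (\<lambda>t. c * F v t + F w t))"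
  "monoid.mult op_alg = (\<lambda>F G. G \<circ> F)" "one op_alg = id" "ring.zero op_alg = (\<lambda>v t. 0)"
  "add op_alg = (\<lambda>F G v t. F v t + G v t)" "smult op_alg = (\<lambda>c F v t. c * F v t)"
  by (simp_all add: op_alg_def)

lemma op_alg_algebra: "complex_algebra op_alg"
proof (intro complex_algebra.intro complex_algebra_axioms.intro ringI abelian_groupI monoidI)
  have add: "F (\<lambda>t. v t + w t) = (\<lambda>t. F v t + F w t)"
    if "F \<in> carrier op_alg" for F :: "('p \<Rightarrow> complex) \<Rightarrow> ('p \<Rightarrow> complex)" and v w
    using that[simplified, rule_format, of 1 v w] by simp
  \<comment> \<open>For \<open>c = -1\<close> and zero vectors, linearity reads
    \<open>F 0 = - F 0 + F 0\<close>.\<close>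
  have zero: "F (\<lambda>t. 0) = (\<lambda>t. 0)"
    if "F \<in> carrier op_alg" for F :: "('p \<Rightarrow> complex) \<Rightarrow> ('p \<Rightarrow> complex)"
    using that[simplified, rule_format, of "-1" "\<lambda>t. 0" "\<lambda>t. 0"] by (simp add: fun_eq_iff)
  have scale: "F (\<lambda>t. c * v t) = (\<lambda>t. c * F v t)"
    if "F \<in> carrier op_alg" for F :: "('p \<Rightarrow> complex) \<Rightarrow> ('p \<Rightarrow> complex)" and c v
    using that[simplified, rule_format, of c v "\<lambda>t. 0"] zero[OF that] by simp
  fix F G H :: "('p \<Rightarrow> complex) \<Rightarrow> ('p \<Rightarrow> complex)" and c d :: complex
  assume F: "F \<in> carrier op_alg"
  show "\<exists>G\<in>carrier op_alg. G \<oplus>\<^bsub>op_alg\<^esub> F = \<zero>\<^bsub>op_alg\<^esub>"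
    by (rule bexI[of _ "\<lambda>v t. - F v t"]) (use F in \<open>simp_all add: algebra_simps\<close>)
  assume G: "G \<in> carrier op_alg"
  show "F \<otimes>\<^bsub>op_alg\<^esub> G \<in> carrier op_alg"
    using F G by simp
  show "F \<otimes>\<^bsub>op_alg\<^esub> (c \<odot>\<^bsub>op_alg\<^esub> G) = c \<odot>\<^bsub>op_alg\<^esub> (F \<otimes>\<^bsub>op_alg\<^esub> G)"
    by (simp add: fun_eq_iff)
  show "(c \<odot>\<^bsub>op_alg\<^esub> F) \<otimes>\<^bsub>op_alg\<^esub> G = c \<odot>\<^bsub>op_alg\<^esub> (F \<otimes>\<^bsub>op_alg\<^esub> G)"
    using scale[OF G] by (simp add: fun_eq_iff)
  assume H: "H \<in> carrier op_alg"
  show "(F \<oplus>\<^bsub>op_alg\<^esub> G) \<otimes>\<^bsub>op_alg\<^esub> H = F \<otimes>\<^bsub>op_alg\<^esub> H \<oplus>\<^bsub>op_alg\<^esub> G \<otimes>\<^bsub>op_alg\<^esub> H"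
    using add[OF H] by (simp add: fun_eq_iff)
qed (auto simp: algebra_simps fun_eq_iff)

interpretation op_alg: complex_algebra op_alg
  by (rule op_alg_algebra)

lemma op_alg_finsum:
  "\<lbrakk>finite S; F ` S \<subseteq> carrier op_alg\<rbrakk> \<Longrightarrow> finsum op_alg F S v t = (\<Sum>w\<in>S. F w v t)"
proof (induction S rule: finite_induct)
  case (insert w S)
  then show ?case
    by (subst op_alg.finsum_insert) (auto simp del: op_alg_simps(1) simp: image_subset_iff)
qed simp

lemma gen_op_carrier [simp]: "gen_op B a i \<in> carrier op_alg"
  by (simp add: gen_op_def fun_eq_iff sum.distrib sum_distrib_left algebra_simps)

text \<open>The reversed composition makes the first letter of a word act first, as in the
  definition of \<open>span_module\<close>.\<close>

lemma op_alg_word_prod: "op_alg.word_prod g w = fold g w"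
  by (induction w) (auto simp: fun_eq_iff)

lemma op_alg_free_hom:
  assumes "f \<in> carrier (free_alg n)" "g ` {1..<n} \<subseteq> carrier op_alg"
  shows "free_hom op_alg g f v = (\<lambda>t. \<Sum>w | f w \<noteq> 0. f w * fold g w v t)"
proof
  fix t
  have "free_hom op_alg g f v t
      = finsum op_alg (\<lambda>w. f w \<odot>\<^bsub>op_alg\<^esub> op_alg.word_prod g w) {w. f w \<noteq> 0} v t"
    by (subst op_alg.free_hom_superset[OF assms(2)]) (use assms(1) in \<open>auto simp: free_alg_carrier\<close>)
  also have "\<dots> = (\<Sum>w | f w \<noteq> 0. (f w \<odot>\<^bsub>op_alg\<^esub> op_alg.word_prod g w) v t)"
  proof (rule op_alg_finsum)
    show "finite {w. f w \<noteq> 0}"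
      using assms(1) by (simp add: free_alg_carrier)
    have "set w \<subseteq> {1..<n}" if "f w \<noteq> 0" for w
      using assms(1) that by (simp add: free_alg_carrier)
    then show "(\<lambda>w. f w \<odot>\<^bsub>op_alg\<^esub> op_alg.word_prod g w) ` {w. f w \<noteq> 0} \<subseteq> carrier op_alg"
      using op_alg.word_prod_closed[OF assms(2)] op_alg.smult_closed by blast
  qed
  finally show "free_hom op_alg g f v t = (\<Sum>w | f w \<noteq> 0. f w * fold g w v t)"
    by (simp add: op_alg_word_prod)
qed

text \<open>The action of \<open>span_module\<close> goes through any element of the coset, so the
  value is computed for every representative and not only for a chosen one.\<close>

lemma (in complex_algebra) hecke_hom_representative:
  assumes "hecke_gens A n g" "h \<in> carrier (hecke n)" "f \<in> h"
  shows "f \<in> carrier (free_alg n)" "free_hom A g f = hecke_hom A g h"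
proof -
  have g: "g ` {1..<n} \<subseteq> carrier A"
    using assms by (simp add: hecke_gens_def)
  obtain e where e: "e \<in> carrier (free_alg n)" "h = hecke_coset n e"
    using assms(2) by (rule hecke_cases)
  obtain r where r: "r \<in> hecke_ideal n" "f = (\<lambda>w. r w + e w)"
    using assms(3) by (auto simp: e(2) a_r_coset_def')
  have r': "r \<in> carrier (free_alg n)" "free_hom A g r = \<zero>"
    using hecke_ideal_le_kernel[OF assms(1)] r(1) unfolding a_kernel_def' by blast+
  then show "f \<in> carrier (free_alg n)"
    by (simp add: r(2) free_alg_add_carrier e(1))
  show "free_hom A g f = hecke_hom A g h"
    using e r' by (simp add: r(2) hecke_hom_coset[OF assms(1)] free_hom_add[OF g] free_hom_closed[OF g])
qed

lemma hecke_nonempty: "h \<in> carrier (hecke n) \<Longrightarrow> h \<noteq> {}"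
  using additive_subgroup.zero_closed[OF ideal.axioms(1)[OF hecke_ideal_ideal[of n]]]
  by (auto elim!: hecke_cases simp: a_r_coset_def')

text \<open>The relations are required as identities of operators on all functions;
  \<open>support\<close> then confines the action to functions supported on
  \<open>B\<close>.\<close>

locale span_data =
  fixes n :: nat and B :: "perm set" and a :: "perm \<Rightarrow> nat \<Rightarrow> vec"
  assumes finite_basis: "finite B"
    and gens: "hecke_gens op_alg n (gen_op B a)"
    and support: "\<lbrakk>\<gamma> \<in> B; i \<in> {1..<n}; a \<gamma> i \<tau> \<noteq> 0\<rbrakk> \<Longrightarrow> \<tau> \<in> B"
begin

lemma span_act:
  assumes h: "h \<in> carrier (hecke n)"
  shows "act (span_module B a) v h = hecke_hom op_alg (gen_op B a) h v"
proof -
  have "(\<lambda>t. \<Sum>w | f w \<noteq> 0. f w * fold (gen_op B a) w v t) = hecke_hom op_alg (gen_op B a) h v"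
    if "f \<in> h" for f
    using op_alg_free_hom[of f n "gen_op B a" v] op_alg.hecke_hom_representative[OF gens h that] gens
    by (simp add: hecke_gens_def)
  then have "(\<lambda>f t. \<Sum>w | f w \<noteq> 0. f w * fold (gen_op B a) w v t) ` h
      = {hecke_hom op_alg (gen_op B a) h v}"
    using hecke_nonempty[OF h] by auto
  then show ?thesis
    by (simp add: span_module_def)
qed

lemma span_carrier: "carrier (span_module B a) = {v. \<forall>\<tau>. v \<tau> \<noteq> 0 \<longrightarrow> \<tau> \<in> B}"
  by (simp add: span_module_def)

lemma span_simps [simp]:
  "monoid.mult (span_module B a) = (\<lambda>v w \<tau>. v \<tau> + w \<tau>)" "one (span_module B a) = (\<lambda>\<tau>. 0)"
  by (simp_all add: span_module_def)

lemma span_act_scalar: "act (span_module B a) v (c \<odot>\<^bsub>hecke n\<^esub> \<one>\<^bsub>hecke n\<^esub>) = (\<lambda>t. c * v t)"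
  by (simp add: span_act op_alg.hecke_hom_scalar[OF gens])

lemma span_act_pibar: "i \<in> {1..<n} \<Longrightarrow> act (span_module B a) v (pibar n i) = gen_op B a i v"
  by (simp add: span_act op_alg.hecke_hom_pibar[OF gens])

lemma span_right_module: "right_module (hecke n) (span_module B a)"
proof -
  note hom = op_alg.hecke_hom_ring_hom[OF gens]
  have closed: "hecke_hom op_alg (gen_op B a) h v \<in> carrier (span_module B a)"
    if "h \<in> carrier (hecke n)" and v: "v \<in> carrier (span_module B a)" for h v
    using that(1)
  proof (induction rule: hecke_induct)
    case (scalar c)
    show ?case
      using v by (simp add: op_alg.hecke_hom_scalar[OF gens] span_carrier)
  next
    case (add x y)
    have "hecke_hom op_alg (gen_op B a) x v t \<noteq> 0 \<or> hecke_hom op_alg (gen_op B a) y v t \<noteq> 0"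
      if "hecke_hom op_alg (gen_op B a) x v t + hecke_hom op_alg (gen_op B a) y v t \<noteq> 0" for t
      using that by auto
    then show ?case
      using add by (simp add: ring_hom_add[OF hom] span_carrier) blast
  next
    case (mult x i)
    have "gen_op B a i u \<in> carrier (span_module B a)" for u
    proof -
      have "\<exists>\<gamma>\<in>B. a \<gamma> i \<tau> \<noteq> 0" if "(\<Sum>\<gamma>\<in>B. u \<gamma> * a \<gamma> i \<tau>) \<noteq> 0" for \<tau>
        using sum.not_neutral_contains_not_neutral[OF that] by auto
      then show ?thesis
        using support mult.hyps(2) by (auto simp: gen_op_def span_carrier)
    qed
    then show ?case
      using mult by (simp add: ring_hom_mult[OF hom] op_alg.hecke_hom_pibar[OF gens])
  qed
  have lin: "hecke_hom op_alg (gen_op B a) h \<in> carrier op_alg" if "h \<in> carrier (hecke n)" for h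
    using ring_hom_closed[OF hom that] .
  have "comm_group (span_module B a)"
  proof (rule comm_groupI)
    fix x y assume "x \<in> carrier (span_module B a)" "y \<in> carrier (span_module B a)"
    moreover have "x t \<noteq> 0 \<or> y t \<noteq> 0" if "x t + y t \<noteq> 0" for t
      using that by auto
    ultimately show "x \<otimes>\<^bsub>span_module B a\<^esub> y \<in> carrier (span_module B a)"
      by (simp add: span_carrier) blast
  next
    fix x assume "x \<in> carrier (span_module B a)"
    then show "\<exists>y\<in>carrier (span_module B a). y \<otimes>\<^bsub>span_module B a\<^esub> x = \<one>\<^bsub>span_module B a\<^esub>"
      by (intro bexI[of _ "\<lambda>t. - x t"]) (simp_all add: span_carrier)
  qed (simp_all add: span_carrier add_ac)
  then show ?thesis
  proof (intro right_module.intro right_module_axioms.intro hecke_ring)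
    fix x y h assume "h \<in> carrier (hecke n)"
    then show "act (span_module B a) (x \<otimes>\<^bsub>span_module B a\<^esub> y) h
        = act (span_module B a) x h \<otimes>\<^bsub>span_module B a\<^esub> act (span_module B a) y h"
      using lin[of h, simplified, rule_format, of 1 x y] by (simp add: span_act)
  qed (simp_all add: span_act closed ring_hom_add[OF hom] ring_hom_mult[OF hom] ring_hom_one[OF hom])
qed

end

section \<open>Inversions and the action on linear extensions\<close>

lemma simple_transp_apply:
  "simple_transp i k = (if k = i then Suc i else if k = Suc i then i else k)"
  by (simp add: simple_transp_def transpose_def)

lemma simple_transp_involution [simp]: "simple_transp i (simple_transp i k) = k"
  by (simp add: simple_transp_apply)

lemma simple_transp_permutes: "i \<in> {1..<n} \<Longrightarrow> simple_transp i permutes {1..n}"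
  unfolding simple_transp_def by (rule permutes_swap_id) auto

lemma comp_simple_transp_permutes:
  "\<lbrakk>\<sigma> permutes {1..n}; i \<in> {1..<n}\<rbrakk> \<Longrightarrow> \<sigma> \<circ> simple_transp i permutes {1..n}"
  using permutes_compose simple_transp_permutes by blast

lemma comp_simple_transp_twice [simp]: "(\<sigma> \<circ> simple_transp i) \<circ> simple_transp i = \<sigma>"
  by (simp add: fun_eq_iff)

lemma simple_transp_braid:
  "\<gamma> \<circ> simple_transp i \<circ> simple_transp (Suc i) \<circ> simple_transp i
    = \<gamma> \<circ> simple_transp (Suc i) \<circ> simple_transp i \<circ> simple_transp (Suc i)"
  by (auto simp: fun_eq_iff simple_transp_apply)

lemma simple_transp_comm:
  "i + 2 \<le> j \<Longrightarrow> \<gamma> \<circ> simple_transp i \<circ> simple_transp j = \<gamma> \<circ> simple_transp j \<circ> simple_transp i"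
  by (auto simp: fun_eq_iff simple_transp_apply)

lemma permutes_neq: "\<lbrakk>\<sigma> permutes S; a \<noteq> b\<rbrakk> \<Longrightarrow> \<sigma> a \<noteq> \<sigma> b"
  using permutes_inj injD by metis

definition inversions :: "nat \<Rightarrow> perm \<Rightarrow> (nat \<times> nat) set" where
  "inversions n \<sigma> = {(a, b). 1 \<le> a \<and> a < b \<and> b \<le> n \<and> \<sigma> b < \<sigma> a}"

lemma finite_inversions [simp]: "finite (inversions n \<sigma>)"
proof (rule finite_subset)
  show "inversions n \<sigma> \<subseteq> {1..n} \<times> {1..n}"
    by (auto simp: inversions_def)
qed simp

lemma inversions_id: "inversions n id = {}"
  by (auto simp: inversions_def)

text \<open>Applying \<open>simple_transp i\<close> to both positions preserves their order for
  every pair other than \<open>(i, Suc i)\<close>, which is the one inversion gained.\<close>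

lemma card_inversions_ascent:
  assumes "i \<in> {1..<n}" "\<sigma> i < \<sigma> (Suc i)"
  shows "card (inversions n (\<sigma> \<circ> simple_transp i)) = Suc (card (inversions n \<sigma>))"
proof -
  let ?f = "map_prod (simple_transp i) (simple_transp i)"
  have "inversions n (\<sigma> \<circ> simple_transp i) = insert (i, Suc i) (?f ` inversions n \<sigma>)"
  proof (intro equalityI subsetI)
    fix p assume p: "p \<in> inversions n (\<sigma> \<circ> simple_transp i)"
    show "p \<in> insert (i, Suc i) (?f ` inversions n \<sigma>)"
    proof (cases "p = (i, Suc i)")
      case False
      have "?f p \<in> inversions n \<sigma>"
        using p False assms by (auto simp: inversions_def simple_transp_apply split: if_splits)
      moreover have "p = ?f (?f p)"
        by (cases p) simp
      ultimately show ?thesis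
        by blast
    qed simp
  next
    fix p assume "p \<in> insert (i, Suc i) (?f ` inversions n \<sigma>)"
    then show "p \<in> inversions n (\<sigma> \<circ> simple_transp i)"
      using assms by (auto simp: inversions_def simple_transp_apply split: if_splits)
  qed
  moreover have "(i, Suc i) \<notin> ?f ` inversions n \<sigma>"
    using assms(2) by (auto simp: inversions_def simple_transp_apply split: if_splits)
  moreover have "inj ?f"
    by (intro prod.inj_map injI) (metis simple_transp_involution)+
  ultimately show ?thesis
    by (simp add: card_image inj_on_subset)
qed

lemma card_inversions_descent:
  assumes "i \<in> {1..<n}" "\<sigma> (Suc i) < \<sigma> i"
  shows "card (inversions n \<sigma>) = Suc (card (inversions n (\<sigma> \<circ> simple_transp i)))"
  using card_inversions_ascent[OF assms(1), of "\<sigma> \<circ> simple_transp i"] assms(2)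
  by (simp add: simple_transp_apply)

definition perm_of_word :: "nat list \<Rightarrow> perm" where
  "perm_of_word is = foldr (\<lambda>i \<tau>. simple_transp i \<circ> \<tau>) is id"

lemma perm_of_word_Nil [simp]: "perm_of_word [] = id"
  by (simp add: perm_of_word_def fun_eq_iff)

lemma perm_of_word_snoc: "perm_of_word (is @ [i]) = perm_of_word is \<circ> simple_transp i"
  by (induction "is") (auto simp: perm_of_word_def)

lemma perm_of_word_permutes: "set is \<subseteq> {1..<n} \<Longrightarrow> perm_of_word is permutes {1..n}"
proof (induction "is" rule: rev_induct)
  case Nil
  then show ?case
    using permutes_id[of "{1..n}"] by (simp only: perm_of_word_Nil)
next
  case (snoc i "is")
  then show ?case
    unfolding perm_of_word_snoc by (intro comp_simple_transp_permutes) auto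
qed

text \<open>Each letter changes the number of inversions by exactly one.\<close>

lemma card_inversions_le_length:
  "set is \<subseteq> {1..<n} \<Longrightarrow> card (inversions n (perm_of_word is)) \<le> length is"
proof (induction "is" rule: rev_induct)
  case Nil
  show ?case
    by (simp only: perm_of_word_Nil inversions_id) simp
next
  case (snoc i "is")
  then have "perm_of_word is i \<noteq> perm_of_word is (Suc i)"
    using permutes_neq[OF perm_of_word_permutes] by auto
  then consider "perm_of_word is i < perm_of_word is (Suc i)"
    | "perm_of_word is (Suc i) < perm_of_word is i"
    by linarith
  then show ?case
    using snoc card_inversions_ascent[of i n "perm_of_word is", folded perm_of_word_snoc]
      card_inversions_descent[of i n "perm_of_word is", folded perm_of_word_snoc]
    by cases auto
qed

text \<open>The values increase from at least \<open>1\<close>, so \<open>i \<le> \<sigma> i\<close>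
  throughout; a permutation of \<open>{1..n}\<close> with this property is the identity.\<close>

lemma no_descent_imp_id:
  assumes "\<sigma> permutes {1..n}" "\<And>i. i \<in> {1..<n} \<Longrightarrow> \<sigma> i < \<sigma> (Suc i)"
  shows "\<sigma> = id"
proof (rule permutes_natset_ge[OF assms(1)])
  have "1 \<le> i \<Longrightarrow> i \<le> n \<Longrightarrow> i \<le> \<sigma> i" for i
  proof (induction i)
    case (Suc i)
    show ?case
    proof (cases "i = 0")
      case True
      then show ?thesis
        using permutes_in_image[OF assms(1), of 1] Suc.prems by simp
    next
      case False
      then show ?thesis
        using Suc assms(2)[of i] by fastforce
    qed
  qed simp
  then show "\<forall>i\<in>{1..n}. i \<le> \<sigma> i"
    by simp
qed

text \<open>Bubble sort: removing a descent costs one letter and one inversion, and the process ends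
  at the identity.\<close>

lemma word_of_perm:
  assumes "\<sigma> permutes {1..n}"
  obtains "is" where "length is = card (inversions n \<sigma>)" "set is \<subseteq> {1..<n}" "\<sigma> = perm_of_word is"
proof -
  have "\<exists>is. length is = card (inversions n \<sigma>) \<and> set is \<subseteq> {1..<n} \<and> \<sigma> = perm_of_word is"
    using assms
  proof (induction "card (inversions n \<sigma>)" arbitrary: \<sigma> rule: less_induct)
    case less
    show ?case
    proof (cases "\<exists>i\<in>{1..<n}. \<sigma> (Suc i) < \<sigma> i")
      case True
      then obtain i where i: "i \<in> {1..<n}" "\<sigma> (Suc i) < \<sigma> i"
        by blast
      note c = card_inversions_descent[OF i]
      obtain "is" where "length is = card (inversions n (\<sigma> \<circ> simple_transp i))"
        "set is \<subseteq> {1..<n}" "\<sigma> \<circ> simple_transp i = perm_of_word is"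
        using less.hyps[OF _ comp_simple_transp_permutes[OF less.prems i(1)]] c by auto
      then have "length (is @ [i]) = card (inversions n \<sigma>)" "set (is @ [i]) \<subseteq> {1..<n}"
        "\<sigma> = perm_of_word (is @ [i])"
        using c i(1) comp_simple_transp_twice[of \<sigma> i] by (simp_all add: perm_of_word_snoc)
      then show ?thesis
        by blast
    next
      case False
      have "\<sigma> = id"
      proof (rule no_descent_imp_id[OF less.prems])
        fix i assume "i \<in> {1..<n}"
        then show "\<sigma> i < \<sigma> (Suc i)"
          using False permutes_neq[OF less.prems, of i "Suc i"] by force
      qed
      then show ?thesis
        by (intro exI[of _ "[]"]) (simp only: perm_of_word_Nil inversions_id, simp)
    qed
  qed
  then show ?thesis
    using that by blast
qed

lemma len_eq_card_inversions:
  assumes "\<sigma> permutes {1..n}"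
  shows "len n \<sigma> = card (inversions n \<sigma>)"
  unfolding len_def
proof (rule Least_equality)
  show "\<exists>is. length is = card (inversions n \<sigma>) \<and> set is \<subseteq> {1..<n}
      \<and> \<sigma> = foldr (\<lambda>i \<tau>. simple_transp i \<circ> \<tau>) is id"
    using word_of_perm[OF assms] unfolding perm_of_word_def by metis
next
  fix k
  assume "\<exists>is. length is = k \<and> set is \<subseteq> {1..<n} \<and> \<sigma> = foldr (\<lambda>i \<tau>. simple_transp i \<circ> \<tau>) is id"
  then show "card (inversions n \<sigma>) \<le> k"
    using card_inversions_le_length unfolding perm_of_word_def by blast
qed

text \<open>Length is the number of inversions, and a simple transposition on the right changes it
  by one, up or down according to the order of the two adjacent values.\<close>

lemma DesR_iff:
  assumes "\<sigma> permutes {1..n}" "i \<in> {1..<n}"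
  shows "i \<in> DesR n \<sigma> \<longleftrightarrow> \<sigma> (Suc i) < \<sigma> i"
proof -
  have "\<sigma> i \<noteq> \<sigma> (Suc i)"
    using permutes_neq[OF assms(1)] by auto
  then consider "\<sigma> i < \<sigma> (Suc i)" | "\<sigma> (Suc i) < \<sigma> i"
    by linarith
  then show ?thesis
    using assms card_inversions_ascent[OF assms(2), of \<sigma>] card_inversions_descent[OF assms(2), of \<sigma>]
      len_eq_card_inversions[OF assms(1)]
      len_eq_card_inversions[OF comp_simple_transp_permutes[OF assms]]
    by cases (auto simp: DesR_def)
qed

text \<open>Writing the two elements as values at positions \<open>a\<close> and \<open>b\<close>
  eliminates the inverse permutation, which suits right multiplication, an operation on
  positions.\<close>

lemma SigmaR_iff:
  "\<sigma> \<in> SigmaR n P \<longleftrightarrow> \<sigma> permutes {1..n} \<and> (\<forall>a b. (\<sigma> a, \<sigma> b) \<in> P \<and> a \<noteq> b \<longrightarrow> a < b)"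
proof (cases "\<sigma> permutes {1..n}")
  case True
  then have "inv_into UNIV \<sigma> (\<sigma> a) = a" "\<sigma> (inv_into UNIV \<sigma> a) = a" for a
    using permutes_inverses[OF True] by simp_all
  then show ?thesis
    unfolding SigmaR_def mem_Collect_eq using True by metis
qed (simp add: SigmaR_def)

lemma SigmaR_permutes: "\<gamma> \<in> SigmaR n P \<Longrightarrow> \<gamma> permutes {1..n}"
  by (simp add: SigmaR_iff)

lemma finite_SigmaR [simp]: "finite (SigmaR n P)"
  by (rule finite_subset[OF _ finite_permutations[of "{1..n}"]]) (auto simp: SigmaR_iff)

text \<open>Swapping adjacent positions changes the relative order of one pair of values only, and
  membership of \<open>\<gamma>\<close> fixes the direction in which these two can be
  comparable.\<close>

lemma SigmaR_simple_transp:
  assumes "\<gamma> \<in> SigmaR n P" "i \<in> {1..<n}"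
  shows "\<gamma> \<circ> simple_transp i \<in> SigmaR n P \<longleftrightarrow> (\<gamma> i, \<gamma> (Suc i)) \<notin> P"
proof
  assume "\<gamma> \<circ> simple_transp i \<in> SigmaR n P"
  then have "Suc i < i" if "(\<gamma> i, \<gamma> (Suc i)) \<in> P"
    using that unfolding SigmaR_iff
    by (elim conjE allE[of _ "Suc i"] allE[of _ i]) (simp add: simple_transp_apply)
  then show "(\<gamma> i, \<gamma> (Suc i)) \<notin> P"
    by auto
next
  assume *: "(\<gamma> i, \<gamma> (Suc i)) \<notin> P"
  have "a < b" if "(\<gamma> (simple_transp i a), \<gamma> (simple_transp i b)) \<in> P" "a \<noteq> b" for a b
  proof -
    have "simple_transp i a \<noteq> simple_transp i b"
      using that(2) by (metis simple_transp_involution)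
    then have "simple_transp i a < simple_transp i b"
      using assms(1) that(1) by (simp add: SigmaR_iff)
    moreover have "(simple_transp i a, simple_transp i b) \<noteq> (i, Suc i)"
      using * that(1) by auto
    ultimately show ?thesis
      by (auto simp: simple_transp_apply split: if_splits)
  qed
  then show "\<gamma> \<circ> simple_transp i \<in> SigmaR n P"
    using comp_simple_transp_permutes[OF SigmaR_permutes[OF assms(1)] assms(2)]
    by (simp add: SigmaR_iff)
qed

text \<open>The parameter \<open>e\<close> treats \<open>M\<^sub>P\<close> (\<open>e = -1\<close>, with \<open>\<pi>bar\<^sub>i\<close> acting as below) and \<open>\<^bold>M\<^sub>P\<close>
  (\<open>e = 1\<close>, with \<open>\<pi>\<^sub>i\<close> acting as below) at once.\<close>

definition sort_act :: "complex \<Rightarrow> nat \<Rightarrow> (nat \<times> nat) set \<Rightarrow> perm \<Rightarrow> nat \<Rightarrow> vec" where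
  "sort_act e n P \<gamma> i =
     (if i \<in> DesR n \<gamma> then \<lambda>\<tau>. e * basis_vec \<gamma> \<tau>
      else if \<gamma> \<circ> simple_transp i \<notin> SigmaR n P then \<lambda>\<tau>. 0
      else basis_vec (\<gamma> \<circ> simple_transp i))"

abbreviation sort_op :: "complex \<Rightarrow> nat \<Rightarrow> (nat \<times> nat) set \<Rightarrow> nat \<Rightarrow> vec \<Rightarrow> vec" where
  "sort_op e n P \<equiv> gen_op (SigmaR n P) (sort_act e n P)"

lemma gen_op_basis: "\<lbrakk>finite B; \<gamma> \<in> B\<rbrakk> \<Longrightarrow> gen_op B a i (basis_vec \<gamma>) = a \<gamma> i"
  by (simp add: gen_op_def basis_vec_def if_distrib[of "\<lambda>x. x * _"] sum.delta cong: if_cong)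

lemma gen_op_scale: "gen_op B a i (\<lambda>\<tau>. c * v \<tau>) = (\<lambda>\<tau>. c * gen_op B a i v \<tau>)"
  by (simp add: gen_op_def sum_distrib_left mult.assoc)

lemma gen_op_zero [simp]: "gen_op B a i (\<lambda>\<tau>. 0) = (\<lambda>\<tau>. 0)"
  by (simp add: gen_op_def)

definition proj :: "perm set \<Rightarrow> vec \<Rightarrow> vec" where
  "proj B v = (\<lambda>\<tau>. if \<tau> \<in> B then v \<tau> else 0)"

lemma gen_op_proj [simp]: "gen_op B a i (proj B v) = gen_op B a i v"
  by (simp add: gen_op_def proj_def)

lemma proj_eq_sum: "finite B \<Longrightarrow> proj B v = (\<lambda>\<tau>. \<Sum>\<gamma>\<in>B. v \<gamma> * basis_vec \<gamma> \<tau>)"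
  by (rule ext) (simp add: proj_def basis_vec_def if_distrib[of "\<lambda>x. _ * x"] cong: if_cong)

lemma linear_sum:
  assumes "F \<in> carrier op_alg" "finite B"
  shows "F (\<lambda>\<tau>. \<Sum>\<gamma>\<in>B. c \<gamma> * u \<gamma> \<tau>) = (\<lambda>\<tau>. \<Sum>\<gamma>\<in>B. c \<gamma> * F (u \<gamma>) \<tau>)"
  using assms(2)
proof (induction B rule: finite_induct)
  case empty
  show ?case
    using assms(1)[simplified, rule_format, of "-1" "\<lambda>t. 0" "\<lambda>t. 0"] by (simp add: fun_eq_iff)
next
  case (insert x B)
  then show ?case
    using assms(1) by simp
qed

text \<open>\<open>gen_op B\<close> ignores coordinates outside \<open>B\<close>, so although
  operators are defined on all functions, their values on finitely many basis vectors determine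
  them.\<close>

lemma op_eqI:
  assumes "finite B" "F \<in> carrier op_alg" "G \<in> carrier op_alg"
    and "\<And>v. F (proj B v) = F v" "\<And>v. G (proj B v) = G v"
    and "\<And>\<gamma>. \<gamma> \<in> B \<Longrightarrow> F (basis_vec \<gamma>) = G (basis_vec \<gamma>)"
  shows "F = G"
proof
  fix v
  have "F v = (\<lambda>\<tau>. \<Sum>\<gamma>\<in>B. v \<gamma> * F (basis_vec \<gamma>) \<tau>)"
    using linear_sum[OF assms(2,1), of v basis_vec] assms(4)[of v] proj_eq_sum[OF assms(1)] by simp
  also have "\<dots> = (\<lambda>\<tau>. \<Sum>\<gamma>\<in>B. v \<gamma> * G (basis_vec \<gamma>) \<tau>)"
    by (simp add: assms(6))
  also have "\<dots> = G v"
    using linear_sum[OF assms(3,1), of v basis_vec] assms(5)[of v] proj_eq_sum[OF assms(1)] by simp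
  finally show "F v = G v" .
qed

lemma op_alg_comp: "\<lbrakk>F \<in> carrier op_alg; G \<in> carrier op_alg\<rbrakk> \<Longrightarrow> F \<circ> G \<in> carrier op_alg"
  by simp

context
  fixes e :: complex and n :: nat and P :: "(nat \<times> nat) set"
begin

lemma sort_op_descent:
  assumes "\<gamma> \<in> SigmaR n P" "i \<in> {1..<n}" "\<gamma> (Suc i) < \<gamma> i"
  shows "sort_op e n P i (basis_vec \<gamma>) = (\<lambda>\<tau>. e * basis_vec \<gamma> \<tau>)"
  using assms DesR_iff[OF SigmaR_permutes[OF assms(1)] assms(2)]
  by (simp add: gen_op_basis sort_act_def)

lemma sort_op_zero:
  assumes "\<gamma> \<in> SigmaR n P" "i \<in> {1..<n}" "\<gamma> i < \<gamma> (Suc i)" "(\<gamma> i, \<gamma> (Suc i)) \<in> P"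
  shows "sort_op e n P i (basis_vec \<gamma>) = (\<lambda>\<tau>. 0)"
  using assms DesR_iff[OF SigmaR_permutes[OF assms(1)] assms(2)] SigmaR_simple_transp[OF assms(1,2)]
  by (simp add: gen_op_basis sort_act_def)

lemma sort_op_swap:
  assumes "\<gamma> \<in> SigmaR n P" "i \<in> {1..<n}" "\<gamma> i < \<gamma> (Suc i)" "(\<gamma> i, \<gamma> (Suc i)) \<notin> P"
  shows "sort_op e n P i (basis_vec \<gamma>) = basis_vec (\<gamma> \<circ> simple_transp i)"
  using assms DesR_iff[OF SigmaR_permutes[OF assms(1)] assms(2)] SigmaR_simple_transp[OF assms(1,2)]
  by (simp add: gen_op_basis sort_act_def)

lemmas sort_op_simps = sort_op_descent sort_op_zero sort_op_swap SigmaR_simple_transp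

text \<open>After an effective swap the position \<open>i\<close> is a descent, so the second
  application multiplies by \<open>e\<close>.\<close>

lemma sort_op_quadratic:
  assumes i: "i \<in> {1..<n}"
  shows "sort_op e n P i (sort_op e n P i v) = (\<lambda>\<tau>. e * sort_op e n P i v \<tau>)"
proof -
  have "sort_op e n P i \<circ> sort_op e n P i = (\<lambda>v \<tau>. e * sort_op e n P i v \<tau>)"
  proof (rule op_eqI[OF finite_SigmaR[of n P]])
    show "sort_op e n P i \<circ> sort_op e n P i \<in> carrier op_alg"
      by (intro op_alg_comp gen_op_carrier)
    show "(\<lambda>v \<tau>. e * sort_op e n P i v \<tau>) \<in> carrier op_alg"
      using op_alg.smult_closed[OF gen_op_carrier[of "SigmaR n P" "sort_act e n P" i], of e] by simp
    fix \<gamma> assume \<gamma>: "\<gamma> \<in> SigmaR n P"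
    then have "\<gamma> i \<noteq> \<gamma> (Suc i)"
      using permutes_neq[OF SigmaR_permutes] by auto
    then show "(sort_op e n P i \<circ> sort_op e n P i) (basis_vec \<gamma>)
        = (\<lambda>\<tau>. e * sort_op e n P i (basis_vec \<gamma>) \<tau>)"
      using \<gamma> i
      by (cases "\<gamma> i < \<gamma> (Suc i)"; cases "(\<gamma> i, \<gamma> (Suc i)) \<in> P")
        (simp_all add: sort_op_simps gen_op_scale simple_transp_apply)
  qed simp_all
  then show ?thesis
    by (simp add: fun_eq_iff)
qed

text \<open>Only the values at three adjacent positions matter. For each relative order and each
  pattern of comparabilities both sides give the same multiple of the same basis vector, or both
  vanish.\<close>

lemma sort_op_braid:
  assumes i: "i \<in> {1..<n}" "Suc i \<in> {1..<n}"
  shows "sort_op e n P i \<circ> sort_op e n P (Suc i) \<circ> sort_op e n P i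
    = sort_op e n P (Suc i) \<circ> sort_op e n P i \<circ> sort_op e n P (Suc i)"
proof (rule op_eqI[OF finite_SigmaR[of n P]])
  fix \<gamma> assume \<gamma>: "\<gamma> \<in> SigmaR n P"
  let ?a = "\<gamma> i" and ?b = "\<gamma> (Suc i)" and ?c = "\<gamma> (Suc (Suc i))"
  have "?a \<noteq> ?b" "?a \<noteq> ?c" "?b \<noteq> ?c"
    using permutes_neq[OF SigmaR_permutes[OF \<gamma>]] by auto
  \<comment> \<open>The six orders of three distinct values, each with its third inequality spelled
    out, so that every comparison arising after a swap is at hand.\<close>
  then have "(?a < ?b \<and> ?b < ?c \<and> ?a < ?c) \<or> (?a < ?c \<and> ?c < ?b \<and> ?a < ?b)
    \<or> (?b < ?a \<and> ?a < ?c \<and> ?b < ?c) \<or> (?b < ?c \<and> ?c < ?a \<and> ?b < ?a)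
    \<or> (?c < ?a \<and> ?a < ?b \<and> ?c < ?b) \<or> (?c < ?b \<and> ?b < ?a \<and> ?c < ?a)"
    by linarith
  then show "(sort_op e n P i \<circ> sort_op e n P (Suc i) \<circ> sort_op e n P i) (basis_vec \<gamma>)
    = (sort_op e n P (Suc i) \<circ> sort_op e n P i \<circ> sort_op e n P (Suc i)) (basis_vec \<gamma>)"
    using \<gamma> i
    by - (elim disjE conjE; cases "(?a, ?b) \<in> P"; cases "(?a, ?c) \<in> P"; cases "(?b, ?c) \<in> P";
      simp add: sort_op_simps gen_op_scale simple_transp_apply simple_transp_braid)
qed (simp_all only: op_alg_comp gen_op_carrier o_apply gen_op_proj)

lemma sort_op_comm:
  assumes i: "i \<in> {1..<n}" "j \<in> {1..<n}" "i + 2 \<le> j"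
  shows "sort_op e n P i \<circ> sort_op e n P j = sort_op e n P j \<circ> sort_op e n P i"
proof (rule op_eqI[OF finite_SigmaR[of n P]])
  fix \<gamma> assume \<gamma>: "\<gamma> \<in> SigmaR n P"
  let ?a = "\<gamma> i" and ?b = "\<gamma> (Suc i)" and ?c = "\<gamma> j" and ?d = "\<gamma> (Suc j)"
  have "?a \<noteq> ?b" "?c \<noteq> ?d"
    using permutes_neq[OF SigmaR_permutes[OF \<gamma>]] by auto
  then have "(?a < ?b \<and> ?c < ?d) \<or> (?a < ?b \<and> ?d < ?c) \<or> (?b < ?a \<and> ?c < ?d) \<or> (?b < ?a \<and> ?d < ?c)"
    by linarith
  then show "(sort_op e n P i \<circ> sort_op e n P j) (basis_vec \<gamma>)
    = (sort_op e n P j \<circ> sort_op e n P i) (basis_vec \<gamma>)"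
    using \<gamma> i
    by - (elim disjE conjE; cases "(?a, ?b) \<in> P"; cases "(?c, ?d) \<in> P";
      simp add: sort_op_simps gen_op_scale simple_transp_apply simple_transp_comm[OF i(3)])
qed (simp_all only: op_alg_comp gen_op_carrier o_apply gen_op_proj)

end

section \<open>Right modules, twists and restriction\<close>

lemma comm_group_cong:
  assumes "comm_group G" "carrier H = carrier G" "monoid.mult H = monoid.mult G" "one H = one G"
  shows "comm_group H"
proof -
  interpret comm_group G
    by fact
  show ?thesis
    by (rule comm_groupI) (auto simp: assms m_assoc m_comm m_lcomm intro: l_inv_ex)
qed

lemma right_module_comm_group: "right_module R M \<Longrightarrow> comm_group M"
  by (simp add: right_module_def)

text \<open>Injectivity of \<open>f\<close> lets every module law be verified after applying
  \<open>f\<close>.\<close>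

lemma right_module_transport:
  assumes N: "right_module R N" and M: "comm_group M"
    and closed: "\<And>x r. \<lbrakk>x \<in> carrier M; r \<in> carrier R\<rbrakk> \<Longrightarrow> act M x r \<in> carrier M"
    and f: "f \<in> hom M N" "inj_on f (carrier M)"
    and equiv: "\<And>x r. \<lbrakk>x \<in> carrier M; r \<in> carrier R\<rbrakk> \<Longrightarrow> f (act M x r) = act N (f x) r"
  shows "right_module R M"
proof -
  interpret N: right_module R N
    by fact
  interpret M: comm_group M
    by fact
  have fc: "f x \<in> carrier N" if "x \<in> carrier M" for x
    using f(1) that by (auto simp: hom_def)
  note hom = hom_mult[OF f(1)]
  show ?thesis
  proof (intro right_module.intro right_module_axioms.intro M N.R.ring_axioms closed)
    fix x y r assume a: "x \<in> carrier M" "y \<in> carrier M" "r \<in> carrier R"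
    show "act M (x \<otimes>\<^bsub>M\<^esub> y) r = act M x r \<otimes>\<^bsub>M\<^esub> act M y r"
      by (rule inj_onD[OF f(2)]) (simp_all add: a closed equiv hom fc N.act_add_left)
  next
    fix x r s assume a: "x \<in> carrier M" "r \<in> carrier R" "s \<in> carrier R"
    show "act M x (r \<oplus>\<^bsub>R\<^esub> s) = act M x r \<otimes>\<^bsub>M\<^esub> act M x s"
      by (rule inj_onD[OF f(2)]) (simp_all add: a closed equiv hom fc N.act_add_right)
    show "act M x (r \<otimes>\<^bsub>R\<^esub> s) = act M (act M x r) s"
      by (rule inj_onD[OF f(2)]) (simp_all add: a closed equiv hom fc N.act_mult)
  next
    fix x assume a: "x \<in> carrier M"
    show "act M x \<one>\<^bsub>R\<^esub> = x"
      by (rule inj_onD[OF f(2)]) (simp_all add: a closed equiv hom fc N.act_one)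
  qed
qed

lemma rmod_isoI:
  assumes "right_module R M" "right_module R N" "f \<in> iso M N"
    and "\<And>x r. \<lbrakk>x \<in> carrier M; r \<in> carrier R\<rbrakk> \<Longrightarrow> f (act M x r) = act N (f x) r"
  shows "rmod_iso R M N"
  using assms unfolding rmod_iso_def by blast

lemma rmod_isoE:
  assumes "rmod_iso R M N"
  obtains f where "right_module R M" "right_module R N" "f \<in> hom M N" "bij_betw f (carrier M) (carrier N)"
    "\<And>x r. \<lbrakk>x \<in> carrier M; r \<in> carrier R\<rbrakk> \<Longrightarrow> f (act M x r) = act N (f x) r"
  using assms unfolding rmod_iso_def iso_def by blast

lemma rmod_iso_sym:
  assumes "rmod_iso R M N"
  shows "rmod_iso R N M"
  using assms
proof (rule rmod_isoE)
  fix f assume M: "right_module R M" and N: "right_module R N" and f: "f \<in> hom M N"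
    "bij_betw f (carrier M) (carrier N)"
    and eq: "\<And>x r. \<lbrakk>x \<in> carrier M; r \<in> carrier R\<rbrakk> \<Longrightarrow> f (act M x r) = act N (f x) r"
  interpret M: right_module R M
    by fact
  let ?g = "inv_into (carrier M) f"
  have "?g \<in> iso N M"
    by (rule M.M.iso_set_sym) (use f in \<open>simp add: iso_def\<close>)
  moreover have "?g (act N y r) = act M (?g y) r" if "y \<in> carrier N" "r \<in> carrier R" for y r
  proof -
    have c: "?g y \<in> carrier M" "f (?g y) = y"
      using f(2) that(1) by (auto simp: bij_betw_def inv_into_into f_inv_into_f)
    then have "act N y r = f (act M (?g y) r)"
      using eq that(2) by simp
    then show ?thesis
      using f(2) M.act_closed[OF c(1) that(2)] by (simp add: bij_betw_def inv_into_f_f)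
  qed
  ultimately show ?thesis
    by (intro rmod_isoI[OF N M])
qed

lemma rmod_iso_trans:
  assumes "rmod_iso R L M" "rmod_iso R M N"
  shows "rmod_iso R L N"
  using assms(1)
proof (rule rmod_isoE)
  fix f assume L: "right_module R L" and f: "f \<in> hom L M" "bij_betw f (carrier L) (carrier M)"
    and feq: "\<And>x r. \<lbrakk>x \<in> carrier L; r \<in> carrier R\<rbrakk> \<Longrightarrow> f (act L x r) = act M (f x) r"
  show ?thesis
    using assms(2)
  proof (rule rmod_isoE)
    fix g assume N: "right_module R N" and g: "g \<in> hom M N" "bij_betw g (carrier M) (carrier N)"
      and geq: "\<And>x r. \<lbrakk>x \<in> carrier M; r \<in> carrier R\<rbrakk> \<Longrightarrow> g (act M x r) = act N (g x) r"
    have fc: "f x \<in> carrier M" if "x \<in> carrier L" for x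
      using f(1) that by (auto simp: hom_def)
    have "g \<circ> f \<in> hom L N"
      using f(1) g(1) by (auto simp: hom_def Pi_iff)
    then have "g \<circ> f \<in> iso L N"
      using bij_betw_trans[OF f(2) g(2)] by (simp add: iso_def)
    then show ?thesis
      by (rule rmod_isoI[OF L N]) (simp add: feq geq fc)
  qed
qed

text \<open>Restricting a twist and twisting a restriction give different records whose actions
  agree on the carriers; this is enough for one to replace the other.\<close>

lemma rmod_iso_cong:
  assumes "rmod_iso R M N" and "carrier M' = carrier M" "monoid.mult M' = monoid.mult M" "one M' = one M"
    and "\<And>x r. \<lbrakk>x \<in> carrier M; r \<in> carrier R\<rbrakk> \<Longrightarrow> act M' x r = act M x r"
  shows "rmod_iso R M' N"
proof -
  have M: "right_module R M"
    using assms(1) by (simp add: rmod_iso_def)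
  interpret M: right_module R M
    by fact
  have cg: "comm_group M'"
    by (rule comm_group_cong[OF right_module_comm_group[OF M]]) (simp_all add: assms)
  have id: "(\<lambda>x. x) \<in> hom M' M"
    by (simp add: hom_def assms)
  have M': "right_module R M'"
    by (rule right_module_transport[OF M cg _ id]) (simp_all add: assms M.act_closed)
  have "rmod_iso R M' M"
    by (rule rmod_isoI[OF M' M, of "\<lambda>x. x"]) (use id in \<open>simp_all add: iso_def assms bij_betw_def\<close>)
  then show ?thesis
    using assms(1) by (rule rmod_iso_trans)
qed

lemma twist_simps [simp]:
  "carrier (twist \<mu> M) = carrier M" "monoid.mult (twist \<mu> M) = monoid.mult M"
  "one (twist \<mu> M) = one M" "act (twist \<mu> M) x r = act M x (\<mu> r)"
  by (simp_all add: twist_def)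

lemma twist_right_module:
  assumes "right_module R M" "ring S" "\<mu> \<in> ring_hom S R"
  shows "right_module S (twist \<mu> M)"
proof -
  interpret M: right_module R M
    by fact
  note hom = ring_hom_closed[OF assms(3)] ring_hom_mult[OF assms(3)] ring_hom_add[OF assms(3)]
    ring_hom_one[OF assms(3)]
  have "comm_group (twist \<mu> M)"
    by (rule comm_group_cong[OF right_module_comm_group[OF assms(1)]]) simp_all
  then show ?thesis
    by (intro right_module.intro right_module_axioms.intro assms(2))
      (simp_all add: hom M.act_closed M.act_add_left M.act_add_right M.act_mult M.act_one)
qed

lemma twist_rmod_iso:
  assumes "rmod_iso R M N" "ring S" "\<mu> \<in> ring_hom S R"
  shows "rmod_iso S (twist \<mu> M) (twist \<mu> N)"
  using assms(1)
proof (rule rmod_isoE)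
  fix f assume M: "right_module R M" and N: "right_module R N" and f: "f \<in> hom M N"
    "bij_betw f (carrier M) (carrier N)"
    and eq: "\<And>x r. \<lbrakk>x \<in> carrier M; r \<in> carrier R\<rbrakk> \<Longrightarrow> f (act M x r) = act N (f x) r"
  show ?thesis
    by (rule rmod_isoI[OF twist_right_module[OF M assms(2,3)] twist_right_module[OF N assms(2,3)], of f])
      (use f eq ring_hom_closed[OF assms(3)] in \<open>simp_all add: iso_def hom_def\<close>)
qed

lemma anti_twist_carrier:
  "\<delta> \<in> carrier (anti_twist A \<nu> M) \<longleftrightarrow> (\<forall>x. x \<notin> carrier M \<longrightarrow> \<delta> x = 0)
    \<and> (\<forall>x \<in> carrier M. \<forall>y \<in> carrier M. \<delta> (x \<otimes>\<^bsub>M\<^esub> y) = \<delta> x + \<delta> y)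
    \<and> (\<forall>x \<in> carrier M. \<forall>c. \<delta> (act M x (c \<odot>\<^bsub>A\<^esub> \<one>\<^bsub>A\<^esub>)) = c * \<delta> x)"
  by (simp add: anti_twist_def)

lemma anti_twist_simps [simp]:
  "monoid.mult (anti_twist A \<nu> M) = (\<lambda>\<delta> \<epsilon> x. \<delta> x + \<epsilon> x)" "one (anti_twist A \<nu> M) = (\<lambda>x. 0)"
  "act (anti_twist A \<nu> M) \<delta> r = (\<lambda>x. if x \<in> carrier M then \<delta> (act M x (\<nu> r)) else 0)"
  by (simp_all add: anti_twist_def)

context complex_algebra
begin

context
  fixes \<nu> :: "'a \<Rightarrow> 'a"
  assumes nu: "\<nu> \<in> ring_hom A (opposite A)"
begin

lemma nu_simps:
  "x \<in> carrier A \<Longrightarrow> \<nu> x \<in> carrier A"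
  "\<lbrakk>x \<in> carrier A; y \<in> carrier A\<rbrakk> \<Longrightarrow> \<nu> (x \<otimes> y) = \<nu> y \<otimes> \<nu> x"
  "\<lbrakk>x \<in> carrier A; y \<in> carrier A\<rbrakk> \<Longrightarrow> \<nu> (x \<oplus> y) = \<nu> x \<oplus> \<nu> y"
  "\<nu> \<one> = \<one>"
  using ring_hom_closed[OF nu] ring_hom_mult[OF nu] ring_hom_add[OF nu] ring_hom_one[OF nu]
  by simp_all

lemma anti_twist_right_module:
  assumes "right_module A M"
  shows "right_module A (anti_twist A \<nu> M)"
proof -
  interpret M: right_module A M
    by fact
  have cg: "comm_group (anti_twist A \<nu> M)"
  proof (rule comm_groupI)
    fix \<delta> assume "\<delta> \<in> carrier (anti_twist A \<nu> M)"
    then show "\<exists>\<epsilon>\<in>carrier (anti_twist A \<nu> M). \<epsilon> \<otimes>\<^bsub>anti_twist A \<nu> M\<^esub> \<delta> = \<one>\<^bsub>anti_twist A \<nu> M\<^esub>"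
      by (intro bexI[of _ "\<lambda>x. - \<delta> x"]) (simp_all add: anti_twist_carrier)
  qed (simp_all add: anti_twist_carrier algebra_simps)
  show ?thesis
  proof (intro right_module.intro right_module_axioms.intro cg ring_axioms)
    fix \<delta> r assume d: "\<delta> \<in> carrier (anti_twist A \<nu> M)" and r: "r \<in> carrier A"
    \<comment> \<open>Scalars are central, so \<open>\<nu> r\<close> commutes with them in the
      action; this keeps the new functional complex linear.\<close>
    have "act M (act M x (c \<odot> \<one>)) (\<nu> r) = act M (act M x (\<nu> r)) (c \<odot> \<one>)"
      if "x \<in> carrier M" for x c
      using that r scalar_central[of "\<nu> r" c] nu_simps(1)[OF r] by (simp flip: M.act_mult)
    then show "act (anti_twist A \<nu> M) \<delta> r \<in> carrier (anti_twist A \<nu> M)"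
      using d r by (simp add: anti_twist_carrier M.act_closed nu_simps M.act_add_left)
  next
    fix \<delta> r s
    assume "\<delta> \<in> carrier (anti_twist A \<nu> M)" and r: "r \<in> carrier A" "s \<in> carrier A"
    then show "act (anti_twist A \<nu> M) \<delta> (r \<oplus> s)
        = act (anti_twist A \<nu> M) \<delta> r \<otimes>\<^bsub>anti_twist A \<nu> M\<^esub> act (anti_twist A \<nu> M) \<delta> s"
      by (auto simp: anti_twist_carrier M.act_closed nu_simps M.act_add_right)
    show "act (anti_twist A \<nu> M) \<delta> (r \<otimes> s)
        = act (anti_twist A \<nu> M) (act (anti_twist A \<nu> M) \<delta> r) s"
      using r by (auto simp: M.act_closed nu_simps M.act_mult)
  next
    fix \<delta> assume "\<delta> \<in> carrier (anti_twist A \<nu> M)"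
    then show "act (anti_twist A \<nu> M) \<delta> \<one> = \<delta>"
      by (auto simp: anti_twist_carrier nu_simps M.act_one)
  qed auto
qed

text \<open>Duality reverses arrows, hence the isomorphism is first turned around. Composition with
  \<open>f\<close> and with its inverse is extended by \<open>0\<close> off the carrier, as
  functionals are.\<close>

lemma anti_twist_rmod_iso:
  assumes "rmod_iso A M N"
  shows "rmod_iso A (anti_twist A \<nu> M) (anti_twist A \<nu> N)"
  using rmod_iso_sym[OF assms]
proof (rule rmod_isoE)
  fix f assume N: "right_module A N" and M: "right_module A M" and f: "f \<in> hom N M"
    "bij_betw f (carrier N) (carrier M)"
    and eq: "\<And>x r. \<lbrakk>x \<in> carrier N; r \<in> carrier A\<rbrakk> \<Longrightarrow> f (act N x r) = act M (f x) r"
  interpret M: right_module A M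
    by fact
  interpret N: right_module A N
    by fact
  have fc: "f x \<in> carrier M" if "x \<in> carrier N" for x
    using f(1) that by (auto simp: hom_def)
  let ?g = "inv_into (carrier N) f"
  have g: "?g y \<in> carrier N" "f (?g y) = y" if "y \<in> carrier M" for y
    using f(2) that by (auto simp: bij_betw_def inv_into_into f_inv_into_f)
  have gf: "?g (f x) = x" if "x \<in> carrier N" for x
    using f(2) that by (simp add: bij_betw_def inv_into_f_f)
  have gh: "?g (y \<otimes>\<^bsub>M\<^esub> z) = ?g y \<otimes>\<^bsub>N\<^esub> ?g z" if "y \<in> carrier M" "z \<in> carrier M" for y z
    using gf[of "?g y \<otimes>\<^bsub>N\<^esub> ?g z"] g[OF that(1)] g[OF that(2)] hom_mult[OF f(1), of "?g y" "?g z"]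
    by simp
  have ga: "?g (act M y r) = act N (?g y) r" if "y \<in> carrier M" "r \<in> carrier A" for y r
    using gf[of "act N (?g y) r"] g[OF that(1)] that eq[of "?g y" r] by (simp add: N.act_closed)
  let ?F = "\<lambda>\<delta> x. if x \<in> carrier N then \<delta> (f x) else 0"
  let ?G = "\<lambda>\<epsilon> y. if y \<in> carrier M then \<epsilon> (?g y) else 0"
  have F: "?F \<delta> \<in> carrier (anti_twist A \<nu> N)" if "\<delta> \<in> carrier (anti_twist A \<nu> M)" for \<delta>
    using that by (simp add: anti_twist_carrier eq fc N.act_closed hom_mult[OF f(1)])
  have G: "?G \<epsilon> \<in> carrier (anti_twist A \<nu> M)" if "\<epsilon> \<in> carrier (anti_twist A \<nu> N)" for \<epsilon>
    using that by (simp add: anti_twist_carrier ga g gh M.act_closed)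
  have "bij_betw ?F (carrier (anti_twist A \<nu> M)) (carrier (anti_twist A \<nu> N))"
    by (rule bij_betw_byWitness[of _ ?G])
      (use F G in \<open>auto simp: fun_eq_iff g gf fc anti_twist_carrier\<close>)
  moreover have "?F \<in> hom (anti_twist A \<nu> M) (anti_twist A \<nu> N)"
    using F by (auto simp: hom_def)
  ultimately have iso: "?F \<in> iso (anti_twist A \<nu> M) (anti_twist A \<nu> N)"
    by (simp add: iso_def)
  show ?thesis
    by (rule rmod_isoI[OF anti_twist_right_module[OF M] anti_twist_right_module[OF N] iso])
      (auto simp: fun_eq_iff eq fc N.act_closed nu_simps)
qed

end

end

text \<open>Elements of \<open>iso\<close> are additive bijections, so compatibility with scalars is
  a separate condition besides that with the generators.\<close>

lemma hecke_rmod_isoI: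
  assumes M: "right_module (hecke n) M" and N: "right_module (hecke n) N" and f: "f \<in> iso M N"
    and scalar: "\<And>x c. x \<in> carrier M \<Longrightarrow>
      f (act M x (c \<odot>\<^bsub>hecke n\<^esub> \<one>\<^bsub>hecke n\<^esub>)) = act N (f x) (c \<odot>\<^bsub>hecke n\<^esub> \<one>\<^bsub>hecke n\<^esub>)"
    and pibar: "\<And>x i. \<lbrakk>x \<in> carrier M; i \<in> {1..<n}\<rbrakk> \<Longrightarrow>
      f (act M x (pibar n i)) = act N (f x) (pibar n i)"
  shows "rmod_iso (hecke n) M N"
proof (rule rmod_isoI[OF M N f])
  interpret M: right_module "hecke n" M
    by fact
  interpret N: right_module "hecke n" N
    by fact
  have h: "f \<in> hom M N"
    using f by (simp add: iso_def)
  then have fc: "f x \<in> carrier N" if "x \<in> carrier M" for x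
    using that by (auto simp: hom_def)
  fix x r assume x: "x \<in> carrier M" and r: "r \<in> carrier (hecke n)"
  show "f (act M x r) = act N (f x) r"
    using r
  proof (induction rule: hecke_induct)
    case (add a b)
    then show ?case
      using x by (simp add: M.act_add_right N.act_add_right fc hom_mult[OF h] M.act_closed)
  next
    case (mult a i)
    then show ?case
      using x by (simp add: M.act_mult N.act_mult fc M.act_closed pibar)
  qed (simp add: scalar x)
qed

section \<open>Parabolic subalgebras and restriction\<close>

lemma parabolic_gens_carrier:
  "{pi_gen (m + n) i | i. i \<in> {1..<m + n} - {m}}
      \<union> {c \<odot>\<^bsub>hecke (m + n)\<^esub> \<one>\<^bsub>hecke (m + n)\<^esub> | c. True} \<subseteq> carrier (hecke (m + n))"
  by (auto simp: pi_gen_def)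

lemma parabolic_simps [simp]:
  "monoid.mult (parabolic m n) = monoid.mult (hecke (m + n))"
  "one (parabolic m n) = one (hecke (m + n))"
  "ring.zero (parabolic m n) = ring.zero (hecke (m + n))"
  "add (parabolic m n) = add (hecke (m + n))"
  "smult (parabolic m n) = smult (hecke (m + n))"
  by (simp_all add: parabolic_def)

lemma parabolic_carrier:
  "carrier (parabolic m n) = generate_ring (hecke (m + n))
     ({pi_gen (m + n) i | i. i \<in> {1..<m + n} - {m}}
      \<union> {c \<odot>\<^bsub>hecke (m + n)\<^esub> \<one>\<^bsub>hecke (m + n)\<^esub> | c. True})"
  by (simp add: parabolic_def)

lemma parabolic_subset: "h \<in> carrier (parabolic m n) \<Longrightarrow> h \<in> carrier (hecke (m + n))"
  unfolding parabolic_carrier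
  by (rule hecke.generate_ring_in_carrier[OF parabolic_gens_carrier])

lemma parabolic_scalar: "c \<odot>\<^bsub>hecke (m + n)\<^esub> \<one>\<^bsub>hecke (m + n)\<^esub> \<in> carrier (parabolic m n)"
  unfolding parabolic_carrier by (rule generate_ring.incl) blast

lemma parabolic_add:
  "\<lbrakk>a \<in> carrier (parabolic m n); b \<in> carrier (parabolic m n)\<rbrakk>
    \<Longrightarrow> a \<oplus>\<^bsub>hecke (m + n)\<^esub> b \<in> carrier (parabolic m n)"
  unfolding parabolic_carrier by (rule generate_ring.eng_add)

lemma parabolic_mult:
  "\<lbrakk>a \<in> carrier (parabolic m n); b \<in> carrier (parabolic m n)\<rbrakk>
    \<Longrightarrow> a \<otimes>\<^bsub>hecke (m + n)\<^esub> b \<in> carrier (parabolic m n)"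
  unfolding parabolic_carrier by (rule generate_ring.eng_mult)

lemma parabolic_neg:
  "a \<in> carrier (parabolic m n) \<Longrightarrow> \<ominus>\<^bsub>hecke (m + n)\<^esub> a \<in> carrier (parabolic m n)"
  unfolding parabolic_carrier by (rule generate_ring.a_inv)

lemma parabolic_one: "\<one>\<^bsub>hecke (m + n)\<^esub> \<in> carrier (parabolic m n)"
  unfolding parabolic_carrier by (rule generate_ring.one)

lemma parabolic_pi_gen: "i \<in> {1..<m + n} - {m} \<Longrightarrow> pi_gen (m + n) i \<in> carrier (parabolic m n)"
  unfolding parabolic_carrier by (rule generate_ring.incl) blast

lemma parabolic_pibar:
  assumes "i \<in> {1..<m + n} - {m}"
  shows "pibar (m + n) i \<in> carrier (parabolic m n)"
proof -
  have "pi_gen (m + n) i \<ominus>\<^bsub>hecke (m + n)\<^esub> \<one>\<^bsub>hecke (m + n)\<^esub> = pibar (m + n) i"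
    using assms by (simp add: pi_gen_def a_minus_def hecke.a_assoc hecke.r_neg)
  moreover have "pi_gen (m + n) i \<ominus>\<^bsub>hecke (m + n)\<^esub> \<one>\<^bsub>hecke (m + n)\<^esub> \<in> carrier (parabolic m n)"
    unfolding a_minus_def
    using assms by (intro parabolic_add parabolic_neg parabolic_one parabolic_pi_gen)
  ultimately show ?thesis
    by simp
qed

lemma parabolic_algebra: "complex_algebra (parabolic m n)"
proof (intro complex_algebra.intro complex_algebra_axioms.intro)
  show "ring (parabolic m n)"
    by (rule ring_cong[OF hecke.generate_ring_is_ring[OF parabolic_gens_carrier]])
      (simp_all add: parabolic_carrier)
  fix a c assume "a \<in> carrier (parabolic m n)"
  then show "c \<odot>\<^bsub>parabolic m n\<^esub> a \<in> carrier (parabolic m n)"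
    using hecke.smult_eq_mult[OF parabolic_subset, of a m n c] parabolic_mult[OF parabolic_scalar, of a m n c]
    by simp
qed (auto dest!: parabolic_subset
    simp: hecke.smult_l_distr hecke.smult_r_distr hecke.smult_assoc hecke.smult_mult_l hecke.smult_mult_r)

text \<open>Closure under negation is absorbed into multiplication by the scalar \<open>-1\<close>,
  and \<open>pi_gen\<close> is traded for \<open>pibar\<close>, whose images under the three twists
  are given directly.\<close>

lemma parabolic_induct [consumes 1, case_names pibar scalar add mult]:
  assumes "h \<in> carrier (parabolic m n)"
    and pibar: "\<And>i. i \<in> {1..<m + n} - {m} \<Longrightarrow> Q (pibar (m + n) i)"
    and scalar: "\<And>c. Q (c \<odot>\<^bsub>hecke (m + n)\<^esub> \<one>\<^bsub>hecke (m + n)\<^esub>)"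
    and add: "\<And>x y. \<lbrakk>x \<in> carrier (parabolic m n); y \<in> carrier (parabolic m n); Q x; Q y\<rbrakk>
      \<Longrightarrow> Q (x \<oplus>\<^bsub>hecke (m + n)\<^esub> y)"
    and mult: "\<And>x y. \<lbrakk>x \<in> carrier (parabolic m n); y \<in> carrier (parabolic m n); Q x; Q y\<rbrakk>
      \<Longrightarrow> Q (x \<otimes>\<^bsub>hecke (m + n)\<^esub> y)"
  shows "Q h"
proof -
  have one: "Q \<one>\<^bsub>hecke (m + n)\<^esub>"
    using scalar[of 1] by simp
  show ?thesis
    using assms(1)[unfolded parabolic_carrier]
  proof (induction rule: generate_ring.induct)
    case (incl h)
    then consider i where "i \<in> {1..<m + n} - {m}" "h = pi_gen (m + n) i"
      | c where "h = c \<odot>\<^bsub>hecke (m + n)\<^esub> \<one>\<^bsub>hecke (m + n)\<^esub>"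
      by blast
    then show ?case
      by cases (auto simp: pi_gen_def scalar intro!: add pibar parabolic_pibar parabolic_one one)
  next
    case (a_inv h)
    then have h: "h \<in> carrier (parabolic m n)"
      by (simp add: parabolic_carrier)
    have "\<ominus>\<^bsub>hecke (m + n)\<^esub> h
        = ((-1) \<odot>\<^bsub>hecke (m + n)\<^esub> \<one>\<^bsub>hecke (m + n)\<^esub>) \<otimes>\<^bsub>hecke (m + n)\<^esub> h"
      using parabolic_subset[OF h] by (simp add: hecke.smult_minus_one hecke.l_minus)
    then show ?case
      using mult[OF parabolic_scalar h scalar a_inv.IH] by simp
  next
    case (eng_add x y)
    then show ?case
      unfolding parabolic_carrier[symmetric] by (intro add)
  next
    case (eng_mult x y)
    then show ?case
      unfolding parabolic_carrier[symmetric] by (intro mult)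
  qed (rule one)
qed

lemma restriction_simps [simp]:
  "carrier (restriction A M) = carrier M" "monoid.mult (restriction A M) = monoid.mult M"
  "one (restriction A M) = one M" "r \<in> carrier A \<Longrightarrow> act (restriction A M) x r = act M x r"
  by (simp_all add: restriction_def)

lemma restriction_right_module:
  assumes "right_module (hecke (m + n)) M"
  shows "right_module (parabolic m n) (restriction (parabolic m n) M)"
proof -
  interpret M: right_module "hecke (m + n)" M
    by fact
  interpret P: complex_algebra "parabolic m n"
    by (rule parabolic_algebra)
  have cg: "comm_group (restriction (parabolic m n) M)"
    by (rule comm_group_cong[OF right_module_comm_group[OF assms]]) simp_all
  show ?thesis
    by (intro right_module.intro right_module_axioms.intro cg P.ring_axioms)
      (simp_all add: parabolic_subset parabolic_add parabolic_mult parabolic_one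
        M.act_closed M.act_add_left M.act_add_right M.act_mult M.act_one)
qed

lemma restriction_rmod_iso:
  assumes "rmod_iso (hecke (m + n)) M N"
  shows "rmod_iso (parabolic m n) (restriction (parabolic m n) M) (restriction (parabolic m n) N)"
  using assms
proof (rule rmod_isoE)
  fix f assume M: "right_module (hecke (m + n)) M" and N: "right_module (hecke (m + n)) N"
    and f: "f \<in> hom M N" "bij_betw f (carrier M) (carrier N)"
    and eq: "\<And>x r. \<lbrakk>x \<in> carrier M; r \<in> carrier (hecke (m + n))\<rbrakk> \<Longrightarrow> f (act M x r) = act N (f x) r"
  show ?thesis
    by (rule rmod_isoI[OF restriction_right_module[OF M] restriction_right_module[OF N], of f])
      (use f in \<open>simp_all add: iso_def hom_def eq parabolic_subset\<close>)
qed

section \<open>Poset modules and their twists\<close>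

lemma op_alg_a_inv: "F \<in> carrier op_alg \<Longrightarrow> \<ominus>\<^bsub>op_alg\<^esub> F = (\<lambda>v t. - F v t)"
  using op_alg.smult_minus_one[of F] by (simp del: op_alg_simps(1))

text \<open>The relations evaluated on vectors. The reversed product of \<open>op_alg\<close> leaves
  no trace, since the braid words are palindromes and commutation is symmetric.\<close>

lemma hecke_gens_op_iff:
  "hecke_gens op_alg n X \<longleftrightarrow> (\<forall>i\<in>{1..<n}. X i \<in> carrier op_alg) \<and>
     (\<forall>i\<in>{1..<n}. \<forall>v. X i (X i v) = (\<lambda>t. - X i v t)) \<and>
     (\<forall>i\<in>{1..<n}. Suc i \<in> {1..<n} \<longrightarrow> (\<forall>v. X i (X (Suc i) (X i v)) = X (Suc i) (X i (X (Suc i) v)))) \<and>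
     (\<forall>i\<in>{1..<n}. \<forall>j\<in>{1..<n}. i + 2 \<le> j \<longrightarrow> (\<forall>v. X i (X j v) = X j (X i v)))"
proof (cases "\<forall>i\<in>{1..<n}. X i \<in> carrier op_alg")
  case True
  then have inv: "\<ominus>\<^bsub>op_alg\<^esub> X i = (\<lambda>v t. - X i v t)" if "i \<in> {1..<n}" for i
    using that op_alg_a_inv by blast
  have quadratic: "X i \<circ> X i = \<ominus>\<^bsub>op_alg\<^esub> X i \<longleftrightarrow> (\<forall>v. X i (X i v) = (\<lambda>t. - X i v t))" if "i \<in> {1..<n}" for i
    unfolding inv[OF that] by (simp add: fun_eq_iff)
  have braid: "X i \<circ> X j \<circ> X i = X j \<circ> X i \<circ> X j \<longleftrightarrow> (\<forall>v. X i (X j (X i v)) = X j (X i (X j v)))" for i j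
    by (simp add: fun_eq_iff)
  have comm: "X j \<circ> X i = X i \<circ> X j \<longleftrightarrow> (\<forall>v. X i (X j v) = X j (X i v))" for i j
    by (auto simp: fun_eq_iff)
  show ?thesis
    unfolding hecke_gens_def
    using True quadratic by (auto simp: braid comm image_subset_iff simp del: op_alg_simps(1))
next
  case False
  then show ?thesis
    unfolding hecke_gens_def by blast
qed

text \<open>Meant for \<open>sort_op - 1\<close>, which satisfies the relations on all functions,
  whereas \<open>gen_op\<close> kills coordinates outside \<open>B\<close>. Inserting
  \<open>proj B\<close> keeps the relations because the projected operators take values supported on
  \<open>B\<close>.\<close>

lemma hecke_gens_proj:
  assumes "hecke_gens op_alg n X"
    and Y: "\<And>i v. i \<in> {1..<n} \<Longrightarrow> Y i v = X i (proj B v)"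
    and inv: "\<And>i v. i \<in> {1..<n} \<Longrightarrow> proj B (Y i v) = Y i v"
  shows "hecke_gens op_alg n Y"
proof -
  have X: "X i \<in> carrier op_alg" if "i \<in> {1..<n}" for i
    using assms(1) that by (simp add: hecke_gens_op_iff)
  have proj: "proj B \<in> carrier op_alg"
    by (auto simp: proj_def fun_eq_iff)
  have "Y i \<in> carrier op_alg" if "i \<in> {1..<n}" for i
  proof -
    have "Y i = X i \<circ> proj B"
      using Y[OF that] by auto
    then show ?thesis
      using op_alg_comp[OF X[OF that] proj] by simp
  qed
  moreover have "Y i (Y j v) = X i (X j (proj B v))" if "i \<in> {1..<n}" "j \<in> {1..<n}" for i j v
    using Y[OF that(1), of "Y j v"] inv[OF that(2), of v] Y[OF that(2), of v] by simp
  moreover have "Y i (Y j (Y k v)) = X i (X j (X k (proj B v)))"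
    if "i \<in> {1..<n}" "j \<in> {1..<n}" "k \<in> {1..<n}" for i j k v
    using calculation(2)[OF that(1,2), of "Y k v"] inv[OF that(3), of v] Y[OF that(3), of v] by simp
  ultimately show ?thesis
    using assms(1) unfolding hecke_gens_op_iff by (auto simp: Y simp del: op_alg_simps(1))
qed

text \<open>\<open>(1 + e) / 2\<close> is \<open>0\<close> for \<open>e = -1\<close> and
  \<open>1\<close> for \<open>e = 1\<close>: in the first case \<open>sort_act\<close> already
  describes \<open>pibar\<close>, in the second it describes \<open>pibar + 1\<close>.\<close>

definition shift_act :: "complex \<Rightarrow> nat \<Rightarrow> (nat \<times> nat) set \<Rightarrow> perm \<Rightarrow> nat \<Rightarrow> vec" where
  "shift_act e n P \<gamma> i = (\<lambda>\<tau>. sort_act e n P \<gamma> i \<tau> - (1 + e) / 2 * basis_vec \<gamma> \<tau>)"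

abbreviation sort_module :: "complex \<Rightarrow> nat \<Rightarrow> (nat \<times> nat) set \<Rightarrow> (vec, hecke_elem) acted" where
  "sort_module e n P \<equiv> span_module (SigmaR n P) (shift_act e n P)"

lemma poset_module_eq: "poset_module n P = sort_module (-1) n P"
  unfolding poset_module_def
  by (rule arg_cong[where f = "span_module _"]) (auto simp: fun_eq_iff shift_act_def sort_act_def)

lemma bold_poset_module_eq: "bold_poset_module n P = sort_module 1 n P"
  unfolding bold_poset_module_def
  by (rule arg_cong[where f = "span_module _"]) (auto simp: fun_eq_iff shift_act_def sort_act_def)

lemma sort_act_support: "\<lbrakk>\<gamma> \<in> SigmaR n P; sort_act e n P \<gamma> i \<tau> \<noteq> 0\<rbrakk> \<Longrightarrow> \<tau> \<in> SigmaR n P"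
  by (auto simp: sort_act_def basis_vec_def split: if_splits)

lemma shift_op_eq:
  "gen_op (SigmaR n P) (shift_act e n P) i v
    = (\<lambda>\<tau>. sort_op e n P i v \<tau> - (1 + e) / 2 * proj (SigmaR n P) v \<tau>)"
  by (simp add: gen_op_def shift_act_def proj_eq_sum algebra_simps sum_subtractf sum_distrib_left)

lemma proj_sort_op: "proj (SigmaR n P) (sort_op e n P i v) = sort_op e n P i v"
proof -
  have "(\<Sum>\<gamma>\<in>SigmaR n P. v \<gamma> * sort_act e n P \<gamma> i \<tau>) = 0" if "\<tau> \<notin> SigmaR n P" for \<tau>
    using that sort_act_support by (intro sum.neutral ballI) (metis mult_eq_0_iff)
  then show ?thesis
    by (auto simp: proj_def gen_op_def)
qed

text \<open>For \<open>e = 1\<close> the operators \<open>sort_op\<close> are idempotent, so their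
  negatives satisfy the relations of \<open>pibar\<close>. Applying \<open>hecke_gens_theta\<close>
  to these yields \<open>sort_op - 1\<close>, which is the operator wanted up to projection to the
  span.\<close>

lemma span_data_sort_module:
  assumes "e = -1 \<or> e = 1"
  shows "span_data n (SigmaR n P) (shift_act e n P)"
proof
  have q: "sort_op e n P i (sort_op e n P i v) = (\<lambda>t. e * sort_op e n P i v t)" if "i \<in> {1..<n}" for i v
    using sort_op_quadratic[OF that] .
  have b: "sort_op e n P i (sort_op e n P (Suc i) (sort_op e n P i v))
      = sort_op e n P (Suc i) (sort_op e n P i (sort_op e n P (Suc i) v))"
    if "i \<in> {1..<n}" "Suc i \<in> {1..<n}" for i v
    using fun_cong[OF sort_op_braid[OF that, where e = e and P = P], of v] by simp
  have c: "sort_op e n P i (sort_op e n P j v) = sort_op e n P j (sort_op e n P i v)"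
    if "i \<in> {1..<n}" "j \<in> {1..<n}" "i + 2 \<le> j" for i j v
    using fun_cong[OF sort_op_comm[OF that, where e = e and P = P], of v] by simp
  show "hecke_gens op_alg n (gen_op (SigmaR n P) (shift_act e n P))"
    using assms
  proof
    assume e: "e = -1"
    have "gen_op (SigmaR n P) (shift_act e n P) = sort_op e n P"
      by (intro ext) (simp add: shift_op_eq e)
    then show ?thesis
      unfolding hecke_gens_op_iff using q b by (auto simp: e intro: c[unfolded e] simp del: op_alg_simps(1))
  next
    assume e: "e = 1"
    let ?X = "\<lambda>i v t. - sort_op e n P i v t"
    have neg: "sort_op e n P i (\<lambda>t. - v t) = (\<lambda>t. - sort_op e n P i v t)" for i v
      using gen_op_scale[of "SigmaR n P" "sort_act e n P" i "-1" v] by simp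
    have X: "?X i \<in> carrier op_alg" for i
      using op_alg.a_inv_closed[OF gen_op_carrier, of "SigmaR n P" "sort_act e n P" i]
        op_alg_a_inv[OF gen_op_carrier, of "SigmaR n P" "sort_act e n P" i] by simp
    have "hecke_gens op_alg n ?X"
      unfolding hecke_gens_op_iff
      using X q b by (auto simp: e neg[unfolded e] intro: c[unfolded e] simp del: op_alg_simps(1))
    then have g: "hecke_gens op_alg n (\<lambda>i. \<ominus>\<^bsub>op_alg\<^esub> (?X i \<oplus>\<^bsub>op_alg\<^esub> \<one>\<^bsub>op_alg\<^esub>))"
      by (rule op_alg.hecke_gens_theta)
    have eq: "\<ominus>\<^bsub>op_alg\<^esub> (?X i \<oplus>\<^bsub>op_alg\<^esub> \<one>\<^bsub>op_alg\<^esub>) = (\<lambda>v t. sort_op e n P i v t - v t)" for i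
    proof -
      have "?X i \<oplus>\<^bsub>op_alg\<^esub> \<one>\<^bsub>op_alg\<^esub> \<in> carrier op_alg"
        using X op_alg.one_closed by (rule op_alg.a_closed)
      then show ?thesis
        by (subst op_alg_a_inv) (simp_all add: fun_eq_iff del: op_alg_simps(1))
    qed
    show ?thesis
    proof (rule hecke_gens_proj[OF g[unfolded eq]])
      fix i v
      show "gen_op (SigmaR n P) (shift_act e n P) i v
          = (\<lambda>t. sort_op e n P i (proj (SigmaR n P) v) t - proj (SigmaR n P) v t)"
        by (simp add: shift_op_eq e)
      have "proj (SigmaR n P) (\<lambda>\<tau>. sort_op e n P i v \<tau> - proj (SigmaR n P) v \<tau>)
          = (\<lambda>\<tau>. proj (SigmaR n P) (sort_op e n P i v) \<tau> - proj (SigmaR n P) v \<tau>)"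
        by (auto simp: proj_def fun_eq_iff)
      then show "proj (SigmaR n P) (gen_op (SigmaR n P) (shift_act e n P) i v)
          = gen_op (SigmaR n P) (shift_act e n P) i v"
        by (simp add: shift_op_eq e proj_sort_op)
    qed
  qed
  fix \<gamma> i \<tau> assume "\<gamma> \<in> SigmaR n P" "shift_act e n P \<gamma> i \<tau> \<noteq> 0"
  then show "\<tau> \<in> SigmaR n P"
    using sort_act_support[of \<gamma> n P e i \<tau>] by (auto simp: shift_act_def basis_vec_def split: if_splits)
qed simp

lemma poset_module_span: "span_data n (SigmaR n P) (shift_act (-1) n P)"
  and bold_poset_module_span: "span_data n (SigmaR n P) (shift_act 1 n P)"
  by (simp_all add: span_data_sort_module)

lemma proj_span: "v \<in> carrier (span_module B a) \<Longrightarrow> proj B v = v"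
  by (auto simp: span_module_def proj_def fun_eq_iff)

lemma op_eq_on_span:
  assumes "finite B" "F \<in> carrier op_alg" "G \<in> carrier op_alg"
    and "\<And>\<gamma>. \<gamma> \<in> B \<Longrightarrow> F (basis_vec \<gamma>) = G (basis_vec \<gamma>)" and v: "v \<in> carrier (span_module B a)"
  shows "F v = G v"
proof -
  have e: "v = (\<lambda>\<tau>. \<Sum>\<gamma>\<in>B. v \<gamma> * basis_vec \<gamma> \<tau>)"
    using proj_eq_sum[OF assms(1), of v] proj_span[OF v] by simp
  have "F v = (\<lambda>\<tau>. \<Sum>\<gamma>\<in>B. v \<gamma> * F (basis_vec \<gamma>) \<tau>)"
    by (subst e, rule linear_sum[OF assms(2,1)])
  also have "\<dots> = (\<lambda>\<tau>. \<Sum>\<gamma>\<in>B. v \<gamma> * G (basis_vec \<gamma>) \<tau>)"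
    by (simp add: assms(4))
  also have "\<dots> = G v"
    by (subst (2) e, rule linear_sum[OF assms(3,1), symmetric])
  finally show ?thesis .
qed

text \<open>The longest permutation of \<open>{1..n}\<close>, continued by the identity so that it
  \<open>permutes {1..n}\<close>.\<close>

definition flip :: "nat \<Rightarrow> nat \<Rightarrow> nat" where
  "flip n k = (if k \<in> {1..n} then n + 1 - k else k)"

lemma flip_flip [simp]: "flip n (flip n k) = k"
  by (auto simp: flip_def)

lemma flip_comp_flip [simp]: "flip n \<circ> (flip n \<circ> f) = f" "(f \<circ> flip n) \<circ> flip n = f"
  by (simp_all add: fun_eq_iff)

lemma flip_in [simp]: "flip n k \<in> {1..n} \<longleftrightarrow> k \<in> {1..n}"
  by (auto simp: flip_def)

lemma flip_eq_iff: "flip n a = flip n b \<longleftrightarrow> a = b"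
  by (metis flip_flip)

lemma flip_permutes: "flip n permutes {1..n}"
  unfolding permutes_def by (metis flip_flip flip_def)

lemma flip_less_iff: "\<lbrakk>a \<in> {1..n}; b \<in> {1..n}\<rbrakk> \<Longrightarrow> flip n a < flip n b \<longleftrightarrow> b < a"
  by (auto simp: flip_def)

lemma flip_simple_transp:
  "i \<in> {1..<n} \<Longrightarrow> flip n \<circ> simple_transp i = simple_transp (n - i) \<circ> flip n"
  by (auto simp: fun_eq_iff flip_def simple_transp_apply)

lemma comp_flip_permutes_iff: "flip n \<circ> \<tau> permutes {1..n} \<longleftrightarrow> \<tau> permutes {1..n}"
  using permutes_compose[OF _ flip_permutes, of "flip n \<circ> \<tau>" n] permutes_compose[OF _ flip_permutes, of \<tau> n]
  by auto

lemma conj_flip_permutes_iff: "flip n \<circ> \<tau> \<circ> flip n permutes {1..n} \<longleftrightarrow> \<tau> permutes {1..n}"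
  using permutes_compose[OF flip_permutes, of "flip n \<circ> \<tau>" n]
    permutes_compose[OF flip_permutes, of "flip n \<circ> \<tau> \<circ> flip n" n] comp_flip_permutes_iff[of n \<tau>]
  by (auto simp del: One_nat_def)

lemma bar_iff: "(u, v) \<in> bar n P \<longleftrightarrow> u \<in> {1..n} \<and> v \<in> {1..n} \<and> (flip n u, flip n v) \<in> P"
  by (auto simp: bar_def flip_def)

lemma SigmaR_bar:
  assumes "P \<subseteq> {1..n} \<times> {1..n}"
  shows "\<tau> \<in> SigmaR n (bar n P) \<longleftrightarrow> flip n \<circ> \<tau> \<in> SigmaR n P"
proof -
  have "(u, v) \<in> bar n P \<longleftrightarrow> (flip n u, flip n v) \<in> P" for u v
    using assms flip_in[of n u] flip_in[of n v] by (auto simp: bar_iff simp del: flip_in)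
  then show ?thesis
    by (simp add: SigmaR_iff comp_flip_permutes_iff del: One_nat_def)
qed

text \<open>The left factor renames values as \<open>bar\<close> does. Reversing the positions by
  the right factor reverses all required inequalities, which accounts for the converse.\<close>

lemma SigmaR_bar_converse:
  assumes P: "P \<subseteq> {1..n} \<times> {1..n}"
  shows "\<tau> \<in> SigmaR n ((bar n P)\<inverse>) \<longleftrightarrow> flip n \<circ> \<tau> \<circ> flip n \<in> SigmaR n P"
proof (cases "\<tau> permutes {1..n}")
  case True
  have bar: "(u, v) \<in> bar n P \<longleftrightarrow> (flip n u, flip n v) \<in> P" for u v
    using assms flip_in[of n u] flip_in[of n v] by (auto simp: bar_iff simp del: flip_in)
  have range: "a \<in> {1..n} \<and> b \<in> {1..n}" if "(flip n (\<tau> a), flip n (\<tau> b)) \<in> P" for a b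
    using that P permutes_in_image[OF True] flip_in by blast
  have "(\<forall>a b. (flip n (\<tau> b), flip n (\<tau> a)) \<in> P \<and> a \<noteq> b \<longrightarrow> a < b) \<longleftrightarrow>
      (\<forall>a b. (flip n (\<tau> (flip n a)), flip n (\<tau> (flip n b))) \<in> P \<and> a \<noteq> b \<longrightarrow> a < b)" (is "?L \<longleftrightarrow> ?R")
  proof
    assume L: ?L
    show ?R
    proof (intro allI impI)
      fix a b assume ab: "(flip n (\<tau> (flip n a)), flip n (\<tau> (flip n b))) \<in> P \<and> a \<noteq> b"
      then have "flip n b < flip n a"
        using L flip_eq_iff by metis
      moreover have "a \<in> {1..n}" "b \<in> {1..n}"
        using range[of "flip n a" "flip n b"] ab unfolding flip_in by blast+
      ultimately show "a < b"
        using flip_less_iff[of b n a] by simp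
    qed
  next
    assume R: ?R
    show ?L
    proof (intro allI impI)
      fix a b assume ab: "(flip n (\<tau> b), flip n (\<tau> a)) \<in> P \<and> a \<noteq> b"
      then have "flip n b < flip n a"
        using R[rule_format, of "flip n b" "flip n a"] flip_eq_iff by auto
      then show "a < b"
        using range[of b a] ab flip_less_iff[of b n a] by auto
    qed
  qed
  then show ?thesis
    using True by (simp add: SigmaR_iff bar conj_flip_permutes_iff del: One_nat_def)
qed (simp add: SigmaR_iff conj_flip_permutes_iff del: One_nat_def)

text \<open>Conjugation exchanges right multiplication by \<open>simple_transp (n - i)\<close> with
  that by \<open>simple_transp i\<close>. Positions and values are both reversed, so a descent at
  \<open>n - i\<close> becomes a descent at \<open>i\<close>.\<close>

lemma phi_poset_module:
  assumes P: "P \<subseteq> {1..n} \<times> {1..n}"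
  shows "rmod_iso (hecke n) (twist (hecke_phi n) (poset_module n P)) (poset_module n ((bar n P)\<inverse>))"
proof -
  let ?P' = "(bar n P)\<inverse>"
  let ?c = "\<lambda>\<tau>. flip n \<circ> \<tau> \<circ> flip n"
  let ?f = "\<lambda>v \<tau>. v (?c \<tau>) :: complex"
  interpret M: span_data n "SigmaR n P" "shift_act (-1) n P"
    by (rule poset_module_span)
  interpret N: span_data n "SigmaR n ?P'" "shift_act (-1) n ?P'"
    by (rule poset_module_span)
  have cc: "?c (?c \<tau>) = \<tau>" for \<tau>
    by (simp add: fun_eq_iff)
  have c_eq: "?c \<tau> = \<gamma> \<longleftrightarrow> \<tau> = ?c \<gamma>" for \<tau> \<gamma>
    using cc by metis
  note S = SigmaR_bar_converse[OF P]
  have basis: "?f (basis_vec \<gamma>) = basis_vec (?c \<gamma>)" for \<gamma>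
    unfolding basis_vec_def c_eq ..
  have closed: "?f v \<in> carrier (sort_module (-1) n ?P')" if "v \<in> carrier (sort_module (-1) n P)" for v
    using that by (simp add: M.span_carrier N.span_carrier S)
  have closed': "?f v \<in> carrier (sort_module (-1) n P)" if "v \<in> carrier (sort_module (-1) n ?P')" for v
    using that by (simp add: M.span_carrier N.span_carrier S) (metis cc)
  have iso: "?f \<in> iso (twist (hecke_phi n) (poset_module n P)) (poset_module n ?P')"
    unfolding iso_def poset_module_eq
  proof (intro CollectI conjI)
    show "?f \<in> hom (twist (hecke_phi n) (sort_module (-1) n P)) (sort_module (-1) n ?P')"
      using closed by (simp add: hom_def)
    have "bij_betw ?f (carrier (sort_module (-1) n P)) (carrier (sort_module (-1) n ?P'))"
      by (rule bij_betw_byWitness[of _ ?f]) (use closed closed' in \<open>auto simp: cc\<close>)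
    then show "bij_betw ?f (carrier (twist (hecke_phi n) (sort_module (-1) n P))) (carrier (sort_module (-1) n ?P'))"
      by simp
  qed
  show ?thesis
  proof (rule hecke_rmod_isoI[where f = ?f, OF _ _ iso])
    show "right_module (hecke n) (twist (hecke_phi n) (poset_module n P))"
      unfolding poset_module_eq by (rule twist_right_module[OF M.span_right_module hecke_ring hecke_phi_hom])
    show "right_module (hecke n) (poset_module n ?P')"
      unfolding poset_module_eq by (rule N.span_right_module)
    show "?f (act (twist (hecke_phi n) (poset_module n P)) x (k \<odot>\<^bsub>hecke n\<^esub> \<one>\<^bsub>hecke n\<^esub>))
        = act (poset_module n ?P') (?f x) (k \<odot>\<^bsub>hecke n\<^esub> \<one>\<^bsub>hecke n\<^esub>)" for x k
      by (simp add: poset_module_eq hecke_twist_scalar M.span_act_scalar N.span_act_scalar)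
    fix x i assume x: "x \<in> carrier (twist (hecke_phi n) (poset_module n P))" and i: "i \<in> {1..<n}"
    let ?A = "gen_op (SigmaR n P) (shift_act (-1) n P)" and ?A' = "gen_op (SigmaR n ?P') (shift_act (-1) n ?P')"
    have ni: "n - i \<in> {1..<n}"
      using i by auto
    have f: "?f \<in> carrier op_alg"
      by simp
    have "(?f \<circ> ?A (n - i)) x = (?A' i \<circ> ?f) x"
    proof (rule op_eq_on_span[where F = "?f \<circ> ?A (n - i)" and G = "?A' i \<circ> ?f", OF finite_SigmaR[of n P]])
      show "?f \<circ> ?A (n - i) \<in> carrier op_alg" "?A' i \<circ> ?f \<in> carrier op_alg"
        by (intro op_alg_comp f gen_op_carrier)+
      show "x \<in> carrier (sort_module (-1) n P)"
        using x by (simp add: poset_module_eq)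
      fix \<gamma> assume \<gamma>: "\<gamma> \<in> SigmaR n P"
      then have c\<gamma>: "?c \<gamma> \<in> SigmaR n ?P'"
        by (simp add: S cc)
      have comp: "?c \<gamma> \<circ> simple_transp i = ?c (\<gamma> \<circ> simple_transp (n - i))"
        using flip_simple_transp[OF i] by (metis comp_assoc)
      have "Suc i \<in> {1..n}" "i \<in> {1..n}"
        using i by auto
      then have "\<gamma> (flip n i) \<in> {1..n}" "\<gamma> (flip n (Suc i)) \<in> {1..n}"
        using permutes_in_image[OF SigmaR_permutes[OF \<gamma>]] flip_in by blast+
      moreover have "flip n i = Suc (n - i)" "flip n (Suc i) = n - i"
        using i by (auto simp: flip_def)
      ultimately have des: "i \<in> DesR n (?c \<gamma>) \<longleftrightarrow> n - i \<in> DesR n \<gamma>"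
        using DesR_iff[OF SigmaR_permutes[OF c\<gamma>] i] DesR_iff[OF SigmaR_permutes[OF \<gamma>] ni]
        by (simp add: flip_less_iff)
      have "?f (shift_act (-1) n P \<gamma> (n - i)) = shift_act (-1) n ?P' (?c \<gamma>) i"
        using des comp S[of "?c (\<gamma> \<circ> simple_transp (n - i))"]
        by (simp add: shift_act_def sort_act_def basis[symmetric] cc del: o_apply)
      then show "(?f \<circ> ?A (n - i)) (basis_vec \<gamma>) = (?A' i \<circ> ?f) (basis_vec \<gamma>)"
        using \<gamma> c\<gamma> by (simp add: gen_op_basis basis)
    qed
    then show "?f (act (twist (hecke_phi n) (poset_module n P)) x (pibar n i))
        = act (poset_module n ?P') (?f x) (pibar n i)"
      by (simp add: poset_module_eq hecke_twist_pibar[OF i] M.span_act_pibar[OF ni] N.span_act_pibar[OF i])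
  qed
qed

definition inv_sign :: "nat \<Rightarrow> perm \<Rightarrow> complex" where
  "inv_sign n \<gamma> = (-1) ^ card (inversions n \<gamma>)"

lemma inv_sign_square [simp]: "inv_sign n \<gamma> * inv_sign n \<gamma> = 1"
  by (simp add: inv_sign_def flip: power_add mult_2)

lemma inv_sign_cancel [simp]: "inv_sign n \<gamma> * (inv_sign n \<gamma> * x) = x"
  by (simp flip: mult.assoc)

lemma inv_sign_simple_transp:
  assumes "\<gamma> permutes {1..n}" "i \<in> {1..<n}"
  shows "inv_sign n (\<gamma> \<circ> simple_transp i) = - inv_sign n \<gamma>"
proof -
  have "\<gamma> i \<noteq> \<gamma> (Suc i)"
    using permutes_neq[OF assms(1)] by auto
  then consider "\<gamma> i < \<gamma> (Suc i)" | "\<gamma> (Suc i) < \<gamma> i"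
    by linarith
  then show ?thesis
    using card_inversions_ascent[OF assms(2), of \<gamma>] card_inversions_descent[OF assms(2), of \<gamma>]
    unfolding inv_sign_def by cases simp_all
qed

lemma act_neg_pi_gen:
  assumes "span_data n B a" and i: "i \<in> {1..<n}" and v: "v \<in> carrier (span_module B a)"
  shows "act (span_module B a) v (\<ominus>\<^bsub>hecke n\<^esub> pi_gen n i) = (\<lambda>\<tau>. - gen_op B a i v \<tau> - v \<tau>)"
proof -
  interpret M: span_data n B a
    by fact
  interpret R: right_module "hecke n" "span_module B a"
    by (rule M.span_right_module)
  let ?s = "(-1) \<odot>\<^bsub>hecke n\<^esub> \<one>\<^bsub>hecke n\<^esub>"
  have p: "pi_gen n i \<in> carrier (hecke n)"
    using i by (simp add: pi_gen_def)
  \<comment> \<open>Negation is right multiplication by the scalar \<open>-1\<close>, so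
    \<open>act_mult\<close> reduces the claim to the action of \<open>pi_gen\<close>.\<close>
  have "\<ominus>\<^bsub>hecke n\<^esub> pi_gen n i = pi_gen n i \<otimes>\<^bsub>hecke n\<^esub> ?s"
    using p by (simp add: hecke.smult_minus_one hecke.r_minus)
  then have "act (span_module B a) v (\<ominus>\<^bsub>hecke n\<^esub> pi_gen n i)
      = act (span_module B a) (act (span_module B a) v (pi_gen n i)) ?s"
    using v p by (simp add: R.act_mult)
  also have "act (span_module B a) v (pi_gen n i) = (\<lambda>\<tau>. gen_op B a i v \<tau> + v \<tau>)"
    using v i by (simp add: pi_gen_def R.act_add_right R.act_one M.span_act_pibar)
  finally show ?thesis
    by (simp add: M.span_act_scalar)
qed

text \<open>\<open>hecke_theta\<close> lets \<open>pibar\<close> act as \<open>- pi_gen\<close>. On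
  \<open>\<gamma>\<close> this differs from the action of \<open>pibar\<close> on the bold module
  only in the sign of the term \<open>\<gamma> \<circ> simple_transp i\<close>, and
  \<open>inv_sign\<close> changes under such a transposition.\<close>

lemma theta_poset_module:
  "rmod_iso (hecke n) (twist (hecke_theta n) (poset_module n P)) (bold_poset_module n P)"
proof -
  let ?f = "\<lambda>v \<tau>. inv_sign n \<tau> * v \<tau> :: complex"
  interpret M: span_data n "SigmaR n P" "shift_act (-1) n P"
    by (rule poset_module_span)
  interpret N: span_data n "SigmaR n P" "shift_act 1 n P"
    by (rule bold_poset_module_span)
  have iso: "?f \<in> iso (twist (hecke_theta n) (poset_module n P)) (bold_poset_module n P)"
    unfolding iso_def poset_module_eq bold_poset_module_eq
  proof (intro CollectI conjI)
    have "bij_betw ?f (carrier (sort_module (-1) n P)) (carrier (sort_module 1 n P))"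
      by (rule bij_betw_byWitness[of _ ?f]) (auto simp: M.span_carrier N.span_carrier)
    then show "bij_betw ?f (carrier (twist (hecke_theta n) (sort_module (-1) n P))) (carrier (sort_module 1 n P))"
      by simp
  qed (simp add: hom_def M.span_carrier N.span_carrier distrib_left)
  show ?thesis
  proof (rule hecke_rmod_isoI[where f = ?f, OF _ _ iso])
    show "right_module (hecke n) (twist (hecke_theta n) (poset_module n P))"
      unfolding poset_module_eq by (rule twist_right_module[OF M.span_right_module hecke_ring hecke_theta_hom])
    show "right_module (hecke n) (bold_poset_module n P)"
      unfolding bold_poset_module_eq by (rule N.span_right_module)
    show "?f (act (twist (hecke_theta n) (poset_module n P)) x (k \<odot>\<^bsub>hecke n\<^esub> \<one>\<^bsub>hecke n\<^esub>))
        = act (bold_poset_module n P) (?f x) (k \<odot>\<^bsub>hecke n\<^esub> \<one>\<^bsub>hecke n\<^esub>)" for x k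
      by (simp add: poset_module_eq bold_poset_module_eq hecke_twist_scalar M.span_act_scalar
          N.span_act_scalar mult.left_commute)
    fix x i assume x: "x \<in> carrier (twist (hecke_theta n) (poset_module n P))" and i: "i \<in> {1..<n}"
    then have x': "x \<in> carrier (sort_module (-1) n P)"
      by (simp add: poset_module_eq)
    let ?A = "gen_op (SigmaR n P) (shift_act (-1) n P)" and ?A' = "gen_op (SigmaR n P) (shift_act 1 n P)"
    let ?F = "\<lambda>v \<tau>. inv_sign n \<tau> * (- ?A i v \<tau> - v \<tau>)"
    have "?F x = (?A' i \<circ> ?f) x"
    proof (rule op_eq_on_span[where F = ?F and G = "?A' i \<circ> ?f", OF finite_SigmaR[of n P] _ _ _ x'])
      have "?f \<in> carrier op_alg"
        by (simp add: algebra_simps)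
      then show "?A' i \<circ> ?f \<in> carrier op_alg"
        by (intro op_alg_comp gen_op_carrier)
      show "?F \<in> carrier op_alg"
        using gen_op_carrier[of "SigmaR n P" "shift_act (-1) n P" i] by (simp add: algebra_simps)
      fix \<gamma> assume \<gamma>: "\<gamma> \<in> SigmaR n P"
      have f: "?f (basis_vec \<gamma>) = (\<lambda>\<tau>. inv_sign n \<gamma> * basis_vec \<gamma> \<tau>)" for \<gamma>
        by (auto simp: basis_vec_def)
      have "?A' i (?f (basis_vec \<gamma>)) = (\<lambda>\<tau>. inv_sign n \<gamma> * shift_act 1 n P \<gamma> i \<tau>)"
        using \<gamma> by (simp add: f gen_op_scale gen_op_basis)
      also have "\<dots> = ?F (basis_vec \<gamma>)"
      proof -
        have A: "?A i (basis_vec \<gamma>) = shift_act (-1) n P \<gamma> i"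
          using \<gamma> by (simp add: gen_op_basis)
        have sign: "inv_sign n \<tau> * basis_vec \<alpha> \<tau> = inv_sign n \<alpha> * basis_vec \<alpha> \<tau>" for \<tau> \<alpha>
          by (simp add: basis_vec_def)
        show ?thesis
          unfolding A using inv_sign_simple_transp[OF SigmaR_permutes[OF \<gamma>] i]
          by (auto simp: shift_act_def sort_act_def right_diff_distrib
              sign[of _ \<gamma>] sign[of _ "\<gamma> \<circ> simple_transp i"])
      qed
      finally show "?F (basis_vec \<gamma>) = (?A' i \<circ> ?f) (basis_vec \<gamma>)"
        by simp
    qed
    then show "?f (act (twist (hecke_theta n) (poset_module n P)) x (pibar n i))
        = act (bold_poset_module n P) (?f x) (pibar n i)"
      using act_neg_pi_gen[OF M.span_data_axioms i x']
      by (simp add: poset_module_eq bold_poset_module_eq hecke_twist_pibar[OF i] N.span_act_pibar[OF i])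
  qed
qed

text \<open>Left multiplication by the longest permutation complements descent sets. The diagonal
  entry is \<open>-1\<close> at an ascent of \<open>\<sigma>\<close>, that is at a descent of
  \<open>flip n \<circ> \<sigma>\<close>, and \<open>0\<close> otherwise. An entry \<open>1\<close>
  leads from an ascent \<open>\<sigma>\<close> to \<open>\<sigma> \<circ> simple_transp i\<close>;
  after flipping, the latter has the ascent, which transposes the matrix.\<close>

lemma shift_act_transpose:
  assumes P: "P \<subseteq> {1..n} \<times> {1..n}" and i: "i \<in> {1..<n}"
    and \<sigma>: "\<sigma> \<in> SigmaR n (bar n P)" and \<tau>: "\<tau> \<in> SigmaR n (bar n P)"
  shows "shift_act 1 n (bar n P) \<sigma> i \<tau> = shift_act (-1) n P (flip n \<circ> \<tau>) i (flip n \<circ> \<sigma>)"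
proof -
  have eq: "flip n \<circ> \<alpha> = flip n \<circ> \<beta> \<longleftrightarrow> \<alpha> = \<beta>" for \<alpha> \<beta>
    by (auto simp: fun_eq_iff flip_eq_iff)
  have des: "i \<in> DesR n (flip n \<circ> \<rho>) \<longleftrightarrow> i \<notin> DesR n \<rho>" if \<rho>: "\<rho> \<in> SigmaR n (bar n P)" for \<rho>
  proof -
    have p: "\<rho> permutes {1..n}"
      using \<rho> by (rule SigmaR_permutes)
    have "\<rho> i \<noteq> \<rho> (Suc i)"
      using permutes_neq[OF p] by auto
    moreover have "i \<in> {1..n}" "Suc i \<in> {1..n}"
      using i by auto
    then have "\<rho> i \<in> {1..n}" "\<rho> (Suc i) \<in> {1..n}"
      using permutes_in_image[OF p] by blast+
    ultimately show ?thesis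
      using DesR_iff[OF p i] DesR_iff[OF comp_flip_permutes_iff[THEN iffD2, OF p] i]
      by (auto simp: flip_less_iff simp del: One_nat_def)
  qed
  have swap: "i \<in> DesR n (\<rho> \<circ> simple_transp i) \<longleftrightarrow> i \<notin> DesR n \<rho>" if \<rho>: "\<rho> permutes {1..n}" for \<rho>
    using DesR_iff[OF \<rho> i] DesR_iff[OF comp_simple_transp_permutes[OF \<rho> i] i]
      permutes_neq[OF \<rho>, of i "Suc i"] by (auto simp: simple_transp_apply)
  have mem: "(flip n \<circ> \<rho>) \<circ> simple_transp i \<in> SigmaR n P \<longleftrightarrow> \<rho> \<circ> simple_transp i \<in> SigmaR n (bar n P)" for \<rho>
    using SigmaR_bar[OF P, of "\<rho> \<circ> simple_transp i"] by (simp add: comp_assoc)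
  have bsym: "basis_vec \<alpha> \<beta> = basis_vec \<beta> \<alpha>" for \<alpha> \<beta>
    by (simp add: basis_vec_def eq_commute)
  have b: "basis_vec (flip n \<circ> \<alpha>) (flip n \<circ> \<beta>) = basis_vec \<alpha> \<beta>" for \<alpha> \<beta>
    by (simp only: basis_vec_def eq)
  have b': "basis_vec ((flip n \<circ> \<alpha>) \<circ> simple_transp i) (flip n \<circ> \<beta>) = basis_vec (\<alpha> \<circ> simple_transp i) \<beta>" for \<alpha> \<beta>
    by (simp only: basis_vec_def eq comp_assoc)
  \<comment> \<open>Diagonal entries, entries between neighbours, and the rest, where both matrices
    vanish. In the last case the third inequation follows from the second because
    \<open>simple_transp i\<close> is an involution.\<close>
  consider "\<tau> = \<sigma>" | "\<tau> = \<sigma> \<circ> simple_transp i" "\<tau> \<noteq> \<sigma>"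
    | "\<tau> \<noteq> \<sigma>" "\<tau> \<noteq> \<sigma> \<circ> simple_transp i" "\<sigma> \<noteq> \<tau> \<circ> simple_transp i"
    by (metis comp_simple_transp_twice)
  then show ?thesis
  proof cases
    case 1
    have "\<sigma> \<noteq> \<sigma> \<circ> simple_transp i"
    proof
      assume "\<sigma> = \<sigma> \<circ> simple_transp i"
      then have "\<sigma> i = (\<sigma> \<circ> simple_transp i) i"
        by (rule fun_cong)
      then show False
        using permutes_neq[OF SigmaR_permutes[OF \<sigma>], of i "Suc i"] by (simp add: simple_transp_apply)
    qed
    then have "basis_vec (\<sigma> \<circ> simple_transp i) \<sigma> = 0"
      by (simp add: basis_vec_def)
    then show ?thesis
      using 1 des[OF \<sigma>] b[of \<sigma> \<sigma>] b'[of \<sigma> \<sigma>] by (simp add: shift_act_def sort_act_def)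
  next
    case 2
    have "basis_vec \<sigma> \<tau> = 0" "basis_vec \<tau> \<sigma> = 0" "basis_vec (\<sigma> \<circ> simple_transp i) \<tau> = 1"
      using 2 by (simp_all add: basis_vec_def)
    moreover have s: "\<sigma> = \<tau> \<circ> simple_transp i"
      using 2 by simp
    have "basis_vec (\<tau> \<circ> simple_transp i) \<sigma> = 1"
      unfolding s by (simp add: basis_vec_def)
    moreover have "i \<in> DesR n \<tau> \<longleftrightarrow> i \<notin> DesR n \<sigma>"
      using swap[OF SigmaR_permutes[OF \<sigma>]] unfolding 2(1) .
    moreover have "\<sigma> \<circ> simple_transp i \<in> SigmaR n (bar n P)"
      using \<tau> unfolding 2(1) .
    moreover have "\<tau> \<circ> simple_transp i \<in> SigmaR n (bar n P)"
      unfolding s[symmetric] by (rule \<sigma>)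
    ultimately show ?thesis
      using des[OF \<tau>] mem[of \<tau>] b[of \<tau> \<sigma>] b'[of \<tau> \<sigma>]
      by (simp add: shift_act_def sort_act_def)
  next
    case 3
    then have "basis_vec \<sigma> \<tau> = 0" "basis_vec \<tau> \<sigma> = 0" "basis_vec (\<sigma> \<circ> simple_transp i) \<tau> = 0"
      "basis_vec (\<tau> \<circ> simple_transp i) \<sigma> = 0"
      by (simp_all add: basis_vec_def)
    then show ?thesis
      using b[of \<tau> \<sigma>] b'[of \<tau> \<sigma>] by (simp add: shift_act_def sort_act_def)
  qed
qed

text \<open>As \<open>hecke_chi\<close> fixes \<open>pibar\<close>, on the dual space a generator
  acts by the transposed matrix, which \<open>shift_act_transpose\<close> identifies.
  \<open>?f\<close> reads the coordinates of a functional and relabels them by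
  \<open>flip n\<close>; \<open>?g\<close> rebuilds the functional from them.\<close>

lemma chi_poset_module:
  assumes P: "P \<subseteq> {1..n} \<times> {1..n}"
  shows "rmod_iso (hecke n) (anti_twist (hecke n) (hecke_chi n) (poset_module n P))
    (bold_poset_module n (bar n P))"
proof -
  let ?S = "SigmaR n P" and ?S' = "SigmaR n (bar n P)"
  let ?M = "sort_module (-1) n P" and ?N = "sort_module 1 n (bar n P)"
  let ?D = "anti_twist (hecke n) (hecke_chi n) ?M"
  let ?f = "\<lambda>\<delta> \<tau>. if \<tau> \<in> ?S' then \<delta> (basis_vec (flip n \<circ> \<tau>)) else 0 :: complex"
  let ?g = "\<lambda>v x. if x \<in> carrier ?M then \<Sum>\<gamma>\<in>?S. x \<gamma> * v (flip n \<circ> \<gamma>) else 0 :: complex"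
  interpret M: span_data n ?S "shift_act (-1) n P"
    by (rule poset_module_span)
  interpret N: span_data n ?S' "shift_act 1 n (bar n P)"
    by (rule bold_poset_module_span)
  interpret R: right_module "hecke n" ?M
    by (rule M.span_right_module)
  note S = SigmaR_bar[OF P]
  have S2: "flip n \<circ> \<gamma> \<in> ?S' \<longleftrightarrow> \<gamma> \<in> ?S" for \<gamma>
    by (simp add: S)
  have bc: "basis_vec \<gamma> \<in> carrier ?M" if "\<gamma> \<in> ?S" for \<gamma>
    using that by (simp add: M.span_carrier basis_vec_def)
  have lin: "\<delta> (\<lambda>t. \<Sum>\<gamma>\<in>B. c \<gamma> * basis_vec \<gamma> t) = (\<Sum>\<gamma>\<in>B. c \<gamma> * \<delta> (basis_vec \<gamma>))"
    if d: "\<delta> \<in> carrier ?D" and B: "B \<subseteq> ?S" for \<delta> c B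
  proof -
    have "finite B"
      using B finite_subset finite_SigmaR by blast
    then have "(\<lambda>t. \<Sum>\<gamma>\<in>B. c \<gamma> * basis_vec \<gamma> t) \<in> carrier ?M
        \<and> \<delta> (\<lambda>t. \<Sum>\<gamma>\<in>B. c \<gamma> * basis_vec \<gamma> t) = (\<Sum>\<gamma>\<in>B. c \<gamma> * \<delta> (basis_vec \<gamma>))"
      using B
    proof (induction B rule: finite_induct)
      case empty
      have "(\<lambda>t. 0) \<in> carrier ?M"
        by (simp add: M.span_carrier)
      \<comment> \<open>Homogeneity of \<open>\<delta>\<close> is stated through the action, so
        \<open>\<delta> 0 = 0\<close> is extracted from the scalar \<open>0\<close> acting on the
        zero vector.\<close>
      then have "\<delta> (act ?M (\<lambda>t. 0) (0 \<odot>\<^bsub>hecke n\<^esub> \<one>\<^bsub>hecke n\<^esub>)) = 0 * \<delta> (\<lambda>t. 0)"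
        using d unfolding anti_twist_carrier by blast
      then show ?case
        by (simp add: M.span_act_scalar M.span_carrier del: hecke.smult_zero)
    next
      case (insert \<gamma> B)
      let ?u = "act ?M (basis_vec \<gamma>) (c \<gamma> \<odot>\<^bsub>hecke n\<^esub> \<one>\<^bsub>hecke n\<^esub>)"
        and ?w = "\<lambda>t. \<Sum>\<gamma>\<in>B. c \<gamma> * basis_vec \<gamma> t"
      have b: "basis_vec \<gamma> \<in> carrier ?M"
        using insert.prems by (simp add: bc)
      have u: "?u \<in> carrier ?M"
        using b by (intro R.act_closed) simp_all
      have w: "?w \<in> carrier ?M" "\<delta> ?w = (\<Sum>\<gamma>\<in>B. c \<gamma> * \<delta> (basis_vec \<gamma>))"
        using insert by auto
      have "\<delta> ?u = c \<gamma> * \<delta> (basis_vec \<gamma>)"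
        using d b by (simp add: anti_twist_carrier)
      moreover have "\<delta> (?u \<otimes>\<^bsub>?M\<^esub> ?w) = \<delta> ?u + \<delta> ?w"
        using d u w(1) unfolding anti_twist_carrier by blast
      ultimately show ?case
        using R.M.m_closed[OF u w(1)] insert.hyps w(2) by (simp add: M.span_act_scalar)
    qed
    then show ?thesis ..
  qed
  have expand: "x = (\<lambda>t. \<Sum>\<gamma>\<in>?S. x \<gamma> * basis_vec \<gamma> t)" if "x \<in> carrier ?M" for x
    using proj_eq_sum[OF finite_SigmaR, of n P x] proj_span[OF that] by simp
  have f: "?f \<delta> \<in> carrier ?N" for \<delta>
    by (simp add: N.span_carrier)
  have g: "?g v \<in> carrier ?D" for v
  proof -
    have "(\<lambda>t. c * x t) \<in> carrier ?M" if "x \<in> carrier ?M" for x c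
      using that by (simp add: M.span_carrier)
    then show ?thesis
      using R.M.m_closed
      by (simp add: anti_twist_carrier M.span_act_scalar sum.distrib distrib_right sum_distrib_left
          mult.assoc)
  qed
  have fg: "?f (?g v) = v" if "v \<in> carrier ?N" for v
  proof
    fix \<tau>
    have "(\<Sum>\<gamma>\<in>?S. basis_vec (flip n \<circ> \<tau>) \<gamma> * v (flip n \<circ> \<gamma>)) = v \<tau>" if \<tau>: "\<tau> \<in> ?S'"
    proof -
      have "(\<Sum>\<gamma>\<in>?S. basis_vec (flip n \<circ> \<tau>) \<gamma> * v (flip n \<circ> \<gamma>))
          = (\<Sum>\<gamma>\<in>?S. if \<gamma> = flip n \<circ> \<tau> then v \<tau> else 0)"
        by (rule sum.cong) (auto simp: basis_vec_def simp del: o_apply)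
      also have "\<dots> = v \<tau>"
        using \<tau> S by (simp only: sum.delta finite_SigmaR if_True)
      finally show ?thesis .
    qed
    then show "?f (?g v) \<tau> = v \<tau>"
      using that bc S[of \<tau>] by (auto simp: N.span_carrier)
  qed
  have gf: "?g (?f \<delta>) = \<delta>" if d: "\<delta> \<in> carrier ?D" for \<delta>
  proof
    fix x
    show "?g (?f \<delta>) x = \<delta> x"
    proof (cases "x \<in> carrier ?M")
      case True
      have "?g (?f \<delta>) x = (\<Sum>\<gamma>\<in>?S. x \<gamma> * \<delta> (basis_vec \<gamma>))"
        using True S2 by simp
      also have "\<dots> = \<delta> x"
        using lin[OF d order_refl, of x] expand[OF True] by simp
      finally show ?thesis .
    next
      case False
      have "\<delta> x = 0"
        using d False unfolding anti_twist_carrier by blast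
      then show ?thesis
        using False by simp
    qed
  qed
  have "?f \<in> hom ?D ?N"
    using f by (auto simp: hom_def)
  moreover have "bij_betw ?f (carrier ?D) (carrier ?N)"
    by (rule bij_betw_byWitness[of _ ?g]) (use f g fg gf in blast)+
  ultimately have iso: "?f \<in> iso ?D ?N"
    by (simp add: iso_def)
  have "rmod_iso (hecke n) ?D ?N"
  proof (rule hecke_rmod_isoI[where f = ?f, OF _ _ iso])
    show "right_module (hecke n) ?D"
      by (rule hecke.anti_twist_right_module[OF hecke_chi_hom M.span_right_module])
    show "right_module (hecke n) ?N"
      by (rule N.span_right_module)
    fix \<delta> assume d: "\<delta> \<in> carrier ?D"
    show "?f (act ?D \<delta> (k \<odot>\<^bsub>hecke n\<^esub> \<one>\<^bsub>hecke n\<^esub>)) = act ?N (?f \<delta>) (k \<odot>\<^bsub>hecke n\<^esub> \<one>\<^bsub>hecke n\<^esub>)" for k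
    proof
      fix \<tau>
      have "\<delta> (act ?M (basis_vec (flip n \<circ> \<tau>)) (k \<odot>\<^bsub>hecke n\<^esub> \<one>\<^bsub>hecke n\<^esub>)) = k * \<delta> (basis_vec (flip n \<circ> \<tau>))"
        if "\<tau> \<in> ?S'"
        using d bc that unfolding S anti_twist_carrier by blast
      then show "?f (act ?D \<delta> (k \<odot>\<^bsub>hecke n\<^esub> \<one>\<^bsub>hecke n\<^esub>)) \<tau> = act ?N (?f \<delta>) (k \<odot>\<^bsub>hecke n\<^esub> \<one>\<^bsub>hecke n\<^esub>) \<tau>"
        using bc S[of \<tau>] by (auto simp: hecke_twist_scalar N.span_act_scalar)
    qed
    fix i assume i: "i \<in> {1..<n}"
    show "?f (act ?D \<delta> (pibar n i)) = act ?N (?f \<delta>) (pibar n i)"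
    proof
      fix \<tau>
      show "?f (act ?D \<delta> (pibar n i)) \<tau> = act ?N (?f \<delta>) (pibar n i) \<tau>"
      proof (cases "\<tau> \<in> ?S'")
        case True
        then have t: "flip n \<circ> \<tau> \<in> ?S"
          by (simp add: S)
        let ?x = "shift_act (-1) n P (flip n \<circ> \<tau>) i"
        have x: "act ?M (basis_vec (flip n \<circ> \<tau>)) (pibar n i) = ?x"
          using t by (simp add: M.span_act_pibar[OF i] gen_op_basis)
        have xc: "?x \<in> carrier ?M"
          using R.act_closed[OF bc[OF t], of "pibar n i"] i by (simp add: x)
        have "?f (act ?D \<delta> (pibar n i)) \<tau> = \<delta> ?x"
          using True bc[OF t] by (simp add: hecke_twist_pibar[OF i] x)
        also have "\<dots> = (\<Sum>\<gamma>\<in>?S. ?x \<gamma> * \<delta> (basis_vec \<gamma>))"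
          using lin[OF d order_refl, of ?x] expand[OF xc] by simp
        also have "\<dots> = (\<Sum>\<sigma>\<in>?S'. ?x (flip n \<circ> \<sigma>) * \<delta> (basis_vec (flip n \<circ> \<sigma>)))"
          by (rule sum.reindex_bij_witness[of _ "\<lambda>\<sigma>. flip n \<circ> \<sigma>" "\<lambda>\<gamma>. flip n \<circ> \<gamma>"])
            (simp_all add: S)
        \<comment> \<open>The expansion of the image of one basis vector turns into the action on
          coordinates: the matrix has been transposed.\<close>
        also have "\<dots> = (\<Sum>\<sigma>\<in>?S'. ?f \<delta> \<sigma> * shift_act 1 n (bar n P) \<sigma> i \<tau>)"
          by (rule sum.cong) (simp_all add: shift_act_transpose[OF P i _ True])
        also have "\<dots> = act ?N (?f \<delta>) (pibar n i) \<tau>"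
          by (simp add: N.span_act_pibar[OF i] gen_op_def)
        finally show ?thesis .
      next
        case False
        interpret RN: right_module "hecke n" ?N
          by (rule N.span_right_module)
        have "act ?N (?f \<delta>) (pibar n i) \<in> carrier ?N"
          using f i by (intro RN.act_closed) auto
        then have "act ?N (?f \<delta>) (pibar n i) \<tau> = 0"
          using False unfolding N.span_carrier by blast
        then show ?thesis
          using False by simp
      qed
    qed
  qed
  then show ?thesis
    by (simp add: poset_module_eq bold_poset_module_eq)
qed

section \<open>Stability of the parabolic subalgebras and part (b)\<close>

lemma hecke_phi_parabolic:
  assumes "h \<in> carrier (parabolic m n)"
  shows "hecke_phi (m + n) h \<in> carrier (parabolic n m)"
  using assms
proof (induction rule: parabolic_induct)
  case (pibar i)
  then have "i \<in> {1..<m + n}" "m + n - i \<in> {1..<n + m} - {n}"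
    by auto
  then show ?case
    using parabolic_pibar[of "m + n - i" n m] by (simp add: hecke_twist_pibar add.commute)
next
  case (scalar c)
  show ?case
    using parabolic_scalar[where m = n and n = m and c = c] by (simp add: hecke_twist_scalar add.commute)
next
  case (add x y)
  then show ?case
    using parabolic_add[of _ n m] by (simp add: ring_hom_add[OF hecke_phi_hom] parabolic_subset add.commute[of n m])
next
  case (mult x y)
  then show ?case
    using parabolic_mult[of _ n m] by (simp add: ring_hom_mult[OF hecke_phi_hom] parabolic_subset add.commute[of n m])
qed

lemma hecke_theta_parabolic:
  assumes "h \<in> carrier (parabolic m n)"
  shows "hecke_theta (m + n) h \<in> carrier (parabolic m n)"
  using assms
proof (induction rule: parabolic_induct)
  case (pibar i)
  then show ?case
    by (simp add: hecke_twist_pibar parabolic_neg parabolic_pi_gen)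
qed (simp_all add: hecke_twist_scalar parabolic_scalar ring_hom_add[OF hecke_theta_hom]
    ring_hom_mult[OF hecke_theta_hom] parabolic_subset parabolic_add parabolic_mult)

lemma hecke_chi_parabolic:
  assumes "h \<in> carrier (parabolic m n)"
  shows "hecke_chi (m + n) h \<in> carrier (parabolic m n)"
  using assms
proof (induction rule: parabolic_induct)
  case (pibar i)
  then show ?case
    by (simp add: hecke_twist_pibar parabolic_pibar)
qed (simp_all add: hecke_twist_scalar parabolic_scalar ring_hom_add[OF hecke_chi_hom]
    ring_hom_mult[OF hecke_chi_hom] parabolic_subset parabolic_add parabolic_mult)

text \<open>Since the three maps carry parabolic subalgebras into parabolic subalgebras, twisting
  commutes with restriction. For \<open>hecke_chi\<close> the dual spaces must agree as well, and
  they do because the scalars lie in the subalgebra.\<close>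

lemma restriction_twists:
  assumes P: "P \<subseteq> {1..m + n} \<times> {1..m + n}"
  shows "rmod_iso (parabolic m n)
      (twist (hecke_phi (m + n)) (restriction (parabolic n m) (poset_module (m + n) P)))
      (restriction (parabolic m n) (poset_module (m + n) ((bar (m + n) P)\<inverse>)))"
    and "rmod_iso (parabolic m n)
      (twist (hecke_theta (m + n)) (restriction (parabolic m n) (poset_module (m + n) P)))
      (restriction (parabolic m n) (bold_poset_module (m + n) P))"
    and "rmod_iso (parabolic m n)
      (anti_twist (parabolic m n) (hecke_chi (m + n))
        (restriction (parabolic m n) (poset_module (m + n) P)))
      (restriction (parabolic m n) (bold_poset_module (m + n) (bar (m + n) P)))"
proof -
  show "rmod_iso (parabolic m n)
      (twist (hecke_phi (m + n)) (restriction (parabolic n m) (poset_module (m + n) P)))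
      (restriction (parabolic m n) (poset_module (m + n) ((bar (m + n) P)\<inverse>)))"
    by (rule rmod_iso_cong[OF restriction_rmod_iso[OF phi_poset_module[OF P]]])
      (simp_all add: hecke_phi_parabolic)
  show "rmod_iso (parabolic m n)
      (twist (hecke_theta (m + n)) (restriction (parabolic m n) (poset_module (m + n) P)))
      (restriction (parabolic m n) (bold_poset_module (m + n) P))"
    by (rule rmod_iso_cong[OF restriction_rmod_iso[OF theta_poset_module]])
      (simp_all add: hecke_theta_parabolic)
  show "rmod_iso (parabolic m n)
      (anti_twist (parabolic m n) (hecke_chi (m + n))
        (restriction (parabolic m n) (poset_module (m + n) P)))
      (restriction (parabolic m n) (bold_poset_module (m + n) (bar (m + n) P)))"
    by (rule rmod_iso_cong[OF restriction_rmod_iso[OF chi_poset_module[OF P]]])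
      (auto simp: hecke_chi_parabolic parabolic_scalar anti_twist_carrier)
qed

section \<open>Tensor products\<close>

definition biadditive :: "'r set \<Rightarrow> ('x, 'r) acted \<Rightarrow> ('y, 'r) acted \<Rightarrow> ('k, 'm) monoid_scheme
    \<Rightarrow> ('x \<times> 'y \<Rightarrow> 'k) \<Rightarrow> bool" where
  "biadditive S X Y K f \<longleftrightarrow>
     (\<forall>x\<in>carrier X. \<forall>y\<in>carrier Y. f (x, y) \<in> carrier K) \<and>
     (\<forall>x\<in>carrier X. \<forall>x'\<in>carrier X. \<forall>y\<in>carrier Y. f (x \<otimes>\<^bsub>X\<^esub> x', y) = f (x, y) \<otimes>\<^bsub>K\<^esub> f (x', y)) \<and>
     (\<forall>x\<in>carrier X. \<forall>y\<in>carrier Y. \<forall>y'\<in>carrier Y. f (x, y \<otimes>\<^bsub>Y\<^esub> y') = f (x, y) \<otimes>\<^bsub>K\<^esub> f (x, y')) \<and>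
     (\<forall>x\<in>carrier X. \<forall>y\<in>carrier Y. \<forall>r\<in>S. f (act X x r, y) = f (x, act Y y r))"

lemma biadditiveI:
  assumes "\<And>x y. \<lbrakk>x \<in> carrier X; y \<in> carrier Y\<rbrakk> \<Longrightarrow> f (x, y) \<in> carrier K"
    and "\<And>x x' y. \<lbrakk>x \<in> carrier X; x' \<in> carrier X; y \<in> carrier Y\<rbrakk>
      \<Longrightarrow> f (x \<otimes>\<^bsub>X\<^esub> x', y) = f (x, y) \<otimes>\<^bsub>K\<^esub> f (x', y)"
    and "\<And>x y y'. \<lbrakk>x \<in> carrier X; y \<in> carrier Y; y' \<in> carrier Y\<rbrakk>
      \<Longrightarrow> f (x, y \<otimes>\<^bsub>Y\<^esub> y') = f (x, y) \<otimes>\<^bsub>K\<^esub> f (x, y')"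
    and "\<And>x y r. \<lbrakk>x \<in> carrier X; y \<in> carrier Y; r \<in> S\<rbrakk> \<Longrightarrow> f (act X x r, y) = f (x, act Y y r)"
  shows "biadditive S X Y K f"
  using assms by (simp add: biadditive_def)

locale tensor_data = X: comm_group X + Y: comm_group Y
  for S :: "'r set" and X :: "('x, 'r) acted" and Y :: "('y, 'r) acted" +
  assumes act_X_closed: "\<lbrakk>x \<in> carrier X; r \<in> S\<rbrakk> \<Longrightarrow> act X x r \<in> carrier X"
    and act_Y_closed: "\<lbrakk>y \<in> carrier Y; r \<in> S\<rbrakk> \<Longrightarrow> act Y y r \<in> carrier Y"
begin

abbreviation "free_group \<equiv> free_Abelian_group (carrier X \<times> carrier Y)"
abbreviation "ker \<equiv> tensor_kernel S X Y"
abbreviation "pure \<equiv> pure_tensor S X Y"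
abbreviation "T \<equiv> tensor S X Y"

interpretation F: comm_group free_group
  by (rule abelian_free_Abelian_group)

lemma keys_frag_diff3:
  "\<lbrakk>a \<in> Q; b \<in> Q; c \<in> Q\<rbrakk> \<Longrightarrow> Poly_Mapping.keys (frag_of a - frag_of b - frag_of c) \<subseteq> Q"
  using keys_diff[of "frag_of a - frag_of b" "frag_of c"] keys_diff[of "frag_of a" "frag_of b"]
  by (auto simp: keys_frag_of)

lemma keys_frag_diff2:
  "\<lbrakk>a \<in> Q; b \<in> Q\<rbrakk> \<Longrightarrow> Poly_Mapping.keys (frag_of a - frag_of b) \<subseteq> Q"
  using keys_diff[of "frag_of a" "frag_of b"] by (auto simp: keys_frag_of)

lemma relators_carrier: "tensor_relators S X Y \<subseteq> carrier free_group"
  unfolding tensor_relators_def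
  by (intro Un_least subsetI; elim CollectE exE conjE; simp only: carrier_free_Abelian_group_iff;
      rule keys_frag_diff3 keys_frag_diff2)
    (simp_all add: act_X_closed act_Y_closed)

lemma ker_subgroup: "subgroup ker free_group"
  unfolding tensor_kernel_def by (rule F.generate_is_subgroup[OF relators_carrier])

lemma ker_normal: "ker \<lhd> free_group"
  using ker_subgroup by (simp add: F.normal_iff_subgroup)

lemma tensor_comm_group: "comm_group T"
  unfolding tensor_def by (rule F.abelian_FactGroup[OF ker_subgroup])

interpretation T: comm_group T
  by (rule tensor_comm_group)

abbreviation "coset \<equiv> (\<lambda>a. ker #>\<^bsub>free_group\<^esub> a)"

lemma coset_hom: "coset \<in> hom free_group T"
  unfolding tensor_def by (rule normal.r_coset_hom_Mod[OF ker_normal])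

lemma coset_ker: "a \<in> ker \<Longrightarrow> coset a = \<one>\<^bsub>T\<^esub>"
  using subgroup.rcos_const[OF ker_subgroup F.is_group] by (simp add: tensor_def)

lemma pure_eq_coset: "pure x y = coset (frag_of (x, y))"
  by (simp add: pure_tensor_def)

lemma relator_in_ker: "a \<in> tensor_relators S X Y \<Longrightarrow> a \<in> ker"
  unfolding tensor_kernel_def by (rule generate.incl)

lemma pure_closed [simp]: "\<lbrakk>x \<in> carrier X; y \<in> carrier Y\<rbrakk> \<Longrightarrow> pure x y \<in> carrier T"
  unfolding pure_eq_coset by (rule hom_in_carrier[OF coset_hom]) simp

lemma coset_diff_eq:
  assumes "a - b \<in> ker" "a \<in> carrier free_group" "b \<in> carrier free_group"
  shows "coset a = coset b"
proof -
  have "a - b \<in> carrier free_group"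
    using assms(1) ker_subgroup subgroup.subset by blast
  then have "coset ((a - b) \<otimes>\<^bsub>free_group\<^esub> b) = coset (a - b) \<otimes>\<^bsub>T\<^esub> coset b"
    using assms(3) by (rule hom_mult[OF coset_hom])
  then show ?thesis
    using coset_ker[OF assms(1)] hom_in_carrier[OF coset_hom assms(3)] by simp
qed

lemma coset_plus:
  "\<lbrakk>a \<in> carrier free_group; b \<in> carrier free_group\<rbrakk> \<Longrightarrow> coset (a + b) = coset a \<otimes>\<^bsub>T\<^esub> coset b"
  using hom_mult[OF coset_hom, of a b] by simp

lemma frag_plus_carrier:
  "\<lbrakk>a \<in> carrier free_group; b \<in> carrier free_group\<rbrakk> \<Longrightarrow> a + b \<in> carrier free_group"
  using F.m_closed[of a b] by simp

lemma pure_add_left: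
  assumes "x \<in> carrier X" "x' \<in> carrier X" "y \<in> carrier Y"
  shows "pure (x \<otimes>\<^bsub>X\<^esub> x') y = pure x y \<otimes>\<^bsub>T\<^esub> pure x' y"
proof -
  have "frag_of (x \<otimes>\<^bsub>X\<^esub> x', y) - frag_of (x, y) - frag_of (x', y) \<in> tensor_relators S X Y"
    unfolding tensor_relators_def using assms by blast
  then have "frag_of (x \<otimes>\<^bsub>X\<^esub> x', y) - (frag_of (x, y) + frag_of (x', y)) \<in> ker"
    by (intro relator_in_ker) (simp add: diff_diff_eq)
  then have "coset (frag_of (x \<otimes>\<^bsub>X\<^esub> x', y)) = coset (frag_of (x, y) + frag_of (x', y))"
    by (rule coset_diff_eq) (simp_all add: assms frag_plus_carrier del: carrier_free_Abelian_group_iff)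
  also have "\<dots> = coset (frag_of (x, y)) \<otimes>\<^bsub>T\<^esub> coset (frag_of (x', y))"
    by (rule coset_plus) (simp_all add: assms)
  finally show ?thesis
    by (simp only: pure_eq_coset)
qed

lemma pure_add_right:
  assumes "x \<in> carrier X" "y \<in> carrier Y" "y' \<in> carrier Y"
  shows "pure x (y \<otimes>\<^bsub>Y\<^esub> y') = pure x y \<otimes>\<^bsub>T\<^esub> pure x y'"
proof -
  have "frag_of (x, y \<otimes>\<^bsub>Y\<^esub> y') - frag_of (x, y) - frag_of (x, y') \<in> tensor_relators S X Y"
    unfolding tensor_relators_def using assms by blast
  then have "frag_of (x, y \<otimes>\<^bsub>Y\<^esub> y') - (frag_of (x, y) + frag_of (x, y')) \<in> ker"
    by (intro relator_in_ker) (simp add: diff_diff_eq)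
  then have "coset (frag_of (x, y \<otimes>\<^bsub>Y\<^esub> y')) = coset (frag_of (x, y) + frag_of (x, y'))"
    by (rule coset_diff_eq) (simp_all add: assms frag_plus_carrier del: carrier_free_Abelian_group_iff)
  also have "\<dots> = coset (frag_of (x, y)) \<otimes>\<^bsub>T\<^esub> coset (frag_of (x, y'))"
    by (rule coset_plus) (simp_all add: assms)
  finally show ?thesis
    by (simp only: pure_eq_coset)
qed

lemma pure_balanced:
  assumes "x \<in> carrier X" "y \<in> carrier Y" "r \<in> S"
  shows "pure (act X x r) y = pure x (act Y y r)"
proof -
  have "frag_of (act X x r, y) - frag_of (x, act Y y r) \<in> tensor_relators S X Y"
    unfolding tensor_relators_def using assms by blast
  then show ?thesis
    unfolding pure_eq_coset
    by (intro coset_diff_eq relator_in_ker) (simp_all add: assms act_X_closed act_Y_closed)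
qed

text \<open>The free abelian group is generated by pairs under subtraction, which explains the
  difference step; the unit is the difference of a pure tensor with itself.\<close>

lemma tensor_induct [consumes 1, case_names pure diff]:
  assumes "Z \<in> carrier T"
    and pure: "\<And>x y. \<lbrakk>x \<in> carrier X; y \<in> carrier Y\<rbrakk> \<Longrightarrow> Q (pure x y)"
    and diff: "\<And>A B. \<lbrakk>A \<in> carrier T; B \<in> carrier T; Q A; Q B\<rbrakk> \<Longrightarrow> Q (A \<otimes>\<^bsub>T\<^esub> inv\<^bsub>T\<^esub> B)"
  shows "Q Z"
proof -
  interpret h: group_hom free_group T coset
    by (intro group_hom.intro group_hom_axioms.intro F.is_group T.is_group coset_hom)
  obtain F where F: "Z = coset F" "Poly_Mapping.keys F \<subseteq> carrier X \<times> carrier Y"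
    using assms(1) by (auto simp: tensor_def carrier_FactGroup)
  have one: "Q \<one>\<^bsub>T\<^esub>"
    using diff[of "pure \<one>\<^bsub>X\<^esub> \<one>\<^bsub>Y\<^esub>" "pure \<one>\<^bsub>X\<^esub> \<one>\<^bsub>Y\<^esub>"] pure by (simp add: T.r_inv)
  show ?thesis
    unfolding F(1)
  proof (rule free_Abelian_group_induct[OF F(2), where P = "\<lambda>F. Q (coset F)"])
    show "Q (coset 0)"
      using one h.hom_one by simp
  next
    fix x y :: "'x \<times> 'y \<Rightarrow>\<^sub>0 int"
    assume xy: "Poly_Mapping.keys x \<subseteq> carrier X \<times> carrier Y" "Poly_Mapping.keys y \<subseteq> carrier X \<times> carrier Y"
      "Q (coset x)" "Q (coset y)"
    then have c: "x \<in> carrier free_group" "y \<in> carrier free_group"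
      by auto
    have "coset (x - y) = coset (x \<otimes>\<^bsub>free_group\<^esub> inv\<^bsub>free_group\<^esub> y)"
      using xy by simp
    also have "\<dots> = coset x \<otimes>\<^bsub>T\<^esub> inv\<^bsub>T\<^esub> coset y"
      using c by (simp only: h.hom_mult h.hom_inv F.inv_closed)
    finally show "Q (coset (x - y))"
      using diff[OF h.hom_closed[OF c(1)] h.hom_closed[OF c(2)]] xy by simp
  next
    fix p :: "'x \<times> 'y"
    assume "p \<in> carrier X \<times> carrier Y"
    then show "Q (coset (frag_of p))"
      using pure by (cases p) (simp add: pure_eq_coset)
  qed
qed

lemma tensor_hom_eqI:
  assumes "group K" "g \<in> hom T K" "h \<in> hom T K"
    and "\<And>x y. \<lbrakk>x \<in> carrier X; y \<in> carrier Y\<rbrakk> \<Longrightarrow> g (pure x y) = h (pure x y)"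
    and "Z \<in> carrier T"
  shows "g Z = h Z"
proof -
  interpret g: group_hom T K g
    using assms(1,2) by (intro group_hom.intro group_hom_axioms.intro T.is_group)
  interpret h: group_hom T K h
    using assms(1,3) by (intro group_hom.intro group_hom_axioms.intro T.is_group)
  show ?thesis
    using assms(5)
    by (induction rule: tensor_induct) (simp_all add: assms(4))
qed

section \<open>The universal property of the tensor product\<close>

context
  fixes K :: "('k, 'm) monoid_scheme" and f :: "'x \<times> 'y \<Rightarrow> 'k"
  assumes K: "comm_group K" and f: "biadditive S X Y K f"
begin

interpretation K: comm_group K
  by (rule K)

definition free_lift :: "('x \<times> 'y \<Rightarrow>\<^sub>0 int) \<Rightarrow> 'k" where
  "free_lift F = finprod K (\<lambda>p. f p [^]\<^bsub>K\<^esub> Poly_Mapping.lookup F p) (Poly_Mapping.keys F)"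

lemma f_closed: "p \<in> carrier X \<times> carrier Y \<Longrightarrow> f p \<in> carrier K"
  using f by (auto simp: biadditive_def)

text \<open>Keys may cancel in a sum, so a product over the keys is not visibly additive. Over the
  fixed index set of all pairs, with trivial factors off the keys, it is.\<close>

lemma free_lift_eq_gfinprod:
  assumes "Poly_Mapping.keys F \<subseteq> carrier X \<times> carrier Y"
  shows "free_lift F = gfinprod K (\<lambda>p. f p [^]\<^bsub>K\<^esub> Poly_Mapping.lookup F p) (carrier X \<times> carrier Y)"
proof -
  have c: "(\<lambda>p. f p [^]\<^bsub>K\<^esub> Poly_Mapping.lookup F p) \<in> carrier X \<times> carrier Y \<rightarrow> carrier K"
    using f_closed by (intro Pi_I K.int_pow_closed)
  then have "(\<lambda>p. f p [^]\<^bsub>K\<^esub> Poly_Mapping.lookup F p) \<in> Poly_Mapping.keys F \<rightarrow> carrier K"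
    using assms by blast
  then have "free_lift F = gfinprod K (\<lambda>p. f p [^]\<^bsub>K\<^esub> Poly_Mapping.lookup F p) (Poly_Mapping.keys F)"
    by (simp add: free_lift_def)
  also have "\<dots> = gfinprod K (\<lambda>p. f p [^]\<^bsub>K\<^esub> Poly_Mapping.lookup F p) (carrier X \<times> carrier Y)"
    using assms c by (intro K.gfinprod_mono_neutral_cong_left) (auto simp: in_keys_iff)
  finally show ?thesis .
qed

lemma free_lift_hom: "free_lift \<in> hom free_group K"
proof (rule homI)
  have c: "(\<lambda>p. f p [^]\<^bsub>K\<^esub> Poly_Mapping.lookup F p) \<in> carrier X \<times> carrier Y \<rightarrow> carrier K"
    for F :: "'x \<times> 'y \<Rightarrow>\<^sub>0 int"
    using f_closed by (intro Pi_I K.int_pow_closed)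
  have fin: "finite {p \<in> carrier X \<times> carrier Y. f p [^]\<^bsub>K\<^esub> Poly_Mapping.lookup F p \<noteq> \<one>\<^bsub>K\<^esub>}"
    for F :: "'x \<times> 'y \<Rightarrow>\<^sub>0 int"
    by (rule finite_subset[OF _ finite_keys[of F]]) (auto simp: in_keys_iff)
  fix F assume F: "F \<in> carrier free_group"
  then show "free_lift F \<in> carrier K"
    using c by (simp add: free_lift_eq_gfinprod K.gfinprod_closed)
  fix G assume G: "G \<in> carrier free_group"
  have "gfinprod K (\<lambda>p. f p [^]\<^bsub>K\<^esub> Poly_Mapping.lookup (F + G) p) (carrier X \<times> carrier Y)
      = gfinprod K (\<lambda>p. f p [^]\<^bsub>K\<^esub> Poly_Mapping.lookup F p \<otimes>\<^bsub>K\<^esub> f p [^]\<^bsub>K\<^esub> Poly_Mapping.lookup G p)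
          (carrier X \<times> carrier Y)"
    using f_closed by (intro K.gfinprod_cong)
      (auto simp: Poly_Mapping.lookup_add K.int_pow_mult)
  also have "\<dots> = gfinprod K (\<lambda>p. f p [^]\<^bsub>K\<^esub> Poly_Mapping.lookup F p) (carrier X \<times> carrier Y)
      \<otimes>\<^bsub>K\<^esub> gfinprod K (\<lambda>p. f p [^]\<^bsub>K\<^esub> Poly_Mapping.lookup G p) (carrier X \<times> carrier Y)"
    by (rule K.gfinprod_distrib[OF fin fin c c])
  finally show "free_lift (F \<otimes>\<^bsub>free_group\<^esub> G) = free_lift F \<otimes>\<^bsub>K\<^esub> free_lift G"
    using F G frag_plus_carrier[of F G] by (simp add: free_lift_eq_gfinprod)
qed

lemma free_lift_frag_of: "p \<in> carrier X \<times> carrier Y \<Longrightarrow> free_lift (frag_of p) = f p"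
  using f_closed[of p] by (simp add: free_lift_def K.finprod_singleton)

interpretation L: group_hom free_group K free_lift
  by (intro group_hom.intro group_hom_axioms.intro F.is_group K.is_group free_lift_hom)

lemma free_lift_minus:
  assumes "a \<in> carrier free_group" "b \<in> carrier free_group"
  shows "free_lift (a - b) = free_lift a \<otimes>\<^bsub>K\<^esub> inv\<^bsub>K\<^esub> free_lift b"
proof -
  have "a - b = a \<otimes>\<^bsub>free_group\<^esub> inv\<^bsub>free_group\<^esub> b"
    using assms by simp
  then show ?thesis
    using assms by (simp only: L.hom_mult L.hom_inv F.inv_closed)
qed

text \<open>Each of the three kinds of relators is killed by one clause of
  \<open>biadditive\<close>; since the kernel is a subgroup, this settles the generated
  subgroup.\<close>

lemma ker_le_kernel: "ker \<subseteq> kernel free_group K free_lift"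
  unfolding tensor_kernel_def
proof (rule F.generate_subgroup_incl[OF _ L.subgroup_kernel])
  note b = f[unfolded biadditive_def]
  have three: "free_lift (frag_of p - frag_of q - frag_of r) = \<one>\<^bsub>K\<^esub>"
    if "p \<in> carrier X \<times> carrier Y" "q \<in> carrier X \<times> carrier Y" "r \<in> carrier X \<times> carrier Y"
      and e: "f p = f q \<otimes>\<^bsub>K\<^esub> f r" for p q r
  proof -
    have c: "f q \<in> carrier K" "f r \<in> carrier K"
      using that f_closed by blast+
    have "frag_of p - frag_of q \<in> carrier free_group"
      using that keys_frag_diff2 by (simp only: carrier_free_Abelian_group_iff)
    then have "free_lift (frag_of p - frag_of q - frag_of r) = f p \<otimes>\<^bsub>K\<^esub> inv\<^bsub>K\<^esub> f q \<otimes>\<^bsub>K\<^esub> inv\<^bsub>K\<^esub> f r"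
      using that by (simp only: free_lift_minus frag_of_in_free_Abelian_group free_lift_frag_of)
    also have "\<dots> = \<one>\<^bsub>K\<^esub>"
      using c unfolding e by (simp add: K.m_comm[of "f q"] K.m_assoc)
    finally show ?thesis .
  qed
  have two: "free_lift (frag_of p - frag_of q) = \<one>\<^bsub>K\<^esub>"
    if "p \<in> carrier X \<times> carrier Y" "q \<in> carrier X \<times> carrier Y" and e: "f p = f q" for p q
    using that f_closed[of q] by (simp add: free_lift_minus free_lift_frag_of K.r_inv)
  have "free_lift a = \<one>\<^bsub>K\<^esub>" if "a \<in> tensor_relators S X Y" for a
    using that unfolding tensor_relators_def
  proof (elim UnE CollectE exE conjE)
    fix x x' y
    assume "a = frag_of (x \<otimes>\<^bsub>X\<^esub> x', y) - frag_of (x, y) - frag_of (x', y)"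
      "x \<in> carrier X" "x' \<in> carrier X" "y \<in> carrier Y"
    then show ?thesis
      using b by (simp only:, intro three) simp_all
  next
    fix x y y'
    assume "a = frag_of (x, y \<otimes>\<^bsub>Y\<^esub> y') - frag_of (x, y) - frag_of (x, y')"
      "x \<in> carrier X" "y \<in> carrier Y" "y' \<in> carrier Y"
    then show ?thesis
      using b by (simp only:, intro three) simp_all
  next
    fix x y r
    assume "a = frag_of (act X x r, y) - frag_of (x, act Y y r)"
      "x \<in> carrier X" "y \<in> carrier Y" "r \<in> S"
    then show ?thesis
      using b by (simp only:, intro two) (simp_all add: act_X_closed act_Y_closed)
  qed
  then show "tensor_relators S X Y \<subseteq> kernel free_group K free_lift"
    using relators_carrier unfolding kernel_def by blast
qed

text \<open>Elements of a coset differ by elements of the kernel, so their common value is what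
  \<open>the_elem\<close> returns.\<close>

lemma tensor_lift_coset:
  assumes "F \<in> carrier free_group"
  shows "tensor_lift K f (coset F) = free_lift F"
proof -
  have "free_lift G = free_lift F" if G: "G \<in> coset F" for G
  proof -
    obtain k where k: "k \<in> ker" "G = k \<otimes>\<^bsub>free_group\<^esub> F"
      using G unfolding r_coset_def by blast
    have kk: "k \<in> carrier free_group" "free_lift k = \<one>\<^bsub>K\<^esub>"
      using ker_le_kernel k(1) unfolding kernel_def by blast+
    show ?thesis
      unfolding k(2) using kk assms L.hom_closed[OF assms] by (simp only: L.hom_mult K.l_one)
  qed
  moreover have "coset F \<noteq> {}"
    using F.rcos_self[OF assms ker_subgroup] by blast
  ultimately have "free_lift ` coset F = {free_lift F}"
    by (metis image_cong image_constant_conv)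
  then show ?thesis
    by (simp add: tensor_lift_def free_lift_def[abs_def])
qed

lemma tensor_lift_hom: "tensor_lift K f \<in> hom T K"
proof (rule homI)
  fix A assume "A \<in> carrier T"
  then obtain F where F: "A = coset F" "F \<in> carrier free_group"
    unfolding tensor_def carrier_FactGroup by blast
  then show "tensor_lift K f A \<in> carrier K"
    using L.hom_closed[OF F(2)] by (simp only: tensor_lift_coset)
  fix B assume "B \<in> carrier T"
  then obtain G where G: "B = coset G" "G \<in> carrier free_group"
    unfolding tensor_def carrier_FactGroup by blast
  show "tensor_lift K f (A \<otimes>\<^bsub>T\<^esub> B) = tensor_lift K f A \<otimes>\<^bsub>K\<^esub> tensor_lift K f B"
    using F G by (simp only: hom_mult[OF coset_hom, symmetric] tensor_lift_coset L.hom_mult F.m_closed)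
qed

lemma tensor_lift_pure:
  "\<lbrakk>x \<in> carrier X; y \<in> carrier Y\<rbrakk> \<Longrightarrow> tensor_lift K f (pure x y) = f (x, y)"
  by (simp only: pure_eq_coset tensor_lift_coset frag_of_in_free_Abelian_group mem_Sigma_iff
      free_lift_frag_of simp_thms)

end

end

section \<open>Shuffle elements\<close>

text \<open>The relations common to \<open>pibar\<close> (with \<open>e = -1\<close>) and
  \<open>pi_gen\<close> (with \<open>e = 1\<close>), for the indices \<open>1 \<le> i < d\<close>.
  The computations with coset representatives are carried out from these relations.\<close>

locale shuffle_algebra = complex_algebra A for A :: "(complex, 'a, 'm) module_scheme" (structure) +
  fixes g :: "nat \<Rightarrow> 'a" and d :: nat and e :: complex
  assumes g_closed: "\<lbrakk>1 \<le> i; i < d\<rbrakk> \<Longrightarrow> g i \<in> carrier A"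
    and quadratic: "\<lbrakk>1 \<le> i; i < d\<rbrakk> \<Longrightarrow> g i \<otimes> g i = e \<odot> g i"
    and braid: "\<lbrakk>1 \<le> i; Suc i < d\<rbrakk> \<Longrightarrow> g i \<otimes> (g (Suc i) \<otimes> g i) = g (Suc i) \<otimes> (g i \<otimes> g (Suc i))"
    and comm_less: "\<lbrakk>1 \<le> i; i + 2 \<le> j; j < d\<rbrakk> \<Longrightarrow> g i \<otimes> g j = g j \<otimes> g i"
begin

lemma comm: "\<lbrakk>1 \<le> i; 1 \<le> j; i < d; j < d; i + 2 \<le> j \<or> j + 2 \<le> i\<rbrakk> \<Longrightarrow> g i \<otimes> g j = g j \<otimes> g i"
  using comm_less[of i j] comm_less[of j i] by auto

text \<open>Acting from the right, \<open>cycle m k\<close> moves the entry in position \<open>m\<close> to position \<open>k\<close>.\<close>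

primrec cycle :: "nat \<Rightarrow> nat \<Rightarrow> 'a" where
  "cycle m 0 = \<one>"
| "cycle m (Suc k) = (if m \<le> k then cycle m k \<otimes> g k else \<one>)"

lemma cycle_closed: "\<lbrakk>1 \<le> m; k \<le> d\<rbrakk> \<Longrightarrow> cycle m k \<in> carrier A"
  by (induction k) (auto intro!: m_closed g_closed)

lemma cycle_trivial: "k \<le> m \<Longrightarrow> cycle m k = \<one>"
  by (cases k) auto

text \<open>Every letter of the cycle has an index from \<open>m\<close> to \<open>k - 1\<close>,
  hence at distance at least two from \<open>j\<close>.\<close>

lemma cycle_comm:
  assumes "1 \<le> m" "k \<le> d" "1 \<le> j" "j < d" "j + 2 \<le> m \<or> k < j"
  shows "g j \<otimes> cycle m k = cycle m k \<otimes> g j"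
  using assms
proof (induction k)
  case 0
  then show ?case
    by (simp add: g_closed)
next
  case (Suc k)
  show ?case
  proof (cases "m \<le> k")
    case True
    have c: "g j \<in> carrier A" "g k \<in> carrier A" "cycle m k \<in> carrier A"
      using Suc.prems True by (auto intro: g_closed cycle_closed)
    have "g j \<otimes> (cycle m k \<otimes> g k) = (g j \<otimes> cycle m k) \<otimes> g k"
      using c by (simp add: m_assoc)
    also have "g j \<otimes> cycle m k = cycle m k \<otimes> g j"
      using Suc by auto
    also have "cycle m k \<otimes> g j \<otimes> g k = cycle m k \<otimes> (g j \<otimes> g k)"
      using c by (simp add: m_assoc)
    also have "g j \<otimes> g k = g k \<otimes> g j"
      using Suc.prems True by (intro comm) auto
    finally show ?thesis
      using c True by (simp add: m_assoc)
  qed (use Suc.prems in \<open>simp add: g_closed\<close>)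
qed

text \<open>The factor \<open>g j\<close> passes the letters above \<open>Suc j\<close>, makes one
  braid move with \<open>g j\<close> and \<open>g (Suc j)\<close>, and emerges as
  \<open>g (Suc j)\<close>, which passes the letters below \<open>j\<close>.\<close>

lemma cycle_shift:
  assumes "1 \<le> m" "k \<le> d" "m \<le> j" "Suc j < k"
  shows "cycle m k \<otimes> g j = g (Suc j) \<otimes> cycle m k"
  using assms
proof (induction k)
  case (Suc k)
  have c: "g j \<in> carrier A" "g (Suc j) \<in> carrier A" "g k \<in> carrier A" "cycle m k \<in> carrier A"
    "cycle m j \<in> carrier A"
    using Suc.prems by (auto intro: g_closed cycle_closed)
  show ?case
  proof (cases "k = Suc j")
    case True
    have "cycle m (Suc k) \<otimes> g j = cycle m j \<otimes> (g j \<otimes> (g (Suc j) \<otimes> g j))"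
      using Suc.prems c by (simp add: True m_assoc)
    also have "g j \<otimes> (g (Suc j) \<otimes> g j) = g (Suc j) \<otimes> (g j \<otimes> g (Suc j))"
      using Suc.prems by (intro braid) auto
    also have "cycle m j \<otimes> (g (Suc j) \<otimes> (g j \<otimes> g (Suc j)))
        = (cycle m j \<otimes> g (Suc j)) \<otimes> (g j \<otimes> g (Suc j))"
      using c by (simp add: m_assoc)
    also have "cycle m j \<otimes> g (Suc j) = g (Suc j) \<otimes> cycle m j"
      using Suc.prems by (intro cycle_comm[symmetric]) auto
    finally show ?thesis
      using c Suc.prems by (simp add: True m_assoc)
  next
    case False
    have "cycle m (Suc k) \<otimes> g j = cycle m k \<otimes> (g k \<otimes> g j)"
      using Suc.prems c by (simp add: m_assoc)
    also have "g k \<otimes> g j = g j \<otimes> g k"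
      using Suc.prems False by (intro comm) auto
    also have "cycle m k \<otimes> (g j \<otimes> g k) = (cycle m k \<otimes> g j) \<otimes> g k"
      using c by (simp add: m_assoc)
    also have "cycle m k \<otimes> g j = g (Suc j) \<otimes> cycle m k"
      using Suc False by auto
    finally show ?thesis
      using c Suc.prems by (simp add: m_assoc)
  qed
qed simp

lemma cycle_rec_left:
  assumes "1 \<le> m" "k \<le> d" "m < k"
  shows "cycle m k = g m \<otimes> cycle (Suc m) k"
  using assms
proof (induction k)
  case (Suc k)
  show ?case
  proof (cases "m = k")
    case True
    then show ?thesis
      using Suc.prems by (simp add: cycle_trivial g_closed)
  next
    case False
    have "g m \<in> carrier A" "g k \<in> carrier A" "cycle (Suc m) k \<in> carrier A"
      using Suc.prems by (auto intro: g_closed cycle_closed)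
    then show ?thesis
      using Suc False by (simp add: m_assoc)
  qed
qed simp

text \<open>Repeated \<open>cycle_shift\<close>: a cycle passing a longer one from right to left has
  all its indices raised by one. This exchanges the last two cycles of a shuffle when
  \<open>N\<close> and \<open>Suc N\<close> both lie in the set.\<close>

lemma cycle_cycle:
  assumes "1 \<le> p" "k \<le> d" "q < k"
  shows "cycle p k \<otimes> cycle p q = cycle (Suc p) (Suc q) \<otimes> cycle p k"
  using assms
proof (induction q)
  case 0
  then show ?case
    by (simp add: cycle_closed)
next
  case (Suc q)
  show ?case
  proof (cases "p \<le> q")
    case True
    have c: "cycle p k \<in> carrier A" "cycle p q \<in> carrier A" "cycle (Suc p) (Suc q) \<in> carrier A"
      "g q \<in> carrier A" "g (Suc q) \<in> carrier A"
      using Suc.prems True by (auto intro: g_closed cycle_closed simp del: cycle.simps)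
    have "cycle p k \<otimes> cycle p (Suc q) = (cycle p k \<otimes> cycle p q) \<otimes> g q"
      using c True by (simp add: m_assoc)
    also have "\<dots> = cycle (Suc p) (Suc q) \<otimes> (cycle p k \<otimes> g q)"
      using Suc c by (simp add: m_assoc del: cycle.simps)
    also have "cycle p k \<otimes> g q = g (Suc q) \<otimes> cycle p k"
      using Suc.prems True by (intro cycle_shift) auto
    also have "cycle (Suc p) (Suc q) \<otimes> (g (Suc q) \<otimes> cycle p k) = cycle (Suc p) (Suc (Suc q)) \<otimes> cycle p k"
      using c True by (simp add: m_assoc[symmetric] cycle.simps(2)[of _ "Suc q"] del: cycle.simps)
    finally show ?thesis .
  qed (use Suc.prems in \<open>simp add: cycle_closed\<close>)
qed

text \<open>\<open>shuffle N S\<close> is the product along a reduced word of the permutation \<open>shuffle_rank N S\<close>, which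
  numbers first the positions in \<open>S\<close> and then the remaining ones.\<close>

primrec shuffle :: "nat \<Rightarrow> nat set \<Rightarrow> 'a" where
  "shuffle 0 S = \<one>"
| "shuffle (Suc N) S =
     (if Suc N \<in> S then cycle (card (S \<inter> {1..Suc N})) (Suc N) \<otimes> shuffle N S else shuffle N S)"

end

definition shuffle_rank :: "nat \<Rightarrow> nat set \<Rightarrow> nat \<Rightarrow> nat" where
  "shuffle_rank N S i =
     (if i \<notin> {1..N} then i
      else if i \<in> S then card (S \<inter> {1..i}) else card (S \<inter> {1..N}) + card ({1..i} - S))"

lemma inter_atLeastAtMost_Suc:
  "S \<inter> {1..Suc N} = (if Suc N \<in> S then insert (Suc N) (S \<inter> {1..N}) else S \<inter> {1..N})"
  "{1..Suc N} - S = (if Suc N \<in> S then {1..N} - S else insert (Suc N) ({1..N} - S))"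
  by (auto simp: atLeastAtMostSuc_conv)

lemma card_inter_Suc:
  "card (S \<inter> {1..Suc N}) = (if Suc N \<in> S then Suc (card (S \<inter> {1..N})) else card (S \<inter> {1..N}))"
  "card ({1..Suc N} - S) = (if Suc N \<in> S then card ({1..N} - S) else Suc (card ({1..N} - S)))"
  unfolding inter_atLeastAtMost_Suc by (auto simp: card_insert_if)

lemma card_inter_diff: "card (S \<inter> {1..N}) + card ({1..N} - S) = N"
  using card_Int_Diff[of "{1..N}" S] by (simp add: Int_commute)

lemma card_inter_mono: "(i :: nat) \<le> N \<Longrightarrow> card (S \<inter> {1..i}) \<le> card (S \<inter> {1..N})"
  by (intro card_mono) auto

lemma card_diff_mono: "(i :: nat) \<le> N \<Longrightarrow> card ({1..i} - S) \<le> card ({1..N} - S)"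
  by (intro card_mono) auto

lemma shuffle_rank_Suc:
  assumes "i \<in> {1..<N}" "i \<in> S \<longleftrightarrow> Suc i \<in> S"
  shows "shuffle_rank N S (Suc i) = Suc (shuffle_rank N S i)"
  using assms card_inter_Suc(1)[of S i] card_inter_Suc(2)[of i S] by (auto simp: shuffle_rank_def)

definition swap_set :: "nat \<Rightarrow> nat set \<Rightarrow> nat set" where
  "swap_set i S = simple_transp i -` S"

lemma swap_set_iff: "k \<in> swap_set i S \<longleftrightarrow> simple_transp i k \<in> S"
  by (simp add: swap_set_def)

lemma swap_set_twice [simp]: "swap_set i (swap_set i S) = S"
  by (auto simp: swap_set_iff)

lemma card_swap_set:
  assumes "1 \<le> i" "i \<noteq> N"
  shows "card (swap_set i S \<inter> {1..N}) = card (S \<inter> {1..N})"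
proof (rule bij_betw_same_card)
  show "bij_betw (simple_transp i) (swap_set i S \<inter> {1..N}) (S \<inter> {1..N})"
    by (rule bij_betw_byWitness[of _ "simple_transp i"])
      (use assms in \<open>auto simp: swap_set_iff simple_transp_apply split: if_splits\<close>)
qed

context shuffle_algebra
begin

lemma shuffle_closed: "N \<le> d \<Longrightarrow> shuffle N S \<in> carrier A"
proof (induction N)
  case (Suc N)
  have "1 \<le> card (S \<inter> {1..Suc N})" if "Suc N \<in> S"
    using card_inter_Suc(1)[of S N] that by simp
  then show ?case
    using Suc cycle_closed[of "card (S \<inter> {1..Suc N})" "Suc N"]
    by (auto simp del: cycle.simps)
qed simp

lemma shuffle_cong: "S \<inter> {1..N} = S' \<inter> {1..N} \<Longrightarrow> shuffle N S = shuffle N S'"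
proof (induction N)
  case (Suc N)
  have "k \<in> S \<longleftrightarrow> k \<in> S'" if "k \<in> {1..Suc N}" for k
    using Suc.prems that by blast
  then have "S \<inter> {1..N} = S' \<inter> {1..N}" "Suc N \<in> S \<longleftrightarrow> Suc N \<in> S'"
    by auto
  then show ?case
    using Suc by simp
qed simp

text \<open>The letters of \<open>shuffle N S\<close> have indices below \<open>N\<close>, hence at
  distance at least two from \<open>i\<close>.\<close>

lemma shuffle_comm:
  assumes "N < i" "i < d"
  shows "g i \<otimes> shuffle N S = shuffle N S \<otimes> g i"
  using assms
proof (induction N)
  case 0
  then show ?case
    by (simp add: g_closed)
next
  case (Suc N)
  let ?m = "card (S \<inter> {1..Suc N})"
  show ?case
  proof (cases "Suc N \<in> S")
    case True
    have m: "1 \<le> ?m"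
      using card_inter_Suc(1)[of S N] True by simp
    have c: "g i \<in> carrier A" "cycle ?m (Suc N) \<in> carrier A" "shuffle N S \<in> carrier A"
      using Suc.prems m by (auto intro: g_closed cycle_closed shuffle_closed simp del: cycle.simps)
    have "g i \<otimes> cycle ?m (Suc N) = cycle ?m (Suc N) \<otimes> g i"
      using Suc.prems m by (intro cycle_comm) auto
    moreover have "g i \<otimes> (cycle ?m (Suc N) \<otimes> shuffle N S) = (g i \<otimes> cycle ?m (Suc N)) \<otimes> shuffle N S"
      using c by (simp add: m_assoc del: cycle.simps)
    ultimately show ?thesis
      using Suc c True by (simp add: m_assoc del: cycle.simps)
  qed (use Suc in simp)
qed

text \<open>Induction on \<open>N\<close>. A generator below the last pair of positions moves
  through the inner shuffle first and then through the outermost cycle; two cycles meet only at the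
  last pair.\<close>

lemma shuffle_same:
  assumes "N \<le> d" "i \<in> {1..<N}" "i \<in> S \<longleftrightarrow> Suc i \<in> S"
  shows "shuffle N S \<otimes> g i = g (shuffle_rank N S i) \<otimes> shuffle N S"
  using assms
proof (induction N)
  case (Suc N)
  let ?m = "card (S \<inter> {1..Suc N})"
  have gi: "g i \<in> carrier A"
    using Suc.prems by (intro g_closed) auto
  have sN: "shuffle N S \<in> carrier A"
    using Suc.prems by (intro shuffle_closed) simp
  show ?case
  proof (cases "i < N")
    case True
    then have IH: "shuffle N S \<otimes> g i = g (shuffle_rank N S i) \<otimes> shuffle N S"
      using Suc by simp
    show ?thesis
    proof (cases "Suc N \<in> S")
      case SN: True
      define j where "j = shuffle_rank N S i"
      have m: "?m = Suc (card (S \<inter> {1..N}))"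
        using SN card_inter_Suc(1)[of S N] by simp
      have c: "cycle ?m (Suc N) \<in> carrier A"
        using Suc.prems m by (intro cycle_closed) auto
      \<comment> \<open>If \<open>i \<in> S\<close>, the rank \<open>j\<close> computed up to
        \<open>N\<close> lies below the cycle, and \<open>g j\<close> commutes with it. If
        \<open>i \<notin> S\<close>, it falls inside the cycle, which raises it by one, matching the
        larger number of elements of \<open>S\<close>.\<close>
      have j: "1 \<le> j \<and> j < d \<and> 1 \<le> shuffle_rank (Suc N) S i \<and> shuffle_rank (Suc N) S i < d
          \<and> cycle ?m (Suc N) \<otimes> g j = g (shuffle_rank (Suc N) S i) \<otimes> cycle ?m (Suc N)"
      proof (cases "i \<in> S")
        case True
        then have "j = card (S \<inter> {1..i})" "shuffle_rank (Suc N) S i = card (S \<inter> {1..i})"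
          using Suc.prems \<open>i < N\<close> by (auto simp: j_def shuffle_rank_def)
        moreover have "Suc (card (S \<inter> {1..i})) \<le> card (S \<inter> {1..N})"
          using card_inter_mono[of "Suc i" N S] card_inter_Suc(1)[of S i] Suc.prems True \<open>i < N\<close> by simp
        moreover have "1 \<le> card (S \<inter> {1..i})"
          using card_inter_Suc(1)[of S "i - 1"] True Suc.prems by simp
        moreover have "card (S \<inter> {1..N}) \<le> N"
          using card_inter_diff[of S N] by linarith
        ultimately show ?thesis
          using Suc.prems m cycle_comm[of ?m "Suc N" j] by auto
      next
        case False
        then have eq: "j = card (S \<inter> {1..N}) + card ({1..i} - S)" "shuffle_rank (Suc N) S i = Suc j"
          using Suc.prems \<open>i < N\<close> m by (auto simp: j_def shuffle_rank_def)
        have "Suc (card ({1..i} - S)) \<le> card ({1..N} - S)"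
          using card_diff_mono[of "Suc i" N S] card_inter_Suc(2)[of i S] Suc.prems False \<open>i < N\<close> by simp
        then have "j < N"
          using eq(1) card_inter_diff[of S N] by linarith
        moreover have "1 \<le> card ({1..i} - S)"
          using card_inter_Suc(2)[of "i - 1" S] False Suc.prems by simp
        ultimately show ?thesis
          using Suc.prems m eq cycle_shift[of ?m "Suc N" j] by auto
      qed
      then have gj: "g j \<in> carrier A" "g (shuffle_rank (Suc N) S i) \<in> carrier A"
        by (auto intro: g_closed)
      have "shuffle (Suc N) S \<otimes> g i = cycle ?m (Suc N) \<otimes> (shuffle N S \<otimes> g i)"
        using SN c sN gi by (simp add: m_assoc del: cycle.simps)
      also have "\<dots> = (cycle ?m (Suc N) \<otimes> g j) \<otimes> shuffle N S"
        using c sN gj by (simp add: IH j_def m_assoc del: cycle.simps)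
      also have "\<dots> = g (shuffle_rank (Suc N) S i) \<otimes> shuffle (Suc N) S"
        using SN c sN gj j by (simp add: m_assoc del: cycle.simps)
      finally show ?thesis .
    next
      case False
      moreover have "shuffle_rank (Suc N) S i = shuffle_rank N S i"
        using Suc.prems \<open>i < N\<close> False card_inter_Suc(1)[of S N] by (auto simp: shuffle_rank_def)
      ultimately show ?thesis
        using IH by simp
    qed
  next
    case False
    then have i: "i = N"
      using Suc.prems by simp
    then obtain K where K: "N = Suc K"
      using Suc.prems by (cases N) auto
    have sK: "shuffle K S \<in> carrier A"
      using Suc.prems K by (intro shuffle_closed) simp
    have comm: "g N \<otimes> shuffle K S = shuffle K S \<otimes> g N"
      using Suc.prems K by (intro shuffle_comm) auto
    show ?thesis
    proof (cases "N \<in> S")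
      case True
      then have SN: "Suc N \<in> S"
        using Suc.prems i by simp
      define p where "p = card (S \<inter> {1..N})"
      have m: "?m = Suc p"
        using SN card_inter_Suc(1)[of S N] by (simp add: p_def)
      have p: "1 \<le> p" "p \<le> N"
        using True card_inter_Suc(1)[of S K] card_inter_diff[of S N] unfolding p_def K by auto
      have c: "cycle (Suc p) (Suc N) \<in> carrier A" "cycle p N \<in> carrier A" "g p \<in> carrier A"
        using Suc.prems p by (auto intro!: cycle_closed g_closed simp del: cycle.simps)
      have "shuffle N S = cycle p N \<otimes> shuffle K S"
        using True K by (simp add: p_def del: cycle.simps)
      then have s: "shuffle (Suc N) S = cycle (Suc p) (Suc N) \<otimes> (cycle p N \<otimes> shuffle K S)"
        using SN m by (simp del: cycle.simps)
      \<comment> \<open>Multiplying by \<open>g N\<close> prolongs the inner cycle to end at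
        \<open>Suc N\<close>; the two cycles then change places by \<open>cycle_cycle\<close>, and
        the first letter \<open>g p\<close> of the longer one is split off on the left.\<close>
      have "shuffle (Suc N) S \<otimes> g i = cycle (Suc p) (Suc N) \<otimes> (cycle p N \<otimes> (shuffle K S \<otimes> g N))"
        using s c sK gi i by (simp add: m_assoc del: cycle.simps)
      also have "\<dots> = (cycle (Suc p) (Suc N) \<otimes> cycle p (Suc N)) \<otimes> shuffle K S"
        using c sK gi i p by (simp add: comm[symmetric] m_assoc cycle.simps(2)[of p N] del: cycle.simps)
      also have "cycle (Suc p) (Suc N) \<otimes> cycle p (Suc N) = cycle p (Suc N) \<otimes> cycle p N"
        using Suc.prems p by (intro cycle_cycle[symmetric]) auto
      also have "cycle p (Suc N) = g p \<otimes> cycle (Suc p) (Suc N)"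
        using Suc.prems p by (intro cycle_rec_left) auto
      also have "g p \<otimes> cycle (Suc p) (Suc N) \<otimes> cycle p N \<otimes> shuffle K S = g p \<otimes> shuffle (Suc N) S"
        using s c sK by (simp add: m_assoc del: cycle.simps)
      finally show ?thesis
        using True i K by (simp add: shuffle_rank_def p_def)
    next
      case False
      then have SN: "Suc N \<notin> S"
        using Suc.prems i by simp
      have "shuffle_rank (Suc N) S i = N"
        using False SN i K card_inter_Suc(1)[of S N] card_inter_diff[of S N] by (simp add: shuffle_rank_def)
      then show ?thesis
        using False SN i K comm by simp
    qed
  qed
qed simp

text \<open>At the last pair of positions \<open>g N\<close> prolongs the cycle of \<open>N\<close>
  by one letter, giving the cycle of \<open>Suc N\<close> for the swapped set. Earlier swaps leave
  the outermost cycle alone, since neither the cardinality nor the membership of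
  \<open>Suc N\<close> changes.\<close>

lemma shuffle_ascent:
  assumes "N \<le> d" "i \<in> {1..<N}" "i \<in> S" "Suc i \<notin> S"
  shows "shuffle N S \<otimes> g i = shuffle N (swap_set i S)"
  using assms
proof (induction N)
  case (Suc N)
  let ?m = "card (S \<inter> {1..Suc N})"
  have gi: "g i \<in> carrier A"
    using Suc.prems by (intro g_closed) auto
  have sN: "shuffle N S \<in> carrier A"
    using Suc.prems by (intro shuffle_closed) simp
  have card: "card (swap_set i S \<inter> {1..Suc N}) = ?m"
    using Suc.prems by (intro card_swap_set) auto
  show ?case
  proof (cases "i < N")
    case True
    then have IH: "shuffle N S \<otimes> g i = shuffle N (swap_set i S)"
      using Suc by simp
    have iff: "Suc N \<in> swap_set i S \<longleftrightarrow> Suc N \<in> S"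
      using True by (simp add: swap_set_iff simple_transp_apply)
    show ?thesis
    proof (cases "Suc N \<in> S")
      case SN: True
      have "1 \<le> ?m"
        using SN card_inter_Suc(1)[of S N] by simp
      then have "cycle ?m (Suc N) \<in> carrier A"
        using Suc.prems by (intro cycle_closed) auto
      then show ?thesis
        using SN IH iff card sN gi by (simp add: m_assoc del: cycle.simps)
    next
      case False
      then show ?thesis
        using IH iff by simp
    qed
  next
    case False
    then have i: "i = N"
      using Suc.prems by simp
    then obtain K where K: "N = Suc K"
      using Suc.prems by (cases N) auto
    have sK: "shuffle K S \<in> carrier A"
      using Suc.prems K by (intro shuffle_closed) simp
    have comm: "g N \<otimes> shuffle K S = shuffle K S \<otimes> g N"
      using Suc.prems K by (intro shuffle_comm) auto
    have NS: "N \<in> S" "Suc N \<notin> S"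
      using Suc.prems i by auto
    define p where "p = card (S \<inter> {1..N})"
    have m: "?m = p"
      using NS card_inter_Suc(1)[of S N] by (simp add: p_def)
    have p: "1 \<le> p" "p \<le> N"
      using NS card_inter_Suc(1)[of S K] card_inter_diff[of S N] unfolding p_def K by auto
    have c: "cycle p N \<in> carrier A"
      using Suc.prems p by (intro cycle_closed) auto
    have swap: "Suc N \<in> swap_set i S" "N \<notin> swap_set i S"
      using NS i by (simp_all add: swap_set_iff simple_transp_apply)
    have "shuffle K (swap_set i S) = shuffle K S"
      by (rule shuffle_cong) (auto simp: swap_set_iff simple_transp_apply i K)
    then have "shuffle (Suc N) (swap_set i S) = cycle p (Suc N) \<otimes> shuffle K S"
      using swap card m K by (simp del: cycle.simps)
    also have "\<dots> = cycle p N \<otimes> (g N \<otimes> shuffle K S)"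
      using p c sK gi i by (simp add: m_assoc)
    also have "\<dots> = shuffle (Suc N) S \<otimes> g i"
    proof -
      have "shuffle N S = cycle p N \<otimes> shuffle K S"
        using NS K by (simp add: p_def del: cycle.simps)
      then show ?thesis
        using NS c sK gi by (simp add: comm m_assoc i del: cycle.simps)
    qed
    finally show ?thesis ..
  qed
qed simp

text \<open>The shuffle is that of the swapped set times \<open>g i\<close>, and a further
  \<open>g i\<close> is absorbed by the quadratic relation.\<close>

lemma shuffle_descent:
  assumes "N \<le> d" "i \<in> {1..<N}" "i \<notin> S" "Suc i \<in> S"
  shows "shuffle N S \<otimes> g i = e \<odot> shuffle N S"
proof -
  have c: "g i \<in> carrier A" "shuffle N (swap_set i S) \<in> carrier A"
    using assms by (auto intro: g_closed shuffle_closed)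
  have "i \<in> swap_set i S" "Suc i \<notin> swap_set i S"
    using assms by (simp_all add: swap_set_iff simple_transp_apply)
  then have s: "shuffle N S = shuffle N (swap_set i S) \<otimes> g i"
    using shuffle_ascent[of N i "swap_set i S"] assms by simp
  have "g i \<otimes> g i = e \<odot> g i"
    using assms by (intro quadratic) auto
  then show ?thesis
    unfolding s using c by (simp add: m_assoc smult_mult_r)
qed

text \<open>No position is displaced: up to \<open>m\<close> each cycle goes from \<open>k\<close>
  to \<open>k\<close>, and beyond \<open>m\<close> no cycle occurs.\<close>

lemma shuffle_initial:
  assumes "m \<le> N" "N \<le> d"
  shows "shuffle N {1..m} = \<one>"
proof -
  have small: "shuffle k {1..m} = \<one>" if "k \<le> m" for k
    using that
  proof (induction k)
    case (Suc k)
    then have "{1..m} \<inter> {1..Suc k} = {1..Suc k}"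
      by auto
    then show ?case
      using Suc by (simp add: cycle_trivial del: cycle.simps)
  qed simp
  show ?thesis
    using assms(1)
  proof (induction N rule: dec_induct)
    case base
    show ?case
      by (rule small) simp
  qed simp
qed

end

section \<open>Induced modules\<close>

lemma left_regular_simps [simp]:
  "carrier (left_regular B) = carrier B" "monoid.mult (left_regular B) = add B"
  "one (left_regular B) = ring.zero B" "act (left_regular B) b a = a \<otimes>\<^bsub>B\<^esub> b"
  by (simp_all add: left_regular_def)

lemma (in ring) left_regular_comm_group: "comm_group (left_regular R)"
  by (rule comm_group_cong[OF a_comm_group]) simp_all

locale induced_data = B: ring B + X: comm_group X
  for A :: "('r, 'm) ring_scheme" and B :: "('r, 'n) ring_scheme" and X :: "('v, 'r) acted" +
  assumes A_subset: "carrier A \<subseteq> carrier B"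
    and X_closed: "\<lbrakk>x \<in> carrier X; a \<in> carrier A\<rbrakk> \<Longrightarrow> act X x a \<in> carrier X"
begin

sublocale tensor_data "carrier A" X "left_regular B"
  using A_subset X_closed
  by (intro tensor_data.intro tensor_data_axioms.intro B.left_regular_comm_group X.comm_group_axioms) auto

interpretation T: comm_group T
  by (rule tensor_comm_group)

lemma induced_simps:
  "carrier (induced A B X) = carrier T" "monoid.mult (induced A B X) = monoid.mult T"
  "one (induced A B X) = one T"
  "act (induced A B X) Z r = tensor_lift T (\<lambda>(x, b). pure x (b \<otimes>\<^bsub>B\<^esub> r)) Z"
  by (simp_all add: induced_def Let_def)

lemma induced_biadditive:
  assumes r: "r \<in> carrier B"
  shows "biadditive (carrier A) X (left_regular B) T (\<lambda>(x, b). pure x (b \<otimes>\<^bsub>B\<^esub> r))"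
proof (rule biadditiveI; clarsimp)
  fix x y a assume x: "x \<in> carrier X" "y \<in> carrier B" "a \<in> carrier A"
  then show "pure (act X x a) (y \<otimes>\<^bsub>B\<^esub> r) = pure x (a \<otimes>\<^bsub>B\<^esub> y \<otimes>\<^bsub>B\<^esub> r)"
    using pure_balanced[of x "y \<otimes>\<^bsub>B\<^esub> r" a] A_subset r by (auto simp: B.m_assoc)
next
  fix x y y' assume "x \<in> carrier X" "y \<in> carrier B" "y' \<in> carrier B"
  then show "pure x ((y \<oplus>\<^bsub>B\<^esub> y') \<otimes>\<^bsub>B\<^esub> r) = pure x (y \<otimes>\<^bsub>B\<^esub> r) \<otimes>\<^bsub>T\<^esub> pure x (y' \<otimes>\<^bsub>B\<^esub> r)"
    using pure_add_right[of x "y \<otimes>\<^bsub>B\<^esub> r" "y' \<otimes>\<^bsub>B\<^esub> r"] r by (simp add: B.l_distr)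
qed (use r pure_add_left in auto)

lemma induced_act_hom: "r \<in> carrier B \<Longrightarrow> (\<lambda>Z. act (induced A B X) Z r) \<in> hom T T"
  unfolding induced_simps
  using tensor_lift_hom[OF tensor_comm_group induced_biadditive] .

lemma induced_act_pure:
  "\<lbrakk>x \<in> carrier X; b \<in> carrier B; r \<in> carrier B\<rbrakk>
    \<Longrightarrow> act (induced A B X) (pure x b) r = pure x (b \<otimes>\<^bsub>B\<^esub> r)"
  unfolding induced_simps
  using tensor_lift_pure[OF tensor_comm_group induced_biadditive, of r x b] by simp

lemma induced_act_closed: "\<lbrakk>Z \<in> carrier T; r \<in> carrier B\<rbrakk> \<Longrightarrow> act (induced A B X) Z r \<in> carrier T"
  using hom_in_carrier[OF induced_act_hom] by simp

text \<open>The laws about products, sums and the unit of \<open>B\<close> are equalities of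
  additive maps in \<open>Z\<close>, so they are checked on pure tensors, where they come from ring
  laws in \<open>B\<close>.\<close>

lemma induced_right_module: "right_module B (induced A B X)"
proof -
  have cg: "comm_group (induced A B X)"
    by (rule comm_group_cong[OF tensor_comm_group]) (simp_all add: induced_simps)
  have id: "(\<lambda>Z. Z) \<in> hom T T"
    by (simp add: hom_def)
  show ?thesis
  proof (intro right_module.intro right_module_axioms.intro cg B.ring_axioms)
    fix Z r assume "Z \<in> carrier (induced A B X)" "r \<in> carrier B"
    then show "act (induced A B X) Z r \<in> carrier (induced A B X)"
      using induced_act_closed by (simp add: induced_simps(1))
  next
    fix Z W r assume "Z \<in> carrier (induced A B X)" "W \<in> carrier (induced A B X)" "r \<in> carrier B"
    then show "act (induced A B X) (Z \<otimes>\<^bsub>induced A B X\<^esub> W) r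
        = act (induced A B X) Z r \<otimes>\<^bsub>induced A B X\<^esub> act (induced A B X) W r"
      using hom_mult[OF induced_act_hom] by (simp add: induced_simps(1,2))
  next
    fix Z r s assume Z: "Z \<in> carrier (induced A B X)" and r: "r \<in> carrier B" and s: "s \<in> carrier B"
    then have Z': "Z \<in> carrier T"
      by (simp add: induced_simps(1))
    have "(\<lambda>Z. act (induced A B X) Z r \<otimes>\<^bsub>T\<^esub> act (induced A B X) Z s) \<in> hom T T"
      using hom_mult[OF induced_act_hom] r s
      by (intro homI) (simp_all add: induced_act_closed T.m_ac)
    then have "act (induced A B X) Z (r \<oplus>\<^bsub>B\<^esub> s)
        = act (induced A B X) Z r \<otimes>\<^bsub>T\<^esub> act (induced A B X) Z s"
      by (rule tensor_hom_eqI[OF T.is_group induced_act_hom _ _ Z', rotated])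
        (use r s pure_add_right in \<open>auto simp: induced_act_pure B.r_distr\<close>)
    then show "act (induced A B X) Z (r \<oplus>\<^bsub>B\<^esub> s)
        = act (induced A B X) Z r \<otimes>\<^bsub>induced A B X\<^esub> act (induced A B X) Z s"
      by (simp add: induced_simps(2))
    have "(\<lambda>Z. act (induced A B X) (act (induced A B X) Z r) s) \<in> hom T T"
      using hom_mult[OF induced_act_hom] r s by (intro homI) (simp_all add: induced_act_closed)
    then show "act (induced A B X) Z (r \<otimes>\<^bsub>B\<^esub> s) = act (induced A B X) (act (induced A B X) Z r) s"
      by (rule tensor_hom_eqI[OF T.is_group induced_act_hom _ _ Z', rotated])
        (use r s in \<open>auto simp: induced_act_pure B.m_assoc\<close>)
  next
    fix Z assume "Z \<in> carrier (induced A B X)"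
    then have Z': "Z \<in> carrier T"
      by (simp add: induced_simps(1))
    show "act (induced A B X) Z \<one>\<^bsub>B\<^esub> = Z"
      by (rule tensor_hom_eqI[OF T.is_group induced_act_hom[OF B.one_closed] id _ Z'])
        (auto simp: induced_act_pure)
  qed
qed

end

text \<open>The maps are additive, so agreement is asked on all complex multiples of basis vectors;
  the coordinates are then added one at a time.\<close>

lemma span_hom_eqI:
  assumes "group K" "comm_group (span_module B a)" "F \<in> hom (span_module B a) K" "G \<in> hom (span_module B a) K" "finite B"
    and "\<And>\<gamma> c. \<gamma> \<in> B \<Longrightarrow> F (\<lambda>\<tau>. c * basis_vec \<gamma> \<tau>) = G (\<lambda>\<tau>. c * basis_vec \<gamma> \<tau>)"
    and v: "v \<in> carrier (span_module B a)"
  shows "F v = G v"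
proof -
  interpret V: comm_group "span_module B a"
    by fact
  interpret F: group_hom "span_module B a" K F
    using assms by (intro group_hom.intro group_hom_axioms.intro V.is_group)
  interpret G: group_hom "span_module B a" K G
    using assms by (intro group_hom.intro group_hom_axioms.intro V.is_group)
  have s: "carrier (span_module B a) = {v. \<forall>\<tau>. v \<tau> \<noteq> 0 \<longrightarrow> \<tau> \<in> B}"
    "monoid.mult (span_module B a) = (\<lambda>v w \<tau>. v \<tau> + w \<tau>)" "one (span_module B a) = (\<lambda>\<tau>. 0)"
    by (simp_all add: span_module_def)
  have "F (proj C v) = G (proj C v)" if "C \<subseteq> B" for C
    using finite_subset[OF that \<open>finite B\<close>] that
  proof (induction C rule: finite_induct)
    case empty
    have "proj {} v = \<one>\<^bsub>span_module B a\<^esub>"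
      by (simp add: proj_def s)
    then show ?case
      by simp
  next
    case (insert \<gamma> C)
    let ?b = "\<lambda>\<tau>. v \<gamma> * basis_vec \<gamma> \<tau>"
    have e: "proj (insert \<gamma> C) v = ?b \<otimes>\<^bsub>span_module B a\<^esub> proj C v"
    proof
      show "proj (insert \<gamma> C) v \<tau> = (?b \<otimes>\<^bsub>span_module B a\<^esub> proj C v) \<tau>" for \<tau>
        using insert.hyps(2) by (cases "\<tau> = \<gamma>") (simp_all add: s proj_def basis_vec_def)
    qed
    have "?b \<in> carrier (span_module B a)" "proj C v \<in> carrier (span_module B a)"
      using insert.prems by (auto simp: s proj_def basis_vec_def)
    then show ?case
      unfolding e using insert assms(6)[of \<gamma> "v \<gamma>"] by (simp del: s)
  qed
  then show ?thesis
    using proj_span[OF v] by (metis order_refl)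
qed

text \<open>This is \<open>pibar\<close> for \<open>e = -1\<close> and \<open>pi_gen\<close> for
  \<open>e = 1\<close>, the generator that acts by \<open>sort_op\<close> on the module with
  parameter \<open>e\<close>.\<close>

definition sort_gen :: "complex \<Rightarrow> nat \<Rightarrow> nat \<Rightarrow> hecke_elem" where
  "sort_gen e d i = pibar d i \<oplus>\<^bsub>hecke d\<^esub> ((1 + e) / 2) \<odot>\<^bsub>hecke d\<^esub> \<one>\<^bsub>hecke d\<^esub>"

lemma sort_gen_minus: "i \<in> {1..<d} \<Longrightarrow> sort_gen (-1) d i = pibar d i"
  by (simp add: sort_gen_def)

lemma sort_gen_plus: "i \<in> {1..<d} \<Longrightarrow> sort_gen 1 d i = pibar d i \<oplus>\<^bsub>hecke d\<^esub> \<one>\<^bsub>hecke d\<^esub>"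
  by (simp add: sort_gen_def)

lemma sort_gen_closed: "i \<in> {1..<d} \<Longrightarrow> sort_gen e d i \<in> carrier (hecke d)"
  by (simp add: sort_gen_def)

lemma shuffle_algebra_hecke:
  assumes "e = -1 \<or> e = 1"
  shows "shuffle_algebra (hecke d) (sort_gen e d) d e"
  using assms
proof
  assume e: "e = -1"
  note g = hecke_gens_pibar[of d, unfolded hecke_gens_def]
  have "pibar d i \<otimes>\<^bsub>hecke d\<^esub> pibar d j = pibar d j \<otimes>\<^bsub>hecke d\<^esub> pibar d i"
    if "1 \<le> i" "i + 2 \<le> j" "j < d" for i j
  proof -
    have "i \<in> {1..<d}" "j \<in> {1..<d}"
      using that by auto
    then show ?thesis
      using g that(2) by blast
  qed
  then show ?thesis
    using g by (intro shuffle_algebra.intro shuffle_algebra_axioms.intro hecke_algebra)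
      (simp_all only: e, simp_all add: sort_gen_minus hecke.smult_minus_one)
next
  assume e: "e = 1"
  note p = hecke.pi_relations[OF hecke_gens_pibar, of _ d]
  show ?thesis
    using p by (intro shuffle_algebra.intro shuffle_algebra_axioms.intro hecke_algebra)
      (simp_all add: e sort_gen_plus)
qed

lemma sort_gen_parabolic: "i \<in> {1..<m + n} - {m} \<Longrightarrow> sort_gen e (m + n) i \<in> carrier (parabolic m n)"
  unfolding sort_gen_def by (intro parabolic_add parabolic_pibar parabolic_scalar)

lemma sort_module_act_gen:
  assumes "e = -1 \<or> e = 1" "i \<in> {1..<d}" "v \<in> carrier (sort_module e d P)"
  shows "act (sort_module e d P) v (sort_gen e d i) = sort_op e d P i v"
proof -
  interpret V: span_data d "SigmaR d P" "shift_act e d P"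
    by (rule span_data_sort_module[OF assms(1)])
  interpret R: right_module "hecke d" "sort_module e d P"
    by (rule V.span_right_module)
  show ?thesis
    using assms(2,3)
    by (simp add: sort_gen_def R.act_add_right V.span_act_pibar V.span_act_scalar shift_op_eq proj_span)
qed

section \<open>Rank permutations of sets of positions\<close>

lemma shuffle_rank_swap_aux:
  assumes "i \<in> {1..<N}" "i \<in> S" "Suc i \<notin> S"
  shows "shuffle_rank N (swap_set i S) = shuffle_rank N S \<circ> simple_transp i"
proof
  fix k
  let ?S = "swap_set i S"
  have cN: "card (?S \<inter> {1..N}) = card (S \<inter> {1..N})"
    using assms by (intro card_swap_set) auto
  have ck: "card (?S \<inter> {1..k}) = card (S \<inter> {1..k})" if "k \<noteq> i" for k
    using assms that by (intro card_swap_set) auto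
  have ckd: "card ({1..k} - ?S) = card ({1..k} - S)" if "k \<noteq> i" for k
    using ck[OF that] card_inter_diff[of ?S k] card_inter_diff[of S k] by linarith
  have mem: "k \<in> ?S \<longleftrightarrow> simple_transp i k \<in> S" for k
    by (rule swap_set_iff)
  consider "k = i" | "k = Suc i" | "k \<noteq> i" "k \<noteq> Suc i"
    by blast
  then show "shuffle_rank N ?S k = (shuffle_rank N S \<circ> simple_transp i) k"
  proof cases
    case 1
    have "card ({1..Suc i} - ?S) = card ({1..i} - ?S)"
      using card_inter_Suc(2)[of i ?S] assms by (simp add: mem simple_transp_apply)
    then show ?thesis
      using 1 assms cN ckd[of "Suc i"] by (simp add: shuffle_rank_def mem simple_transp_apply)
  next
    case 2
    have "card (S \<inter> {1..Suc i}) = card (S \<inter> {1..i})"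
      using card_inter_Suc(1)[of S i] assms by simp
    then show ?thesis
      using 2 assms ck[of "Suc i"] by (simp add: shuffle_rank_def mem simple_transp_apply)
  next
    case 3
    then show ?thesis
      using cN ck[of k] ckd[of k] by (simp add: shuffle_rank_def mem simple_transp_apply)
  qed
qed

lemma shuffle_rank_swap:
  assumes "i \<in> {1..<N}" "i \<in> S \<longleftrightarrow> Suc i \<notin> S"
  shows "shuffle_rank N (swap_set i S) = shuffle_rank N S \<circ> simple_transp i"
proof (cases "i \<in> S")
  case True
  then show ?thesis
    using assms by (intro shuffle_rank_swap_aux) auto
next
  case False
  then have "shuffle_rank N (swap_set i (swap_set i S)) = shuffle_rank N (swap_set i S) \<circ> simple_transp i"
    using assms by (intro shuffle_rank_swap_aux) (auto simp: swap_set_iff simple_transp_apply)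
  then show ?thesis
    by (simp add: comp_assoc) (simp add: fun_eq_iff)
qed

lemma shuffle_rank_less:
  assumes "a \<in> {1..N}" "b \<in> {1..N}" "a \<in> S \<longleftrightarrow> b \<in> S" "a < b"
  shows "shuffle_rank N S a < shuffle_rank N S b"
proof (cases "b \<in> S")
  case True
  have "card (S \<inter> {1..a}) < card (S \<inter> {1..b})"
  proof (rule psubset_card_mono)
    have "b \<in> S \<inter> {1..b}" "b \<notin> S \<inter> {1..a}" "S \<inter> {1..a} \<subseteq> S \<inter> {1..b}"
      using assms True by auto
    then show "S \<inter> {1..a} \<subset> S \<inter> {1..b}"
      by blast
  qed simp
  then show ?thesis
    using assms True by (simp add: shuffle_rank_def)
next
  case False
  have "card ({1..a} - S) < card ({1..b} - S)"
  proof (rule psubset_card_mono)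
    have "b \<in> {1..b} - S" "b \<notin> {1..a} - S" "{1..a} - S \<subseteq> {1..b} - S"
      using assms False by auto
    then show "{1..a} - S \<subset> {1..b} - S"
      by blast
  qed simp
  then show ?thesis
    using assms False by (simp add: shuffle_rank_def)
qed

lemma shuffle_rank_range:
  assumes "a \<in> {1..N}"
  shows "shuffle_rank N S a \<in> {1..N}" "shuffle_rank N S a \<le> card (S \<inter> {1..N}) \<longleftrightarrow> a \<in> S"
proof -
  have "card (S \<inter> {1..a}) \<le> card (S \<inter> {1..N})" "card ({1..a} - S) \<le> card ({1..N} - S)"
    using assms card_inter_mono card_diff_mono by auto
  moreover have "a \<in> S \<Longrightarrow> 0 < card (S \<inter> {1..a})" "a \<notin> S \<Longrightarrow> 0 < card ({1..a} - S)"
    using assms by (auto simp: card_gt_0_iff)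
  moreover note card_inter_diff[of S N]
  ultimately show "shuffle_rank N S a \<in> {1..N}" "shuffle_rank N S a \<le> card (S \<inter> {1..N}) \<longleftrightarrow> a \<in> S"
    using assms by (auto simp: shuffle_rank_def simp del: One_nat_def)
qed

text \<open>The set takes the ranks up to its cardinality and the complement those above, so equal
  ranks occur on one side, where the rank is strictly increasing.\<close>

lemma shuffle_rank_permutes: "shuffle_rank N S permutes {1..N}"
proof (rule bij_imp_permutes)
  have "inj_on (shuffle_rank N S) {1..N}"
  proof (rule inj_onI)
    fix a b assume ab: "a \<in> {1..N}" "b \<in> {1..N}" "shuffle_rank N S a = shuffle_rank N S b"
    then have "a \<in> S \<longleftrightarrow> b \<in> S"
      using shuffle_rank_range(2) by metis
    then show "a = b"
      using ab shuffle_rank_less[of a N b S] shuffle_rank_less[of b N a S]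
      by (cases a b rule: linorder_cases) auto
  qed
  moreover have "shuffle_rank N S ` {1..N} \<subseteq> {1..N}"
    using shuffle_rank_range(1) by blast
  ultimately show "bij_betw (shuffle_rank N S) {1..N} {1..N}"
    by (simp add: bij_betw_def endo_inj_surj)
qed (simp add: shuffle_rank_def)

lemma shuffle_rank_initial:
  assumes "m \<le> N"
  shows "shuffle_rank N {1..m} = id"
proof
  fix k
  have "{1..m} \<inter> {1..k} = {1..k}" if "k \<le> m"
    using that by auto
  moreover have "{1..m} \<inter> {1..N} = {1..m}" "{1..k} - {1..m} = {Suc m..k}" if "m < k"
    using assms by auto
  ultimately show "shuffle_rank N {1..m} k = id k"
    by (auto simp: shuffle_rank_def simp del: One_nat_def)
qed

section \<open>Inducing the part that preserves \<open>{1..m}\<close>\<close>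

definition parabolic_perms :: "nat \<Rightarrow> nat \<Rightarrow> (nat \<times> nat) set \<Rightarrow> perm set" where
  "parabolic_perms m N P = {\<delta> \<in> SigmaR N P. \<forall>k. \<delta> k \<le> m \<longleftrightarrow> k \<le> m}"

lemma hom_comp: "\<lbrakk>f \<in> hom G H; g \<in> hom H K\<rbrakk> \<Longrightarrow> (\<lambda>x. g (f x)) \<in> hom G K"
  by (auto simp: hom_def Pi_iff)

abbreviation scaled :: "complex \<Rightarrow> perm \<Rightarrow> vec" where
  "scaled c \<gamma> \<equiv> (\<lambda>\<tau>. c * basis_vec \<gamma> \<tau>)"

text \<open>The module \<open>X\<close> is abstract, known through an embedding \<open>j\<close>
  whose image is the span of \<open>parabolic_perms\<close>. By \<open>P_split\<close> no element up
  to \<open>m\<close> is comparable with one above \<open>m\<close>.\<close>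

locale induced_sort =
  fixes e :: complex and m n :: nat and P :: "(nat \<times> nat) set"
    and X :: "('v, hecke_elem) acted" and j :: "'v \<Rightarrow> vec"
  assumes e: "e = -1 \<or> e = 1"
    and P_range: "P \<subseteq> {1..m + n} \<times> {1..m + n}"
    and P_split: "(u, w) \<in> P \<Longrightarrow> u \<le> m \<longleftrightarrow> w \<le> m"
    and X: "comm_group X"
    and X_closed': "\<lbrakk>x \<in> carrier X; a \<in> carrier (parabolic m n)\<rbrakk> \<Longrightarrow> act X x a \<in> carrier X"
    and j_hom: "j \<in> hom X (sort_module e (m + n) P)"
    and j_inj: "inj_on j (carrier X)"
    and j_act: "\<lbrakk>x \<in> carrier X; a \<in> carrier (parabolic m n)\<rbrakk>
      \<Longrightarrow> j (act X x a) = act (sort_module e (m + n) P) (j x) a"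
    and j_surj: "\<delta> \<in> parabolic_perms m (m + n) P \<Longrightarrow> \<exists>z\<in>carrier X. j z = scaled c \<delta>"
    and j_support: "\<lbrakk>z \<in> carrier X; j z \<tau> \<noteq> 0\<rbrakk> \<Longrightarrow> \<tau> \<in> parabolic_perms m (m + n) P"
begin

abbreviation "N \<equiv> m + n"
abbreviation "V \<equiv> sort_module e N P"
abbreviation "Ind \<equiv> induced (parabolic m n) (hecke N) X"
abbreviation "W \<equiv> parabolic_perms m N P"

sublocale induced_data "parabolic m n" "hecke N" X
  by (intro induced_data.intro induced_data_axioms.intro hecke_ring X X_closed')
    (use parabolic_subset in auto)

sublocale V: span_data N "SigmaR N P" "shift_act e N P"
  by (rule span_data_sort_module[OF e])

sublocale VM: right_module "hecke N" V
  by (rule V.span_right_module)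

sublocale sh: shuffle_algebra "hecke N" "sort_gen e N" N e
  by (rule shuffle_algebra_hecke[OF e])

interpretation T: comm_group T
  by (rule tensor_comm_group)

interpretation Ind: right_module "hecke N" Ind
  by (rule induced_right_module)

definition low :: "perm \<Rightarrow> nat set" where
  "low \<gamma> = {k \<in> {1..N}. \<gamma> k \<le> m}"

abbreviation "rank \<gamma> \<equiv> shuffle_rank N (low \<gamma>)"

text \<open>The factorization \<open>\<gamma> = base \<gamma> \<circ> rank \<gamma>\<close>:
  \<open>rank \<gamma>\<close> is the minimal coset representative, and \<open>base \<gamma>\<close>
  lists first the values up to \<open>m\<close>, then the others, each group in its order in
  \<open>\<gamma>\<close>.\<close>

definition base :: "perm \<Rightarrow> perm" where
  "base \<gamma> = \<gamma> \<circ> inv_into UNIV (rank \<gamma>)"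

lemma base_comp_rank: "base \<gamma> \<circ> rank \<gamma> = \<gamma>"
  unfolding base_def using permutes_inv_o(2)[OF shuffle_rank_permutes] by (simp add: comp_assoc)

lemma base_rank: "base \<gamma> (rank \<gamma> k) = \<gamma> k"
  using fun_cong[OF base_comp_rank, of \<gamma> k] by simp

lemma base_unique:
  assumes "\<delta> \<circ> rank \<gamma> = \<gamma>"
  shows "base \<gamma> = \<delta>"
proof -
  have "base \<gamma> = (\<delta> \<circ> rank \<gamma>) \<circ> inv_into UNIV (rank \<gamma>)"
    by (simp only: assms base_def)
  then show ?thesis
    using permutes_inv_o(1)[OF shuffle_rank_permutes] by (simp add: comp_assoc)
qed

context
  fixes \<gamma>
  assumes \<gamma>: "\<gamma> \<in> SigmaR N P"
begin

lemma \<gamma>_permutes: "\<gamma> permutes {1..N}"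
  using \<gamma> by (rule SigmaR_permutes)

lemma \<gamma>_range: "\<gamma> k \<in> {1..N} \<longleftrightarrow> k \<in> {1..N}"
  using permutes_in_image[OF \<gamma>_permutes] .

lemma card_low: "card (low \<gamma> \<inter> {1..N}) = m"
proof -
  have "\<gamma> ` (low \<gamma> \<inter> {1..N}) = {1..m}"
  proof (intro equalityI subsetI)
    fix y assume "y \<in> \<gamma> ` (low \<gamma> \<inter> {1..N})"
    then show "y \<in> {1..m}"
      using \<gamma>_range by (auto simp: low_def simp del: One_nat_def)
  next
    fix y assume y: "y \<in> {1..m}"
    then obtain k where "y = \<gamma> k"
      using permutes_surj[OF \<gamma>_permutes] by blast
    moreover from this y have "k \<in> {1..N}"
      using \<gamma>_range[of k] by auto
    ultimately show "y \<in> \<gamma> ` (low \<gamma> \<inter> {1..N})"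
      using y by (auto simp: low_def)
  qed
  then have "card (low \<gamma> \<inter> {1..N}) = card {1..m}"
    using card_image[of \<gamma> "low \<gamma> \<inter> {1..N}"] permutes_inj[OF \<gamma>_permutes] inj_on_subset by fastforce
  then show ?thesis
    by simp
qed

lemma rank_le_iff: "k \<in> {1..N} \<Longrightarrow> rank \<gamma> k \<le> m \<longleftrightarrow> \<gamma> k \<le> m"
  using shuffle_rank_range(2)[of k N "low \<gamma>"] unfolding card_low by (auto simp: low_def)

text \<open>Comparable values lie on the same side of \<open>m\<close>, so their positions are both
  inside or both outside \<open>low \<gamma>\<close>, where \<open>rank \<gamma>\<close> is
  increasing; hence \<open>base \<gamma>\<close> keeps the order of comparable values.\<close>

lemma base_mem: "base \<gamma> \<in> W"
proof -
  have p: "base \<gamma> permutes {1..N}"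
    unfolding base_def
    by (rule permutes_compose[OF permutes_inv[OF shuffle_rank_permutes] \<gamma>_permutes])
  have surj: "\<exists>k. a = rank \<gamma> k" for a
    using permutes_surj[OF shuffle_rank_permutes] by blast
  have "a < b" if ab: "(base \<gamma> a, base \<gamma> b) \<in> P" "a \<noteq> b" for a b
  proof -
    obtain k l where kl: "a = rank \<gamma> k" "b = rank \<gamma> l"
      using surj by meson
    then have P: "(\<gamma> k, \<gamma> l) \<in> P" "k \<noteq> l"
      using ab by (auto simp: base_rank)
    then have "k < l"
      using \<gamma> by (simp add: SigmaR_iff)
    moreover have "k \<in> {1..N}" "l \<in> {1..N}"
      using P(1) P_range \<gamma>_range by blast+
    moreover from this have "k \<in> low \<gamma> \<longleftrightarrow> l \<in> low \<gamma>"
      using P_split[OF P(1)] by (simp add: low_def)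
    ultimately show ?thesis
      unfolding kl by (intro shuffle_rank_less)
  qed
  then have "base \<gamma> \<in> SigmaR N P"
    using p by (simp add: SigmaR_iff)
  moreover have "base \<gamma> a \<le> m \<longleftrightarrow> a \<le> m" for a
  proof -
    obtain k where k: "a = rank \<gamma> k"
      using surj by blast
    show ?thesis
    proof (cases "k \<in> {1..N}")
      case True
      then show ?thesis
        using rank_le_iff unfolding k base_rank by simp
    next
      case False
      then have "rank \<gamma> k = k" "\<gamma> k = k"
        using permutes_not_in[OF \<gamma>_permutes] by (auto simp: shuffle_rank_def)
      then show ?thesis
        unfolding k base_rank by simp
    qed
  qed
  ultimately show ?thesis
    by (simp add: parabolic_perms_def)
qed

lemma low_swap:
  assumes "i \<in> {1..<N}"
  shows "low (\<gamma> \<circ> simple_transp i) = swap_set i (low \<gamma>)"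
proof -
  have "simple_transp i k \<in> {1..N} \<longleftrightarrow> k \<in> {1..N}" for k
    using permutes_in_image[OF simple_transp_permutes[OF assms]] .
  then show ?thesis
    by (auto simp: low_def swap_set_def simp del: One_nat_def)
qed

lemma base_swap_diff:
  assumes "i \<in> {1..<N}" "i \<in> low \<gamma> \<longleftrightarrow> Suc i \<notin> low \<gamma>"
  shows "base (\<gamma> \<circ> simple_transp i) = base \<gamma>"
  by (rule base_unique)
    (simp add: low_swap[OF assms(1)] shuffle_rank_swap[OF assms] base_comp_rank flip: comp_assoc)

text \<open>Adjacent positions on the same side have consecutive ranks, so the transposition at
  \<open>i\<close> passes through \<open>rank \<gamma>\<close> and becomes the one at
  \<open>rank \<gamma> i\<close>. That index differs from \<open>m\<close>, because both ranks are
  on the same side of \<open>m\<close>.\<close>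

lemma base_swap_same:
  assumes i: "i \<in> {1..<N}" and same: "i \<in> low \<gamma> \<longleftrightarrow> Suc i \<in> low \<gamma>"
  shows "rank \<gamma> i \<in> {1..<N} - {m}" "base \<gamma> (rank \<gamma> i) = \<gamma> i" "base \<gamma> (Suc (rank \<gamma> i)) = \<gamma> (Suc i)"
    "swap_set i (low \<gamma>) = low \<gamma>" "base (\<gamma> \<circ> simple_transp i) = base \<gamma> \<circ> simple_transp (rank \<gamma> i)"
proof -
  have suc: "rank \<gamma> (Suc i) = Suc (rank \<gamma> i)"
    by (rule shuffle_rank_Suc[OF i same])
  have ir: "i \<in> {1..N}" "Suc i \<in> {1..N}"
    using i by auto
  have "rank \<gamma> i \<in> {1..N}" "rank \<gamma> (Suc i) \<in> {1..N}"
    using shuffle_rank_range(1) ir by blast+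
  moreover have "rank \<gamma> i \<le> m \<longleftrightarrow> rank \<gamma> (Suc i) \<le> m"
    using same ir rank_le_iff by (auto simp: low_def)
  ultimately show "rank \<gamma> i \<in> {1..<N} - {m}"
    using suc by auto
  show "base \<gamma> (rank \<gamma> i) = \<gamma> i" "base \<gamma> (Suc (rank \<gamma> i)) = \<gamma> (Suc i)"
    using base_rank[of \<gamma> i] base_rank[of \<gamma> "Suc i"] by (simp_all add: suc)
  show swap: "swap_set i (low \<gamma>) = low \<gamma>"
    using same by (auto simp: swap_set_iff simple_transp_apply split: if_splits)
  have "rank \<gamma> (simple_transp i k) = simple_transp (rank \<gamma> i) (rank \<gamma> k)" for k
  proof -
    have "rank \<gamma> k = rank \<gamma> l \<longleftrightarrow> k = l" for l
      using permutes_inj[OF shuffle_rank_permutes] by (simp add: inj_eq)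
    from this[of i] this[of "Suc i"] show ?thesis
      by (auto simp: simple_transp_apply suc)
  qed
  then have "simple_transp (rank \<gamma> i) \<circ> rank \<gamma> = rank \<gamma> \<circ> simple_transp i"
    by (simp add: fun_eq_iff)
  then have "base \<gamma> \<circ> simple_transp (rank \<gamma> i) \<circ> rank (\<gamma> \<circ> simple_transp i) = \<gamma> \<circ> simple_transp i"
    by (simp add: low_swap[OF i] swap comp_assoc) (simp add: base_comp_rank flip: comp_assoc)
  then show "base (\<gamma> \<circ> simple_transp i) = base \<gamma> \<circ> simple_transp (rank \<gamma> i)"
    by (rule base_unique)
qed

end

lemma W_SigmaR: "\<delta> \<in> W \<Longrightarrow> \<delta> \<in> SigmaR N P"
  by (simp add: parabolic_perms_def)

lemma low_W:
  assumes "\<delta> \<in> W"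
  shows "low \<delta> = {1..m}"
proof -
  have le: "\<delta> k \<le> m \<longleftrightarrow> k \<le> m" for k
    using assms unfolding parabolic_perms_def by blast
  show ?thesis
  proof (rule Set.set_eqI)
    show "k \<in> low \<delta> \<longleftrightarrow> k \<in> {1..m}" for k
      unfolding low_def mem_Collect_eq atLeastAtMost_iff using le[of k] by linarith
  qed
qed

lemma base_W: "\<delta> \<in> W \<Longrightarrow> base \<delta> = \<delta>"
  by (intro base_unique) (simp add: low_W shuffle_rank_initial del: One_nat_def)

lemma scaled_closed: "\<gamma> \<in> SigmaR N P \<Longrightarrow> scaled c \<gamma> \<in> carrier V"
  by (simp add: V.span_carrier basis_vec_def)

lemma act_gen_scaled:
  assumes "\<gamma> \<in> SigmaR N P" "i \<in> {1..<N}"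
  shows "act V (scaled c \<gamma>) (sort_gen e N i) = (\<lambda>\<tau>. c * sort_act e N P \<gamma> i \<tau>)"
  using sort_module_act_gen[OF e assms(2) scaled_closed[OF assms(1)]] assms(1)
  by (simp add: gen_op_scale gen_op_basis)

text \<open>Preimages of all multiples and not only of basis vectors: \<open>X\<close> is handled as
  an abelian group whose scalars act through the algebra.\<close>

definition pre :: "complex \<Rightarrow> perm \<Rightarrow> 'v" where
  "pre c \<delta> = inv_into (carrier X) j (scaled c \<delta>)"

lemma pre:
  assumes "\<delta> \<in> W"
  shows "pre c \<delta> \<in> carrier X" "j (pre c \<delta>) = scaled c \<delta>"
proof -
  have "scaled c \<delta> \<in> j ` carrier X"
    using j_surj[OF assms, of c] by force
  then show "pre c \<delta> \<in> carrier X" "j (pre c \<delta>) = scaled c \<delta>"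
    unfolding pre_def by (auto intro: inv_into_into f_inv_into_f)
qed

lemma pre_eqI: "\<lbrakk>z \<in> carrier X; j z = scaled c \<delta>\<rbrakk> \<Longrightarrow> pre c \<delta> = z"
  unfolding pre_def using inv_into_f_f[OF j_inj, of z] by simp

lemma j_closed: "z \<in> carrier X \<Longrightarrow> j z \<in> carrier V"
  using j_hom by (auto simp: hom_def)

lemma pre_add:
  assumes "\<delta> \<in> W"
  shows "pre (c + d) \<delta> = pre c \<delta> \<otimes>\<^bsub>X\<^esub> pre d \<delta>"
  by (rule pre_eqI) (simp_all add: assms pre hom_mult[OF j_hom] distrib_right)

lemma pre_zero: "pre 0 \<delta> = \<one>\<^bsub>X\<^esub>"
proof (rule pre_eqI)
  show "j \<one>\<^bsub>X\<^esub> = scaled 0 \<delta>"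
    using hom_one[OF j_hom X.is_group VM.M.is_group] by simp
qed simp

lemma pre_scalar:
  assumes "\<delta> \<in> W"
  shows "act X (pre c \<delta>) (d \<odot>\<^bsub>hecke N\<^esub> \<one>\<^bsub>hecke N\<^esub>) = pre (d * c) \<delta>"
  by (rule pre_eqI[symmetric])
    (simp_all add: assms pre j_act parabolic_scalar X_closed V.span_act_scalar mult.assoc)

definition shuf :: "perm \<Rightarrow> hecke_elem" where
  "shuf \<gamma> = sh.shuffle N (low \<gamma>)"

lemma shuf_closed [simp]: "shuf \<gamma> \<in> carrier (hecke N)"
  unfolding shuf_def by (rule sh.shuffle_closed) simp

text \<open>The tensor \<open>\<delta> \<otimes> T_S\<close> assigned to a basis vector, with the
  coefficient placed in the left factor.\<close>

definition lift1 :: "complex \<Rightarrow> perm \<Rightarrow> ('v \<times> hecke_elem \<Rightarrow>\<^sub>0 int) set" where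
  "lift1 c \<gamma> = pure (pre c (base \<gamma>)) (shuf \<gamma>)"

lemma lift1_closed: "\<gamma> \<in> SigmaR N P \<Longrightarrow> lift1 c \<gamma> \<in> carrier T"
  unfolding lift1_def by (intro pure_closed pre base_mem) simp_all

lemma pure_one_left: "b \<in> carrier (hecke N) \<Longrightarrow> pure \<one>\<^bsub>X\<^esub> b = \<one>\<^bsub>T\<^esub>"
  using pure_add_left[of "\<one>\<^bsub>X\<^esub>" "\<one>\<^bsub>X\<^esub>" b] by (simp add: T.l_cancel_one)

lemma lift1_zero: "lift1 0 \<gamma> = \<one>\<^bsub>T\<^esub>"
  by (simp add: lift1_def pre_zero pure_one_left)

lemma lift1_add:
  "\<gamma> \<in> SigmaR N P \<Longrightarrow> lift1 (c + d) \<gamma> = lift1 c \<gamma> \<otimes>\<^bsub>T\<^esub> lift1 d \<gamma>"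
  unfolding lift1_def by (simp add: pre_add base_mem pre pure_add_left)

lemma pure_scalar:
  assumes "x \<in> carrier X" "b \<in> carrier (hecke N)"
  shows "pure x (c \<odot>\<^bsub>hecke N\<^esub> b) = pure (act X x (c \<odot>\<^bsub>hecke N\<^esub> \<one>\<^bsub>hecke N\<^esub>)) b"
  using pure_balanced[OF assms(1) _ parabolic_scalar, of b c] assms(2) by (simp add: hecke.smult_mult_l)

lemma lift1_scale:
  "\<gamma> \<in> SigmaR N P \<Longrightarrow> lift1 (d * c) \<gamma> = pure (pre c (base \<gamma>)) (d \<odot>\<^bsub>hecke N\<^esub> shuf \<gamma>)"
  by (simp add: lift1_def pure_scalar pre base_mem pre_scalar)

text \<open>A product instead of a sum over the basis, because the tensor product is written as a
  multiplicative abelian group.\<close>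

definition lift :: "vec \<Rightarrow> ('v \<times> hecke_elem \<Rightarrow>\<^sub>0 int) set" where
  "lift v = finprod T (\<lambda>\<gamma>. lift1 (v \<gamma>) \<gamma>) (SigmaR N P)"

lemma lift_hom: "lift \<in> hom V T"
proof (rule homI)
  fix v w
  show "lift v \<in> carrier T"
    unfolding lift_def by (rule T.finprod_closed) (simp add: lift1_closed)
  show "lift (v \<otimes>\<^bsub>V\<^esub> w) = lift v \<otimes>\<^bsub>T\<^esub> lift w"
  proof -
    have "lift (v \<otimes>\<^bsub>V\<^esub> w)
        = finprod T (\<lambda>\<gamma>. lift1 (v \<gamma>) \<gamma> \<otimes>\<^bsub>T\<^esub> lift1 (w \<gamma>) \<gamma>) (SigmaR N P)"
      unfolding lift_def by (rule T.finprod_cong') (simp_all add: lift1_closed lift1_add)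
    then show ?thesis
      unfolding lift_def using lift1_closed by (simp add: T.finprod_multf)
  qed
qed

lemma lift_scaled:
  assumes "\<gamma> \<in> SigmaR N P"
  shows "lift (scaled c \<gamma>) = lift1 c \<gamma>"
proof -
  have "lift (scaled c \<gamma>) = finprod T (\<lambda>\<tau>. if \<gamma> = \<tau> then lift1 c \<tau> else \<one>\<^bsub>T\<^esub>) (SigmaR N P)"
    unfolding lift_def
    by (rule T.finprod_cong') (auto simp: basis_vec_def lift1_zero lift1_closed)
  also have "\<dots> = lift1 c \<gamma>"
    using assms by (intro T.finprod_singleton) (auto simp: lift1_closed)
  finally show ?thesis .
qed

lemma lift_zero: "lift (\<lambda>\<tau>. 0) = \<one>\<^bsub>T\<^esub>"
  using hom_one[OF lift_hom VM.M.is_group T.is_group] by simp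

lemma low_iff: "i \<in> {1..N} \<Longrightarrow> i \<in> low \<gamma> \<longleftrightarrow> \<gamma> i \<le> m"
  by (simp add: low_def)

lemma swap_mem:
  assumes "\<gamma> \<in> SigmaR N P" "i \<in> {1..<N}" "i \<in> low \<gamma> \<longleftrightarrow> Suc i \<notin> low \<gamma>"
  shows "\<gamma> \<circ> simple_transp i \<in> SigmaR N P"
proof -
  have "i \<in> {1..N}" "Suc i \<in> {1..N}"
    using assms(2) by auto
  then have "(\<gamma> i, \<gamma> (Suc i)) \<notin> P"
    using assms(3) P_split[of "\<gamma> i" "\<gamma> (Suc i)"] low_iff by blast
  then show ?thesis
    using SigmaR_simple_transp[OF assms(1,2)] by simp
qed

text \<open>If only \<open>i\<close> is low, the values at \<open>i\<close> and \<open>Suc i\<close>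
  are incomparable and the generator swaps the set of the shuffle. If only \<open>Suc i\<close> is
  low, there is a descent and the shuffle absorbs the generator. If both lie on one side, the
  generator turns into one of the parabolic subalgebra and acts on
  \<open>base \<gamma>\<close>.\<close>

lemma lift1_act_gen:
  assumes \<gamma>: "\<gamma> \<in> SigmaR N P" and i: "i \<in> {1..<N}"
  shows "act Ind (lift1 c \<gamma>) (sort_gen e N i) = lift (\<lambda>\<tau>. c * sort_act e N P \<gamma> i \<tau>)"
proof -
  have g: "sort_gen e N i \<in> carrier (hecke N)"
    using i by (rule sort_gen_closed)
  have ir: "i \<in> {1..N}" "Suc i \<in> {1..N}"
    using i by auto
  note b = base_mem[OF \<gamma>]
  note des = DesR_iff[OF SigmaR_permutes[OF \<gamma>] i]
  have L: "act Ind (lift1 c \<gamma>) (sort_gen e N i)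
      = pure (pre c (base \<gamma>)) (shuf \<gamma> \<otimes>\<^bsub>hecke N\<^esub> sort_gen e N i)"
    unfolding lift1_def using b g by (intro induced_act_pure pre) simp_all
  consider "i \<in> low \<gamma>" "Suc i \<notin> low \<gamma>" | "i \<notin> low \<gamma>" "Suc i \<in> low \<gamma>" | "i \<in> low \<gamma> \<longleftrightarrow> Suc i \<in> low \<gamma>"
    by blast
  then show ?thesis
  proof cases
    case 1
    then have diff: "i \<in> low \<gamma> \<longleftrightarrow> Suc i \<notin> low \<gamma>"
      by simp
    have "shuf \<gamma> \<otimes>\<^bsub>hecke N\<^esub> sort_gen e N i = shuf (\<gamma> \<circ> simple_transp i)"
      unfolding shuf_def low_swap[OF \<gamma> i] using 1 i by (intro sh.shuffle_ascent) auto
    moreover have "i \<notin> DesR N \<gamma>"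
      using 1 ir des by (auto simp: low_iff)
    ultimately show ?thesis
      using swap_mem[OF \<gamma> i diff]
      unfolding L by (simp add: sort_act_def lift_scaled lift1_def base_swap_diff[OF \<gamma> i diff])
  next
    case 2
    have "shuf \<gamma> \<otimes>\<^bsub>hecke N\<^esub> sort_gen e N i = e \<odot>\<^bsub>hecke N\<^esub> shuf \<gamma>"
      unfolding shuf_def using 2 i by (intro sh.shuffle_descent) auto
    moreover have "i \<in> DesR N \<gamma>"
      using 2 ir des by (auto simp: low_iff)
    ultimately show ?thesis
      using lift_scaled[OF \<gamma>, of "e * c"] lift1_scale[OF \<gamma>, of e c]
      unfolding L by (simp add: sort_act_def mult.left_commute mult.assoc)
  next
    case 3
    let ?k = "rank \<gamma> i"
    note s = base_swap_same[OF \<gamma> i 3]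
    have k: "?k \<in> {1..<N}"
      using s(1) by blast
    have gk: "sort_gen e N ?k \<in> carrier (parabolic m n)"
      using s(1) by (rule sort_gen_parabolic)
    have des': "?k \<in> DesR N (base \<gamma>) \<longleftrightarrow> i \<in> DesR N \<gamma>"
      using DesR_iff[OF SigmaR_permutes[OF W_SigmaR[OF b]] k] des s(2,3) by simp
    have mem: "base \<gamma> \<circ> simple_transp ?k \<in> SigmaR N P \<longleftrightarrow> \<gamma> \<circ> simple_transp i \<in> SigmaR N P"
      using SigmaR_simple_transp[OF \<gamma> i] SigmaR_simple_transp[OF W_SigmaR[OF b] k] s(2,3) by simp
    have jz: "j (act X (pre c (base \<gamma>)) (sort_gen e N ?k)) = (\<lambda>\<tau>. c * sort_act e N P (base \<gamma>) ?k \<tau>)"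
      using b gk act_gen_scaled[OF W_SigmaR[OF b] k] by (simp add: j_act pre)
    have xc: "act X (pre c (base \<gamma>)) (sort_gen e N ?k) \<in> carrier X"
      using b gk by (intro X_closed pre)
    have "shuf \<gamma> \<otimes>\<^bsub>hecke N\<^esub> sort_gen e N i = sort_gen e N ?k \<otimes>\<^bsub>hecke N\<^esub> shuf \<gamma>"
      unfolding shuf_def using 3 i by (intro sh.shuffle_same) auto
    \<comment> \<open>The index \<open>rank \<gamma> i\<close> is not \<open>m\<close>, so the
      generator may cross the tensor sign.\<close>
    then have L': "act Ind (lift1 c \<gamma>) (sort_gen e N i) = pure (act X (pre c (base \<gamma>)) (sort_gen e N ?k)) (shuf \<gamma>)"
      using pure_balanced[OF pre(1)[OF b] _ gk, of "shuf \<gamma>"] by (simp add: L)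
    consider "i \<in> DesR N \<gamma>" | "i \<notin> DesR N \<gamma>" "\<gamma> \<circ> simple_transp i \<notin> SigmaR N P"
      | "i \<notin> DesR N \<gamma>" "\<gamma> \<circ> simple_transp i \<in> SigmaR N P"
      by blast
    then show ?thesis
    proof cases
      case 1
      then have "pre (c * e) (base \<gamma>) = act X (pre c (base \<gamma>)) (sort_gen e N ?k)"
        using des' by (intro pre_eqI xc) (simp add: jz sort_act_def mult.assoc)
      then show ?thesis
        using 1 lift_scaled[OF \<gamma>, of "c * e"] unfolding L' by (simp add: sort_act_def lift1_def mult.assoc)
    next
      case 2
      then have "pre 0 (base \<gamma>) = act X (pre c (base \<gamma>)) (sort_gen e N ?k)"
        using des' mem by (intro pre_eqI xc) (simp add: jz sort_act_def)
      then have "act X (pre c (base \<gamma>)) (sort_gen e N ?k) = \<one>\<^bsub>X\<^esub>"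
        by (simp add: pre_zero)
      then show ?thesis
        using 2 unfolding L' by (simp add: sort_act_def lift_zero pre_zero pure_one_left)
    next
      case 3
      then have "pre c (base (\<gamma> \<circ> simple_transp i)) = act X (pre c (base \<gamma>)) (sort_gen e N ?k)"
        using des' mem by (intro pre_eqI xc) (simp add: jz sort_act_def s(5))
      moreover have "shuf (\<gamma> \<circ> simple_transp i) = shuf \<gamma>"
        by (simp add: shuf_def low_swap[OF \<gamma> i] s(4))
      ultimately show ?thesis
        using 3 unfolding L' by (simp add: sort_act_def lift_scaled lift1_def)
    qed
  qed
qed

lemma V_group: "comm_group V"
  by (rule VM.M.comm_group_axioms)

lemma act_V_hom: "r \<in> carrier (hecke N) \<Longrightarrow> (\<lambda>v. act V v r) \<in> hom V V"
  by (intro homI) (simp_all only: VM.act_closed VM.act_add_left)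

lemma lift_closed: "v \<in> carrier V \<Longrightarrow> lift v \<in> carrier T"
  using hom_in_carrier[OF lift_hom] .

lemma lift_act_gen:
  assumes "v \<in> carrier V" "i \<in> {1..<N}"
  shows "lift (act V v (sort_gen e N i)) = act Ind (lift v) (sort_gen e N i)"
proof (rule span_hom_eqI[OF T.is_group V_group _ _ finite_SigmaR _ assms(1),
    where F = "\<lambda>v. lift (act V v (sort_gen e N i))" and G = "\<lambda>v. act Ind (lift v) (sort_gen e N i)"])
  show "(\<lambda>v. lift (act V v (sort_gen e N i))) \<in> hom V T"
    by (rule hom_comp[OF act_V_hom lift_hom]) (rule sort_gen_closed[OF assms(2)])
  show "(\<lambda>v. act Ind (lift v) (sort_gen e N i)) \<in> hom V T"
    by (rule hom_comp[OF lift_hom induced_act_hom]) (rule sort_gen_closed[OF assms(2)])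
qed (simp only: act_gen_scaled assms(2) lift_scaled lift1_act_gen)

lemma lift_act_scalar:
  assumes "v \<in> carrier V"
  shows "lift (act V v (k \<odot>\<^bsub>hecke N\<^esub> \<one>\<^bsub>hecke N\<^esub>)) = act Ind (lift v) (k \<odot>\<^bsub>hecke N\<^esub> \<one>\<^bsub>hecke N\<^esub>)"
proof (rule span_hom_eqI[OF T.is_group V_group _ _ finite_SigmaR _ assms(1),
    where F = "\<lambda>v. lift (act V v (k \<odot>\<^bsub>hecke N\<^esub> \<one>\<^bsub>hecke N\<^esub>))"
      and G = "\<lambda>v. act Ind (lift v) (k \<odot>\<^bsub>hecke N\<^esub> \<one>\<^bsub>hecke N\<^esub>)"])
  have k: "k \<odot>\<^bsub>hecke N\<^esub> \<one>\<^bsub>hecke N\<^esub> \<in> carrier (hecke N)"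
    by simp
  show "(\<lambda>v. lift (act V v (k \<odot>\<^bsub>hecke N\<^esub> \<one>\<^bsub>hecke N\<^esub>))) \<in> hom V T"
    by (rule hom_comp[OF act_V_hom[OF k] lift_hom])
  show "(\<lambda>v. act Ind (lift v) (k \<odot>\<^bsub>hecke N\<^esub> \<one>\<^bsub>hecke N\<^esub>)) \<in> hom V T"
    by (rule hom_comp[OF lift_hom induced_act_hom[OF k]])
  fix \<gamma> c assume \<gamma>: "\<gamma> \<in> SigmaR N P"
  have "act Ind (lift1 c \<gamma>) (k \<odot>\<^bsub>hecke N\<^esub> \<one>\<^bsub>hecke N\<^esub>)
      = pure (pre c (base \<gamma>)) (shuf \<gamma> \<otimes>\<^bsub>hecke N\<^esub> (k \<odot>\<^bsub>hecke N\<^esub> \<one>\<^bsub>hecke N\<^esub>))"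
    unfolding lift1_def using k by (intro induced_act_pure pre base_mem[OF \<gamma>]) simp_all
  also have "\<dots> = lift1 (k * c) \<gamma>"
    by (simp add: lift1_scale[OF \<gamma>] hecke.smult_mult_r)
  finally show "lift (act V (scaled c \<gamma>) (k \<odot>\<^bsub>hecke N\<^esub> \<one>\<^bsub>hecke N\<^esub>))
      = act Ind (lift (scaled c \<gamma>)) (k \<odot>\<^bsub>hecke N\<^esub> \<one>\<^bsub>hecke N\<^esub>)"
    using \<gamma> lift_scaled[OF \<gamma>, of "k * c"]
    by (simp add: lift_scaled V.span_act_scalar mult.assoc)
qed

lemma lift_act:
  assumes v: "v \<in> carrier V" and h: "h \<in> carrier (hecke N)"
  shows "lift (act V v h) = act Ind (lift v) h"
  using h
proof (induction rule: hecke_induct)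
  case (scalar c)
  show ?case
    using v by (rule lift_act_scalar)
next
  case (add x y)
  then show ?case
    using v lift_closed[OF v] Ind.act_add_right[of "lift v" x y]
    by (simp add: VM.act_add_right hom_mult[OF lift_hom] VM.act_closed induced_simps(1,2) del: V.span_simps)
next
  case (mult x i)
  let ?u = "act V v x"
  have u: "?u \<in> carrier V"
    using v mult by (simp add: VM.act_closed)
  let ?s = "((1 + e) / 2) \<odot>\<^bsub>hecke N\<^esub> \<one>\<^bsub>hecke N\<^esub>"
  have p: "pibar N i \<in> carrier (hecke N)"
    using mult by simp
  have s: "?s \<in> carrier (hecke N)"
    by simp
  \<comment> \<open>\<open>sort_gen\<close> is \<open>pibar\<close> plus a scalar, and both maps are
    additive; the scalar part, already known to be respected, is cancelled.\<close>
  have "lift (act V ?u (sort_gen e N i)) = lift (act V ?u (pibar N i)) \<otimes>\<^bsub>T\<^esub> lift (act V ?u ?s)"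
    unfolding sort_gen_def VM.act_add_right[OF u p s]
    by (rule hom_mult[OF lift_hom]) (rule VM.act_closed[OF u], rule p s)+
  moreover have "act Ind (lift ?u) (sort_gen e N i)
      = act Ind (lift ?u) (pibar N i) \<otimes>\<^bsub>T\<^esub> act Ind (lift ?u) ?s"
    using Ind.act_add_right[of "lift ?u", OF _ p s] lift_closed[OF u]
    by (simp add: sort_gen_def induced_simps(1,2))
  ultimately have "lift (act V ?u (pibar N i)) \<otimes>\<^bsub>T\<^esub> act Ind (lift ?u) ?s
      = act Ind (lift ?u) (pibar N i) \<otimes>\<^bsub>T\<^esub> act Ind (lift ?u) ?s"
    using lift_act_gen[OF u mult(2)] lift_act_scalar[OF u] by simp
  then have "lift (act V ?u (pibar N i)) = act Ind (lift ?u) (pibar N i)"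
    using lift_closed[OF u] lift_closed[OF VM.act_closed[OF u p]] induced_act_closed p s
    by (metis T.right_cancel)
  then show ?case
    using v mult p lift_closed[OF v] by (simp add: VM.act_mult Ind.act_mult induced_simps(1))
qed

text \<open>Elements of \<open>W\<close> have trivial rank, so their shuffle is
  \<open>\<one>\<close> and \<open>lift\<close> leaves them in the left factor; additivity extends
  this to the image of \<open>j\<close>.\<close>

lemma lift_j:
  assumes z: "z \<in> carrier X"
  shows "lift (j z) = pure z \<one>\<^bsub>hecke N\<^esub>"
proof -
  \<comment> \<open>A module with zero generators, serving as the group of functions supported on
    \<open>W\<close>, to which \<open>span_hom_eqI\<close> applies.\<close>
  let ?U = "span_module W (\<lambda>\<gamma> i \<tau>. 0)"
  have U: "carrier ?U = {v. \<forall>\<tau>. v \<tau> \<noteq> 0 \<longrightarrow> \<tau> \<in> W}"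
    "monoid.mult ?U = (\<lambda>v w \<tau>. v \<tau> + w \<tau>)" "one ?U = (\<lambda>\<tau>. 0)"
    by (simp_all add: span_module_def)
  have fin: "finite W"
    by (rule finite_subset[OF _ finite_SigmaR[of N P]]) (auto simp: parabolic_perms_def)
  have add: "v \<otimes>\<^bsub>?U\<^esub> w \<in> carrier ?U" if "v \<in> carrier ?U" "w \<in> carrier ?U" for v w
  proof -
    have "v \<tau> \<noteq> 0 \<or> w \<tau> \<noteq> 0" if "v \<tau> + w \<tau> \<noteq> 0" for \<tau>
      using that by auto
    then show ?thesis
      using that by (simp add: U) blast
  qed
  have cg: "comm_group ?U"
  proof (rule comm_groupI)
    fix v w assume "v \<in> carrier ?U" "w \<in> carrier ?U"
    then show "v \<otimes>\<^bsub>?U\<^esub> w \<in> carrier ?U"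
      by (rule add)
  next
    fix v assume "v \<in> carrier ?U"
    then show "\<exists>w\<in>carrier ?U. w \<otimes>\<^bsub>?U\<^esub> v = \<one>\<^bsub>?U\<^esub>"
      by (intro bexI[of _ "\<lambda>\<tau>. - v \<tau>"]) (simp_all add: U)
  qed (simp_all add: U add_ac)
  have UV: "v \<in> carrier V" if "v \<in> carrier ?U" for v
    using that W_SigmaR by (auto simp: U V.span_carrier)
  have inv: "\<exists>z\<in>carrier X. j z = v" if v: "v \<in> carrier ?U" for v
  proof -
    have "\<exists>z\<in>carrier X. j z = proj C v" if "C \<subseteq> W" for C
      using finite_subset[OF that fin] that
    proof (induction C rule: finite_induct)
      case empty
      have "j \<one>\<^bsub>X\<^esub> = proj {} v"
        using hom_one[OF j_hom X.is_group VM.M.is_group] by (simp add: proj_def)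
      then show ?case
        by blast
    next
      case (insert \<gamma> C)
      then obtain y where y: "y \<in> carrier X" "j y = proj C v"
        by blast
      have "j (pre (v \<gamma>) \<gamma> \<otimes>\<^bsub>X\<^esub> y) = proj (insert \<gamma> C) v"
        using insert.prems insert.hyps(2) y
        by (auto simp: hom_mult[OF j_hom] pre proj_def basis_vec_def intro!: ext)
      moreover have "pre (v \<gamma>) \<gamma> \<otimes>\<^bsub>X\<^esub> y \<in> carrier X"
        using insert.prems y by (simp add: pre)
      ultimately show ?case
        by blast
    qed
    then show ?thesis
      using proj_span[OF v] by (metis order_refl)
  qed
  let ?i = "inv_into (carrier X) j"
  have i: "?i v \<in> carrier X" "j (?i v) = v" if "v \<in> carrier ?U" for v
    using inv[OF that] by (metis image_eqI inv_into_into f_inv_into_f)+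
  have ij: "?i (j y) = y" if "y \<in> carrier X" for y
    using inv_into_f_f[OF j_inj that] .
  have "lift (j z) = pure (?i (j z)) \<one>\<^bsub>hecke N\<^esub>"
  proof (rule span_hom_eqI[OF T.is_group cg _ _ fin,
      where F = lift and G = "\<lambda>v. pure (?i v) \<one>\<^bsub>hecke N\<^esub>"])
    show "lift \<in> hom ?U T"
      using hom_mult[OF lift_hom] UV lift_closed by (intro homI) (simp_all add: U(2))
    show "(\<lambda>v. pure (?i v) \<one>\<^bsub>hecke N\<^esub>) \<in> hom ?U T"
    proof (rule homI)
      fix v w assume v: "v \<in> carrier ?U" and w: "w \<in> carrier ?U"
      show "pure (?i v) \<one>\<^bsub>hecke N\<^esub> \<in> carrier T"
        using i(1)[OF v] by simp
      have "j (?i v \<otimes>\<^bsub>X\<^esub> ?i w) = v \<otimes>\<^bsub>?U\<^esub> w"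
        using hom_mult[OF j_hom i(1)[OF v] i(1)[OF w]] i(2)[OF v] i(2)[OF w] by (simp add: U(2))
      then have "?i (v \<otimes>\<^bsub>?U\<^esub> w) = ?i v \<otimes>\<^bsub>X\<^esub> ?i w"
        using ij[of "?i v \<otimes>\<^bsub>X\<^esub> ?i w"] i(1)[OF v] i(1)[OF w] by simp
      then show "pure (?i (v \<otimes>\<^bsub>?U\<^esub> w)) \<one>\<^bsub>hecke N\<^esub> = pure (?i v) \<one>\<^bsub>hecke N\<^esub> \<otimes>\<^bsub>T\<^esub> pure (?i w) \<one>\<^bsub>hecke N\<^esub>"
        using pure_add_left[OF i(1)[OF v] i(1)[OF w]] by simp
    qed
    show "j z \<in> carrier ?U"
      using j_support[OF z] by (simp add: U)
    fix \<gamma> c assume \<gamma>: "\<gamma> \<in> W"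
    have "shuf \<gamma> = \<one>\<^bsub>hecke N\<^esub>"
      unfolding shuf_def low_W[OF \<gamma>] by (rule sh.shuffle_initial) simp_all
    then show "lift (scaled c \<gamma>) = pure (?i (scaled c \<gamma>)) \<one>\<^bsub>hecke N\<^esub>"
      using lift_scaled[OF W_SigmaR[OF \<gamma>], of c] by (simp add: lift1_def base_W[OF \<gamma>] pre_def)
  qed
  then show ?thesis
    using ij[OF z] by simp
qed

definition eval :: "('v \<times> hecke_elem \<Rightarrow>\<^sub>0 int) set \<Rightarrow> vec" where
  "eval = tensor_lift V (\<lambda>(z, b). act V (j z) b)"

lemma eval_biadditive: "biadditive (carrier (parabolic m n)) X (left_regular (hecke N)) V (\<lambda>(z, b). act V (j z) b)"
  by (rule biadditiveI)
    (use parabolic_subset in \<open>simp_all add: j_closed VM.act_closed hom_mult[OF j_hom] VM.act_add_left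
      VM.act_add_right j_act VM.act_mult del: V.span_simps\<close>)

lemma eval_hom: "eval \<in> hom T V"
  unfolding eval_def by (rule tensor_lift_hom[OF V_group eval_biadditive])

lemma eval_pure: "\<lbrakk>z \<in> carrier X; b \<in> carrier (hecke N)\<rbrakk> \<Longrightarrow> eval (pure z b) = act V (j z) b"
  unfolding eval_def using tensor_lift_pure[OF V_group eval_biadditive, of z b] by simp

lemma eval_act:
  assumes "Z \<in> carrier T" "r \<in> carrier (hecke N)"
  shows "eval (act Ind Z r) = act V (eval Z) r"
  by (rule tensor_hom_eqI[OF VM.M.is_group hom_comp[OF induced_act_hom[OF assms(2)] eval_hom]
      hom_comp[OF eval_hom act_V_hom[OF assms(2)]] _ assms(1)])
    (use assms(2) in \<open>simp add: induced_act_pure eval_pure j_closed VM.act_mult\<close>)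

text \<open>Equivariance and \<open>lift_j\<close> give \<open>lift (j z \<cdot> b) = (z \<otimes>
  1) \<cdot> b = z \<otimes> b\<close>. This yields the injectivity of \<open>eval\<close>, which
  bounds the size of the induced module.\<close>

lemma lift_eval:
  assumes "Z \<in> carrier T"
  shows "lift (eval Z) = Z"
proof (rule tensor_hom_eqI[OF T.is_group hom_comp[OF eval_hom lift_hom] _ _ assms])
  show "(\<lambda>Z. Z) \<in> hom T T"
    by (simp add: hom_def)
  fix z b assume "z \<in> carrier X" "b \<in> carrier (left_regular (hecke N))"
  then show "lift (eval (pure z b)) = pure z b"
    by (simp add: eval_pure lift_act j_closed lift_j induced_act_pure)
qed

text \<open>Sorting \<open>\<gamma>\<close> down to \<open>base \<gamma>\<close>, one letter of the shuffle at a time.\<close>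

lemma act_base_shuf:
  assumes "\<gamma> \<in> SigmaR N P"
  shows "act V (scaled c (base \<gamma>)) (shuf \<gamma>) = scaled c \<gamma>"
  using assms
proof (induction "card (inversions N \<gamma>)" arbitrary: \<gamma> rule: less_induct)
  case less
  note \<gamma> = less.prems
  show ?case
  proof (cases "\<exists>i\<in>{1..<N}. i \<notin> low \<gamma> \<and> Suc i \<in> low \<gamma>")
    case True
    then obtain i where i: "i \<in> {1..<N}" "i \<notin> low \<gamma>" "Suc i \<in> low \<gamma>"
      by blast
    let ?\<gamma> = "\<gamma> \<circ> simple_transp i"
    have ir: "i \<in> {1..N}" "Suc i \<in> {1..N}"
      using i(1) by auto
    have diff: "i \<in> low \<gamma> \<longleftrightarrow> Suc i \<notin> low \<gamma>"
      using i by simp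
    have less': "\<gamma> (Suc i) < \<gamma> i"
      using i ir by (simp add: low_iff)
    have \<gamma>': "?\<gamma> \<in> SigmaR N P"
      by (rule swap_mem[OF \<gamma> i(1) diff])
    have IH: "act V (scaled c (base ?\<gamma>)) (shuf ?\<gamma>) = scaled c ?\<gamma>"
      using less.hyps[OF _ \<gamma>'] card_inversions_descent[OF i(1) less'] by simp
    have "sh.shuffle N (swap_set i (low \<gamma>)) \<otimes>\<^bsub>hecke N\<^esub> sort_gen e N i
        = sh.shuffle N (swap_set i (swap_set i (low \<gamma>)))"
      using i by (intro sh.shuffle_ascent) (auto simp: swap_set_iff simple_transp_apply)
    then have s: "shuf \<gamma> = shuf ?\<gamma> \<otimes>\<^bsub>hecke N\<^esub> sort_gen e N i"
      by (simp add: shuf_def low_swap[OF \<gamma> i(1)])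
    have "act V (scaled c (base \<gamma>)) (shuf \<gamma>) = act V (scaled c ?\<gamma>) (sort_gen e N i)"
      using s scaled_closed[OF W_SigmaR[OF base_mem[OF \<gamma>]], of c] sort_gen_closed[OF i(1), of e] IH
      by (simp add: VM.act_mult base_swap_diff[OF \<gamma> i(1) diff])
    also have "\<dots> = scaled c \<gamma>"
    proof -
      have "i \<notin> DesR N ?\<gamma>"
        using DesR_iff[OF SigmaR_permutes[OF \<gamma>'] i(1)] less' by (simp add: simple_transp_apply)
      then show ?thesis
        using act_gen_scaled[OF \<gamma>' i(1)] \<gamma> by (simp add: sort_act_def)
    qed
    finally show ?thesis .
  next
    case False
    then have step: "i \<in> low \<gamma>" if "i \<in> {1..<N}" "Suc i \<in> low \<gamma>" for i
      using that by blast
    \<comment> \<open>Without a high position directly before a low one, \<open>low \<gamma>\<close>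
      is closed downwards; having \<open>m\<close> elements it is \<open>{1..m}\<close>, so
      \<open>\<gamma>\<close> is its own base.\<close>
    have down: "k \<in> low \<gamma>" if "l \<in> low \<gamma>" "1 \<le> k" "k \<le> l" for k l
      using that(3,2,1)
    proof (induction k rule: inc_induct)
      case (step k)
      then have "l \<in> {1..N}"
        by (simp add: low_def)
      then show ?case
        using step \<open>\<And>i. i \<in> {1..<N} \<Longrightarrow> Suc i \<in> low \<gamma> \<Longrightarrow> i \<in> low \<gamma>\<close>[of k] by auto
    qed
    have "low \<gamma> = {1..m}"
    proof (cases "low \<gamma> = {}")
      case True
      then show ?thesis
        using card_low[OF \<gamma>] by simp
    next
      case False
      have fin: "finite (low \<gamma>)"
        by (simp add: low_def)
      have "low \<gamma> = {1..Max (low \<gamma>)}"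
      proof (intro equalityI subsetI)
        fix k assume "k \<in> low \<gamma>"
        then show "k \<in> {1..Max (low \<gamma>)}"
          using Max_ge[OF fin] by (auto simp: low_def)
      next
        fix k assume "k \<in> {1..Max (low \<gamma>)}"
        then show "k \<in> low \<gamma>"
          using down[OF Max_in[OF fin False]] by simp
      qed
      moreover have "low \<gamma> \<inter> {1..N} = low \<gamma>"
        by (auto simp: low_def)
      ultimately show ?thesis
        using card_low[OF \<gamma>] by (metis card_atLeastAtMost diff_Suc_1)
    qed
    then have "base \<gamma> = \<gamma>" "shuf \<gamma> = \<one>\<^bsub>hecke N\<^esub>"
      by (auto intro!: base_unique sh.shuffle_initial simp: shuffle_rank_initial shuf_def simp del: One_nat_def)
    then show ?thesis
      using VM.act_one[OF scaled_closed[OF \<gamma>]] by simp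
  qed
qed

lemma eval_lift:
  assumes "v \<in> carrier V"
  shows "eval (lift v) = v"
proof (rule span_hom_eqI[OF VM.M.is_group V_group hom_comp[OF lift_hom eval_hom] _ finite_SigmaR _ assms])
  show "(\<lambda>v. v) \<in> hom V V"
    by (simp add: hom_def)
  fix \<gamma> c assume \<gamma>: "\<gamma> \<in> SigmaR N P"
  then show "eval (lift (scaled c \<gamma>)) = scaled c \<gamma>"
    by (simp add: lift_scaled lift1_def eval_pure pre base_mem act_base_shuf)
qed

theorem induced_rmod_iso: "rmod_iso (hecke N) Ind V"
proof (rule rmod_isoI[OF induced_right_module V.span_right_module, of eval])
  have "bij_betw eval (carrier T) (carrier V)"
    by (rule bij_betw_byWitness[of _ lift])
      (use lift_eval eval_lift lift_closed hom_in_carrier[OF eval_hom] in auto)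
  then show "eval \<in> iso Ind V"
    using eval_hom by (simp add: iso_def hom_def induced_simps(1,2))
qed (simp add: eval_act induced_simps(1))

end

section \<open>Induction products of poset modules\<close>

definition join :: "nat \<Rightarrow> (nat \<times> nat) set \<Rightarrow> (nat \<times> nat) set \<Rightarrow> (nat \<times> nat) set" where
  "join m P1 P2 = P1 \<union> {(m + a, m + b) | a b. (a, b) \<in> P2}"

lemma join_range:
  assumes "P1 \<subseteq> {1..m} \<times> {1..m}" "P2 \<subseteq> {1..n} \<times> {1..n}"
  shows "join m P1 P2 \<subseteq> {1..m + n} \<times> {1..m + n}"
  using assms by (fastforce simp: join_def)

lemma join_split:
  assumes "P1 \<subseteq> {1..m} \<times> {1..m}" "P2 \<subseteq> {1..n} \<times> {1..n}" "(u, w) \<in> join m P1 P2"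
  shows "u \<le> m \<longleftrightarrow> w \<le> m"
  using assms by (fastforce simp: join_def)

lemma join_converse: "(join m P1 P2)\<inverse> = join m (P1\<inverse>) (P2\<inverse>)"
  by (auto simp: join_def)

lemma bar_range: "bar n P \<subseteq> {1..n} \<times> {1..n}"
  by (auto simp: bar_def)

lemma joinI: "(a, b) \<in> P1 \<Longrightarrow> (a, b) \<in> join m P1 P2" "(a, b) \<in> P2 \<Longrightarrow> (m + a, m + b) \<in> join m P1 P2"
  unfolding join_def by blast+

lemma barI: "\<lbrakk>u \<in> {1..n}; w \<in> {1..n}; (n + 1 - u, n + 1 - w) \<in> P\<rbrakk> \<Longrightarrow> (u, w) \<in> bar n P"
  unfolding bar_def by blast

lemma barD: "(u, w) \<in> bar n P \<Longrightarrow> u \<in> {1..n} \<and> w \<in> {1..n} \<and> (n + 1 - u, n + 1 - w) \<in> P"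
  unfolding bar_def by blast

text \<open>Reversal of \<open>{1..m + n}\<close> exchanges the two blocks; this is the source of
  the exchanged factors in the statements for \<open>hecke_phi\<close> and
  \<open>hecke_chi\<close>.\<close>

lemma bar_join:
  assumes P1: "P1 \<subseteq> {1..m} \<times> {1..m}" and P2: "P2 \<subseteq> {1..n} \<times> {1..n}"
  shows "bar (m + n) (join m P1 P2) = join n (bar n P2) (bar m P1)"
proof (intro equalityI subrelI)
  fix u w assume uw: "(u, w) \<in> bar (m + n) (join m P1 P2)"
  note r = barD[OF uw]
  then consider "(m + n + 1 - u, m + n + 1 - w) \<in> P1"
    | a b where "m + n + 1 - u = m + a" "m + n + 1 - w = m + b" "(a, b) \<in> P2"
    unfolding join_def by blast
  then show "(u, w) \<in> join n (bar n P2) (bar m P1)"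
  proof cases
    case 1
    then have "m + n + 1 - u \<in> {1..m}" "m + n + 1 - w \<in> {1..m}"
      using P1 by blast+
    then have c: "u = n + (u - n)" "w = n + (w - n)" "m + n + 1 - u = m + 1 - (u - n)"
      "m + n + 1 - w = m + 1 - (w - n)" "u - n \<in> {1..m}" "w - n \<in> {1..m}"
      using r by auto
    have "(u - n, w - n) \<in> bar m P1"
      using 1 unfolding c(3,4) by (rule barI[OF c(5,6)])
    then show ?thesis
      by (subst c(1), subst c(2)) (rule joinI)
  next
    case 2
    then have "a \<in> {1..n}" "b \<in> {1..n}"
      using P2 by blast+
    then have c: "a = n + 1 - u" "b = n + 1 - w" "u \<in> {1..n}" "w \<in> {1..n}"
      using 2(1,2) r by auto
    have "(u, w) \<in> bar n P2"
      using 2(3) unfolding c(1,2) by (rule barI[OF c(3,4)])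
    then show ?thesis
      by (rule joinI)
  qed
next
  fix u w assume "(u, w) \<in> join n (bar n P2) (bar m P1)"
  then consider "(u, w) \<in> bar n P2" | a b where "u = n + a" "w = n + b" "(a, b) \<in> bar m P1"
    unfolding join_def by blast
  then show "(u, w) \<in> bar (m + n) (join m P1 P2)"
  proof cases
    case 1
    note u = barD[OF 1]
    then have "u \<in> {1..m + n}" "w \<in> {1..m + n}" "m + n + 1 - u = m + (n + 1 - u)"
      "m + n + 1 - w = m + (n + 1 - w)"
      by auto
    then show ?thesis
      using u by (intro barI) (simp_all only: joinI)
  next
    case 2
    note a = barD[OF 2(3)]
    then have "u \<in> {1..m + n}" "w \<in> {1..m + n}" "m + n + 1 - u = m + 1 - a" "m + n + 1 - w = m + 1 - b"
      using 2(1,2) by auto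
    then show ?thesis
      using a by (intro barI) (simp_all only: joinI)
  qed
qed

lemma hecke_gens_initial:
  assumes "hecke_gens A d g" "m \<le> d"
  shows "hecke_gens A m g"
  using assms unfolding hecke_gens_def by fastforce

lemma hecke_gens_shift:
  assumes "hecke_gens A (m + n) g"
  shows "hecke_gens A n (\<lambda>i. g (m + i))"
proof -
  have mem: "m + i \<in> {1..<m + n}" if "i \<in> {1..<n}" for i
    using that by auto
  note g = assms[unfolded hecke_gens_def]
  show ?thesis
    unfolding hecke_gens_def
  proof (intro conjI ballI impI)
    show "(\<lambda>i. g (m + i)) ` {1..<n} \<subseteq> carrier A"
      using g mem by blast
  next
    fix i assume "i \<in> {1..<n}"
    then show "g (m + i) \<otimes>\<^bsub>A\<^esub> g (m + i) = \<ominus>\<^bsub>A\<^esub> g (m + i)"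
      using g mem by blast
  next
    fix i assume "i \<in> {1..<n}" "i + 1 \<in> {1..<n}"
    then show "g (m + i) \<otimes>\<^bsub>A\<^esub> (g (m + (i + 1)) \<otimes>\<^bsub>A\<^esub> g (m + i))
        = g (m + (i + 1)) \<otimes>\<^bsub>A\<^esub> (g (m + i) \<otimes>\<^bsub>A\<^esub> g (m + (i + 1)))"
      using g mem[of i] mem[of "i + 1"] by (simp add: add.assoc[symmetric])
  next
    fix i j assume "i \<in> {1..<n}" "j \<in> {1..<n}" "i + 2 \<le> j"
    moreover from this have "m + i + 2 \<le> m + j"
      by simp
    ultimately show "g (m + i) \<otimes>\<^bsub>A\<^esub> g (m + j) = g (m + j) \<otimes>\<^bsub>A\<^esub> g (m + i)"
      using g mem by blast
  qed
qed

section \<open>Block sums of permutations\<close>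

definition comb :: "nat \<Rightarrow> perm \<Rightarrow> perm \<Rightarrow> perm" where
  "comb m \<gamma>1 \<gamma>2 = (\<lambda>i. if i \<le> m then \<gamma>1 i else m + \<gamma>2 (i - m))"

definition left_part :: "nat \<Rightarrow> perm \<Rightarrow> perm" where
  "left_part m \<tau> = (\<lambda>i. if i \<le> m then \<tau> i else i)"

text \<open>At \<open>k = 0\<close> the subtraction truncates: if \<open>\<tau> m \<le> m\<close>,
  the value is \<open>0\<close>, as a permutation of \<open>{1..n}\<close> requires.\<close>

definition right_part :: "nat \<Rightarrow> perm \<Rightarrow> perm" where
  "right_part m \<tau> = (\<lambda>i. \<tau> (m + i) - m)"

lemma comb_parts:
  assumes "\<And>k. \<tau> k \<le> m \<longleftrightarrow> k \<le> m"
  shows "comb m (left_part m \<tau>) (right_part m \<tau>) = \<tau>"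
proof
  fix k
  show "comb m (left_part m \<tau>) (right_part m \<tau>) k = \<tau> k"
    using assms[of k] by (auto simp: comb_def left_part_def right_part_def)
qed

lemma permutes_le_iff: "\<gamma> permutes {1..m} \<Longrightarrow> \<gamma> k \<le> m \<longleftrightarrow> k \<le> (m :: nat)"
  using permutes_in_image[of \<gamma> "{1..m}" k] permutes_not_in[of \<gamma> "{1..m}" k]
  by (cases "k = 0") auto

lemma left_part_comb: "\<gamma>1 permutes {1..m} \<Longrightarrow> left_part m (comb m \<gamma>1 \<gamma>2) = \<gamma>1"
  using permutes_not_in[of \<gamma>1 "{1..m}"] by (auto simp: left_part_def comb_def fun_eq_iff)

lemma permutes_zero: "\<gamma> permutes {1..m} \<Longrightarrow> \<gamma> 0 = (0 :: nat)"
  using permutes_not_in[of \<gamma> "{1..m}" 0] by simp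

lemma right_part_comb:
  assumes "\<gamma>1 permutes {1..m}" "\<gamma>2 permutes {1..n}"
  shows "right_part m (comb m \<gamma>1 \<gamma>2) = \<gamma>2"
proof
  fix k
  show "right_part m (comb m \<gamma>1 \<gamma>2) k = \<gamma>2 k"
    using permutes_le_iff[OF assms(1), of m] permutes_zero[OF assms(2)]
    by (cases "k = 0") (auto simp: right_part_def comb_def)
qed

lemma permutes_zero_iff: "\<gamma> permutes {1..m} \<Longrightarrow> \<gamma> k = 0 \<longleftrightarrow> k = (0 :: nat)"
  using permutes_inj[of \<gamma> "{1..m}"] permutes_zero[of \<gamma> m] by (metis injD)

lemma comb_le_iff:
  assumes "\<gamma>1 permutes {1..m}" "\<gamma>2 permutes {1..n}"
  shows "comb m \<gamma>1 \<gamma>2 k \<le> m \<longleftrightarrow> k \<le> m"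
  using permutes_le_iff[OF assms(1), of k] permutes_zero_iff[OF assms(2), of "k - m"]
  by (auto simp: comb_def)

lemma comb_comp:
  assumes "\<delta>1 permutes {1..m}" "\<delta>2 permutes {1..n}"
  shows "comb m \<gamma>1 \<gamma>2 \<circ> comb m \<delta>1 \<delta>2 = comb m (\<gamma>1 \<circ> \<delta>1) (\<gamma>2 \<circ> \<delta>2)"
proof
  fix k
  show "(comb m \<gamma>1 \<gamma>2 \<circ> comb m \<delta>1 \<delta>2) k = comb m (\<gamma>1 \<circ> \<delta>1) (\<gamma>2 \<circ> \<delta>2) k"
    using comb_le_iff[OF assms, of k] by (auto simp: comb_def)
qed

lemma comb_permutes:
  assumes "\<gamma>1 permutes {1..m}" "\<gamma>2 permutes {1..n}"
  shows "comb m \<gamma>1 \<gamma>2 permutes {1..m + n}"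
proof -
  have id: "comb m id id = id"
    by (auto simp: comb_def)
  have "bij (comb m \<gamma>1 \<gamma>2)"
  proof (rule o_bij)
    show "comb m \<gamma>1 \<gamma>2 \<circ> comb m (inv_into UNIV \<gamma>1) (inv_into UNIV \<gamma>2) = id"
      using assms by (simp add: comb_comp[OF permutes_inv permutes_inv] permutes_inv_o id)
    show "comb m (inv_into UNIV \<gamma>1) (inv_into UNIV \<gamma>2) \<circ> comb m \<gamma>1 \<gamma>2 = id"
      using assms by (simp add: comb_comp permutes_inv_o id)
  qed
  moreover have "comb m \<gamma>1 \<gamma>2 k = k" if "k \<notin> {1..m + n}" for k
  proof (cases "k = 0")
    case True
    then show ?thesis
      using permutes_zero[OF assms(1)] by (simp add: comb_def)
  next
    case False
    then have k: "m + n < k"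
      using that by simp
    then have "k - m \<notin> {1..n}"
      by auto
    then have "\<gamma>2 (k - m) = k - m"
      by (rule permutes_not_in[OF assms(2)])
    then show ?thesis
      using k by (simp add: comb_def)
  qed
  ultimately show ?thesis
    unfolding permutes_def bij_iff by blast
qed

lemma comb_simple_transp_left:
  assumes "i \<in> {1..<m}"
  shows "comb m \<gamma>1 \<gamma>2 \<circ> simple_transp i = comb m (\<gamma>1 \<circ> simple_transp i) \<gamma>2"
  using assms by (auto simp: comb_def simple_transp_apply fun_eq_iff)

lemma comb_simple_transp_right:
  assumes "1 \<le> i"
  shows "comb m \<gamma>1 \<gamma>2 \<circ> simple_transp (m + i) = comb m \<gamma>1 (\<gamma>2 \<circ> simple_transp i)"
  using assms by (auto simp: comb_def simple_transp_apply fun_eq_iff)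

section \<open>The outer tensor product inside the poset module of the union\<close>

locale outer_sort =
  fixes e :: complex and m n :: nat and P1 P2 :: "(nat \<times> nat) set"
  assumes e: "e = -1 \<or> e = 1"
    and P1: "P1 \<subseteq> {1..m} \<times> {1..m}" and P2: "P2 \<subseteq> {1..n} \<times> {1..n}"
begin

abbreviation "N \<equiv> m + n"
abbreviation "P \<equiv> join m P1 P2"
abbreviation "M1 \<equiv> sort_module e m P1"
abbreviation "M2 \<equiv> sort_module e n P2"
abbreviation "V \<equiv> sort_module e N P"
abbreviation "W \<equiv> parabolic_perms m N P"
abbreviation "X1 \<equiv> mod_space (hecke m) M1"
abbreviation "X2 \<equiv> mod_space (hecke n) M2"

sublocale A1: span_data m "SigmaR m P1" "shift_act e m P1"
  by (rule span_data_sort_module[OF e])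
sublocale A2: span_data n "SigmaR n P2" "shift_act e n P2"
  by (rule span_data_sort_module[OF e])
sublocale AV: span_data N "SigmaR N P" "shift_act e N P"
  by (rule span_data_sort_module[OF e])

interpretation R1: right_module "hecke m" M1
  by (rule A1.span_right_module)
interpretation R2: right_module "hecke n" M2
  by (rule A2.span_right_module)
interpretation RV: right_module "hecke N" V
  by (rule AV.span_right_module)

lemma mod_space_simps:
  "carrier (mod_space A M) = carrier M" "monoid.mult (mod_space A M) = monoid.mult M"
  "one (mod_space A M) = one M" "act (mod_space A M) x c = act M x (c \<odot>\<^bsub>A\<^esub> \<one>\<^bsub>A\<^esub>)"
  by (simp_all add: mod_space_def)

lemma alg_space_simps:
  "carrier (alg_space A) = carrier A" "monoid.mult (alg_space A) = add A"
  "one (alg_space A) = ring.zero A" "act (alg_space A) a c = c \<odot>\<^bsub>A\<^esub> a"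
  by (simp_all add: alg_space_def)

sublocale K: tensor_data UNIV X1 X2
proof (intro tensor_data.intro tensor_data_axioms.intro)
  show "comm_group X1"
    by (rule comm_group_cong[OF right_module_comm_group[OF A1.span_right_module]])
      (simp_all only: mod_space_simps)
  show "comm_group X2"
    by (rule comm_group_cong[OF right_module_comm_group[OF A2.span_right_module]])
      (simp_all only: mod_space_simps)
qed (simp_all only: mod_space_simps R1.act_closed R2.act_closed hecke.smult_closed hecke.one_closed)

sublocale H: tensor_data UNIV "alg_space (hecke m)" "alg_space (hecke n)"
proof (intro tensor_data.intro tensor_data_axioms.intro)
  have cg: "comm_group (alg_space (hecke d))" for d
    by (rule comm_group_cong[OF hecke.a_comm_group]) (simp_all add: alg_space_simps)
  show "comm_group (alg_space (hecke m))" "comm_group (alg_space (hecke n))"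
    by (rule cg)+
qed (simp_all add: alg_space_simps)

interpretation KG: comm_group K.T
  by (rule K.tensor_comm_group)
interpretation HG: comm_group H.T
  by (rule H.tensor_comm_group)

lemma join_left_iff: "a \<le> m \<Longrightarrow> b \<le> m \<Longrightarrow> (a, b) \<in> P \<longleftrightarrow> (a, b) \<in> P1"
  using P2 by (auto simp: join_def)

lemma join_right_iff: "1 \<le> a \<Longrightarrow> (m + a, m + b) \<in> P \<longleftrightarrow> (a, b) \<in> P2"
  using P1 by (auto simp: join_def)

text \<open>A comparable pair of the union lies in one block, so the order condition splits into
  those of the two factors.\<close>

lemma comb_mem:
  assumes g1: "\<gamma>1 \<in> SigmaR m P1" and g2: "\<gamma>2 \<in> SigmaR n P2"
  shows "comb m \<gamma>1 \<gamma>2 \<in> W"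
proof -
  note p = SigmaR_permutes[OF g1] SigmaR_permutes[OF g2]
  have "a < b" if ab: "(comb m \<gamma>1 \<gamma>2 a, comb m \<gamma>1 \<gamma>2 b) \<in> P" "a \<noteq> b" for a b
  proof -
    have "a \<le> m \<longleftrightarrow> b \<le> m"
      using join_split[OF P1 P2 ab(1)] comb_le_iff[OF p] by simp
    then consider "a \<le> m" "b \<le> m" | "m < a" "m < b"
      by linarith
    then show ?thesis
    proof cases
      case 1
      then have "(\<gamma>1 a, \<gamma>1 b) \<in> P1"
        using ab(1) permutes_le_iff[OF p(1)] join_left_iff by (simp add: comb_def)
      then show ?thesis
        using g1 ab(2) by (simp add: SigmaR_iff)
    next
      case 2
      then have "1 \<le> \<gamma>2 (a - m)"
        using permutes_zero_iff[OF p(2), of "a - m"] by simp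
      then have "(\<gamma>2 (a - m), \<gamma>2 (b - m)) \<in> P2"
        using 2 ab(1) join_right_iff by (simp add: comb_def)
      moreover have "a - m \<noteq> b - m"
        using 2 ab(2) by linarith
      ultimately have "a - m < b - m"
        using g2 by (simp add: SigmaR_iff)
      then show ?thesis
        by linarith
    qed
  qed
  then show ?thesis
    using comb_permutes[OF p] comb_le_iff[OF p] by (simp add: parabolic_perms_def SigmaR_iff)
qed

context
  fixes \<tau>
  assumes \<tau>: "\<tau> \<in> W"
begin

lemma W_facts: "\<tau> \<in> SigmaR N P" "\<tau> permutes {1..N}" "\<tau> k \<le> m \<longleftrightarrow> k \<le> m"
  using \<tau> SigmaR_permutes unfolding parabolic_perms_def by blast+

lemma comb_W: "comb m (left_part m \<tau>) (right_part m \<tau>) = \<tau>"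
  by (rule comb_parts) (rule W_facts)

lemma left_part_mem: "left_part m \<tau> \<in> SigmaR m P1"
proof -
  have "left_part m \<tau> permutes {1..m}"
  proof (rule bij_imp_permutes)
    have "inj_on (left_part m \<tau>) {1..m}"
      using permutes_neq[OF W_facts(2)] by (auto simp: inj_on_def left_part_def)
    moreover have "left_part m \<tau> ` {1..m} \<subseteq> {1..m}"
    proof (rule image_subsetI)
      fix k assume "k \<in> {1..m}"
      then show "left_part m \<tau> k \<in> {1..m}"
        using W_facts(3)[of k] permutes_zero_iff[OF W_facts(2), of k] by (auto simp: left_part_def)
    qed
    ultimately show "bij_betw (left_part m \<tau>) {1..m} {1..m}"
      by (simp add: bij_betw_def endo_inj_surj)
    fix k assume "k \<notin> {1..m}"
    then show "left_part m \<tau> k = k"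
      using permutes_zero[OF W_facts(2)] by (cases "k = 0") (auto simp: left_part_def)
  qed
  moreover have "a < b" if ab: "(left_part m \<tau> a, left_part m \<tau> b) \<in> P1" "a \<noteq> b" for a b
  proof -
    have "left_part m \<tau> a \<in> {1..m}" "left_part m \<tau> b \<in> {1..m}"
      using ab(1) P1 by blast+
    then have "a \<le> m" "b \<le> m"
      by (auto simp: left_part_def split: if_splits)
    then have "(\<tau> a, \<tau> b) \<in> P"
      using ab(1) by (auto simp: left_part_def join_def)
    then show ?thesis
      using W_facts(1) ab(2) by (simp add: SigmaR_iff)
  qed
  ultimately show ?thesis
    by (simp add: SigmaR_iff)
qed

lemma right_part_eq: "1 \<le> k \<Longrightarrow> m + right_part m \<tau> k = \<tau> (m + k)"
  using W_facts(3)[of "m + k"] by (simp add: right_part_def)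

lemma right_part_mem: "right_part m \<tau> \<in> SigmaR n P2"
proof -
  have "right_part m \<tau> permutes {1..n}"
  proof (rule bij_imp_permutes)
    have "inj_on (right_part m \<tau>) {1..n}"
    proof (rule inj_onI)
      fix a b assume "a \<in> {1..n}" "b \<in> {1..n}" "right_part m \<tau> a = right_part m \<tau> b"
      then have "\<tau> (m + a) = \<tau> (m + b)"
        using right_part_eq[of a] right_part_eq[of b] by simp
      then show "a = b"
        using permutes_neq[OF W_facts(2), of "m + a" "m + b"] by auto
    qed
    moreover have "right_part m \<tau> ` {1..n} \<subseteq> {1..n}"
    proof (rule image_subsetI)
      fix k assume k: "k \<in> {1..n}"
      then have "m + k \<in> {1..N}"
        by auto
      then have "\<tau> (m + k) \<in> {1..N}"
        using permutes_in_image[OF W_facts(2)] by blast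
      moreover have "\<not> \<tau> (m + k) \<le> m"
        using W_facts(3)[of "m + k"] k by simp
      ultimately show "right_part m \<tau> k \<in> {1..n}"
        by (auto simp: right_part_def)
    qed
    ultimately show "bij_betw (right_part m \<tau>) {1..n} {1..n}"
      by (simp add: bij_betw_def endo_inj_surj)
    fix k assume k: "k \<notin> {1..n}"
    show "right_part m \<tau> k = k"
    proof (cases "k = 0")
      case True
      then show ?thesis
        using W_facts(3)[of m] by (simp add: right_part_def)
    next
      case False
      then have "\<tau> (m + k) = m + k"
        using k by (intro permutes_not_in[OF W_facts(2)]) auto
      then show ?thesis
        by (simp add: right_part_def)
    qed
  qed
  moreover have "a < b" if ab: "(right_part m \<tau> a, right_part m \<tau> b) \<in> P2" "a \<noteq> b" for a b
  proof -
    have "right_part m \<tau> a \<in> {1..n}" "right_part m \<tau> b \<in> {1..n}"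
      using ab(1) P2 by blast+
    \<comment> \<open>Comparable values are at least \<open>1\<close>, so neither position is
      \<open>0\<close> and \<open>right_part_eq\<close> applies to both.\<close>
    moreover have "right_part m \<tau> 0 = 0"
      using W_facts(3)[of m] by (simp add: right_part_def)
    ultimately have "a \<noteq> 0" "b \<noteq> 0"
      by (metis atLeastAtMost_iff not_one_le_zero)+
    then have "1 \<le> a" "1 \<le> b"
      by simp_all
    then have "(\<tau> (m + a), \<tau> (m + b)) \<in> P"
      using joinI(2)[OF ab(1), of m P1] right_part_eq[of a] right_part_eq[of b] by simp
    then have "m + a < m + b"
      using W_facts(1) ab(2) unfolding SigmaR_iff by (metis add_left_cancel)
    then show ?thesis
      by simp
  qed
  ultimately show ?thesis
    by (simp add: SigmaR_iff)
qed

end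

text \<open>The product function on pairs of permutations, read on \<open>W\<close> through the
  bijection between pairs of linear extensions and block sums.\<close>

definition pair :: "vec \<times> vec \<Rightarrow> vec" where
  "pair = (\<lambda>(x, y) \<tau>. if \<tau> \<in> W then x (left_part m \<tau>) * y (right_part m \<tau>) else 0)"

lemma pair_add:
  "pair (\<lambda>\<tau>. x \<tau> + x' \<tau>, y) = (\<lambda>\<tau>. pair (x, y) \<tau> + pair (x', y) \<tau>)"
  "pair (x, \<lambda>\<tau>. y \<tau> + y' \<tau>) = (\<lambda>\<tau>. pair (x, y) \<tau> + pair (x, y') \<tau>)"
  by (auto simp: pair_def distrib_left distrib_right)

lemma pair_scale:
  "pair (\<lambda>\<tau>. c * x \<tau>, y) = (\<lambda>\<tau>. c * pair (x, y) \<tau>)"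
  "pair (x, \<lambda>\<tau>. c * y \<tau>) = (\<lambda>\<tau>. c * pair (x, y) \<tau>)"
  by (auto simp: pair_def)

lemma pair_closed: "pair p \<in> carrier V"
  by (cases p) (auto simp: pair_def AV.span_carrier parabolic_perms_def)

lemma comb_eq_iff:
  assumes "\<gamma>1 \<in> SigmaR m P1" "\<gamma>2 \<in> SigmaR n P2" "\<tau> \<in> W"
  shows "left_part m \<tau> = \<gamma>1 \<and> right_part m \<tau> = \<gamma>2 \<longleftrightarrow> \<tau> = comb m \<gamma>1 \<gamma>2"
  using left_part_comb[OF SigmaR_permutes[OF assms(1)]]
    right_part_comb[OF SigmaR_permutes[OF assms(1)] SigmaR_permutes[OF assms(2)]] comb_W[OF assms(3)]
  by metis

lemma pair_basis:
  assumes "\<gamma>1 \<in> SigmaR m P1" "\<gamma>2 \<in> SigmaR n P2"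
  shows "pair (basis_vec \<gamma>1, basis_vec \<gamma>2) = basis_vec (comb m \<gamma>1 \<gamma>2)"
proof
  fix \<tau>
  show "pair (basis_vec \<gamma>1, basis_vec \<gamma>2) \<tau> = basis_vec (comb m \<gamma>1 \<gamma>2) \<tau>"
  proof (cases "\<tau> \<in> W")
    case True
    show ?thesis
    proof (cases "\<tau> = comb m \<gamma>1 \<gamma>2")
      case eq: True
      then have "left_part m \<tau> = \<gamma>1" "right_part m \<tau> = \<gamma>2"
        using comb_eq_iff[OF assms True] by blast+
      then have "pair (basis_vec \<gamma>1, basis_vec \<gamma>2) \<tau> = 1"
        using True by (simp add: pair_def basis_vec_def)
      moreover have "basis_vec (comb m \<gamma>1 \<gamma>2) \<tau> = 1"
        unfolding basis_vec_def using eq by (rule if_P)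
      ultimately show ?thesis
        by simp
    next
      case False
      then have "left_part m \<tau> \<noteq> \<gamma>1 \<or> right_part m \<tau> \<noteq> \<gamma>2"
        using comb_eq_iff[OF assms True] by blast
      then show ?thesis
        using False by (auto simp: pair_def basis_vec_def)
    qed
  next
    case False
    then have "\<tau> \<noteq> comb m \<gamma>1 \<gamma>2"
      using comb_mem[OF assms] by blast
    then show ?thesis
      using False by (simp add: pair_def basis_vec_def)
  qed
qed

lemma pair_scaled:
  assumes "\<gamma>1 \<in> SigmaR m P1" "\<gamma>2 \<in> SigmaR n P2"
  shows "pair (scaled c \<gamma>1, scaled d \<gamma>2) = scaled (c * d) (comb m \<gamma>1 \<gamma>2)"
  by (simp only: pair_scale pair_basis[OF assms] mult.assoc)

lemma pair_biadditive: "biadditive UNIV X1 X2 V pair"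
  by (rule biadditiveI)
    (simp_all add: mod_space_simps pair_closed pair_add pair_scale A1.span_act_scalar A2.span_act_scalar)

definition emb :: "((vec \<times> vec) \<Rightarrow>\<^sub>0 int) set \<Rightarrow> vec" where
  "emb = tensor_lift V pair"

lemma emb_hom: "emb \<in> hom K.T V"
  unfolding emb_def by (rule K.tensor_lift_hom[OF RV.M.comm_group_axioms pair_biadditive])

lemma emb_pure: "\<lbrakk>x \<in> carrier M1; y \<in> carrier M2\<rbrakk> \<Longrightarrow> emb (K.pure x y) = pair (x, y)"
  unfolding emb_def
  by (rule K.tensor_lift_pure[OF RV.M.comm_group_axioms pair_biadditive]) (simp_all add: mod_space_simps)

lemma scaled_mem: "\<gamma> \<in> SigmaR m P1 \<Longrightarrow> scaled c \<gamma> \<in> carrier M1" "\<gamma> \<in> SigmaR n P2 \<Longrightarrow> scaled c \<gamma> \<in> carrier M2"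
  by (simp_all add: A1.span_carrier A2.span_carrier basis_vec_def)

text \<open>The coefficient sits in the left factor; balancedness over \<complex> moves any
  coefficient of the right factor there.\<close>

definition split1 :: "complex \<Rightarrow> perm \<Rightarrow> ((vec \<times> vec) \<Rightarrow>\<^sub>0 int) set" where
  "split1 c \<tau> = K.pure (scaled c (left_part m \<tau>)) (scaled 1 (right_part m \<tau>))"

definition split :: "vec \<Rightarrow> ((vec \<times> vec) \<Rightarrow>\<^sub>0 int) set" where
  "split v = finprod K.T (\<lambda>\<tau>. split1 (v \<tau>) \<tau>) W"

lemma finite_W: "finite W"
  by (rule finite_subset[OF _ finite_SigmaR[of N P]]) (auto simp: parabolic_perms_def)

lemma split1_closed: "\<tau> \<in> W \<Longrightarrow> split1 c \<tau> \<in> carrier K.T"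
  unfolding split1_def
  by (rule K.pure_closed) (simp_all only: mod_space_simps scaled_mem left_part_mem right_part_mem)

lemma split1_add:
  assumes "\<tau> \<in> W"
  shows "split1 (c + d) \<tau> = split1 c \<tau> \<otimes>\<^bsub>K.T\<^esub> split1 d \<tau>"
proof -
  have "scaled (c + d) (left_part m \<tau>) = scaled c (left_part m \<tau>) \<otimes>\<^bsub>X1\<^esub> scaled d (left_part m \<tau>)"
    by (simp add: mod_space_simps distrib_right)
  then show ?thesis
    unfolding split1_def
    by (simp only:, intro K.pure_add_left)
      (simp_all only: mod_space_simps scaled_mem left_part_mem[OF assms] right_part_mem[OF assms])
qed

lemma split1_zero:
  assumes "\<tau> \<in> W"
  shows "split1 0 \<tau> = \<one>\<^bsub>K.T\<^esub>"
  using split1_add[OF assms, of 0 0] split1_closed[OF assms, of 0] by (simp add: KG.l_cancel_one)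

lemma split_hom: "split \<in> hom V K.T"
proof (rule homI)
  fix v w
  show "split v \<in> carrier K.T"
    unfolding split_def by (rule KG.finprod_closed) (simp add: split1_closed)
  have "split (v \<otimes>\<^bsub>V\<^esub> w) = finprod K.T (\<lambda>\<tau>. split1 (v \<tau>) \<tau> \<otimes>\<^bsub>K.T\<^esub> split1 (w \<tau>) \<tau>) W"
    unfolding split_def by (rule KG.finprod_cong') (simp_all add: split1_closed split1_add)
  then show "split (v \<otimes>\<^bsub>V\<^esub> w) = split v \<otimes>\<^bsub>K.T\<^esub> split w"
    unfolding split_def using split1_closed by (simp add: KG.finprod_multf)
qed

lemma split_scaled:
  assumes "\<tau> \<in> W"
  shows "split (scaled c \<tau>) = split1 c \<tau>"
proof -
  have "split (scaled c \<tau>) = finprod K.T (\<lambda>\<sigma>. if \<tau> = \<sigma> then split1 c \<sigma> else \<one>\<^bsub>K.T\<^esub>) W"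
    unfolding split_def
    by (rule KG.finprod_cong') (auto simp: basis_vec_def split1_zero split1_closed)
  also have "\<dots> = split1 c \<tau>"
    using assms finite_W by (intro KG.finprod_singleton) (auto simp: split1_closed)
  finally show ?thesis .
qed

lemma pair_hom:
  "y \<in> carrier M2 \<Longrightarrow> (\<lambda>x. pair (x, y)) \<in> hom M1 V" "x \<in> carrier M1 \<Longrightarrow> (\<lambda>y. pair (x, y)) \<in> hom M2 V"
  by (intro homI; simp add: pair_closed pair_add)+

lemma pure_hom:
  "y \<in> carrier M2 \<Longrightarrow> (\<lambda>x. K.pure x y) \<in> hom M1 K.T" "x \<in> carrier M1 \<Longrightarrow> (\<lambda>y. K.pure x y) \<in> hom M2 K.T"
  using K.pure_add_left K.pure_add_right K.pure_closed
  by (intro homI; simp only: mod_space_simps)+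

text \<open>Both sides are additive in \<open>x\<close> and in \<open>y\<close> separately, so
  scaled basis vectors suffice, one argument being freed at a time. This makes \<open>split\<close>
  a left inverse of \<open>emb\<close>.\<close>

lemma split_pair:
  assumes x: "x \<in> carrier M1" and y: "y \<in> carrier M2"
  shows "split (pair (x, y)) = K.pure x y"
proof -
  have basis: "split (pair (scaled c \<gamma>1, scaled d \<gamma>2)) = K.pure (scaled c \<gamma>1) (scaled d \<gamma>2)"
    if g: "\<gamma>1 \<in> SigmaR m P1" "\<gamma>2 \<in> SigmaR n P2" for \<gamma>1 \<gamma>2 c d
  proof -
    have "split (pair (scaled c \<gamma>1, scaled d \<gamma>2)) = K.pure (scaled (c * d) \<gamma>1) (scaled 1 \<gamma>2)"
      using g by (simp only: pair_scaled split_scaled[OF comb_mem] split1_def left_part_comb SigmaR_permutes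
          right_part_comb[OF SigmaR_permutes SigmaR_permutes])
    also have "\<dots> = K.pure (scaled c \<gamma>1) (scaled d \<gamma>2)"
      using K.pure_balanced[of "scaled c \<gamma>1" "scaled 1 \<gamma>2" d] g
      by (simp add: mod_space_simps scaled_mem A1.span_act_scalar A2.span_act_scalar
          mult.left_commute mult.assoc scaled_mem(2)[of _ 1, simplified])
    finally show ?thesis .
  qed
  have left: "split (pair (x, scaled d \<gamma>2)) = K.pure x (scaled d \<gamma>2)"
    if g: "\<gamma>2 \<in> SigmaR n P2" for d \<gamma>2
    by (rule span_hom_eqI[OF KG.is_group R1.M.comm_group_axioms
        hom_comp[OF pair_hom(1)[OF scaled_mem(2)[OF g]] split_hom]
        pure_hom(1)[OF scaled_mem(2)[OF g]] finite_SigmaR basis[OF _ g] x])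
  show ?thesis
    by (rule span_hom_eqI[OF KG.is_group R2.M.comm_group_axioms
        hom_comp[OF pair_hom(2)[OF x] split_hom] pure_hom(2)[OF x] finite_SigmaR left y])
qed

lemma split_emb: "Z \<in> carrier K.T \<Longrightarrow> split (emb Z) = Z"
proof (rule K.tensor_hom_eqI[OF KG.is_group hom_comp[OF emb_hom split_hom]])
  show "(\<lambda>Z. Z) \<in> hom K.T K.T"
    by (simp add: hom_def)
qed (simp_all only: mod_space_simps emb_pure split_pair)

text \<open>The main tool for the action on the outer tensor product: identities are proved in
  \<open>V\<close> and pulled back.\<close>

lemma emb_inj: "inj_on emb (carrier K.T)"
  by (rule inj_on_inverseI) (rule split_emb)

lemma emb_split1: "\<tau> \<in> W \<Longrightarrow> emb (split1 c \<tau>) = scaled c \<tau>"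
  unfolding split1_def
  by (simp only: emb_pure scaled_mem left_part_mem right_part_mem pair_scaled comb_W mult_1_right)

lemma emb_support:
  assumes "Z \<in> carrier K.T" "\<tau> \<notin> W"
  shows "emb Z \<tau> = 0"
  using assms(1)
proof (induction rule: K.tensor_induct)
  case (pure x y)
  then show ?case
    using assms(2) by (simp add: mod_space_simps emb_pure pair_def)
next
  case (diff A B)
  have "emb ((A \<otimes>\<^bsub>K.T\<^esub> inv\<^bsub>K.T\<^esub> B) \<otimes>\<^bsub>K.T\<^esub> B) = emb (A \<otimes>\<^bsub>K.T\<^esub> inv\<^bsub>K.T\<^esub> B) \<otimes>\<^bsub>V\<^esub> emb B"
    using diff by (intro hom_mult[OF emb_hom]) simp_all
  then have "emb A \<tau> = emb (A \<otimes>\<^bsub>K.T\<^esub> inv\<^bsub>K.T\<^esub> B) \<tau> + emb B \<tau>"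
    using diff by (simp add: KG.m_assoc)
  then show ?case
    using diff by simp
qed

section \<open>Actions of the two tensor factors\<close>

definition incl1 :: "hecke_elem \<Rightarrow> hecke_elem" where
  "incl1 = hecke_hom (hecke N) (pibar N)"

definition incl2 :: "hecke_elem \<Rightarrow> hecke_elem" where
  "incl2 = hecke_hom (hecke N) (\<lambda>i. pibar N (m + i))"

lemma gens1: "hecke_gens (hecke N) m (pibar N)"
  by (rule hecke_gens_initial[OF hecke_gens_pibar]) simp

lemma gens2: "hecke_gens (hecke N) n (\<lambda>i. pibar N (m + i))"
  by (rule hecke_gens_shift[OF hecke_gens_pibar])

lemma incl1_hom: "incl1 \<in> ring_hom (hecke m) (hecke N)"
  unfolding incl1_def by (rule hecke.hecke_hom_ring_hom[OF gens1])

lemma incl2_hom: "incl2 \<in> ring_hom (hecke n) (hecke N)"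
  unfolding incl2_def by (rule hecke.hecke_hom_ring_hom[OF gens2])

lemma incl_scalar:
  "incl1 (c \<odot>\<^bsub>hecke m\<^esub> \<one>\<^bsub>hecke m\<^esub>) = c \<odot>\<^bsub>hecke N\<^esub> \<one>\<^bsub>hecke N\<^esub>"
  "incl2 (c \<odot>\<^bsub>hecke n\<^esub> \<one>\<^bsub>hecke n\<^esub>) = c \<odot>\<^bsub>hecke N\<^esub> \<one>\<^bsub>hecke N\<^esub>"
  unfolding incl1_def incl2_def
  using hecke.hecke_hom_scalar[OF gens1] hecke.hecke_hom_scalar[OF gens2] by simp_all

lemma incl1_pibar: "i \<in> {1..<m} \<Longrightarrow> incl1 (pibar m i) = pibar N i"
  unfolding incl1_def by (rule hecke.hecke_hom_pibar[OF gens1])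

lemma incl2_pibar: "i \<in> {1..<n} \<Longrightarrow> incl2 (pibar n i) = pibar N (m + i)"
  unfolding incl2_def by (rule hecke.hecke_hom_pibar[OF gens2])

text \<open>For an index below \<open>m\<close> the block sum has the values of its left block at
  \<open>i\<close> and \<open>Suc i\<close>, so descents, comparabilities and swaps are those of
  \<open>\<gamma>1\<close>.\<close>

lemma sort_act_left:
  assumes g1: "\<gamma>1 \<in> SigmaR m P1" and g2: "\<gamma>2 \<in> SigmaR n P2" and i: "i \<in> {1..<m}"
  shows "pair (sort_act e m P1 \<gamma>1 i, basis_vec \<gamma>2) = sort_act e N P (comb m \<gamma>1 \<gamma>2) i"
proof -
  note p = SigmaR_permutes[OF g1] SigmaR_permutes[OF g2]
  have W: "comb m \<gamma>1 \<gamma>2 \<in> SigmaR N P"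
    using comb_mem[OF g1 g2] by (rule W_facts)
  have iN: "i \<in> {1..<N}"
    using i by auto
  have v: "comb m \<gamma>1 \<gamma>2 i = \<gamma>1 i" "comb m \<gamma>1 \<gamma>2 (Suc i) = \<gamma>1 (Suc i)"
    using i by (auto simp: comb_def)
  have des: "i \<in> DesR N (comb m \<gamma>1 \<gamma>2) \<longleftrightarrow> i \<in> DesR m \<gamma>1"
    using DesR_iff[OF SigmaR_permutes[OF W] iN] DesR_iff[OF p(1) i] by (simp add: v)
  have "\<gamma>1 i \<le> m" "\<gamma>1 (Suc i) \<le> m"
    using permutes_le_iff[OF p(1)] i by auto
  then have mem: "comb m (\<gamma>1 \<circ> simple_transp i) \<gamma>2 \<in> SigmaR N P \<longleftrightarrow> \<gamma>1 \<circ> simple_transp i \<in> SigmaR m P1"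
    using SigmaR_simple_transp[OF W iN] SigmaR_simple_transp[OF g1 i] join_left_iff
    by (simp add: v comb_simple_transp_left[OF i])
  show ?thesis
    using pair_basis[OF _ g2] g1 pair_scale(1)[of 0 "\<lambda>_. 0"]
    by (simp add: sort_act_def des mem comb_simple_transp_left[OF i] pair_scale)
qed

lemma sort_act_right:
  assumes g1: "\<gamma>1 \<in> SigmaR m P1" and g2: "\<gamma>2 \<in> SigmaR n P2" and i: "i \<in> {1..<n}"
  shows "pair (basis_vec \<gamma>1, sort_act e n P2 \<gamma>2 i) = sort_act e N P (comb m \<gamma>1 \<gamma>2) (m + i)"
proof -
  note p = SigmaR_permutes[OF g1] SigmaR_permutes[OF g2]
  have W: "comb m \<gamma>1 \<gamma>2 \<in> SigmaR N P"
    using comb_mem[OF g1 g2] by (rule W_facts)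
  have iN: "m + i \<in> {1..<N}" "1 \<le> i"
    using i by auto
  have v: "comb m \<gamma>1 \<gamma>2 (m + i) = m + \<gamma>2 i" "comb m \<gamma>1 \<gamma>2 (Suc (m + i)) = m + \<gamma>2 (Suc i)"
    using i by (auto simp: comb_def Suc_diff_le)
  have des: "m + i \<in> DesR N (comb m \<gamma>1 \<gamma>2) \<longleftrightarrow> i \<in> DesR n \<gamma>2"
    using DesR_iff[OF SigmaR_permutes[OF W] iN(1)] DesR_iff[OF p(2) i] by (simp add: v)
  have "1 \<le> \<gamma>2 i"
    using permutes_zero_iff[OF p(2), of i] iN(2) by simp
  then have mem: "comb m \<gamma>1 (\<gamma>2 \<circ> simple_transp i) \<in> SigmaR N P \<longleftrightarrow> \<gamma>2 \<circ> simple_transp i \<in> SigmaR n P2"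
    using SigmaR_simple_transp[OF W iN(1)] SigmaR_simple_transp[OF g2 i] join_right_iff
    by (simp add: v comb_simple_transp_right[OF iN(2)])
  show ?thesis
    using pair_basis[OF g1] g2 pair_scale(2)[of _ 0 "\<lambda>_. 0"]
    by (simp add: sort_act_def des mem comb_simple_transp_right[OF iN(2)] pair_scale)
qed

lemma pair_diff:
  "pair (\<lambda>\<tau>. x \<tau> - c * x' \<tau>, y) = (\<lambda>\<tau>. pair (x, y) \<tau> - c * pair (x', y) \<tau>)"
  "pair (x, \<lambda>\<tau>. y \<tau> - c * y' \<tau>) = (\<lambda>\<tau>. pair (x, y) \<tau> - c * pair (x, y') \<tau>)"
  by (auto simp: pair_def left_diff_distrib right_diff_distrib)

lemma shift_act_left:
  assumes "\<gamma>1 \<in> SigmaR m P1" "\<gamma>2 \<in> SigmaR n P2" "i \<in> {1..<m}"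
  shows "pair (shift_act e m P1 \<gamma>1 i, basis_vec \<gamma>2) = shift_act e N P (comb m \<gamma>1 \<gamma>2) i"
  by (simp only: shift_act_def pair_diff sort_act_left[OF assms] pair_basis[OF assms(1,2)])

lemma shift_act_right:
  assumes "\<gamma>1 \<in> SigmaR m P1" "\<gamma>2 \<in> SigmaR n P2" "i \<in> {1..<n}"
  shows "pair (basis_vec \<gamma>1, shift_act e n P2 \<gamma>2 i) = shift_act e N P (comb m \<gamma>1 \<gamma>2) (m + i)"
  by (simp only: shift_act_def pair_diff sort_act_right[OF assms] pair_basis[OF assms(1,2)])

lemma act_V_hom: "r \<in> carrier (hecke N) \<Longrightarrow> (\<lambda>v. act V v r) \<in> hom V V"
  by (intro homI) (simp_all only: RV.act_closed RV.act_add_left)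

lemma act_M1_hom: "r \<in> carrier (hecke m) \<Longrightarrow> (\<lambda>v. act M1 v r) \<in> hom M1 M1"
  by (intro homI) (simp_all only: R1.act_closed R1.act_add_left)

lemma act_M2_hom: "r \<in> carrier (hecke n) \<Longrightarrow> (\<lambda>v. act M2 v r) \<in> hom M2 M2"
  by (intro homI) (simp_all only: R2.act_closed R2.act_add_left)

text \<open>Two passes of \<open>span_hom_eqI\<close>, one variable after the other; the basis case
  carries two coefficients since the maps are only additive in each variable.\<close>

lemma pair_bilinear_eqI:
  assumes F: "\<And>y. y \<in> carrier M2 \<Longrightarrow> (\<lambda>x. F x y) \<in> hom M1 V" "\<And>x. x \<in> carrier M1 \<Longrightarrow> (\<lambda>y. F x y) \<in> hom M2 V"
    and G: "\<And>y. y \<in> carrier M2 \<Longrightarrow> (\<lambda>x. G x y) \<in> hom M1 V" "\<And>x. x \<in> carrier M1 \<Longrightarrow> (\<lambda>y. G x y) \<in> hom M2 V"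
    and basis: "\<And>\<gamma>1 \<gamma>2 c d. \<lbrakk>\<gamma>1 \<in> SigmaR m P1; \<gamma>2 \<in> SigmaR n P2\<rbrakk>
      \<Longrightarrow> F (scaled c \<gamma>1) (scaled d \<gamma>2) = G (scaled c \<gamma>1) (scaled d \<gamma>2)"
    and x: "x \<in> carrier M1" and y: "y \<in> carrier M2"
  shows "F x y = G x y"
proof -
  have left: "F x (scaled d \<gamma>2) = G x (scaled d \<gamma>2)" if g: "\<gamma>2 \<in> SigmaR n P2" for d \<gamma>2
    by (rule span_hom_eqI[OF RV.M.is_group R1.M.comm_group_axioms F(1) G(1) finite_SigmaR basis[OF _ g] x])
      (rule scaled_mem(2)[OF g])+
  show ?thesis
    by (rule span_hom_eqI[OF RV.M.is_group R2.M.comm_group_axioms F(2)[OF x] G(2)[OF x] finite_SigmaR left y])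
qed

lemma pair_pibar_left:
  assumes i: "i \<in> {1..<m}" and x: "x \<in> carrier M1" and y: "y \<in> carrier M2"
  shows "pair (act M1 x (pibar m i), y) = act V (pair (x, y)) (pibar N i)"
proof (rule pair_bilinear_eqI[OF _ _ _ _ _ x y])
  have iN: "i \<in> {1..<N}"
    using i by auto
  have p: "pibar m i \<in> carrier (hecke m)" "pibar N i \<in> carrier (hecke N)"
    using i iN by (simp_all only: pibar_closed)
  show "(\<lambda>x. pair (act M1 x (pibar m i), y)) \<in> hom M1 V" if "y \<in> carrier M2" for y
    by (rule hom_comp[OF act_M1_hom[OF p(1)] pair_hom(1)[OF that]])
  show "(\<lambda>y. pair (act M1 x (pibar m i), y)) \<in> hom M2 V" if "x \<in> carrier M1" for x
    by (rule pair_hom(2)) (rule R1.act_closed[OF that p(1)])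
  show "(\<lambda>x. act V (pair (x, y)) (pibar N i)) \<in> hom M1 V" if "y \<in> carrier M2" for y
    by (rule hom_comp[OF pair_hom(1)[OF that] act_V_hom[OF p(2)]])
  show "(\<lambda>y. act V (pair (x, y)) (pibar N i)) \<in> hom M2 V" if "x \<in> carrier M1" for x
    by (rule hom_comp[OF pair_hom(2)[OF that] act_V_hom[OF p(2)]])
  fix \<gamma>1 \<gamma>2 c d assume g: "\<gamma>1 \<in> SigmaR m P1" "\<gamma>2 \<in> SigmaR n P2"
  note W = W_facts(1)[OF comb_mem[OF g]]
  show "pair (act M1 (scaled c \<gamma>1) (pibar m i), scaled d \<gamma>2)
      = act V (pair (scaled c \<gamma>1, scaled d \<gamma>2)) (pibar N i)"
    using g W
    by (simp add: pair_scaled[OF g] A1.span_act_pibar[OF i] AV.span_act_pibar[OF iN] gen_op_scale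
        gen_op_basis pair_scale shift_act_left[OF g i] mult.assoc)
qed

lemma pair_pibar_right:
  assumes i: "i \<in> {1..<n}" and x: "x \<in> carrier M1" and y: "y \<in> carrier M2"
  shows "pair (x, act M2 y (pibar n i)) = act V (pair (x, y)) (pibar N (m + i))"
proof (rule pair_bilinear_eqI[OF _ _ _ _ _ x y])
  have iN: "m + i \<in> {1..<N}"
    using i by auto
  have p: "pibar n i \<in> carrier (hecke n)" "pibar N (m + i) \<in> carrier (hecke N)"
    using i iN by (simp_all only: pibar_closed)
  show "(\<lambda>x. pair (x, act M2 y (pibar n i))) \<in> hom M1 V" if "y \<in> carrier M2" for y
    by (rule pair_hom(1)) (rule R2.act_closed[OF that p(1)])
  show "(\<lambda>y. pair (x, act M2 y (pibar n i))) \<in> hom M2 V" if "x \<in> carrier M1" for x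
    by (rule hom_comp[OF act_M2_hom[OF p(1)] pair_hom(2)[OF that]])
  show "(\<lambda>x. act V (pair (x, y)) (pibar N (m + i))) \<in> hom M1 V" if "y \<in> carrier M2" for y
    by (rule hom_comp[OF pair_hom(1)[OF that] act_V_hom[OF p(2)]])
  show "(\<lambda>y. act V (pair (x, y)) (pibar N (m + i))) \<in> hom M2 V" if "x \<in> carrier M1" for x
    by (rule hom_comp[OF pair_hom(2)[OF that] act_V_hom[OF p(2)]])
  fix \<gamma>1 \<gamma>2 c d assume g: "\<gamma>1 \<in> SigmaR m P1" "\<gamma>2 \<in> SigmaR n P2"
  note W = W_facts(1)[OF comb_mem[OF g]]
  show "pair (scaled c \<gamma>1, act M2 (scaled d \<gamma>2) (pibar n i))
      = act V (pair (scaled c \<gamma>1, scaled d \<gamma>2)) (pibar N (m + i))"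
    using g W
    by (simp add: pair_scaled[OF g] A2.span_act_pibar[OF i] AV.span_act_pibar[OF iN] gen_op_scale
        gen_op_basis pair_scale shift_act_right[OF g i] mult.assoc)
qed

lemma pair_act_left:
  assumes a: "a \<in> carrier (hecke m)" and x: "x \<in> carrier M1" and y: "y \<in> carrier M2"
  shows "pair (act M1 x a, y) = act V (pair (x, y)) (incl1 a)"
  using a
proof (induction rule: hecke_induct)
  case (scalar c)
  show ?case
    by (simp add: A1.span_act_scalar pair_scale incl_scalar AV.span_act_scalar)
next
  case (add a b)
  have "pair (act M1 x (a \<oplus>\<^bsub>hecke m\<^esub> b), y) = (\<lambda>\<tau>. pair (act M1 x a, y) \<tau> + pair (act M1 x b, y) \<tau>)"
    using R1.act_add_right[OF x add.hyps] by (simp add: pair_add)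
  also have "\<dots> = act V (pair (x, y)) (incl1 a \<oplus>\<^bsub>hecke N\<^esub> incl1 b)"
    using add RV.act_add_right[OF pair_closed ring_hom_closed[OF incl1_hom add.hyps(1)]
        ring_hom_closed[OF incl1_hom add.hyps(2)], of "(x, y)"] by simp
  finally show ?case
    using ring_hom_add[OF incl1_hom add.hyps] by simp
next
  case (mult a i)
  have p: "pibar m i \<in> carrier (hecke m)" "pibar N i \<in> carrier (hecke N)"
    using mult.hyps(2) by (simp_all add: trans_less_add1)
  have "pair (act M1 x (a \<otimes>\<^bsub>hecke m\<^esub> pibar m i), y) = pair (act M1 (act M1 x a) (pibar m i), y)"
    using R1.act_mult[OF x mult.hyps(1) p(1)] by simp
  also have "\<dots> = act V (act V (pair (x, y)) (incl1 a)) (pibar N i)"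
    using pair_pibar_left[OF mult.hyps(2) R1.act_closed[OF x mult.hyps(1)] y] mult by simp
  also have "\<dots> = act V (pair (x, y)) (incl1 a \<otimes>\<^bsub>hecke N\<^esub> pibar N i)"
    by (rule RV.act_mult[OF pair_closed ring_hom_closed[OF incl1_hom mult.hyps(1)] p(2), symmetric])
  finally show ?case
    using ring_hom_mult[OF incl1_hom mult.hyps(1) p(1)] incl1_pibar[OF mult.hyps(2)] by simp
qed

lemma pair_act_right:
  assumes b: "b \<in> carrier (hecke n)" and x: "x \<in> carrier M1" and y: "y \<in> carrier M2"
  shows "pair (x, act M2 y b) = act V (pair (x, y)) (incl2 b)"
  using b
proof (induction rule: hecke_induct)
  case (scalar c)
  show ?case
    by (simp add: A2.span_act_scalar pair_scale incl_scalar AV.span_act_scalar)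
next
  case (add a b)
  have "pair (x, act M2 y (a \<oplus>\<^bsub>hecke n\<^esub> b)) = (\<lambda>\<tau>. pair (x, act M2 y a) \<tau> + pair (x, act M2 y b) \<tau>)"
    using R2.act_add_right[OF y add.hyps] by (simp add: pair_add)
  also have "\<dots> = act V (pair (x, y)) (incl2 a \<oplus>\<^bsub>hecke N\<^esub> incl2 b)"
    using add RV.act_add_right[OF pair_closed ring_hom_closed[OF incl2_hom add.hyps(1)]
        ring_hom_closed[OF incl2_hom add.hyps(2)], of "(x, y)"] by simp
  finally show ?case
    using ring_hom_add[OF incl2_hom add.hyps] by simp
next
  case (mult a i)
  have p: "pibar n i \<in> carrier (hecke n)" "pibar N (m + i) \<in> carrier (hecke N)"
    using mult.hyps(2) by simp_all
  have "pair (x, act M2 y (a \<otimes>\<^bsub>hecke n\<^esub> pibar n i)) = pair (x, act M2 (act M2 y a) (pibar n i))"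
    using R2.act_mult[OF y mult.hyps(1) p(1)] by simp
  also have "\<dots> = act V (act V (pair (x, y)) (incl2 a)) (pibar N (m + i))"
    using pair_pibar_right[OF mult.hyps(2) x R2.act_closed[OF y mult.hyps(1)]] mult by simp
  also have "\<dots> = act V (pair (x, y)) (incl2 a \<otimes>\<^bsub>hecke N\<^esub> pibar N (m + i))"
    by (rule RV.act_mult[OF pair_closed ring_hom_closed[OF incl2_hom mult.hyps(1)] p(2), symmetric])
  finally show ?case
    using ring_hom_mult[OF incl2_hom mult.hyps(1) p(1)] incl2_pibar[OF mult.hyps(2)] by simp
qed

lemma smult_hom:
  assumes "f \<in> ring_hom (hecke k) (hecke N)"
    and "f (c \<odot>\<^bsub>hecke k\<^esub> \<one>\<^bsub>hecke k\<^esub>) = c \<odot>\<^bsub>hecke N\<^esub> \<one>\<^bsub>hecke N\<^esub>" and a: "a \<in> carrier (hecke k)"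
  shows "f (c \<odot>\<^bsub>hecke k\<^esub> a) = c \<odot>\<^bsub>hecke N\<^esub> f a"
  using ring_hom_mult[OF assms(1) hecke.smult_closed[OF hecke.one_closed] a, of c]
    ring_hom_closed[OF assms(1) a] assms(2) a
  by (simp add: hecke.smult_mult_l)

section \<open>The parabolic subalgebra as an image of the tensor product\<close>

lemma parabolic_emb_biadditive:
  "biadditive UNIV (alg_space (hecke m)) (alg_space (hecke n)) (add_monoid (hecke N))
     (\<lambda>(a, b). incl1 a \<otimes>\<^bsub>hecke N\<^esub> incl2 b)"
  by (rule biadditiveI)
    (simp_all add: alg_space_simps ring_hom_closed[OF incl1_hom] ring_hom_closed[OF incl2_hom]
      ring_hom_add[OF incl1_hom] ring_hom_add[OF incl2_hom] hecke.l_distr hecke.r_distr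
      smult_hom[OF incl1_hom incl_scalar(1)] smult_hom[OF incl2_hom incl_scalar(2)]
      hecke.smult_mult_l hecke.smult_mult_r)

lemma parabolic_emb_eq:
  "parabolic_emb m n = tensor_lift (add_monoid (hecke N)) (\<lambda>(a, b). incl1 a \<otimes>\<^bsub>hecke N\<^esub> incl2 b)"
  by (simp add: parabolic_emb_def incl1_def incl2_def)

lemma parabolic_emb_hom: "parabolic_emb m n \<in> hom H.T (add_monoid (hecke N))"
  unfolding parabolic_emb_eq by (rule H.tensor_lift_hom[OF hecke.a_comm_group parabolic_emb_biadditive])

lemma parabolic_emb_pure:
  "\<lbrakk>a \<in> carrier (hecke m); b \<in> carrier (hecke n)\<rbrakk>
    \<Longrightarrow> parabolic_emb m n (H.pure a b) = incl1 a \<otimes>\<^bsub>hecke N\<^esub> incl2 b"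
  unfolding parabolic_emb_eq
  using H.tensor_lift_pure[OF hecke.a_comm_group parabolic_emb_biadditive, of a b]
  by (simp add: alg_space_simps)

lemma parabolic_emb_closed: "T \<in> carrier H.T \<Longrightarrow> parabolic_emb m n T \<in> carrier (hecke N)"
  using hom_in_carrier[OF parabolic_emb_hom] by simp

text \<open>The missing index \<open>m\<close> separates the two families of generators:
  \<open>i < m\<close> and \<open>1 \<le> j\<close> give \<open>i + 2 \<le> m + j\<close>.\<close>

lemma incl2_comm:
  assumes i: "i \<in> {1..<m}" and b: "b \<in> carrier (hecke n)"
  shows "incl2 b \<otimes>\<^bsub>hecke N\<^esub> pibar N i = pibar N i \<otimes>\<^bsub>hecke N\<^esub> incl2 b"
  using b
proof (induction rule: hecke_induct)
  have p: "pibar N i \<in> carrier (hecke N)"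
    using i by simp
  {
    case (scalar c)
    then show ?case
      using p by (simp add: incl_scalar hecke.scalar_central)
  next
    case (add x y)
    then show ?case
      using p by (simp add: ring_hom_add[OF incl2_hom] ring_hom_closed[OF incl2_hom] hecke.l_distr hecke.r_distr)
  next
    case (mult x j)
    have q: "pibar N (m + j) \<in> carrier (hecke N)" "incl2 x \<in> carrier (hecke N)"
      using mult ring_hom_closed[OF incl2_hom] by simp_all
    have "i \<in> {1..<N}" "m + j \<in> {1..<N}" "i + 2 \<le> m + j"
      using i mult.hyps(2) by auto
    then have c: "pibar N i \<otimes>\<^bsub>hecke N\<^esub> pibar N (m + j) = pibar N (m + j) \<otimes>\<^bsub>hecke N\<^esub> pibar N i"
      using hecke_gens_pibar[of N] unfolding hecke_gens_def by blast
    have "incl2 (x \<otimes>\<^bsub>hecke n\<^esub> pibar n j) = incl2 x \<otimes>\<^bsub>hecke N\<^esub> pibar N (m + j)"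
      using mult.hyps by (simp add: ring_hom_mult[OF incl2_hom] incl2_pibar)
    moreover have "incl2 x \<otimes>\<^bsub>hecke N\<^esub> pibar N (m + j) \<otimes>\<^bsub>hecke N\<^esub> pibar N i
        = (incl2 x \<otimes>\<^bsub>hecke N\<^esub> pibar N i) \<otimes>\<^bsub>hecke N\<^esub> pibar N (m + j)"
      using p q c by (simp add: hecke.m_assoc)
    ultimately show ?case
      using p q mult.IH by (simp add: hecke.m_assoc)
  }
qed

lemma image_subgroup: "subgroup (parabolic_emb m n ` carrier H.T) (add_monoid (hecke N))"
proof -
  interpret G: group_hom H.T "add_monoid (hecke N)" "parabolic_emb m n"
    by (intro group_hom.intro group_hom_axioms.intro HG.is_group parabolic_emb_hom
        hecke.add.is_group)
  show ?thesis
    by (rule G.img_is_subgroup)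
qed

text \<open>Right multiplication by \<open>r\<close> is additive and the image is an additive
  subgroup, so pure tensors suffice.\<close>

lemma image_mult_generator:
  assumes T: "T \<in> carrier H.T" and r: "r \<in> carrier (hecke N)"
    and pure: "\<And>a b. \<lbrakk>a \<in> carrier (hecke m); b \<in> carrier (hecke n)\<rbrakk>
      \<Longrightarrow> incl1 a \<otimes>\<^bsub>hecke N\<^esub> incl2 b \<otimes>\<^bsub>hecke N\<^esub> r \<in> parabolic_emb m n ` carrier H.T"
  shows "parabolic_emb m n T \<otimes>\<^bsub>hecke N\<^esub> r \<in> parabolic_emb m n ` carrier H.T"
  using T
proof (induction rule: H.tensor_induct)
  case (pure a b)
  then show ?case
    using assms(3) by (simp add: alg_space_simps parabolic_emb_pure)
next
  case (diff A B)
  interpret G: group_hom H.T "add_monoid (hecke N)" "parabolic_emb m n"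
    by (intro group_hom.intro group_hom_axioms.intro HG.is_group parabolic_emb_hom hecke.add.is_group)
  have c: "parabolic_emb m n A \<in> carrier (hecke N)" "parabolic_emb m n B \<in> carrier (hecke N)"
    using diff parabolic_emb_closed by blast+
  have "parabolic_emb m n (A \<otimes>\<^bsub>H.T\<^esub> inv\<^bsub>H.T\<^esub> B)
      = parabolic_emb m n A \<oplus>\<^bsub>hecke N\<^esub> (\<ominus>\<^bsub>hecke N\<^esub> parabolic_emb m n B)"
    using diff G.hom_mult[of A "inv\<^bsub>H.T\<^esub> B"] G.hom_inv[of B] by (simp add: a_inv_def)
  then have "parabolic_emb m n (A \<otimes>\<^bsub>H.T\<^esub> inv\<^bsub>H.T\<^esub> B) \<otimes>\<^bsub>hecke N\<^esub> r
      = parabolic_emb m n A \<otimes>\<^bsub>hecke N\<^esub> r \<oplus>\<^bsub>hecke N\<^esub> (\<ominus>\<^bsub>hecke N\<^esub> (parabolic_emb m n B \<otimes>\<^bsub>hecke N\<^esub> r))"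
    using c r by (simp add: hecke.l_distr hecke.l_minus)
  also have "\<dots> \<in> parabolic_emb m n ` carrier H.T"
    using subgroup.m_closed[OF image_subgroup diff.IH(1) subgroup.m_inv_closed[OF image_subgroup diff.IH(2)]]
    by (simp add: a_inv_def)
  finally show ?case .
qed

text \<open>Guarantees that the preimage taken by \<open>inv_into\<close> in
  \<open>outer_tensor\<close> is a genuine one.\<close>

lemma parabolic_emb_surj:
  assumes "h \<in> carrier (parabolic m n)"
  shows "h \<in> parabolic_emb m n ` carrier H.T"
proof -
  have im: "incl1 a \<otimes>\<^bsub>hecke N\<^esub> incl2 b \<in> parabolic_emb m n ` carrier H.T"
    if "a \<in> carrier (hecke m)" "b \<in> carrier (hecke n)" for a b
    using that parabolic_emb_pure[OF that] H.pure_closed[of a b] by (auto simp: alg_space_simps intro!: image_eqI)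
  \<comment> \<open>Stability of the image under right multiplication by \<open>h\<close> is proved
    for all \<open>x\<close> in the image, which lets the induction pass through products; applied
    to \<open>\<one>\<close> it gives the claim.\<close>
  have "x \<otimes>\<^bsub>hecke N\<^esub> h \<in> parabolic_emb m n ` carrier H.T" if "x \<in> parabolic_emb m n ` carrier H.T" for x
    using assms that
  proof (induction arbitrary: x rule: parabolic_induct)
    case (pibar i)
    then have iN: "i \<in> {1..<N}" and p: "pibar N i \<in> carrier (hecke N)"
      by auto
    obtain T where T: "T \<in> carrier H.T" "x = parabolic_emb m n T"
      using pibar.prems by blast
    show ?case
      unfolding T(2)
    proof (rule image_mult_generator[OF T(1) p])
      fix a b assume a: "a \<in> carrier (hecke m)" and b: "b \<in> carrier (hecke n)"
      have ab: "incl1 a \<in> carrier (hecke N)" "incl2 b \<in> carrier (hecke N)"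
        using a b ring_hom_closed[OF incl1_hom] ring_hom_closed[OF incl2_hom] by blast+
      show "incl1 a \<otimes>\<^bsub>hecke N\<^esub> incl2 b \<otimes>\<^bsub>hecke N\<^esub> pibar N i \<in> parabolic_emb m n ` carrier H.T"
      proof (cases "i < m")
        case True
        then have i: "i \<in> {1..<m}"
          using iN by simp
        have "incl1 a \<otimes>\<^bsub>hecke N\<^esub> incl2 b \<otimes>\<^bsub>hecke N\<^esub> pibar N i
            = incl1 (a \<otimes>\<^bsub>hecke m\<^esub> pibar m i) \<otimes>\<^bsub>hecke N\<^esub> incl2 b"
          using a i ab p incl2_comm[OF i b]
          by (simp add: ring_hom_mult[OF incl1_hom] incl1_pibar hecke.m_assoc)
        then show ?thesis
          using im[of "a \<otimes>\<^bsub>hecke m\<^esub> pibar m i" b] a b i by simp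
      next
        case False
        then have i: "i - m \<in> {1..<n}" "m + (i - m) = i"
          using pibar.hyps by auto
        have "incl1 a \<otimes>\<^bsub>hecke N\<^esub> incl2 b \<otimes>\<^bsub>hecke N\<^esub> pibar N i
            = incl1 a \<otimes>\<^bsub>hecke N\<^esub> incl2 (b \<otimes>\<^bsub>hecke n\<^esub> pibar n (i - m))"
          using b ab p incl2_pibar[OF i(1)] pibar_closed[OF i(1)]
          by (simp add: ring_hom_mult[OF incl2_hom] i(2) hecke.m_assoc)
        then show ?thesis
          using im[OF a, of "b \<otimes>\<^bsub>hecke n\<^esub> pibar n (i - m)"] b pibar_closed[OF i(1)] by simp
      qed
    qed
  next
    case (scalar c)
    obtain T where T: "T \<in> carrier H.T" "x = parabolic_emb m n T"
      using scalar.prems by blast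
    show ?case
      unfolding T(2)
    proof (rule image_mult_generator[OF T(1)])
      fix a b assume a: "a \<in> carrier (hecke m)" and b: "b \<in> carrier (hecke n)"
      have ab: "incl1 a \<in> carrier (hecke N)" "incl2 b \<in> carrier (hecke N)"
        using a b ring_hom_closed[OF incl1_hom] ring_hom_closed[OF incl2_hom] by blast+
      have "incl1 a \<otimes>\<^bsub>hecke N\<^esub> incl2 b \<otimes>\<^bsub>hecke N\<^esub> (c \<odot>\<^bsub>hecke N\<^esub> \<one>\<^bsub>hecke N\<^esub>)
          = incl1 a \<otimes>\<^bsub>hecke N\<^esub> incl2 (c \<odot>\<^bsub>hecke n\<^esub> b)"
        using ab b by (simp add: smult_hom[OF incl2_hom incl_scalar(2)] hecke.smult_mult_r)
      then show "incl1 a \<otimes>\<^bsub>hecke N\<^esub> incl2 b \<otimes>\<^bsub>hecke N\<^esub> (c \<odot>\<^bsub>hecke N\<^esub> \<one>\<^bsub>hecke N\<^esub>)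
          \<in> parabolic_emb m n ` carrier H.T"
        using im[OF a, of "c \<odot>\<^bsub>hecke n\<^esub> b"] b by simp
    qed simp
  next
    case (add h k)
    have "x \<in> carrier (hecke N)"
      using add.prems parabolic_emb_closed by blast
    then have "x \<otimes>\<^bsub>hecke N\<^esub> (h \<oplus>\<^bsub>hecke N\<^esub> k) = x \<otimes>\<^bsub>hecke N\<^esub> h \<oplus>\<^bsub>hecke N\<^esub> x \<otimes>\<^bsub>hecke N\<^esub> k"
      using add.hyps by (simp add: hecke.r_distr parabolic_subset)
    then show ?case
      using subgroup.m_closed[OF image_subgroup add.IH(1)[OF add.prems] add.IH(2)[OF add.prems]] by simp
  next
    case (mult h k)
    have "x \<in> carrier (hecke N)"
      using mult.prems parabolic_emb_closed by blast
    then show ?case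
      using mult.IH(2)[OF mult.IH(1)[OF mult.prems]] mult.hyps by (simp add: hecke.m_assoc parabolic_subset)
  qed
  moreover have "\<one>\<^bsub>hecke N\<^esub> \<in> parabolic_emb m n ` carrier H.T"
    using im[of "\<one>\<^bsub>hecke m\<^esub>" "\<one>\<^bsub>hecke n\<^esub>"] ring_hom_one[OF incl1_hom] ring_hom_one[OF incl2_hom] by simp
  ultimately have "\<one>\<^bsub>hecke N\<^esub> \<otimes>\<^bsub>hecke N\<^esub> h \<in> parabolic_emb m n ` carrier H.T"
    by blast
  then show ?thesis
    using parabolic_subset[OF assms] by simp
qed

definition pure_act :: "(hecke_elem \<times> hecke_elem \<Rightarrow>\<^sub>0 int) set \<Rightarrow> vec \<times> vec \<Rightarrow> (vec \<times> vec \<Rightarrow>\<^sub>0 int) set" where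
  "pure_act T = (\<lambda>(x, y). tensor_lift K.T (\<lambda>(a, b). K.pure (act M1 x a) (act M2 y b)) T)"

context
  fixes x y
  assumes x: "x \<in> carrier M1" and y: "y \<in> carrier M2"
begin

lemma pure_act_biadditive:
  "biadditive UNIV (alg_space (hecke m)) (alg_space (hecke n)) K.T (\<lambda>(a, b). K.pure (act M1 x a) (act M2 y b))"
proof (rule biadditiveI; unfold alg_space_simps prod.case)
  fix a b assume a: "a \<in> carrier (hecke m)" and b: "b \<in> carrier (hecke n)"
  show "K.pure (act M1 x a) (act M2 y b) \<in> carrier K.T"
    by (rule K.pure_closed) (simp_all only: mod_space_simps R1.act_closed[OF x a] R2.act_closed[OF y b])
  have "act M1 x (c \<odot>\<^bsub>hecke m\<^esub> a) = act X1 (act M1 x a) c" for c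
    using a R1.act_mult[OF x a, of "c \<odot>\<^bsub>hecke m\<^esub> \<one>\<^bsub>hecke m\<^esub>"] by (simp add: mod_space_simps hecke.smult_mult_r)
  moreover have "act M2 y (c \<odot>\<^bsub>hecke n\<^esub> b) = act X2 (act M2 y b) c" for c
    using b R2.act_mult[OF y b, of "c \<odot>\<^bsub>hecke n\<^esub> \<one>\<^bsub>hecke n\<^esub>"] by (simp add: mod_space_simps hecke.smult_mult_r)
  ultimately show "K.pure (act M1 x (c \<odot>\<^bsub>hecke m\<^esub> a)) (act M2 y b)
      = K.pure (act M1 x a) (act M2 y (c \<odot>\<^bsub>hecke n\<^esub> b))" for c
    using K.pure_balanced[of "act M1 x a" "act M2 y b" c] R1.act_closed[OF x a] R2.act_closed[OF y b]
    by (simp add: mod_space_simps(1))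
next
  fix a a' b assume a: "a \<in> carrier (hecke m)" "a' \<in> carrier (hecke m)" and b: "b \<in> carrier (hecke n)"
  show "K.pure (act M1 x (a \<oplus>\<^bsub>hecke m\<^esub> a')) (act M2 y b)
      = K.pure (act M1 x a) (act M2 y b) \<otimes>\<^bsub>K.T\<^esub> K.pure (act M1 x a') (act M2 y b)"
    using K.pure_add_left[of "act M1 x a" "act M1 x a'" "act M2 y b"] R1.act_closed[OF x a(1)]
      R1.act_closed[OF x a(2)] R2.act_closed[OF y b] R1.act_add_right[OF x a]
    by (simp only: mod_space_simps)
next
  fix a b b' assume a: "a \<in> carrier (hecke m)" and b: "b \<in> carrier (hecke n)" "b' \<in> carrier (hecke n)"
  show "K.pure (act M1 x a) (act M2 y (b \<oplus>\<^bsub>hecke n\<^esub> b'))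
      = K.pure (act M1 x a) (act M2 y b) \<otimes>\<^bsub>K.T\<^esub> K.pure (act M1 x a) (act M2 y b')"
    using K.pure_add_right[of "act M1 x a" "act M2 y b" "act M2 y b'"] R1.act_closed[OF x a]
      R2.act_closed[OF y b(1)] R2.act_closed[OF y b(2)] R2.act_add_right[OF y b]
    by (simp only: mod_space_simps)
qed

lemma pure_act_hom: "(\<lambda>T. pure_act T (x, y)) \<in> hom H.T K.T"
  unfolding pure_act_def prod.case
  by (rule H.tensor_lift_hom[OF K.tensor_comm_group pure_act_biadditive])

lemma pure_act_pure:
  "\<lbrakk>a \<in> carrier (hecke m); b \<in> carrier (hecke n)\<rbrakk>
    \<Longrightarrow> pure_act (H.pure a b) (x, y) = K.pure (act M1 x a) (act M2 y b)"
  unfolding pure_act_def prod.case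
  using H.tensor_lift_pure[OF K.tensor_comm_group pure_act_biadditive, of a b]
  by (simp add: alg_space_simps)

text \<open>Inside \<open>V\<close> the tensor \<open>T\<close> acts as its image under
  \<open>parabolic_emb\<close>. Together with the injectivity of \<open>emb\<close> this shows that
  the action on the outer tensor product depends on the algebra element alone, whichever preimage is
  picked.\<close>

lemma emb_pure_act:
  assumes T: "T \<in> carrier H.T"
  shows "emb (pure_act T (x, y)) = act V (pair (x, y)) (parabolic_emb m n T)"
proof (rule H.tensor_hom_eqI[OF RV.M.is_group hom_comp[OF pure_act_hom emb_hom] _ _ T])
  show "(\<lambda>T. act V (pair (x, y)) (parabolic_emb m n T)) \<in> hom H.T V"
    using hom_mult[OF parabolic_emb_hom] parabolic_emb_closed
    by (intro homI) (simp_all add: RV.act_closed RV.act_add_right pair_closed del: AV.span_simps)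
  fix a b assume "a \<in> carrier (alg_space (hecke m))" "b \<in> carrier (alg_space (hecke n))"
  then have a: "a \<in> carrier (hecke m)" and b: "b \<in> carrier (hecke n)"
    by (simp_all add: alg_space_simps)
  have "emb (pure_act (H.pure a b) (x, y)) = pair (act M1 x a, act M2 y b)"
    using R1.act_closed[OF x a] R2.act_closed[OF y b] by (simp only: pure_act_pure[OF a b] emb_pure)
  also have "\<dots> = act V (act V (pair (x, y)) (incl1 a)) (incl2 b)"
    by (simp only: pair_act_right[OF b R1.act_closed[OF x a] y] pair_act_left[OF a x y])
  also have "\<dots> = act V (pair (x, y)) (incl1 a \<otimes>\<^bsub>hecke N\<^esub> incl2 b)"
    by (rule RV.act_mult[OF pair_closed ring_hom_closed[OF incl1_hom a] ring_hom_closed[OF incl2_hom b], symmetric])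
  finally show "emb (pure_act (H.pure a b) (x, y)) = act V (pair (x, y)) (parabolic_emb m n (H.pure a b))"
    by (simp only: parabolic_emb_pure[OF a b])
qed

end

text \<open>The identities are checked after applying the injective \<open>emb\<close>, where they
  become bilinearity of \<open>pair\<close> and additivity of the action on
  \<open>V\<close>.\<close>

lemma pure_act_bilinear:
  assumes T: "T \<in> carrier H.T"
  shows "biadditive UNIV X1 X2 K.T (pure_act T)"
proof (rule biadditiveI; unfold mod_space_simps)
  have h: "parabolic_emb m n T \<in> carrier (hecke N)"
    by (rule parabolic_emb_closed[OF T])
  have c: "pure_act T (x, y) \<in> carrier K.T" if "x \<in> carrier M1" "y \<in> carrier M2" for x y
    using hom_in_carrier[OF pure_act_hom[OF that] T] .
  show "x \<in> carrier M1 \<Longrightarrow> y \<in> carrier M2 \<Longrightarrow> pure_act T (x, y) \<in> carrier K.T" for x y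
    by (rule c)
  fix x y assume x: "x \<in> carrier M1" and y: "y \<in> carrier M2"
  show "pure_act T (x \<otimes>\<^bsub>M1\<^esub> x', y) = pure_act T (x, y) \<otimes>\<^bsub>K.T\<^esub> pure_act T (x', y)"
    if x': "x' \<in> carrier M1" for x'
  proof (rule inj_onD[OF emb_inj])
    have "pair (x \<otimes>\<^bsub>M1\<^esub> x', y) = pair (x, y) \<otimes>\<^bsub>V\<^esub> pair (x', y)"
      by (simp add: pair_add)
    then show "emb (pure_act T (x \<otimes>\<^bsub>M1\<^esub> x', y)) = emb (pure_act T (x, y) \<otimes>\<^bsub>K.T\<^esub> pure_act T (x', y))"
      using x x' y h
      by (simp only: hom_mult[OF emb_hom] c emb_pure_act[OF _ _ T] R1.M.m_closed RV.act_add_left pair_closed)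
  qed (use x x' y in \<open>simp_all only: c KG.m_closed R1.M.m_closed\<close>)
  show "pure_act T (x, y \<otimes>\<^bsub>M2\<^esub> y') = pure_act T (x, y) \<otimes>\<^bsub>K.T\<^esub> pure_act T (x, y')"
    if y': "y' \<in> carrier M2" for y'
  proof (rule inj_onD[OF emb_inj])
    have "pair (x, y \<otimes>\<^bsub>M2\<^esub> y') = pair (x, y) \<otimes>\<^bsub>V\<^esub> pair (x, y')"
      by (simp add: pair_add)
    then show "emb (pure_act T (x, y \<otimes>\<^bsub>M2\<^esub> y')) = emb (pure_act T (x, y) \<otimes>\<^bsub>K.T\<^esub> pure_act T (x, y'))"
      using x y y' h
      by (simp only: hom_mult[OF emb_hom] c emb_pure_act[OF _ _ T] R2.M.m_closed RV.act_add_left pair_closed)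
  qed (use x y y' in \<open>simp_all only: c KG.m_closed R2.M.m_closed\<close>)
  fix k :: complex
  let ?x = "act M1 x (k \<odot>\<^bsub>hecke m\<^esub> \<one>\<^bsub>hecke m\<^esub>)" and ?y = "act M2 y (k \<odot>\<^bsub>hecke n\<^esub> \<one>\<^bsub>hecke n\<^esub>)"
  have s: "?x \<in> carrier M1" "?y \<in> carrier M2"
    using x y by (simp_all only: R1.act_closed R2.act_closed hecke.smult_closed hecke.one_closed)
  have "pair (?x, y) = pair (x, ?y)"
    by (simp add: A1.span_act_scalar A2.span_act_scalar pair_scale)
  then have "emb (pure_act T (?x, y)) = emb (pure_act T (x, ?y))"
    using x y s by (simp only: emb_pure_act[OF _ _ T])
  then show "pure_act T (?x, y) = pure_act T (x, ?y)"
    using x y s by (intro inj_onD[OF emb_inj] c)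
qed

abbreviation "outer \<equiv> outer_tensor m n M1 M2"

lemma outer_simps:
  "carrier outer = carrier K.T" "monoid.mult outer = monoid.mult K.T" "one outer = one K.T"
  "act outer Z h = tensor_lift K.T (pure_act (inv_into (carrier H.T) (parabolic_emb m n) h)) Z"
  by (simp_all add: outer_tensor_def Let_def hecke_tensor_def pure_act_def)

context
  fixes h
  assumes h: "h \<in> carrier (parabolic m n)"
begin

lemma preimage:
  "inv_into (carrier H.T) (parabolic_emb m n) h \<in> carrier H.T"
  "parabolic_emb m n (inv_into (carrier H.T) (parabolic_emb m n) h) = h"
  using parabolic_emb_surj[OF h] by (simp_all add: inv_into_into f_inv_into_f)

lemma outer_act_hom: "(\<lambda>Z. act outer Z h) \<in> hom K.T K.T"
  unfolding outer_simps
  using K.tensor_lift_hom[OF K.tensor_comm_group pure_act_bilinear[OF preimage(1)]] .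

lemma emb_act:
  assumes Z: "Z \<in> carrier K.T"
  shows "emb (act outer Z h) = act V (emb Z) h"
proof (rule K.tensor_hom_eqI[OF RV.M.is_group hom_comp[OF outer_act_hom emb_hom]
      hom_comp[OF emb_hom act_V_hom[OF parabolic_subset[OF h]]] _ Z])
  fix x y assume "x \<in> carrier X1" "y \<in> carrier X2"
  then have xy: "x \<in> carrier M1" "y \<in> carrier M2"
    by (simp_all only: mod_space_simps)
  have "act outer (K.pure x y) h = pure_act (inv_into (carrier H.T) (parabolic_emb m n) h) (x, y)"
    unfolding outer_simps
    by (rule K.tensor_lift_pure[OF K.tensor_comm_group pure_act_bilinear[OF preimage(1)]])
      (simp_all only: mod_space_simps xy)
  then show "emb (act outer (K.pure x y) h) = act V (emb (K.pure x y)) h"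
    by (simp only: emb_pure_act[OF xy preimage(1)] preimage(2) emb_pure[OF xy])
qed

end

text \<open>The abstract \<open>X\<close> and \<open>j\<close> of \<open>induced_sort\<close> are
  here the outer tensor product and \<open>emb\<close>.\<close>

theorem ind_prod_rmod_iso: "rmod_iso (hecke N) (ind_prod m n M1 M2) V"
proof -
  have "induced_sort e m n P outer emb"
  proof (rule induced_sort.intro)
    show "comm_group outer"
      by (rule comm_group_cong[OF K.tensor_comm_group]) (simp_all only: outer_simps)
    show "act outer Z h \<in> carrier outer" if "Z \<in> carrier outer" "h \<in> carrier (parabolic m n)" for Z h
      using hom_in_carrier[OF outer_act_hom[OF that(2)]] that(1) by (simp only: outer_simps(1))
    show "emb \<in> hom outer V"
      using emb_hom by (simp add: hom_def outer_simps(1,2))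
    show "inj_on emb (carrier outer)"
      using emb_inj by (simp only: outer_simps(1))
    show "emb (act outer Z h) = act V (emb Z) h" if "Z \<in> carrier outer" "h \<in> carrier (parabolic m n)" for Z h
      using emb_act[OF that(2)] that(1) by (simp only: outer_simps(1))
    show "\<exists>Z\<in>carrier outer. emb Z = scaled c \<delta>" if "\<delta> \<in> W" for \<delta> c
      using emb_split1[OF that] split1_closed[OF that] unfolding outer_simps(1) by blast
    show "\<tau> \<in> W" if "Z \<in> carrier outer" "emb Z \<tau> \<noteq> 0" for Z \<tau>
      using emb_support that unfolding outer_simps(1) by blast
  qed (use e join_range[OF P1 P2] join_split[OF P1 P2] in auto)
  then show ?thesis
    unfolding ind_prod_def by (rule induced_sort.induced_rmod_iso)
qed

end

section \<open>Induction products and their twists\<close>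

lemma ind_prod_poset_module:
  assumes "P1 \<subseteq> {1..m} \<times> {1..m}" "P2 \<subseteq> {1..n} \<times> {1..n}"
  shows "rmod_iso (hecke (m + n)) (ind_prod m n (poset_module m P1) (poset_module n P2))
      (poset_module (m + n) (join m P1 P2))"
    and "rmod_iso (hecke (m + n)) (ind_prod m n (bold_poset_module m P1) (bold_poset_module n P2))
      (bold_poset_module (m + n) (join m P1 P2))"
  unfolding poset_module_eq bold_poset_module_eq
  by (rule outer_sort.ind_prod_rmod_iso; simp only: outer_sort_def assms simp_thms)+

lemma partial_order_on_subset: "partial_order_on A P \<Longrightarrow> P \<subseteq> A \<times> A"
  by (auto simp: partial_order_on_def preorder_on_def refl_on_def)

text \<open>Each twist is carried out on the poset module of the union; the resulting poset is a
  union again, with its blocks exchanged for \<open>hecke_phi\<close> and \<open>hecke_chi\<close>,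
  and its module is read back as an induction product.\<close>

lemma induction_product_twists:
  assumes P1: "P1 \<subseteq> {1..m} \<times> {1..m}" and P2: "P2 \<subseteq> {1..n} \<times> {1..n}"
  shows "rmod_iso (hecke (m + n))
      (twist (hecke_phi (m + n)) (ind_prod m n (poset_module m P1) (poset_module n P2)))
      (ind_prod n m (poset_module n ((bar n P2)\<inverse>)) (poset_module m ((bar m P1)\<inverse>)))" (is ?phi)
    and "rmod_iso (hecke (m + n))
      (twist (hecke_theta (m + n)) (ind_prod m n (poset_module m P1) (poset_module n P2)))
      (ind_prod m n (bold_poset_module m P1) (bold_poset_module n P2))" (is ?theta)
    and "rmod_iso (hecke (m + n))
      (anti_twist (hecke (m + n)) (hecke_chi (m + n))
        (ind_prod m n (poset_module m P1) (poset_module n P2)))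
      (ind_prod n m (bold_poset_module n (bar n P2)) (bold_poset_module m (bar m P1)))" (is ?chi)
proof -
  note J = join_range[OF P1 P2]
  note ind = ind_prod_poset_module(1)[OF P1 P2]
  have conv: "(bar n P2)\<inverse> \<subseteq> {1..n} \<times> {1..n}" "(bar m P1)\<inverse> \<subseteq> {1..m} \<times> {1..m}"
    using bar_range by blast+
  \<comment> \<open>The product in the reversed order is a module over \<open>hecke (n + m)\<close>;
    commutativity of addition identifies the two algebras.\<close>
  have "rmod_iso (hecke (m + n)) (poset_module (m + n) ((bar (m + n) (join m P1 P2))\<inverse>))
      (ind_prod n m (poset_module n ((bar n P2)\<inverse>)) (poset_module m ((bar m P1)\<inverse>)))"
    using rmod_iso_sym[OF ind_prod_poset_module(1)[OF conv]]
    unfolding bar_join[OF P1 P2] join_converse by (simp only: add.commute)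
  then show ?phi
    using rmod_iso_trans[OF twist_rmod_iso[OF ind hecke_ring hecke_phi_hom] phi_poset_module[OF J]]
    by (rule rmod_iso_trans[rotated])
  show ?theta
    by (rule rmod_iso_trans[OF twist_rmod_iso[OF ind hecke_ring hecke_theta_hom]
        rmod_iso_trans[OF theta_poset_module rmod_iso_sym[OF ind_prod_poset_module(2)[OF P1 P2]]]])
  have "rmod_iso (hecke (m + n)) (bold_poset_module (m + n) (bar (m + n) (join m P1 P2)))
      (ind_prod n m (bold_poset_module n (bar n P2)) (bold_poset_module m (bar m P1)))"
    using rmod_iso_sym[OF ind_prod_poset_module(2)[OF bar_range[of n P2] bar_range[of m P1]]]
    unfolding bar_join[OF P1 P2] by (simp only: add.commute)
  then show ?chi
    using rmod_iso_trans[OF hecke.anti_twist_rmod_iso[OF hecke_chi_hom ind] chi_poset_module[OF J]]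
    by (rule rmod_iso_trans[rotated])
qed

theorem corollary3p8:
  fixes m n :: nat
  shows
    "(\<forall>P1 P2. partial_order_on {1..m} P1 \<and> partial_order_on {1..n} P2 \<longrightarrow>
        rmod_iso (hecke (m + n))
          (twist (hecke_phi (m + n)) (ind_prod m n (poset_module m P1) (poset_module n P2)))
          (ind_prod n m (poset_module n ((bar n P2)\<inverse>)) (poset_module m ((bar m P1)\<inverse>)))
      \<and> rmod_iso (hecke (m + n))
          (twist (hecke_theta (m + n)) (ind_prod m n (poset_module m P1) (poset_module n P2)))
          (ind_prod m n (bold_poset_module m P1) (bold_poset_module n P2))
      \<and> rmod_iso (hecke (m + n))
          (anti_twist (hecke (m + n)) (hecke_chi (m + n))
            (ind_prod m n (poset_module m P1) (poset_module n P2)))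
          (ind_prod n m (bold_poset_module n (bar n P2)) (bold_poset_module m (bar m P1))))
   \<and> (\<forall>P. partial_order_on {1..m + n} P \<longrightarrow>
        rmod_iso (parabolic m n)
          (twist (hecke_phi (m + n)) (restriction (parabolic n m) (poset_module (m + n) P)))
          (restriction (parabolic m n) (poset_module (m + n) ((bar (m + n) P)\<inverse>)))
      \<and> rmod_iso (parabolic m n)
          (twist (hecke_theta (m + n)) (restriction (parabolic m n) (poset_module (m + n) P)))
          (restriction (parabolic m n) (bold_poset_module (m + n) P))
      \<and> rmod_iso (parabolic m n)
          (anti_twist (parabolic m n) (hecke_chi (m + n))
            (restriction (parabolic m n) (poset_module (m + n) P)))
          (restriction (parabolic m n) (bold_poset_module (m + n) (bar (m + n) P))))"
proof (intro conjI allI impI; (elim conjE)?)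
  fix P1 P2
  assume "partial_order_on {1..m} P1" "partial_order_on {1..n} P2"
  then have P: "P1 \<subseteq> {1..m} \<times> {1..m}" "P2 \<subseteq> {1..n} \<times> {1..n}"
    by (simp_all only: partial_order_on_subset)
  show "rmod_iso (hecke (m + n))
      (twist (hecke_phi (m + n)) (ind_prod m n (poset_module m P1) (poset_module n P2)))
      (ind_prod n m (poset_module n ((bar n P2)\<inverse>)) (poset_module m ((bar m P1)\<inverse>)))"
    by (rule induction_product_twists(1)[OF P])
  show "rmod_iso (hecke (m + n))
      (twist (hecke_theta (m + n)) (ind_prod m n (poset_module m P1) (poset_module n P2)))
      (ind_prod m n (bold_poset_module m P1) (bold_poset_module n P2))"
    by (rule induction_product_twists(2)[OF P])
  show "rmod_iso (hecke (m + n))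
      (anti_twist (hecke (m + n)) (hecke_chi (m + n))
        (ind_prod m n (poset_module m P1) (poset_module n P2)))
      (ind_prod n m (bold_poset_module n (bar n P2)) (bold_poset_module m (bar m P1)))"
    by (rule induction_product_twists(3)[OF P])
next
  fix P
  assume "partial_order_on {1..m + n} P"
  then have P: "P \<subseteq> {1..m + n} \<times> {1..m + n}"
    by (rule partial_order_on_subset)
  show "rmod_iso (parabolic m n)
      (twist (hecke_phi (m + n)) (restriction (parabolic n m) (poset_module (m + n) P)))
      (restriction (parabolic m n) (poset_module (m + n) ((bar (m + n) P)\<inverse>)))"
    by (rule restriction_twists(1)[OF P])
  show "rmod_iso (parabolic m n)
      (twist (hecke_theta (m + n)) (restriction (parabolic m n) (poset_module (m + n) P)))
      (restriction (parabolic m n) (bold_poset_module (m + n) P))"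
    by (rule restriction_twists(2)[OF P])
  show "rmod_iso (parabolic m n)
      (anti_twist (parabolic m n) (hecke_chi (m + n))
        (restriction (parabolic m n) (poset_module (m + n) P)))
      (restriction (parabolic m n) (bold_poset_module (m + n) (bar (m + n) P)))"
    by (rule restriction_twists(3)[OF P])
qed

end
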